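(* Under the standing assumptions listed in the context, the extremal parameter $\lambda_*$ satisfies $\lambda_*>0$ and there exists $\epsilon>0$ such that for every $\lambda\in(0,\lambda_*+\epsilon)$ the problem $(\mathcal{E}_\lambda)$ has at least two positive (weak) solutions $u_\lambda$ and $w_\lambda$, with $u_\lambda\in\mathcal{M}^+_\lambda$ and $w_\lambda\in\mathcal{M}^-_\lambda$.
   Context: Standing assumptions. $N\ge 2$, $0<s<1$, $1<p<\infty$, $sp<N$, $p_s^*=\frac{Np}{N-sp}$, $\mathbb{R}^+=(0,\infty)$. Exponents: $0<\delta<1<p<\gamma<p_s^*-1$. The function $\alpha$ satisfies $\alpha>0$ a.e. in $\mathbb{R}^N$, there is $\xi>1$ with $\alpha\in L^\xi(\mathbb{R}^N)\cap L^\infty(\mathbb{R}^N)$, and there is $\tau$ with $p<\tau<p_s^*$ and $\frac1\xi+\frac{1-\delta}{\tau}=1$. The function $\beta\in L^\infty(\mathbb{R}^N)$ may change sign, and $\beta^+=\max\{\beta,0\}\neq 0$. If $\beta(x)>0$ in $\mathbb{R}^N$, then $(\alpha/\beta)^{1/(\gamma+\delta-1)}\notin W^{s,p}_V(\mathbb{R}^N)$. The Kirchhoff function is $M(t)=at^m$ with $a,m>0$ and $p(m+1)<\gamma$; $\widehat M(t)=\int_0^tM(r)\,dr$. The potential $V:\mathbb{R}^N\to\mathbb{R}^+$ is continuous, $\inf V\ge V_0$ for some $V_0>0$, and there is $h>0$ such that $\lim_{|y|\to\infty}\mathrm{meas}\{x\in B_h(y):V(x)\le c\}=0$ for all $c>0$.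 Space. $W^{s,p}_V(\mathbb{R}^N)$ is the set of $u\in L^p(\mathbb{R}^N)$ with $\|u\|<\infty$, where $\|u\|^p=\iint_{\mathbb{R}^{2N}}\frac{|u(x)-u(y)|^p}{|x-y|^{N+sp}}dxdy+\int_{\mathbb{R}^N}V|u|^pdx$. Problem $(\mathcal{E}_\lambda)$, $\lambda>0$: $M(\|u\|^p)\big[(-\Delta_p)^su+V(x)u^{p-1}\big]=\lambda\alpha(x)u^{-\delta}+\beta(x)u^{\gamma-1}$ in $\mathbb{R}^N$, $u>0$, $u\in W^{s,p}_V(\mathbb{R}^N)$. A (weak) solution is $u\in W^{s,p}_V(\mathbb{R}^N)$ with $u>0$ a.e. such that for all $v\in W^{s,p}_V(\mathbb{R}^N)$: $\alpha u^{-\delta}v\in L^1(\mathbb{R}^N)$ and $$M(\|u\|^p)\Big[\iint_{\mathbb{R}^{2N}}\tfrac{|u(x)-u(y)|^{p-2}(u(x)-u(y))(v(x)-v(y))}{|x-y|^{N+sp}}dxdy+\int_{\mathbb{R}^N} Vu^{p-1}v\,dx\Big]-\lambda\int_{\mathbb{R}^N}\alpha u^{-\delta}v\,dx-\int_{\mathbb{R}^N}\beta u^{\gamma-1}v\,dx=0.$$ Nehari sets. $\Psi_\lambda(u)=\frac1p\widehat M(\|u\|^p)-\frac{\lambda}{1-\delta}\int_{\mathbb{R}^N}\alpha|u|^{1-\delta}dx-\frac1\gamma\int_{\mathbb{R}^N}\beta|u|^\gamma dx$ on $W^{s,p}_V(\mathbb{R}^N)$; $\mathcal{K}=\{u\in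 W^{s,p}_V(\mathbb{R}^N)\setminus\{0\}:u\ge0\}$; for $u\in\mathcal{K}$, $\mathcal{F}_{\lambda,u}(t)=\Psi_\lambda(tu)$, $t>0$; $\mathcal{M}_\lambda=\{u\in\mathcal{K}:\mathcal{F}'_{\lambda,u}(1)=0\}$; $\mathcal{M}^+_\lambda,\mathcal{M}^-_\lambda,\mathcal{M}^0_\lambda$ are the subsets of $\mathcal{M}_\lambda$ where $\mathcal{F}''_{\lambda,u}(1)>0$, $<0$, $=0$ respectively. Extremal parameter. $\mathcal{G}^+=\{u\in\mathcal{K}:\int_{\mathbb{R}^N}\beta|u|^\gamma dx>0\}$; for $u\in\mathcal{G}^+$, $$\lambda(u)=a\,\tfrac{\gamma-p(m+1)}{\gamma+\delta-1}\Big[a\,\tfrac{p(m+1)+\delta-1}{\gamma+\delta-1}\Big]^{\frac{p(m+1)+\delta-1}{\gamma-p(m+1)}}\frac{\big[\|u\|^{p(m+1)}\big]^{\frac{\gamma+\delta-1}{\gamma-p(m+1)}}}{\int_{\mathbb{R}^N}\alpha|u|^{1-\delta}dx\;\big[\int_{\mathbb{R}^N}\beta|u|^\gamma dx\big]^{\frac{p(m+1)+\delta-1}{\gamma-p(m+1)}}},$$ and $\lambda_*=\inf_{u\in\mathcal{G}^+}\lambda(u)$. *)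

theory Defs
  imports "HOL-Analysis.Analysis"
begin

text \<open>
  Functions on the \<open>N\<close>-dimensional space are genuine functions of type
  \<open>real ^ 'n \<Rightarrow> real\<close> with \<open>N = CARD('n)\<close>, measurable with respect to Lebesgue measure.
  They stand for their classes modulo equality almost everywhere, so \<open>u = 0\<close>, \<open>u \<ge> 0\<close>
  and \<open>u > 0\<close> are always read almost everywhere.
  Real powers are \<open>powr\<close>, with \<open>0 powr r = 0\<close> for every \<open>r\<close>.
\<close>

definition Lspace :: "real \<Rightarrow> ('a::euclidean_space \<Rightarrow> real) set" where
  "Lspace q = {f \<in> borel_measurable lebesgue. integrable lebesgue (\<lambda>x. \<bar>f x\<bar> powr q)}"

definition Linfty :: "('a::euclidean_space \<Rightarrow> real) set" where
  "Linfty = {f \<in> borel_measurable lebesgue. \<exists>C. AE x in lebesgue. \<bar>f x\<bar> \<le> C}"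

definition crit_exp :: "nat \<Rightarrow> real \<Rightarrow> real \<Rightarrow> real" where
  "crit_exp N s p = real N * p / (real N - s * p)"

text \<open>
  The \<open>p\<close>-th power of the norm, as an extended nonnegative real, so that its finiteness
  can be expressed. On the (null) diagonal the quotient has the value \<open>0 / 0 = 0\<close>.
\<close>

definition W_energy ::
  "real \<Rightarrow> real \<Rightarrow> (real ^ 'n \<Rightarrow> real) \<Rightarrow> (real ^ 'n \<Rightarrow> real) \<Rightarrow> ennreal" where
  "W_energy s p V u =
     (\<integral>\<^sup>+ (x, y). ennreal (\<bar>u x - u y\<bar> powr p / norm (x - y) powr (real CARD('n) + s * p)) \<partial>lebesgue)
     + (\<integral>\<^sup>+ x. ennreal (V x * \<bar>u x\<bar> powr p) \<partial>lebesgue)"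

definition W_space ::
  "real \<Rightarrow> real \<Rightarrow> (real ^ 'n \<Rightarrow> real) \<Rightarrow> (real ^ 'n \<Rightarrow> real) set" where
  "W_space s p V = {u \<in> Lspace p. W_energy s p V u < \<infinity>}"

definition W_norm ::
  "real \<Rightarrow> real \<Rightarrow> (real ^ 'n \<Rightarrow> real) \<Rightarrow> (real ^ 'n \<Rightarrow> real) \<Rightarrow> real" where
  "W_norm s p V u = enn2real (W_energy s p V u) powr (1 / p)"

definition kirchhoff :: "real \<Rightarrow> real \<Rightarrow> real \<Rightarrow> real" where
  "kirchhoff a m t = a * t powr m"

definition kirchhoff_prim :: "real \<Rightarrow> real \<Rightarrow> real \<Rightarrow> real" where
  "kirchhoff_prim a m t = integral {0..t} (kirchhoff a m)"

definition gagliardo_form ::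
  "real \<Rightarrow> real \<Rightarrow> (real ^ 'n \<Rightarrow> real) \<Rightarrow> (real ^ 'n \<Rightarrow> real) \<Rightarrow> real" where
  "gagliardo_form s p u v =
     (LINT (x, y)|lebesgue.
        \<bar>u x - u y\<bar> powr (p - 2) * (u x - u y) * (v x - v y)
        / norm (x - y) powr (real CARD('n) + s * p))"

definition weak_solution ::
  "real \<Rightarrow> real \<Rightarrow> real \<Rightarrow> real \<Rightarrow> real \<Rightarrow> real \<Rightarrow> (real ^ 'n \<Rightarrow> real) \<Rightarrow> (real ^ 'n \<Rightarrow> real) \<Rightarrow>
   (real ^ 'n \<Rightarrow> real) \<Rightarrow> real \<Rightarrow> (real ^ 'n \<Rightarrow> real) \<Rightarrow> bool" where
  "weak_solution s p \<delta> \<gamma> a m V \<alpha> \<beta> lam u \<longleftrightarrow>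
     u \<in> W_space s p V \<and> (AE x in lebesgue. u x > 0) \<and>
     (\<forall>v \<in> W_space s p V.
        integrable lebesgue (\<lambda>x. \<alpha> x * u x powr (-\<delta>) * v x) \<and>
        kirchhoff a m (W_norm s p V u powr p)
          * (gagliardo_form s p u v + (LINT x|lebesgue. V x * u x powr (p - 1) * v x))
        - lam * (LINT x|lebesgue. \<alpha> x * u x powr (-\<delta>) * v x)
        - (LINT x|lebesgue. \<beta> x * u x powr (\<gamma> - 1) * v x) = 0)"

definition Psi ::
  "real \<Rightarrow> real \<Rightarrow> real \<Rightarrow> real \<Rightarrow> real \<Rightarrow> real \<Rightarrow> (real ^ 'n \<Rightarrow> real) \<Rightarrow> (real ^ 'n \<Rightarrow> real) \<Rightarrow>
   (real ^ 'n \<Rightarrow> real) \<Rightarrow> real \<Rightarrow> (real ^ 'n \<Rightarrow> real) \<Rightarrow> real" where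
  "Psi s p \<delta> \<gamma> a m V \<alpha> \<beta> lam u =
     1 / p * kirchhoff_prim a m (W_norm s p V u powr p)
     - lam / (1 - \<delta>) * (LINT x|lebesgue. \<alpha> x * \<bar>u x\<bar> powr (1 - \<delta>))
     - 1 / \<gamma> * (LINT x|lebesgue. \<beta> x * \<bar>u x\<bar> powr \<gamma>)"

definition W_cone ::
  "real \<Rightarrow> real \<Rightarrow> (real ^ 'n \<Rightarrow> real) \<Rightarrow> (real ^ 'n \<Rightarrow> real) set" where
  "W_cone s p V =
     {u \<in> W_space s p V. \<not> (AE x in lebesgue. u x = 0) \<and> (AE x in lebesgue. u x \<ge> 0)}"

definition fibering ::
  "real \<Rightarrow> real \<Rightarrow> real \<Rightarrow> real \<Rightarrow> real \<Rightarrow> real \<Rightarrow> (real ^ 'n \<Rightarrow> real) \<Rightarrow> (real ^ 'n \<Rightarrow> real) \<Rightarrow>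
   (real ^ 'n \<Rightarrow> real) \<Rightarrow> real \<Rightarrow> (real ^ 'n \<Rightarrow> real) \<Rightarrow> real \<Rightarrow> real" where
  "fibering s p \<delta> \<gamma> a m V \<alpha> \<beta> lam u t = Psi s p \<delta> \<gamma> a m V \<alpha> \<beta> lam (\<lambda>x. t * u x)"

definition Nehari ::
  "real \<Rightarrow> real \<Rightarrow> real \<Rightarrow> real \<Rightarrow> real \<Rightarrow> real \<Rightarrow> (real ^ 'n \<Rightarrow> real) \<Rightarrow> (real ^ 'n \<Rightarrow> real) \<Rightarrow>
   (real ^ 'n \<Rightarrow> real) \<Rightarrow> real \<Rightarrow> (real ^ 'n \<Rightarrow> real) set" where
  "Nehari s p \<delta> \<gamma> a m V \<alpha> \<beta> lam =
     {u \<in> W_cone s p V. deriv (fibering s p \<delta> \<gamma> a m V \<alpha> \<beta> lam u) 1 = 0}"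

definition Nehari_plus ::
  "real \<Rightarrow> real \<Rightarrow> real \<Rightarrow> real \<Rightarrow> real \<Rightarrow> real \<Rightarrow> (real ^ 'n \<Rightarrow> real) \<Rightarrow> (real ^ 'n \<Rightarrow> real) \<Rightarrow>
   (real ^ 'n \<Rightarrow> real) \<Rightarrow> real \<Rightarrow> (real ^ 'n \<Rightarrow> real) set" where
  "Nehari_plus s p \<delta> \<gamma> a m V \<alpha> \<beta> lam =
     {u \<in> Nehari s p \<delta> \<gamma> a m V \<alpha> \<beta> lam. deriv (deriv (fibering s p \<delta> \<gamma> a m V \<alpha> \<beta> lam u)) 1 > 0}"

definition Nehari_minus ::
  "real \<Rightarrow> real \<Rightarrow> real \<Rightarrow> real \<Rightarrow> real \<Rightarrow> real \<Rightarrow> (real ^ 'n \<Rightarrow> real) \<Rightarrow> (real ^ 'n \<Rightarrow> real) \<Rightarrow>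
   (real ^ 'n \<Rightarrow> real) \<Rightarrow> real \<Rightarrow> (real ^ 'n \<Rightarrow> real) set" where
  "Nehari_minus s p \<delta> \<gamma> a m V \<alpha> \<beta> lam =
     {u \<in> Nehari s p \<delta> \<gamma> a m V \<alpha> \<beta> lam. deriv (deriv (fibering s p \<delta> \<gamma> a m V \<alpha> \<beta> lam u)) 1 < 0}"

definition G_plus ::
  "real \<Rightarrow> real \<Rightarrow> real \<Rightarrow> (real ^ 'n \<Rightarrow> real) \<Rightarrow> (real ^ 'n \<Rightarrow> real) \<Rightarrow> (real ^ 'n \<Rightarrow> real) set" where
  "G_plus s p \<gamma> V \<beta> = {u \<in> W_cone s p V. (LINT x|lebesgue. \<beta> x * \<bar>u x\<bar> powr \<gamma>) > 0}"

definition lambda_fun ::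
  "real \<Rightarrow> real \<Rightarrow> real \<Rightarrow> real \<Rightarrow> real \<Rightarrow> real \<Rightarrow> (real ^ 'n \<Rightarrow> real) \<Rightarrow> (real ^ 'n \<Rightarrow> real) \<Rightarrow>
   (real ^ 'n \<Rightarrow> real) \<Rightarrow> (real ^ 'n \<Rightarrow> real) \<Rightarrow> real" where
  "lambda_fun s p \<delta> \<gamma> a m V \<alpha> \<beta> u =
     a * ((\<gamma> - p * (m + 1)) / (\<gamma> + \<delta> - 1))
     * (a * ((p * (m + 1) + \<delta> - 1) / (\<gamma> + \<delta> - 1)))
         powr ((p * (m + 1) + \<delta> - 1) / (\<gamma> - p * (m + 1)))
     * ((W_norm s p V u powr (p * (m + 1))) powr ((\<gamma> + \<delta> - 1) / (\<gamma> - p * (m + 1)))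
        / ((LINT x|lebesgue. \<alpha> x * \<bar>u x\<bar> powr (1 - \<delta>))
           * (LINT x|lebesgue. \<beta> x * \<bar>u x\<bar> powr \<gamma>)
               powr ((p * (m + 1) + \<delta> - 1) / (\<gamma> - p * (m + 1)))))"

text \<open>
  A real infimum: under the standing assumptions \<open>G_plus\<close> is nonempty and \<open>lambda_fun\<close> is
  nonnegative on it.
\<close>

definition lambda_star ::
  "real \<Rightarrow> real \<Rightarrow> real \<Rightarrow> real \<Rightarrow> real \<Rightarrow> real \<Rightarrow> (real ^ 'n \<Rightarrow> real) \<Rightarrow> (real ^ 'n \<Rightarrow> real) \<Rightarrow>
   (real ^ 'n \<Rightarrow> real) \<Rightarrow> real" where
  "lambda_star s p \<delta> \<gamma> a m V \<alpha> \<beta> = (INF u \<in> G_plus s p \<gamma> V \<beta>. lambda_fun s p \<delta> \<gamma> a m V \<alpha> \<beta> u)"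

end

theory Submission
  imports Defs "HOL-Complex_Analysis.Great_Picard"
begin

text \<open>
  Write \<open>k = p (m + 1)\<close>, \<open>q = 1 - \<delta>\<close>, \<open>P\<close> for the \<open>k\<close>-th power of the norm, and \<open>A\<close>, \<open>B\<close> for
  the two lower order integrals, so that a fibre has derivative
  \<open>a t^(k-1) P - \<lambda> t^(q-1) A - t^(\<gamma>-1) B\<close>.
  The first solution minimises the energy over \<open>{(\<gamma> - k) a P \<le> (\<gamma> - q) \<lambda> A}\<close>, a bounded set closed under
  weak limits. The second one minimises the energy minus \<open>1/\<gamma>\<close> times the Nehari functional,
  in which \<open>B\<close> cancels, over \<open>{a P \<le> \<lambda> A + B, (k - q) a P \<le> (\<gamma> - q) B}\<close>, which is closed as well.
  For \<open>\<lambda> < \<lambda>\<^sub>*\<close> the degenerate part of the Nehari set is empty, and minimisers are interior.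

  At \<open>\<lambda> = \<lambda>\<^sub>*\<close> a minimiser \<open>u\<close> on the boundary would be degenerate, hence a minimiser of the quotient that
  defines \<open>\<lambda>\<^sub>*\<close>; it would then satisfy the Euler-Lagrange equation of that quotient in
  addition to the equation of the problem. Eliminating the operator leaves
  \<open>(\<gamma> - k) \<beta> u^(\<gamma>-1) = (k - q) \<lambda>\<^sub>* \<alpha> u^(-\<delta>)\<close>, so that \<open>\<beta> > 0\<close> and \<open>u\<close> is a multiple of
  \<open>(\<alpha>/\<beta>)^(1/(\<gamma>+\<delta>-1))\<close>, which does not belong to the space. Compactness of minimisers carries
  the strict inequalities at \<open>\<lambda>\<^sub>*\<close> over to \<open>\<lambda>\<close> slightly above \<open>\<lambda>\<^sub>*\<close>.

  The compact embedding comes from averaging over a cubic grid. On a cell the oscillation is controlled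
  by the Gagliardo energy; the potential makes the contribution of far away cells small.
\<close>

section \<open>Fibering and constrained minimisation\<close>

text \<open>The obstacle is the singular term. Integrability of
  \<open>\<alpha> u^(-\<delta>) v\<close> is not known beforehand, so \<open>A\<close> cannot be
  differentiated in general directions and no multiplier rule is available. Minimality is therefore
  used one-sidedly: perturbations that do not decrease \<open>A\<close> are scaled back into the
  constraint by explicit factors \<open>t n\<close>. These cost only o(e), because the energy along
  the ray of a point of the Nehari set has zero derivative at 1; for the same reason an active
  constraint leaves no multiplier, and the free equation holds even at a degenerate minimiser.
  Fatou's lemma applied to the difference quotients of \<open>A\<close> then yields positivity and
  an inequality for nonnegative test functions. Testing with the positive part of
  \<open>u + e v\<close> extends it to all directions, and the sign of \<open>v\<close> is free. The
  Nehari set itself is not closed under weak limits. The two constraint sets are inequalities with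
  \<open>P\<close> on the smaller side only, so lower semicontinuity of \<open>P\<close> and
  continuity of \<open>A\<close> and \<open>B\<close> suffice. All of this is done in an abstract
  locale that knows nothing of function spaces.\<close>

lemma powr_sublinear_bound:
  fixes y c1 c2 d \<theta> :: real
  assumes "y > 0" "c1 > 0" "\<theta> < 1" "0 < \<theta>" "d \<ge> 0" "c2 \<ge> 0" "c1 * y \<le> d + c2 * y powr \<theta>"
  shows "y \<le> max 1 (((d + c2) / c1) powr (1 / (1 - \<theta>)))"
proof (cases "y \<le> 1")
  case False
  \<comment> \<open>Once \<open>y > 1\<close> a constant is itself sublinear, so \<open>d\<close>
    joins \<open>c2\<close> and a power of \<open>y\<close> can be divided out.\<close>
  have "d \<le> d * y powr \<theta>"
    using False assms by (simp add: mult_le_cancel_left1 ge_one_powr_ge_zero)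
  then have "c1 * y \<le> (d + c2) * y powr \<theta>"
    using assms by (simp add: algebra_simps)
  moreover have "y = y powr (1-\<theta>) * y powr \<theta>"
    using assms by (simp flip: powr_add)
  ultimately have "(c1 * y powr (1-\<theta>)) * y powr \<theta> \<le> (d + c2) * y powr \<theta>"
    by (metis mult.assoc)
  then have "c1 * y powr (1-\<theta>) \<le> d + c2"
    using assms by (subst (asm) mult_le_cancel_right) auto
  then have "y powr (1-\<theta>) \<le> (d + c2) / c1"
    using assms by (simp add: field_simps)
  then have "(y powr (1-\<theta>)) powr (1/(1-\<theta>)) \<le> ((d+c2)/c1) powr (1/(1-\<theta>))"
    by (intro powr_mono2) (use assms in auto)
  then show ?thesis using assms by (simp add: powr_powr)
qed auto

text \<open>Since \<open>k\<close> is a convex combination of \<open>q\<close> and \<open>g\<close>,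
  this is convexity of \<open>exp\<close>. Equality at \<open>t = 1\<close> is what lets a
  degenerate fibre touch zero without crossing it.\<close>

lemma powr_convex_exponent:
  fixes t q k g :: real
  assumes "t > 0" "q < k" "k < g"
  shows "(g - q) * t powr k \<le> (g - k) * t powr q + (k - q) * t powr g"
proof -
  define u where "u = (k - q) / (g - q)"
  have u: "0 \<le> u" "u \<le> 1" "g - q > 0" using assms by (auto simp: u_def divide_simps)
  have 1: "1 - u = (g - k) / (g - q)" using u by (simp add: u_def field_simps)
  have keq: "(1 - u) * (q * ln t) + u * (g * ln t) = k * ln t"
  proof -
    have "(1 - u) * q + u * g = q + u * (g - q)" by (simp add: algebra_simps)
    also have "\<dots> = k" using u by (simp add: u_def)
    finally show ?thesis by (metis distrib_right mult.assoc)
  qed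
  have "exp ((1 - u) *\<^sub>R (q * ln t) + u *\<^sub>R (g * ln t)) \<le> (1 - u) * exp (q * ln t) + u * exp (g * ln t)"
    by (rule convex_onD[OF exp_convex]) (use u in auto)
  then have "t powr k \<le> (1 - u) * t powr q + u * t powr g"
    using assms keq by (simp add: powr_def)
  then have "(g - q) * t powr k \<le> (g - q) * ((1 - u) * t powr q + u * t powr g)"
    using u by (intro mult_left_mono) auto
  also have "\<dots> = ((g - q) * (1 - u)) * t powr q + ((g - q) * u) * t powr g"
    by (simp add: algebra_simps)
  also have "\<dots> = (g - k) * t powr q + (k - q) * t powr g"
    using u by (simp add: 1) (simp add: u_def)
  finally show ?thesis .
qed

text \<open>The map is a fibre derivative with its lowest power of \<open>t\<close> removed. Its own
  derivative has the sign of \<open>(k - q) b1 - (g - q) b2 t^(g-k)\<close>, which is negative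
  beyond the turning point.\<close>

lemma fibre_strict_decreasing:
  fixes b1 b2 q k g t1 t2 :: real
  assumes "0 < t1" "t1 < t2" "q < k" "k < g" "0 < b2"
    and "(k - q) * b1 \<le> (g - q) * b2 * t1 powr (g - k)"
  shows "b1 * t2 powr (k - q) - b2 * t2 powr (g - q) < b1 * t1 powr (k - q) - b2 * t1 powr (g - q)"
proof -
  let ?r = "\<lambda>t. b1 * t powr (k - q) - b2 * t powr (g - q)"
  let ?r' = "\<lambda>t. b1 * ((k - q) * t powr (k - q - 1)) - b2 * ((g - q) * t powr (g - q - 1))"
  have der: "(?r has_real_derivative ?r' t) (at t)" if "t > 0" for t
    using that by (auto intro!: derivative_eq_intros)
  have "\<exists>z>t1. z < t2 \<and> ?r t2 - ?r t1 = (t2 - t1) * ?r' z"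
    by (rule MVT2) (use assms der in auto)
  then obtain z where z: "t1 < z" "z < t2" "?r t2 - ?r t1 = (t2 - t1) * ?r' z" by blast
  have zp: "z > 0" using z assms by simp
  have "t1 powr (g-k) < z powr (g-k)" using z assms by (intro powr_less_mono2) auto
  then have "(k - q) * b1 < (g - q) * b2 * z powr (g - k)"
    by (rule le_less_trans[OF assms(6) mult_strict_left_mono]) (use assms in auto)
  then have "z powr (k - q - 1) * ((k - q) * b1) < z powr (k - q - 1) * ((g - q) * b2 * z powr (g - k))"
    using zp by (intro mult_strict_left_mono) auto
  also have "\<dots> = (g - q) * b2 * (z powr (k - q - 1) * z powr (g - k))" by (simp add: algebra_simps)
  also have "z powr (k - q - 1) * z powr (g - k) = z powr (g - q - 1)"
    by (simp add: algebra_simps flip: powr_add)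
  finally have "?r' z < 0" by (simp add: algebra_simps)
  then have "?r t2 - ?r t1 < 0" using z assms by (simp add: mult_pos_neg)
  then show ?thesis by simp
qed

text \<open>Only homogeneity, two embedding inequalities and a compactness alternative enter.
  \<open>K\<close> is meant to exclude zero, so a limit may leave it: this is the first alternative.
  In the second one \<open>A\<close> and \<open>B\<close> are continuous while \<open>P\<close> is
  merely lower semicontinuous.\<close>

locale nehari_fibering =
  fixes K :: "'v set" and sc :: "real \<Rightarrow> 'v \<Rightarrow> 'v" and P A B :: "'v \<Rightarrow> real"
    and a k q g C :: real
  assumes a_pos: "0 < a" and q_pos: "0 < q" and q_less: "q < k" and k_less: "k < g" and C_pos: "0 < C"
    and sc_K: "\<And>u t. u \<in> K \<Longrightarrow> t > 0 \<Longrightarrow> sc t u \<in> K"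
    and P_sc: "\<And>u t. u \<in> K \<Longrightarrow> t > 0 \<Longrightarrow> P (sc t u) = t powr k * P u"
    and A_sc: "\<And>u t. u \<in> K \<Longrightarrow> t > 0 \<Longrightarrow> A (sc t u) = t powr q * A u"
    and B_sc: "\<And>u t. u \<in> K \<Longrightarrow> t > 0 \<Longrightarrow> B (sc t u) = t powr g * B u"
    and P_pos: "\<And>u. u \<in> K \<Longrightarrow> P u > 0"
    and A_pos: "\<And>u. u \<in> K \<Longrightarrow> A u > 0"
    and A_le: "\<And>u. u \<in> K \<Longrightarrow> A u \<le> C * P u powr (q / k)"
    and B_le: "\<And>u. u \<in> K \<Longrightarrow> B u \<le> C * P u powr (g / k)"
    and compactness: "\<And>(x :: nat \<Rightarrow> 'v) c. (\<And>n. x n \<in> K) \<Longrightarrow> (\<And>n. P (x n) \<le> c) \<Longrightarrow>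
       \<exists>r. strict_mono r \<and> ((\<lambda>n. A (x (r n))) \<longlonglongrightarrow> 0 \<and> (\<lambda>n. B (x (r n))) \<longlonglongrightarrow> 0 \<or>
         (\<exists>u\<in>K. \<exists>pl. P u \<le> pl \<and> (\<lambda>n. P (x (r n))) \<longlonglongrightarrow> pl \<and>
            (\<lambda>n. A (x (r n))) \<longlonglongrightarrow> A u \<and> (\<lambda>n. B (x (r n))) \<longlonglongrightarrow> B u))"
    and B_positive_ex: "\<exists>u\<in>K. B u > 0"
begin

lemma k_pos: "0 < k" and g_pos: "0 < g" and q_less_g: "q < g"
  using q_pos q_less k_less by auto

text \<open>For \<open>B u > 0\<close> this is the maximiser over \<open>t > 0\<close> of
  \<open>a t^(k-q) P u - t^(g-q) B u\<close>, the turning point of the fibre derivative after its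
  lowest power is removed.\<close>

definition crit :: "'v \<Rightarrow> real" where
  "crit u = ((k - q) * a * P u / ((g - q) * B u)) powr (1 / (g - k))"

text \<open>For \<open>B u > 0\<close> this is the maximum over \<open>t > 0\<close> of
  \<open>(a t^(k-q) P u - t^(g-q) B u) / A u\<close>, that is, the largest \<lambda> for which the
  fibre through \<open>u\<close> has a critical point: a nonlinear Rayleigh quotient, invariant
  under scaling.\<close>

definition ray :: "'v \<Rightarrow> real" where
  "ray u = a * ((g - k) / (g - q)) * (a * ((k - q) / (g - q))) powr ((k - q) / (g - k))
     * (P u powr ((g - q) / (g - k)) / (A u * B u powr ((k - q) / (g - k))))"

definition lam_star :: real where
  "lam_star = (INF u\<in>{u \<in> K. B u > 0}. ray u)"

text \<open>For a point of the Nehari set the inequality says that the second fibre derivative at 1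
  is nonnegative, with \<open>B\<close> eliminated by the first order equation.\<close>

definition U :: "real \<Rightarrow> 'v set" where
  "U lam = {u \<in> K. (g - k) * a * P u \<le> (g - q) * lam * A u}"

text \<open>The first inequality says that the fibre derivative at 1 is nonpositive, the second says
  the same of the second derivative once \<open>A\<close> is eliminated by the first order
  equation.\<close>

definition N :: "real \<Rightarrow> 'v set" where
  "N lam = {u \<in> K. a * P u \<le> lam * A u + B u \<and> (k - q) * a * P u \<le> (g - q) * B u}"

definition energy :: "real \<Rightarrow> 'v \<Rightarrow> real" where
  "energy lam u = a / k * P u - lam / q * A u - 1 / g * B u"

definition reduced :: "real \<Rightarrow> 'v \<Rightarrow> real" where
  "reduced lam u = a * (1 / k - 1 / g) * P u - lam * (1 / q - 1 / g) * A u"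

text \<open>The coefficients \<open>a / k\<close>, \<open>lam / q\<close>, \<open>1 / g\<close> give
  the energy along the ray of \<open>u\<close>; the coefficients \<open>a\<close>,
  \<open>lam\<close>, \<open>1\<close> give \<open>t\<close> times its derivative. Both versions get
  a stationarity condition later.\<close>

definition fib :: "real \<Rightarrow> real \<Rightarrow> real \<Rightarrow> real \<Rightarrow> 'v \<Rightarrow> real" where
  "fib c1 c2 c3 t u = c1 * t powr k * P u - c2 * t powr q * A u - c3 * t powr g * B u"

text \<open>Perturbations \<open>x\<close> of \<open>u\<close> of size \<open>e\<close> on which the singular term \<open>A\<close> is only required to be
  continuous and not to decrease; for functions this is the case for \<open>u + e v\<close> with \<open>v \<ge> 0\<close>.\<close>

definition admissible :: "'v \<Rightarrow> (nat \<Rightarrow> 'v) \<Rightarrow> (nat \<Rightarrow> real) \<Rightarrow> bool" where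
  "admissible u x e \<longleftrightarrow> (\<forall>n. x n \<in> K) \<and> (\<forall>n. e n > 0) \<and> e \<longlonglongrightarrow> 0 \<and>
     (\<exists>D. \<forall>n. \<bar>P (x n) - P u\<bar> \<le> D * e n \<and> \<bar>B (x n) - B u\<bar> \<le> D * e n) \<and>
     (\<forall>n. A u \<le> A (x n)) \<and> (\<lambda>n. A (x n)) \<longlonglongrightarrow> A u"

text \<open>A one-sided first order condition that involves no derivative of \<open>A\<close>. The factor \<open>t\<close> leaves room
  for projecting the perturbation back to the constraint.\<close>

definition stationary :: "real \<Rightarrow> real \<Rightarrow> real \<Rightarrow> 'v \<Rightarrow> bool" where
  "stationary c1 c2 c3 u \<longleftrightarrow> (\<forall>x e. admissible u x e \<longrightarrow>
     (\<exists>r t \<eta>. strict_mono r \<and> t \<longlonglongrightarrow> 1 \<and> \<eta> \<longlonglongrightarrow> 0 \<and>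
       (\<forall>\<^sub>F n in sequentially.
          fib c1 c2 c3 (t n) (x (r n)) - fib c1 c2 c3 (t n) u \<ge> - \<eta> n * e (r n))))"

lemma crit_pos: "u \<in> K \<Longrightarrow> B u > 0 \<Longrightarrow> crit u > 0"
  using P_pos[of u] a_pos q_less k_less by (auto simp: crit_def)

lemma crit_powr:
  assumes "u \<in> K" "B u > 0"
  shows "(k - q) * a * P u = (g - q) * B u * crit u powr (g - k)"
proof -
  have "crit u powr (g - k) = (k - q) * a * P u / ((g - q) * B u)"
    using assms P_pos[OF assms(1)] a_pos q_less k_less by (simp add: crit_def powr_powr)
  then show ?thesis using assms q_less k_less by (simp add: field_simps)
qed

lemma crit_le_iff:
  assumes "u \<in> K" "B u > 0" "t > 0"
  shows "crit u \<le> t \<longleftrightarrow> (k - q) * a * P u \<le> (g - q) * B u * t powr (g - k)"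
proof -
  have "crit u \<le> t \<longleftrightarrow> crit u powr (g - k) \<le> t powr (g - k)"
    using crit_pos[OF assms(1,2)] assms k_less powr_less_mono2[of "g - k" t "crit u"] powr_mono2[of "g - k" "crit u" t]
    by (auto simp: not_le[symmetric])
  then show ?thesis
    unfolding crit_powr[OF assms(1,2)] using assms q_less k_less by simp
qed

lemma crit_eq:
  assumes "u \<in> K" "B u > 0"
  shows "(k - q) * a * (crit u powr k * P u) = (g - q) * (crit u powr g * B u)"
proof -
  have "(k - q) * a * (crit u powr k * P u) = ((k - q) * a * P u) * crit u powr k"
    by simp
  also have "\<dots> = ((g - q) * B u * crit u powr (g - k)) * crit u powr k"
    by (simp only: crit_powr[OF assms])
  also have "\<dots> = (g - q) * B u * (crit u powr (g - k) * crit u powr k)" by simp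
  also have "crit u powr (g - k) * crit u powr k = crit u powr g" by (simp flip: powr_add)
  finally show ?thesis by (simp add: algebra_simps)
qed

lemma ray_eq:
  assumes "u \<in> K" "B u > 0"
  shows "(g - k) * a * (crit u powr k * P u) = (g - q) * ray u * (crit u powr q * A u)"
proof -
  note pos = P_pos[OF assms(1)] A_pos[OF assms(1)] assms(2) a_pos q_less k_less q_less_g
  define e where "e = (k - q) / (g - k)"
  have e1: "(g - q) / (g - k) = 1 + e" using pos by (simp add: e_def field_simps)
  have X: "crit u powr (k - q) = (a * ((k - q) / (g - q))) powr e * P u powr e / B u powr e"
  proof -
    have "crit u powr (k - q) = ((k - q) * a * P u / ((g - q) * B u)) powr e"
      by (simp add: crit_def powr_powr e_def)
    also have "(k - q) * a * P u / ((g - q) * B u) = (a * ((k - q) / (g - q))) * P u / B u"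
      using pos by (simp add: field_simps)
    also have "\<dots> powr e = (a * ((k - q) / (g - q))) powr e * P u powr e / B u powr e"
      using pos by (simp add: powr_divide powr_mult)
    finally show ?thesis .
  qed
  have k: "crit u powr k = crit u powr (k - q) * crit u powr q" by (simp flip: powr_add)
  have P: "P u powr (1 + e) = P u * P u powr e" using pos by (simp add: powr_add)
  have "(g - q) * ray u * A u = (g - k) * a * P u * crit u powr (k - q)"
    unfolding ray_def e1 e_def[symmetric] X P using pos by (simp add: field_simps)
  then have "(g - q) * ray u * A u * crit u powr q = (g - k) * a * P u * crit u powr (k - q) * crit u powr q"
    by (simp only:)
  then show ?thesis unfolding k by (simp only: ac_simps)
qed

text \<open>As \<open>ray\<close> is invariant under scaling, the powers of \<open>P u\<close>
  coming from the bounds for \<open>A\<close> and \<open>B\<close> must cancel the one in its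
  numerator. The identity \<open>ex\<close> checks this, and a positive constant remains.\<close>

lemma ray_lower_bound: "\<exists>c>0. \<forall>u\<in>K. B u > 0 \<longrightarrow> c \<le> ray u"
proof -
  define e where "e = (k - q) / (g - k)"
  define c0 where "c0 = a * ((g - k) / (g - q)) * (a * ((k - q) / (g - q))) powr e"
  have e: "e > 0" using q_less k_less by (simp add: e_def)
  have c0: "c0 > 0" using q_less k_less q_less_g a_pos by (simp add: c0_def)
  have e1: "(g - q) / (g - k) = 1 + e" using k_less by (simp add: e_def field_simps)
  have ex: "q / k + (g / k) * e = 1 + e"
  proof -
    have ek: "e * (g - k) = k - q" using k_less by (simp add: e_def)
    have "(q / k + (g / k) * e) * k = q + g * e" using k_pos by (simp add: field_simps)
    also have "\<dots> = (1 + e) * k" using ek by (simp add: algebra_simps)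
    finally show ?thesis using k_pos by simp
  qed
  have "c0 / (C * C powr e) \<le> ray u" if u: "u \<in> K" "B u > 0" for u
  proof -
    note pos = P_pos[OF u(1)] A_pos[OF u(1)] u(2) C_pos
    have "B u powr e \<le> (C * P u powr (g / k)) powr e"
      using B_le[OF u(1)] pos e by (intro powr_mono2) auto
    then have "A u * B u powr e \<le> (C * P u powr (q / k)) * (C * P u powr (g / k)) powr e"
      using A_le[OF u(1)] pos by (intro mult_mono) auto
    also have "\<dots> = C * C powr e * (P u powr (q / k) * P u powr ((g / k) * e))"
      using pos by (simp add: powr_mult powr_powr)
    also have "P u powr (q / k) * P u powr ((g / k) * e) = P u powr (1 + e)"
      by (simp only: ex flip: powr_add)
    finally have *: "A u * B u powr e \<le> C * C powr e * P u powr (1 + e)" .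
    have AB: "A u * B u powr e > 0" using pos by simp
    have "1 / (C * C powr e) \<le> P u powr (1 + e) / (A u * B u powr e)"
      using * AB pos by (simp add: divide_simps split: if_splits)  (simp add: mult.commute mult.left_commute)
    then have "c0 * (1 / (C * C powr e)) \<le> c0 * (P u powr (1 + e) / (A u * B u powr e))"
      using c0 by (intro mult_left_mono) auto
    then show ?thesis by (simp add: ray_def e1 c0_def e_def[symmetric])
  qed
  moreover have "c0 / (C * C powr e) > 0" using c0 C_pos by simp
  ultimately show ?thesis by blast
qed

lemma lam_star_pos: "lam_star > 0"
proof -
  obtain c where c: "c > 0" "\<forall>u\<in>K. B u > 0 \<longrightarrow> c \<le> ray u" using ray_lower_bound by blast
  have "c \<le> lam_star"
    unfolding lam_star_def using B_positive_ex c by (intro cINF_greatest) auto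
  with c show ?thesis by simp
qed

lemma lam_star_le: "u \<in> K \<Longrightarrow> B u > 0 \<Longrightarrow> lam_star \<le> ray u"
proof -
  assume u: "u \<in> K" "B u > 0"
  obtain c where c: "c > 0" "\<forall>u\<in>K. B u > 0 \<longrightarrow> c \<le> ray u" using ray_lower_bound by blast
  show ?thesis unfolding lam_star_def
    by (rule cINF_lower) (use u c in \<open>auto intro!: bdd_belowI2[where m = c]\<close>)
qed

text \<open>Hypothesis 1 puts \<open>crit u\<close> at or below 1, while hypothesis 2 with
  \<open>lam \<le> lam_star \<le> ray u\<close> pushes it to 1 or above. Hence
  \<open>crit u = 1\<close> and the whole chain of inequalities consists of equalities.\<close>

lemma degenerate_of_le_lam_star:
  assumes u: "u \<in> K" and lam: "0 < lam" "lam \<le> lam_star"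
    and 1: "(k - q) * a * P u \<le> (g - q) * B u" and 2: "(g - k) * a * P u \<le> (g - q) * lam * A u"
  shows "lam = lam_star" "(k - q) * a * P u = (g - q) * B u" "a * P u = lam * A u + B u"
proof -
  note pos = P_pos[OF u] A_pos[OF u] a_pos q_less k_less q_less_g
  have "(k - q) * a * P u > 0" using pos by simp
  with 1 have "0 < (g - q) * B u" by linarith
  then have Bp: "B u > 0" using pos by (simp add: zero_less_mult_iff)
  define y where "y = crit u"
  have y0: "y > 0" using crit_pos[OF u Bp] by (simp add: y_def)
  have y1: "y \<le> 1" unfolding y_def using 1 by (subst crit_le_iff[OF u Bp]) auto
  have ray: "lam_star \<le> ray u" using lam_star_le[OF u Bp] .
  have "y powr q * ((g - k) * a * P u) \<le> y powr q * ((g - q) * lam * A u)"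
    using 2 y0 by (intro mult_left_mono) auto
  also have "\<dots> = lam * ((g - q) * (y powr q * A u))" by (simp add: algebra_simps)
  also have "\<dots> \<le> lam_star * ((g - q) * (y powr q * A u))"
    using lam pos y0 by (intro mult_right_mono) auto
  also have "\<dots> \<le> ray u * ((g - q) * (y powr q * A u))"
    using ray pos y0 by (intro mult_right_mono) auto
  also have "\<dots> = y powr k * ((g - k) * a * P u)"
    using ray_eq[OF u Bp] by (simp add: y_def algebra_simps)
  finally have "y powr q \<le> y powr k" using pos by (simp add: mult_le_cancel_right)
  then have "y = 1" using y0 y1 q_less powr_less_mono'[of y q k] by force
  then have c: "crit u = 1" by (simp add: y_def)
  show 3: "(k - q) * a * P u = (g - q) * B u" using crit_eq[OF u Bp] c by simp
  have "(g - k) * a * P u = (g - q) * (ray u * A u)" using ray_eq[OF u Bp] c by simp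
  moreover have "lam_star * A u \<le> ray u * A u" "lam * A u \<le> lam_star * A u"
    using ray lam pos by (auto intro: mult_right_mono)
  moreover have "(g - q) * (lam * A u) \<ge> (g - q) * (ray u * A u)" using 2 calculation(1) by simp
  then have "lam * A u \<ge> ray u * A u" using q_less_g by simp
  ultimately have 4: "lam * A u = lam_star * A u" "lam * A u = ray u * A u" by linarith+
  have 5: "(g - k) * a * P u = (g - q) * (lam * A u)"
    unfolding 4(2) by (rule \<open>(g - k) * a * P u = (g - q) * (ray u * A u)\<close>)
  from 4(1) show "lam = lam_star" using A_pos[OF u] by simp
  have "(g - q) * (a * P u) = (g - q) * (lam * A u + B u)"
    using 3 5 by (simp add: algebra_simps)
  then show "a * P u = lam * A u + B u" using pos by simp
qed

text \<open>The coefficients of a degenerate fibre are proportional to those of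
  \<open>powr_convex_exponent\<close>, so the energy never increases along the ray, on either side
  of 1.\<close>

lemma degenerate_fib_nonpos:
  assumes u: "u \<in> K" and 1: "(k - q) * a * P u = (g - q) * B u" and 2: "a * P u = lam * A u + B u"
    and t: "t > 0"
  shows "fib a lam 1 t u \<le> 0"
proof -
  note pos = P_pos[OF u] a_pos q_less k_less q_less_g
  define S where "S = a * P u"
  have S: "S > 0" using pos by (simp add: S_def)
  have b: "(g - q) * B u = (k - q) * S" using 1 by (simp add: S_def)
  have "(g - q) * (lam * A u) = (g - q) * (S - B u)" using 2 by (simp add: S_def)
  also have "\<dots> = (g - q) * S - (k - q) * S" unfolding b[symmetric] by (simp add: algebra_simps)
  finally have l: "(g - q) * (lam * A u) = (g - k) * S" by (simp add: algebra_simps)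
  have "(g - q) * fib a lam 1 t u
      = S * ((g - q) * t powr k) - t powr q * ((g - q) * (lam * A u)) - t powr g * ((g - q) * B u)"
    by (simp add: fib_def S_def algebra_simps)
  also have "\<dots> = S * ((g - q) * t powr k - (g - k) * t powr q - (k - q) * t powr g)"
    unfolding b l by (simp add: algebra_simps)
  also have "\<dots> \<le> 0"
    using powr_convex_exponent[OF t q_less k_less] S by (simp add: mult_le_0_iff)
  finally show ?thesis using pos by (simp add: mult_le_0_iff)
qed

lemma fib_sc: "u \<in> K \<Longrightarrow> t > 0 \<Longrightarrow> energy lam (sc t u) = fib (a / k) (lam / q) (1 / g) t u"
  by (simp add: energy_def fib_def P_sc A_sc B_sc)

lemma fib_one: "energy lam u = fib (a / k) (lam / q) (1 / g) 1 u"
  by (simp add: energy_def fib_def)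

lemma fib_deriv:
  "t > 0 \<Longrightarrow> ((\<lambda>t. fib c1 c2 c3 t u) has_real_derivative
     (fib (c1 * k) (c2 * q) (c3 * g) t u / t)) (at t)"
  unfolding fib_def
  by (auto intro!: derivative_eq_intros simp: powr_diff diff_divide_distrib ac_simps)

lemma energy_deriv:
  "t > 0 \<Longrightarrow> ((\<lambda>t. fib (a / k) (lam / q) (1 / g) t u) has_real_derivative fib a lam 1 t u / t) (at t)"
  using fib_deriv[of t "a / k" "lam / q" "1 / g" u] k_pos q_pos g_pos by simp

end

lemma eventually_less_at_right_of_deriv_neg:
  fixes f :: "real \<Rightarrow> real"
  assumes "(f has_real_derivative D) (at x)" "D < 0"
  shows "\<forall>\<^sub>F t in at_right x. f t < f x"
proof -
  obtain d where d: "d > 0" "\<And>h. h > 0 \<Longrightarrow> h < d \<Longrightarrow> f (x + h) < f x"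
    using DERIV_neg_dec_right[OF assms] by blast
  show ?thesis
    unfolding eventually_at_right_field
  proof (intro exI conjI allI impI)
    show "x < x + d" using d by simp
    fix y assume "x < y" "y < x + d"
    then show "f y < f x" using d(2)[of "y - x"] by simp
  qed
qed

lemma eventually_less_at_left_of_deriv_pos:
  fixes f :: "real \<Rightarrow> real"
  assumes "(f has_real_derivative D) (at x)" "D > 0"
  shows "\<forall>\<^sub>F t in at_left x. f t < f x"
proof -
  obtain d where d: "d > 0" "\<And>h. h > 0 \<Longrightarrow> h < d \<Longrightarrow> f (x - h) < f x"
    using DERIV_pos_inc_left[OF assms] by blast
  show ?thesis
    unfolding eventually_at_left_field
  proof (intro exI conjI allI impI)
    show "x - d < x" using d by simp
    fix y assume "x - d < y" "y < x"
    then show "f y < f x" using d(2)[of "x - y"] by simp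
  qed
qed

text \<open>Where \<open>F\<close> has zero derivative, moving its argument by an amount of order
  \<open>e\<close> changes it by o(e) only. This makes the scaling of a perturbation back into a
  constraint free at first order.\<close>

lemma flat_along_powr:
  fixes F \<phi> :: "real \<Rightarrow> real"
  assumes \<phi>: "(\<phi> has_real_derivative d) (at 0)" "\<phi> 0 = 1"
    and F: "(F has_real_derivative 0) (at 1)"
    and e: "e \<longlonglongrightarrow> 0" "\<And>n. e n > 0"
  shows "(\<lambda>n. \<phi> (e n) powr c) \<longlonglongrightarrow> 1" "(\<lambda>n. (F (\<phi> (e n) powr c) - F 1) / e n) \<longlonglongrightarrow> 0"
proof -
  have h: "((\<lambda>s. \<phi> s powr c) has_real_derivative c * \<phi> 0 powr (c - 1) * d) (at 0)"
    by (rule DERIV_chain2[OF has_real_derivative_powr[of "\<phi> 0"] \<phi>(1)]) (simp add: \<phi>)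
  have e0: "filterlim e (at 0) sequentially"
    by (rule filterlim_atI[OF e(1)]) (simp add: e(2) less_imp_neq[symmetric])
  have "isCont (\<lambda>s. \<phi> s powr c) 0" using DERIV_isCont[OF h] .
  then have "((\<lambda>s. \<phi> s powr c) \<longlongrightarrow> 1) (at 0)" by (simp add: isCont_def \<phi>)
  from filterlim_compose[OF this e0] show "(\<lambda>n. \<phi> (e n) powr c) \<longlonglongrightarrow> 1" .
  have "((\<lambda>s. F (\<phi> s powr c)) has_real_derivative 0 * (c * \<phi> 0 powr (c - 1) * d)) (at 0)"
    by (rule DERIV_chain2[OF _ h]) (simp add: \<phi> F)
  then have "((\<lambda>s. (F (\<phi> s powr c) - F 1) / s) \<longlongrightarrow> 0) (at 0)"
    by (simp add: has_field_derivative_iff \<phi>)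
  from filterlim_compose[OF this e0] show "(\<lambda>n. (F (\<phi> (e n) powr c) - F 1) / e n) \<longlonglongrightarrow> 0" .
qed

section \<open>Minimisation of the energy over \<open>U\<close>\<close>

context nehari_fibering
begin

definition min_U :: "real \<Rightarrow> 'v \<Rightarrow> bool" where
  "min_U lam u \<longleftrightarrow> u \<in> U lam \<and> (\<forall>v\<in>U lam. energy lam u \<le> energy lam v)"

definition min_N :: "real \<Rightarrow> 'v \<Rightarrow> bool" where
  "min_N lam u \<longleftrightarrow> u \<in> N lam \<and> (\<forall>v\<in>N lam. reduced lam u \<le> reduced lam v)"

lemma U_K: "u \<in> U lam \<Longrightarrow> u \<in> K" and N_K: "u \<in> N lam \<Longrightarrow> u \<in> K"
  by (auto simp: U_def N_def)

lemma exponents: "0 < q / k" "q / k < 1" "1 < g / k" "0 < 1 / k - 1 / g" "0 < 1 / q - 1 / g"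
  using q_pos q_less k_less k_pos g_pos by (auto simp: field_simps)

text \<open>Coercivity from \<open>q < k\<close>: on \<open>U\<close> a multiple of
  \<open>P u\<close> is bounded by \<open>P u powr (q / k)\<close>. The bound is uniform in the
  parameter because minimisers for varying parameters are compared later.\<close>

lemma U_bounded:
  assumes "L > 0"
  shows "\<exists>M>0. \<forall>lam u. 0 < lam \<and> lam \<le> L \<and> u \<in> U lam \<longrightarrow> P u \<le> M"
proof -
  define c1 where "c1 = (g - k) * a"
  define c2 where "c2 = (g - q) * L * C"
  have c: "c1 > 0" "c2 > 0" using assms a_pos k_less q_less_g C_pos by (auto simp: c1_def c2_def)
  have "P u \<le> max 1 (((0 + c2) / c1) powr (1 / (1 - q / k)))" if "0 < lam" "lam \<le> L" "u \<in> U lam" for lam u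
  proof (rule powr_sublinear_bound)
    have u: "u \<in> K" using that U_K by blast
    have "c1 * P u \<le> (g - q) * lam * A u" using that by (simp add: U_def c1_def)
    also have "\<dots> \<le> (g - q) * L * (C * P u powr (q / k))"
      using that A_le[OF u] A_pos[OF u] q_less_g by (intro mult_mono mult_left_mono) (auto intro!: mult_nonneg_nonneg)
    finally show "c1 * P u \<le> 0 + c2 * P u powr (q / k)" by (simp add: c2_def algebra_simps)
    show "P u > 0" using P_pos[OF u] .
  qed (use c exponents in auto)
  then show ?thesis
    by (intro exI[of _ "max 1 (((0 + c2) / c1) powr (1 / (1 - q / k)))"]) auto
qed

text \<open>Serves minimising sequences (constant \<open>l\<close>) and minimisers for varying
  parameters alike. Vanishing would send \<open>A\<close> and \<open>B\<close> to 0 and force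
  \<open>Y \<ge> 0\<close>. The limit \<open>pl\<close> of \<open>P\<close> is kept apart from
  \<open>P u\<close>, so that convergence of \<open>P\<close> can be recovered once \<open>u\<close>
  is known to be a minimiser.\<close>

lemma U_limit:
  assumes l: "l \<longlonglongrightarrow> lam" "lam > 0" "\<And>n. 0 < l n" and x: "\<And>n. x n \<in> U (l n)"
    and y: "\<And>n. energy (l n) (x n) \<le> y n" "y \<longlonglongrightarrow> Y" "Y < 0"
  shows "\<exists>r u pl. strict_mono r \<and> u \<in> U lam \<and> P u \<le> pl \<and> (\<lambda>n. P (x (r n))) \<longlonglongrightarrow> pl \<and>
     (\<lambda>n. A (x (r n))) \<longlonglongrightarrow> A u \<and> (\<lambda>n. B (x (r n))) \<longlonglongrightarrow> B u \<and>
     a / k * pl - lam / q * A u - 1 / g * B u \<le> Y"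
proof -
  have "Bseq l" by (rule convergent_imp_Bseq[OF convergentI[OF l(1)]])
  then obtain L where "0 < L" and L0: "\<forall>n. norm (l n) \<le> L" by (rule BseqE)
  then have L: "L > 0" "\<And>n. norm (l n) \<le> L" by simp_all
  obtain M where M: "\<And>n. P (x n) \<le> M"
  proof -
    obtain M where "\<forall>lam u. 0 < lam \<and> lam \<le> L \<and> u \<in> U lam \<longrightarrow> P u \<le> M"
      using U_bounded[OF L(1)] by auto
    moreover have "l n \<le> L" for n using L(2)[of n] by simp
    ultimately have "P (x n) \<le> M" for n using l(3) x by blast
    then show ?thesis by (rule that)
  qed
  have xK: "x n \<in> K" for n using x U_K by blast
  obtain r where r: "strict_mono r" and alt: "(\<lambda>n. A (x (r n))) \<longlonglongrightarrow> 0 \<and> (\<lambda>n. B (x (r n))) \<longlonglongrightarrow> 0 \<or>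
         (\<exists>u\<in>K. \<exists>pl. P u \<le> pl \<and> (\<lambda>n. P (x (r n))) \<longlonglongrightarrow> pl \<and>
            (\<lambda>n. A (x (r n))) \<longlonglongrightarrow> A u \<and> (\<lambda>n. B (x (r n))) \<longlonglongrightarrow> B u)"
    using compactness[of x M] xK M by blast
  have lr: "(\<lambda>n. l (r n)) \<longlonglongrightarrow> lam" and yr: "(\<lambda>n. y (r n)) \<longlonglongrightarrow> Y"
    using LIMSEQ_subseq_LIMSEQ[OF l(1) r] LIMSEQ_subseq_LIMSEQ[OF y(2) r] by (simp_all add: o_def)
  have e: "a / k * P (x (r n)) - l (r n) / q * A (x (r n)) - 1 / g * B (x (r n)) \<le> y (r n)" for n
    using y(1)[of "r n"] by (simp add: energy_def)
  show ?thesis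
  proof (cases "(\<lambda>n. A (x (r n))) \<longlonglongrightarrow> 0 \<and> (\<lambda>n. B (x (r n))) \<longlonglongrightarrow> 0")
    case True
    have "(\<lambda>n. - (l (r n) / q * A (x (r n))) - 1 / g * B (x (r n))) \<longlonglongrightarrow> - (lam / q * 0) - 1 / g * 0"
      using True lr q_pos by (intro tendsto_intros) auto
    moreover have "- (l (r n) / q * A (x (r n))) - 1 / g * B (x (r n)) \<le> y (r n)" for n
    proof -
      have "a / k * P (x (r n)) > 0" using P_pos[OF xK] a_pos k_pos by simp
      then show ?thesis using e[of n] by linarith
    qed
    ultimately have "- (lam / q * 0) - 1 / g * 0 \<le> Y" by (intro LIMSEQ_le[OF _ yr]) auto
    then show ?thesis using y(3) by simp
  next
    case False
    then obtain u pl where u: "u \<in> K" "P u \<le> pl" "(\<lambda>n. P (x (r n))) \<longlonglongrightarrow> pl"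
      "(\<lambda>n. A (x (r n))) \<longlonglongrightarrow> A u" "(\<lambda>n. B (x (r n))) \<longlonglongrightarrow> B u" using alt by blast
    have "(\<lambda>n. a / k * P (x (r n)) - l (r n) / q * A (x (r n)) - 1 / g * B (x (r n)))
        \<longlonglongrightarrow> a / k * pl - lam / q * A u - 1 / g * B u"
      using u lr q_pos by (intro tendsto_intros) auto
    then have 1: "a / k * pl - lam / q * A u - 1 / g * B u \<le> Y"
      by (rule LIMSEQ_le[OF _ yr]) (use e in auto)
    have "(\<lambda>n. (g - k) * a * P (x (r n))) \<longlonglongrightarrow> (g - k) * a * pl"
      "(\<lambda>n. (g - q) * l (r n) * A (x (r n))) \<longlonglongrightarrow> (g - q) * lam * A u"
      using u lr by (auto intro!: tendsto_intros)
    then have "(g - k) * a * pl \<le> (g - q) * lam * A u"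
      by (rule LIMSEQ_le) (use x in \<open>auto simp: U_def\<close>)
    moreover have "(g - k) * a * P u \<le> (g - k) * a * pl"
      using u(2) a_pos k_less by (intro mult_left_mono) auto
    ultimately have "u \<in> U lam" using u by (simp add: U_def)
    then show ?thesis using u r 1 by blast
  qed
qed

text \<open>The singular exponent \<open>q\<close> is the smallest one, so for small
  \<open>t\<close> the term with \<open>A\<close> dominates both in the constraint and in the energy
  of \<open>t v\<close>.\<close>

lemma U_energy_negative:
  assumes "lam > 0" shows "\<exists>u\<in>U lam. energy lam u < 0"
proof -
  obtain v where v: "v \<in> K" using B_positive_ex by blast
  note pos = P_pos[OF v] A_pos[OF v] q_pos q_less k_less q_less_g
  let ?t = "\<lambda>n. 1 / real (Suc n)"
  have z: "(\<lambda>n. ?t n powr c) \<longlonglongrightarrow> 0" if "c > 0" for c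
    by (rule tendsto_zero_powrI[of _ _ "\<lambda>_. c" c]) (use that lim_1_over_real_power[of 1] LIMSEQ_Suc[OF lim_1_over_n] in auto)
  have "(\<lambda>n. (g - k) * a * P v * ?t n powr (k - q)) \<longlonglongrightarrow> (g - k) * a * P v * 0"
    by (intro tendsto_intros z) (use pos in auto)
  then have "\<forall>\<^sub>F n in sequentially. (g - k) * a * P v * ?t n powr (k - q) < (g - q) * lam * A v"
    by (rule order_tendstoD) (use pos assms in auto)
  moreover have "(\<lambda>n. a / k * P v * ?t n powr (k - q) - 1 / g * B v * ?t n powr (g - q)) \<longlonglongrightarrow> a / k * P v * 0 - 1 / g * B v * 0"
    by (intro tendsto_intros z) (use pos in auto)
  then have "\<forall>\<^sub>F n in sequentially. a / k * P v * ?t n powr (k - q) - 1 / g * B v * ?t n powr (g - q) < lam / q * A v"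
    by (rule order_tendstoD) (use pos assms in auto)
  ultimately have "\<forall>\<^sub>F n in sequentially. (g - k) * a * P v * ?t n powr (k - q) < (g - q) * lam * A v \<and>
     a / k * P v * ?t n powr (k - q) - 1 / g * B v * ?t n powr (g - q) < lam / q * A v"
    by (rule eventually_conj)
  then obtain n where n: "(g - k) * a * P v * ?t n powr (k - q) < (g - q) * lam * A v"
     "a / k * P v * ?t n powr (k - q) - 1 / g * B v * ?t n powr (g - q) < lam / q * A v"
    by (auto dest: eventually_happens)
  define t where "t = ?t n"
  have t: "t > 0" by (simp add: t_def)
  have k: "t powr k = t powr (k - q) * t powr q" "t powr g = t powr (g - q) * t powr q"
    by (simp_all flip: powr_add)
  have 1: "((g - k) * a * P v * t powr (k - q)) * t powr q \<le> ((g - q) * lam * A v) * t powr q"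
    using n(1) t by (intro mult_right_mono) (auto simp: t_def)
  have 2: "(a / k * P v * t powr (k - q) - 1 / g * B v * t powr (g - q)) * t powr q < (lam / q * A v) * t powr q"
    using n(2) t by (intro mult_strict_right_mono) (auto simp: t_def)
  have "sc t v \<in> U lam"
    using 1 v t by (simp add: U_def sc_K P_sc A_sc k mult_ac)
  moreover have "energy lam (sc t v) < 0"
    using 2 v t by (simp add: energy_def P_sc A_sc B_sc k algebra_simps)
  ultimately show ?thesis by blast
qed

lemma min_U_ex:
  assumes lam: "lam > 0"
  shows "\<exists>u. min_U lam u" and "min_U lam u \<Longrightarrow> energy lam u < 0"
proof -
  show neg: "min_U lam u \<Longrightarrow> energy lam u < 0" for u
    using U_energy_negative[OF lam] unfolding min_U_def by force
  obtain M where M: "M > 0" "\<And>u. u \<in> U lam \<Longrightarrow> P u \<le> M"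
  proof -
    obtain M where "M > 0" "\<forall>mu u. 0 < mu \<and> mu \<le> lam \<and> u \<in> U mu \<longrightarrow> P u \<le> M"
      using U_bounded[OF lam] by auto
    then show ?thesis using lam by (intro that[of M]) auto
  qed
  \<comment> \<open>The part with \<open>P\<close> is positive, and the other two terms are
    controlled through \<open>P u \<le> M\<close>.\<close>
  define b where "b = - (lam / q * (C * M powr (q / k))) - 1 / g * (C * M powr (g / k))"
  have b: "b \<le> energy lam u" if "u \<in> U lam" for u
  proof -
    have u: "u \<in> K" using that U_K by blast
    have "P u powr (q / k) \<le> M powr (q / k)" "P u powr (g / k) \<le> M powr (g / k)"
      using M(2)[OF that] P_pos[OF u] q_pos k_pos g_pos by (auto intro!: powr_mono2)
    then have "A u \<le> C * M powr (q / k)" "B u \<le> C * M powr (g / k)"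
      using A_le[OF u] B_le[OF u] C_pos by (meson mult_le_cancel_left_pos order_trans)+
    then have "lam / q * A u \<le> lam / q * (C * M powr (q / k))" "1 / g * B u \<le> 1 / g * (C * M powr (g / k))"
      using lam q_pos g_pos by (intro mult_left_mono; simp)+
    moreover have "a / k * P u > 0" using P_pos[OF u] a_pos k_pos by simp
    ultimately show ?thesis by (simp add: b_def energy_def)
  qed
  define Y where "Y = (INF u\<in>U lam. energy lam u)"
  have ne: "U lam \<noteq> {}" using U_energy_negative[OF lam] by blast
  have bdd: "bdd_below (energy lam ` U lam)" by (rule bdd_belowI2[OF b])
  have Yle: "Y \<le> energy lam u" if "u \<in> U lam" for u
    unfolding Y_def by (rule cINF_lower[OF bdd that])
  have Yneg: "Y < 0" using U_energy_negative[OF lam] Yle by force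
  have "\<exists>u\<in>U lam. energy lam u < Y + 1 / real (Suc n)" for n
    using cINF_less_iff[OF ne bdd, of "Y + 1 / real (Suc n)"] by (simp add: Y_def)
  then obtain x where x: "\<And>n. x n \<in> U lam" "\<And>n. energy lam (x n) < Y + 1 / real (Suc n)" by metis
  have "(\<lambda>n. Y + 1 / real (Suc n)) \<longlonglongrightarrow> Y + 0"
    by (intro tendsto_intros LIMSEQ_Suc[OF lim_1_over_n])
  then have yl: "(\<lambda>n. Y + 1 / real (Suc n)) \<longlonglongrightarrow> Y" by simp
  obtain r u pl where u: "u \<in> U lam" "P u \<le> pl" "a / k * pl - lam / q * A u - 1 / g * B u \<le> Y"
    using U_limit[OF tendsto_const lam lam x(1) less_imp_le[OF x(2)] yl Yneg]
    by (elim exE conjE) (rule that)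
  have "a / k * P u \<le> a / k * pl" using u a_pos k_pos by (intro mult_left_mono) auto
  then have "energy lam u \<le> Y" using u by (simp add: energy_def)
  then show "\<exists>u. min_U lam u" using u Yle unfolding min_U_def by (meson order_trans)
qed

text \<open>\<open>U\<close> is stable under shrinking, since \<open>t^k \<le> t^q\<close> for
  \<open>t < 1\<close>. A positive fibre derivative at 1 would thus contradict minimality, whether
  or not the constraint is active.\<close>

lemma min_U_fib_le:
  assumes m: "min_U lam u" and lam: "lam > 0"
  shows "a * P u \<le> lam * A u + B u"
proof (rule ccontr)
  assume "\<not> ?thesis"
  then have "fib a lam 1 1 u / 1 > 0" by (simp add: fib_def)
  from eventually_less_at_left_of_deriv_pos[OF energy_deriv this]
  have "\<forall>\<^sub>F t in at_left 1. fib (a / k) (lam / q) (1 / g) t u < energy lam u" by (simp add: fib_one)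
  moreover have "\<forall>\<^sub>F t in at_left (1::real). t > 0 \<and> t < 1"
    by (auto simp: eventually_at_left_field intro!: exI[of _ 0])
  ultimately have "\<forall>\<^sub>F t in at_left 1. fib (a / k) (lam / q) (1 / g) t u < energy lam u \<and> t > 0 \<and> t < 1"
    by (rule eventually_conj)
  then obtain t where t: "fib (a / k) (lam / q) (1 / g) t u < energy lam u" "t > 0" "t < 1"
    by (auto dest: eventually_happens)
  have uU: "u \<in> U lam" and u: "u \<in> K" using m U_K by (auto simp: min_U_def)
  have "t powr k \<le> t powr q" using t q_less by (intro powr_mono') auto
  then have "t powr k * ((g - k) * a * P u) \<le> t powr q * ((g - k) * a * P u)"
    using P_pos[OF u] a_pos k_less by (intro mult_right_mono) auto
  also have "\<dots> \<le> t powr q * ((g - q) * lam * A u)"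
    using uU by (intro mult_left_mono) (auto simp: U_def)
  finally have "sc t u \<in> U lam" using u t by (simp add: U_def sc_K P_sc A_sc mult_ac)
  then show False using m t u by (auto simp: min_U_def fib_sc[OF u, symmetric] not_less[symmetric])
qed

text \<open>Slack in the constraint also permits slight stretching, which excludes a negative fibre
  derivative.\<close>

lemma min_U_interior:
  assumes m: "min_U lam u" and lam: "lam > 0" and s: "(g - k) * a * P u < (g - q) * lam * A u"
  shows "a * P u = lam * A u + B u"
proof (rule ccontr)
  assume "\<not> ?thesis"
  then have "fib a lam 1 1 u / 1 < 0" using min_U_fib_le[OF m lam] by (simp add: fib_def)
  from eventually_less_at_right_of_deriv_neg[OF energy_deriv this]
  have "\<forall>\<^sub>F t in at_right 1. fib (a / k) (lam / q) (1 / g) t u < energy lam u" by (simp add: fib_one)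
  moreover have "((\<lambda>t. t powr q * ((g - q) * lam * A u) - t powr k * ((g - k) * a * P u)) \<longlongrightarrow>
     1 powr q * ((g - q) * lam * A u) - 1 powr k * ((g - k) * a * P u)) (at_right 1)"
    by (intro tendsto_intros) auto
  then have "\<forall>\<^sub>F t in at_right 1. t powr q * ((g - q) * lam * A u) - t powr k * ((g - k) * a * P u) > 0"
    by (rule order_tendstoD) (use s in auto)
  moreover have "\<forall>\<^sub>F t in at_right (1::real). t > 1"
    by (simp add: eventually_at_right_less)
  ultimately have "\<forall>\<^sub>F t in at_right 1. fib (a / k) (lam / q) (1 / g) t u < energy lam u \<and>
     t powr q * ((g - q) * lam * A u) - t powr k * ((g - k) * a * P u) > 0 \<and> t > 1"
    by eventually_elim auto
  then obtain t where t: "fib (a / k) (lam / q) (1 / g) t u < energy lam u"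
     "t powr q * ((g - q) * lam * A u) - t powr k * ((g - k) * a * P u) > 0" "t > 1"
    by (auto dest: eventually_happens)
  have u: "u \<in> K" using m U_K by (auto simp: min_U_def)
  have "sc t u \<in> U lam" using t u by (simp add: U_def sc_K P_sc A_sc mult_ac)
  then show False using m t u by (auto simp: min_U_def fib_sc[OF u, symmetric] not_less[symmetric])
qed

text \<open>The constraint may be active here. Then \<open>x n\<close> can leave \<open>U\<close>,
  because \<open>P\<close> may grow by \<open>D * e n\<close>; the factor \<open>t n\<close>
  restores the constraint, as \<open>A\<close> does not decrease, and by
  \<open>flat_along_powr\<close> it costs o(e).\<close>

lemma stationary_U:
  assumes m: "min_U lam u" and lam: "lam > 0" and eq: "a * P u = lam * A u + B u"
  shows "stationary (a / k) (lam / q) (1 / g) u"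
  unfolding stationary_def
proof (intro allI impI)
  fix x e assume adm: "admissible u x e"
  then obtain D0 where D0: "\<And>n. \<bar>P (x n) - P u\<bar> \<le> D0 * e n" by (auto simp: admissible_def)
  have e: "e \<longlonglongrightarrow> 0" "\<And>n. e n > 0" and xK: "\<And>n. x n \<in> K" and Ax: "\<And>n. A u \<le> A (x n)"
    using adm by (auto simp: admissible_def)
  have uU: "u \<in> U lam" and u: "u \<in> K" using m U_K by (auto simp: min_U_def)
  note pos = P_pos[OF u] a_pos q_less k_less q_less_g
  define D where "D = \<bar>D0\<bar>"
  have D: "P (x n) \<le> P u + D * e n" for n
  proof -
    have "D0 * e n \<le> D * e n" using e(2)[of n] by (simp add: D_def)
    then show ?thesis using D0[of n] by linarith
  qed
  \<comment> \<open>The smallest possible value of \<open>P u / P (x n)\<close>. Its root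
    \<open>t n\<close> satisfies \<open>t n powr (k - q) * P (x n) \<le> P u\<close>.\<close>
  define \<phi> where "\<phi> = (\<lambda>s. P u / (P u + D * s))"
  have D1: "(\<phi> has_real_derivative - (P u * D) / (P u + D * 0)\<^sup>2) (at 0)"
    unfolding \<phi>_def using pos by (auto intro!: derivative_eq_intros simp: power2_eq_square)
  have F: "((\<lambda>t. fib (a / k) (lam / q) (1 / g) t u) has_real_derivative 0) (at 1)"
    using energy_deriv[of 1 lam u] eq by (simp add: fib_def)
  define t where "t = (\<lambda>n. \<phi> (e n) powr (1 / (k - q)))"
  let ?F = "\<lambda>t. fib (a / k) (lam / q) (1 / g) t u"
  have fl: "t \<longlonglongrightarrow> 1" "(\<lambda>n. (?F (t n) - ?F 1) / e n) \<longlonglongrightarrow> 0"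
    unfolding t_def by (rule flat_along_powr[OF D1 _ F e]; use pos in \<open>simp add: \<phi>_def\<close>)+
  have main: "fib (a / k) (lam / q) (1 / g) (t n) (x n) - ?F (t n) \<ge> - ((?F (t n) - ?F 1) / e n) * e n" for n
  proof -
    have De: "D * e n \<ge> 0" using e(2)[of n] by (simp add: D_def)
    have \<phi>p: "\<phi> (e n) > 0" using pos De by (auto simp: \<phi>_def intro!: divide_pos_pos)
    then have tp: "t n > 0" by (simp add: t_def)
    have "t n powr (k - q) = \<phi> (e n)" using \<phi>p pos by (simp add: t_def powr_powr)
    then have "t n powr (k - q) * P (x n) = \<phi> (e n) * P (x n)" by simp
    also have "\<dots> \<le> \<phi> (e n) * (P u + D * e n)" using D \<phi>p by (intro mult_left_mono) auto
    also have "\<dots> = P u" using pos De by (simp add: \<phi>_def)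
    finally have "(g - k) * a * (t n powr (k - q) * P (x n)) \<le> (g - k) * a * P u"
      using pos by (intro mult_left_mono) auto
    also have "\<dots> \<le> (g - q) * lam * A u" using uU by (simp add: U_def)
    also have "\<dots> \<le> (g - q) * lam * A (x n)" using Ax lam pos by (intro mult_left_mono) auto
    finally have "t n powr q * ((g - k) * a * (t n powr (k - q) * P (x n))) \<le> t n powr q * ((g - q) * lam * A (x n))"
      by (intro mult_left_mono) auto
    moreover have "t n powr k = t n powr (k - q) * t n powr q" by (simp flip: powr_add)
    ultimately have "sc (t n) (x n) \<in> U lam" using xK tp by (simp add: U_def sc_K P_sc A_sc mult_ac)
    then have "energy lam u \<le> energy lam (sc (t n) (x n))" using m by (auto simp: min_U_def)
    then have "?F 1 \<le> fib (a / k) (lam / q) (1 / g) (t n) (x n)"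
      unfolding fib_sc[OF xK tp] by (simp only: fib_one)
    then show ?thesis using e(2)[of n] by simp
  qed
  show "\<exists>r t \<eta>. strict_mono r \<and> t \<longlonglongrightarrow> 1 \<and> \<eta> \<longlonglongrightarrow> 0 \<and>
       (\<forall>\<^sub>F n in sequentially. fib (a / k) (lam / q) (1 / g) (t n) (x (r n)) - ?F (t n) \<ge> - \<eta> n * e (r n))"
    using fl main by (intro exI[of _ id] exI[of _ t] exI[of _ "\<lambda>n. (?F (t n) - ?F 1) / e n"])
      (auto simp: strict_mono_id)
qed

section \<open>Fibres beyond their turning point and stationarity over \<open>N\<close>\<close>

lemma admissible_tendsto:
  assumes "admissible u x e"
  shows "(\<lambda>n. P (x n)) \<longlonglongrightarrow> P u" "(\<lambda>n. B (x n)) \<longlonglongrightarrow> B u" "(\<lambda>n. A (x n)) \<longlonglongrightarrow> A u"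
proof -
  obtain D where D: "\<And>n. \<bar>P (x n) - P u\<bar> \<le> D * e n" "\<And>n. \<bar>B (x n) - B u\<bar> \<le> D * e n"
    and e: "e \<longlonglongrightarrow> 0" using assms by (auto simp: admissible_def)
  have "(\<lambda>n. D * e n) \<longlonglongrightarrow> 0" using tendsto_mult_left[OF e, of D] by simp
  then have "(\<lambda>n. P (x n) - P u) \<longlonglongrightarrow> 0" "(\<lambda>n. B (x n) - B u) \<longlonglongrightarrow> 0"
    by (rule Lim_null_comparison[rotated]; simp add: D)+
  then show "(\<lambda>n. P (x n)) \<longlonglongrightarrow> P u" "(\<lambda>n. B (x n)) \<longlonglongrightarrow> B u" by (simp_all add: LIM_zero_iff)
  show "(\<lambda>n. A (x n)) \<longlonglongrightarrow> A u" using assms by (simp add: admissible_def)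
qed

lemma crit_tendsto:
  assumes "(\<lambda>n. P (x n)) \<longlonglongrightarrow> P u" "(\<lambda>n. B (x n)) \<longlonglongrightarrow> B u" "u \<in> K" "B u > 0"
  shows "(\<lambda>n. crit (x n)) \<longlonglongrightarrow> crit u"
  unfolding crit_def using assms P_pos[OF assms(3)] a_pos q_less k_less
  by (intro tendsto_intros) auto

lemma fib_tendsto:
  assumes "(\<lambda>n. P (x n)) \<longlonglongrightarrow> P u" "(\<lambda>n. B (x n)) \<longlonglongrightarrow> B u" "(\<lambda>n. A (x n)) \<longlonglongrightarrow> A u"
    "t \<longlonglongrightarrow> l" "l > 0"
  shows "(\<lambda>n. fib c1 c2 c3 (t n) (x n)) \<longlonglongrightarrow> fib c1 c2 c3 l u"
  unfolding fib_def using assms by (intro tendsto_intros) auto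

text \<open>Up to a positive factor the value is \<open>ray u - lam\<close>.\<close>

lemma fib_crit_nonneg:
  assumes "u \<in> K" "B u > 0" "lam \<le> lam_star"
  shows "fib a lam 1 (crit u) u \<ge> 0"
proof -
  note pos = P_pos[OF assms(1)] A_pos[OF assms(1)] a_pos q_less k_less q_less_g
  let ?y = "crit u"
  have "(g - q) * fib a lam 1 ?y u = (g - q) * a * (?y powr k * P u) - (g - q) * lam * (?y powr q * A u) - (g - q) * (?y powr g * B u)"
    by (simp add: fib_def algebra_simps)
  also have "\<dots> = (g - k) * a * (?y powr k * P u) - (g - q) * lam * (?y powr q * A u)"
    unfolding crit_eq[OF assms(1,2), symmetric] by (simp add: algebra_simps)
  also have "\<dots> = (g - q) * (?y powr q * A u) * (ray u - lam)"
    unfolding ray_eq[OF assms(1,2)] by (simp add: algebra_simps)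
  also have "\<dots> \<ge> 0" using lam_star_le[OF assms(1,2)] assms(3) pos by simp
  finally show ?thesis using q_less_g by (simp add: zero_le_mult_iff)
qed

text \<open>Beyond \<open>crit u\<close> the fibre derivative divided by \<open>t powr q\<close> is
  strictly decreasing, and it vanishes at 1.\<close>

lemma fib_sign:
  assumes u: "u \<in> K" "B u > 0" and c: "crit u \<le> 1" and eq: "a * P u = lam * A u + B u"
  shows "crit u \<le> t \<Longrightarrow> t < 1 \<Longrightarrow> fib a lam 1 t u > 0" "1 < t \<Longrightarrow> fib a lam 1 t u < 0"
proof -
  define \<rho> where "\<rho> = (\<lambda>t. a * P u * t powr (k - q) - B u * t powr (g - q))"
  have dec: "\<rho> t2 < \<rho> t1" if "crit u \<le> t1" "t1 < t2" for t1 t2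
    unfolding \<rho>_def
  proof (rule fibre_strict_decreasing)
    show t1: "0 < t1" using crit_pos[OF u] that by simp
    show "(k - q) * (a * P u) \<le> (g - q) * B u * t1 powr (g - k)"
      using that crit_le_iff[OF u t1] by (simp add: mult_ac)
  qed (use that q_less k_less u in auto)
  have f: "fib a lam 1 t u = t powr q * (\<rho> t - lam * A u)" for t
  proof -
    have "t powr k = t powr (k - q) * t powr q" "t powr g = t powr (g - q) * t powr q"
      by (simp_all flip: powr_add)
    then show ?thesis by (simp add: fib_def \<rho>_def algebra_simps)
  qed
  have 1: "\<rho> 1 = lam * A u" using eq by (simp add: \<rho>_def)
  show "fib a lam 1 t u > 0" if "crit u \<le> t" "t < 1"
    using dec[OF that] 1 crit_pos[OF u] that by (simp add: f)
  show "fib a lam 1 t u < 0" if "1 < t"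
    using dec[OF c that] 1 that by (simp add: f mult_pos_neg)
qed

lemma energy_fib_le_one:
  assumes u: "u \<in> K" "B u > 0" and c: "crit u \<le> 1" and eq: "a * P u = lam * A u + B u"
    and t: "crit u \<le> t"
  shows "fib (a / k) (lam / q) (1 / g) t u \<le> fib (a / k) (lam / q) (1 / g) 1 u"
proof -
  note s = fib_sign[OF u c eq]
  have 0: "fib a lam 1 1 u = 0" using eq by (simp add: fib_def)
  have cp: "crit u > 0" using crit_pos[OF u] .
  consider "t \<le> 1" | "t > 1" by linarith
  then show ?thesis
  proof cases
    case 1
    then show ?thesis
    proof (rule DERIV_nonneg_imp_nondecreasing)
      fix y assume y: "t \<le> y" "y \<le> 1"
      then have "fib a lam 1 y u \<ge> 0" using s(1)[of y] 0 t by (cases "y = 1") auto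
      then show "\<exists>d. ((\<lambda>t. fib (a / k) (lam / q) (1 / g) t u) has_real_derivative d) (at y) \<and> 0 \<le> d"
        using energy_deriv[of y lam u] y t cp by (intro exI[of _ "fib a lam 1 y u / y"]) auto
    qed
  next
    case 2
    then have "1 \<le> t" by simp
    then show ?thesis
    proof (rule DERIV_nonpos_imp_nonincreasing)
      fix y assume y: "1 \<le> y" "y \<le> t"
      then have "fib a lam 1 y u \<le> 0" using s(2)[of y] 0 t by (cases "y = 1") auto
      then show "\<exists>d. ((\<lambda>t. fib (a / k) (lam / q) (1 / g) t u) has_real_derivative d) (at y) \<and> d \<le> 0"
        using energy_deriv[of y lam u] y t cp by (intro exI[of _ "fib a lam 1 y u / y"]) (auto simp: divide_nonpos_pos)
    qed
  qed
qed

lemma energy_eq_reduced: "a * P u = lam * A u + B u \<Longrightarrow> energy lam u = reduced lam u"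
proof -
  assume eq: "a * P u = lam * A u + B u"
  have "energy lam u = a / k * P u - lam / q * A u - 1 / g * (a * P u - lam * A u)"
    using eq by (simp add: energy_def)
  also have "\<dots> = reduced lam u" by (simp add: reduced_def algebra_simps)
  finally show ?thesis .
qed

text \<open>The endpoint 2 is just a fixed number beyond 1; the crossings of perturbed fibres will
  turn out to converge to 1.\<close>

lemma crossing_exists:
  assumes u: "u \<in> K" "B u > 0" and c: "crit u \<le> 2" and 1: "fib a lam 1 (crit u) u \<ge> 0"
    and 2: "fib a lam 1 2 u \<le> 0"
  shows "\<exists>t. crit u \<le> t \<and> t \<le> 2 \<and> fib a lam 1 t u = 0"
proof -
  have "continuous_on {crit u..2} (\<lambda>t. fib a lam 1 t u)"
  proof (rule DERIV_continuous_on)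
    fix t assume "t \<in> {crit u..2}"
    then have "t > 0" using crit_pos[OF u] by simp
    from fib_deriv[OF this] show "((\<lambda>t. fib a lam 1 t u) has_real_derivative
     (fib (a * k) (lam * q) (1 * g) t u / t)) (at t within {crit u..2})"
      by (rule DERIV_subset) simp
  qed
  then show ?thesis
    using IVT2'[of "\<lambda>t. fib a lam 1 t u" 2 0 "crit u"] 1 2 c by auto
qed

text \<open>A zero at or past the turning point gives the second constraint by
  \<open>crit_le_iff\<close> and the first one with equality. On such points \<open>energy\<close>
  and \<open>reduced\<close> agree, so minimality of \<open>reduced\<close> becomes a statement
  about the energy.\<close>

lemma N_of_crossing:
  assumes u: "u \<in> K" "B u > 0" and t: "crit u \<le> t" and 0: "fib a lam 1 t u = 0"
  shows "sc t u \<in> N lam" "energy lam (sc t u) = reduced lam (sc t u)"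
proof -
  have tp: "t > 0" using t crit_pos[OF u] by simp
  have eq: "a * P (sc t u) = lam * A (sc t u) + B (sc t u)"
    using 0 u tp by (simp add: fib_def P_sc A_sc B_sc algebra_simps)
  then show "energy lam (sc t u) = reduced lam (sc t u)" by (rule energy_eq_reduced)
  have "t powr k * ((k - q) * a * P u) \<le> t powr k * ((g - q) * B u * t powr (g - k))"
    using t crit_le_iff[OF u tp] by (intro mult_left_mono) auto
  also have "\<dots> = (g - q) * B u * (t powr (g - k) * t powr k)" by (simp add: mult_ac)
  also have "t powr (g - k) * t powr k = t powr g" by (simp flip: powr_add)
  finally have "(k - q) * a * P (sc t u) \<le> (g - q) * B (sc t u)"
    using u tp by (simp add: P_sc B_sc mult_ac)
  with eq show "sc t u \<in> N lam" using u tp by (simp add: N_def sc_K)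
qed

lemma N_B_pos: "u \<in> N lam \<Longrightarrow> B u > 0"
proof -
  assume u: "u \<in> N lam"
  have "0 < (k - q) * a * P u" using P_pos[OF N_K[OF u]] a_pos q_less by simp
  also have "\<dots> \<le> (g - q) * B u" using u by (simp add: N_def)
  finally show ?thesis using q_less_g by (simp add: zero_less_mult_iff)
qed

lemma N_crit_le: "u \<in> N lam \<Longrightarrow> crit u \<le> 1"
  using N_B_pos[of u lam] N_K[of u lam] by (subst crit_le_iff) (auto simp: N_def)

text \<open>Each \<open>x n\<close> is scaled by a zero \<open>t n\<close> of its fibre derivative
  past its turning point, which lands in \<open>N\<close> and bounds the energy of the scaled point
  from below. What remains is that \<open>t n\<close> tends to 1 and that the energy of
  \<open>t n u\<close> exceeds that of \<open>u\<close> by at most o(e).\<close>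

lemma stationary_N:
  assumes m: "min_N lam u" and lam: "lam > 0" and eq: "a * P u = lam * A u + B u"
    and c: "(k - q) * a * P u < (g - q) * B u \<or> (k - q) * a * P u = (g - q) * B u \<and> lam = lam_star"
  shows "stationary (a / k) (lam / q) (1 / g) u"
  unfolding stationary_def
proof (intro allI impI)
  fix x e assume adm: "admissible u x e"
  then obtain D0 where D0: "\<And>n. \<bar>P (x n) - P u\<bar> \<le> D0 * e n" "\<And>n. \<bar>B (x n) - B u\<bar> \<le> D0 * e n"
    by (auto simp: admissible_def)
  have e: "e \<longlonglongrightarrow> 0" "\<And>n. e n > 0" and xK: "\<And>n. x n \<in> K"
    using adm by (auto simp: admissible_def)
  note lim = admissible_tendsto[OF adm]
  have uN: "u \<in> N lam" and u: "u \<in> K" and Bp: "B u > 0"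
    using m N_K[of u lam] N_B_pos[of u lam] by (auto simp: min_N_def)
  note pos = P_pos[OF u] a_pos q_less k_less q_less_g
  have c1: "crit u \<le> 1" using N_crit_le[OF uN] .
  note sign = fib_sign[OF u Bp c1 eq]
  let ?F = "\<lambda>t. fib (a / k) (lam / q) (1 / g) t u"
  have Bx: "\<forall>\<^sub>F n in sequentially. B (x n) > 0" using order_tendstoD(1)[OF lim(2) Bp] .
  have cl: "(\<lambda>n. crit (x n)) \<longlonglongrightarrow> crit u" using crit_tendsto[OF lim(1,2) u Bp] .
  have cx2: "\<forall>\<^sub>F n in sequentially. crit (x n) < 2" using order_tendstoD(2)[OF cl, of 2] c1 by simp
  have strict_lt: "crit u < 1" if "(k - q) * a * P u < (g - q) * B u"
  proof -
    have "crit u \<noteq> 1" using that crit_eq[OF u Bp] by auto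
    then show ?thesis using c1 by simp
  qed
  have crit1: "crit u = 1" if "(k - q) * a * P u = (g - q) * B u"
    using that pos Bp by (simp add: crit_def)
  \<comment> \<open>A crossing needs a nonnegative value at the turning point. In the nondegenerate
    case this follows by continuity, in the degenerate one from \<open>lam_star\<close> being an
    infimum.\<close>
  have f1: "\<forall>\<^sub>F n in sequentially. fib a lam 1 (crit (x n)) (x n) \<ge> 0"
    using c
  proof
    assume "(k - q) * a * P u < (g - q) * B u"
    then have "fib a lam 1 (crit u) u > 0" using sign(1)[of "crit u"] strict_lt by simp
    moreover have "(\<lambda>n. fib a lam 1 (crit (x n)) (x n)) \<longlonglongrightarrow> fib a lam 1 (crit u) u"
      by (rule fib_tendsto[OF lim cl crit_pos[OF u Bp]])
    ultimately have "\<forall>\<^sub>F n in sequentially. fib a lam 1 (crit (x n)) (x n) > 0"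
      by (rule order_tendstoD(1)[rotated])
    then show ?thesis by eventually_elim simp
  next
    assume "(k - q) * a * P u = (g - q) * B u \<and> lam = lam_star"
    then show ?thesis using Bx by (auto elim!: eventually_mono intro!: fib_crit_nonneg xK)
  qed
  have "(\<lambda>n. fib a lam 1 2 (x n)) \<longlonglongrightarrow> fib a lam 1 2 u"
    by (rule fib_tendsto[OF lim tendsto_const]) simp
  then have f2: "\<forall>\<^sub>F n in sequentially. fib a lam 1 2 (x n) < 0"
    by (rule order_tendstoD(2)) (use sign(2)[of 2] in simp)
  define Q where "Q = (\<lambda>n t. crit (x n) \<le> t \<and> t \<le> 2 \<and> fib a lam 1 t (x n) = 0)"
  have exQ: "\<forall>\<^sub>F n in sequentially. \<exists>t. Q n t"
    using Bx cx2 f1 f2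
  proof eventually_elim
    case (elim n)
    show ?case unfolding Q_def by (rule crossing_exists[OF xK]) (use elim in auto)
  qed
  \<comment> \<open>Crossings are known to exist only for large \<open>n\<close>; the default 1
    keeps the whole sequence in \<open>{0..2}\<close>.\<close>
  define t where "t = (\<lambda>n. if \<exists>t. Q n t then SOME t. Q n t else 1)"
  have tQ: "Q n (t n)" if "\<exists>t. Q n t" for n
    using someI_ex[OF that] that by (simp add: t_def)
  have "crit (x n) \<ge> 0" for n by (simp add: crit_def)
  then have t02: "t n \<in> {0..2}" for n
  proof (cases "\<exists>t. Q n t")
    case True
    then show ?thesis using tQ[OF True] \<open>crit (x n) \<ge> 0\<close> by (auto simp: Q_def)
  qed (auto simp: t_def)
  have "seq_compact {0..2::real}" by (rule compact_imp_seq_compact) simp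
  then obtain l r where r: "strict_mono r" and tl: "(\<lambda>n. t (r n)) \<longlonglongrightarrow> l"
    using t02 by (elim seq_compactE[of _ t]) (auto simp: o_def)
  have rs: "filterlim r at_top sequentially" using r by (rule filterlim_subseq)
  have sub: "\<forall>\<^sub>F n in sequentially. R (r n)" if "\<forall>\<^sub>F n in sequentially. R n" for R
    using that rs by (rule eventually_compose_filterlim)
  note limr = lim[THEN filterlim_compose, OF rs]
  have clr: "(\<lambda>n. crit (x (r n))) \<longlonglongrightarrow> crit u" using filterlim_compose[OF cl rs] .
  have Qr: "\<forall>\<^sub>F n in sequentially. Q (r n) (t (r n))"
    using sub[OF exQ] by eventually_elim (rule tQ)
  have "crit u \<le> l"
    by (rule tendsto_le[OF _ tl clr]) (use Qr in \<open>auto simp: Q_def elim: eventually_mono\<close>)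
  then have lp: "l > 0" and cul: "crit u \<le> l" using crit_pos[OF u Bp] by auto
  have "(\<lambda>n. fib a lam 1 (t (r n)) (x (r n))) \<longlonglongrightarrow> fib a lam 1 l u"
    by (rule fib_tendsto[OF limr tl lp])
  moreover have "(\<lambda>n. fib a lam 1 (t (r n)) (x (r n))) \<longlonglongrightarrow> 0"
    by (rule tendsto_eventually) (use Qr in \<open>auto simp: Q_def elim: eventually_mono\<close>)
  ultimately have "fib a lam 1 l u = 0" by (rule LIMSEQ_unique)
  \<comment> \<open>The limit is a zero of the fibre derivative of \<open>u\<close> at or past
    \<open>crit u\<close>, and by \<open>fib_sign\<close> the only one is 1.\<close>
  then have l1: "l = 1" using sign(1)[of l] sign(2)[of l] cul by (cases l "1::real" rule: linorder_cases) auto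
  have mini: "\<forall>\<^sub>F n in sequentially. ?F 1 \<le> fib (a / k) (lam / q) (1 / g) (t (r n)) (x (r n))"
    using Qr sub[OF Bx]
  proof eventually_elim
    case (elim n)
    then have tr: "crit (x (r n)) \<le> t (r n)" "fib a lam 1 (t (r n)) (x (r n)) = 0" by (auto simp: Q_def)
    have tp: "t (r n) > 0" using crit_pos[OF xK elim(2)] tr by simp
    note N = N_of_crossing[OF xK elim(2) tr]
    have "?F 1 = reduced lam u" using energy_eq_reduced[OF eq] by (simp add: fib_one)
    also have "\<dots> \<le> reduced lam (sc (t (r n)) (x (r n)))" using m N(1) by (auto simp: min_N_def)
    also have "\<dots> = fib (a / k) (lam / q) (1 / g) (t (r n)) (x (r n))"
      unfolding N(2)[symmetric] by (rule fib_sc[OF xK tp])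
    finally show ?case .
  qed
  have "\<exists>\<eta>. \<eta> \<longlonglongrightarrow> 0 \<and> (\<forall>\<^sub>F n in sequentially. ?F (t (r n)) \<le> ?F 1 + \<eta> n * e (r n))"
    using c
  proof
    \<comment> \<open>Eventually \<open>t (r n)\<close> is past \<open>crit u\<close>, where the
      energy along the ray is largest at 1, so no error term appears.\<close>
    assume "(k - q) * a * P u < (g - q) * B u"
    then have "crit u < 1" by (rule strict_lt)
    then have "\<forall>\<^sub>F n in sequentially. crit u < t (r n)" using order_tendstoD(1)[OF tl] l1 by simp
    then have "\<forall>\<^sub>F n in sequentially. ?F (t (r n)) \<le> ?F 1 + 0 * e (r n)"
      by eventually_elim (use energy_fib_le_one[OF u Bp c1 eq] in auto)
    then show ?thesis by (intro exI[of _ "\<lambda>_. 0"]) auto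
  next
    assume "(k - q) * a * P u = (g - q) * B u \<and> lam = lam_star"
    then have dg: "(k - q) * a * P u = (g - q) * B u" by simp
    define D where "D = \<bar>D0\<bar>"
    have "D0 * e n \<le> D * e n" for n using e(2)[of n] by (simp add: D_def)
    with D0 have D: "P (x n) \<ge> P u - D * e n" "B (x n) \<le> B u + D * e n" for n
      by (smt (verit))+
    \<comment> \<open>A lower bound for \<open>crit (x n) powr (g - k)\<close> in terms of
      \<open>D\<close> and \<open>e n\<close> only. It equals 1 at 0 because
      \<open>crit u = 1\<close>.\<close>
    define \<phi> where "\<phi> = (\<lambda>s. ((P u - D * s) / P u) * (B u / (B u + D * s)))"
    have "\<exists>d. (\<phi> has_real_derivative d) (at 0)"
      unfolding \<phi>_def using pos Bp by (intro exI) (auto intro!: derivative_eq_intros)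
    then obtain d where d: "(\<phi> has_real_derivative d) (at 0)" by blast
    have Fd: "(?F has_real_derivative 0) (at 1)"
      using energy_deriv[of 1 lam u] eq by (simp add: fib_def)
    have \<phi>0: "\<phi> 0 = 1" using pos Bp by (simp add: \<phi>_def)
    have er: "(\<lambda>n. e (r n)) \<longlonglongrightarrow> 0" using filterlim_compose[OF e(1) rs] .
    define h where "h = (\<lambda>n. \<phi> (e (r n)) powr (1 / (g - k)))"
    have fl: "h \<longlonglongrightarrow> 1" "(\<lambda>n. (?F (h n) - ?F 1) / e (r n)) \<longlonglongrightarrow> 0"
      unfolding h_def by (rule flat_along_powr[OF d \<phi>0 Fd er e(2)])+
    have "\<forall>\<^sub>F n in sequentially. e (r n) < P u / (D + 1)"
      by (rule order_tendstoD(2)[OF er]) (use pos in \<open>auto simp: D_def intro!: divide_pos_pos\<close>)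
    then have "\<forall>\<^sub>F n in sequentially. ?F (t (r n)) \<le> ?F 1 + ((?F (h n) - ?F 1) / e (r n)) * e (r n)"
      using Qr sub[OF Bx] order_tendstoD(1)[OF fl(1), of 0, simplified]
    proof eventually_elim
      case (elim n)
      have Dp: "D \<ge> 0" by (simp add: D_def)
      have "e (r n) * (D + 1) < P u" using elim(1) Dp by (simp add: field_simps)
      then have Pe: "P u - D * e (r n) > 0" using e(2)[of "r n"] by (simp add: algebra_simps)
      have Be: "B u + D * e (r n) > 0" using Bp Dp e(2)[of "r n"] by (simp add: add_pos_nonneg)
      have "\<phi> (e (r n)) \<le> (P (x (r n)) / P u) * (B u / B (x (r n)))"
        unfolding \<phi>_def using D[of "r n"] pos Bp Pe Be elim(3)
        by (intro mult_mono divide_left_mono divide_right_mono) auto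
      also have "\<dots> = (k - q) * a * P (x (r n)) / ((g - q) * B (x (r n)))"
      proof -
        have "(P (x (r n)) / P u) * (B u / B (x (r n))) = P (x (r n)) * ((g - q) * B u) / (P u * ((g - q) * B (x (r n))))"
          using pos by simp
        also have "\<dots> = (k - q) * a * P (x (r n)) / ((g - q) * B (x (r n)))"
          unfolding dg[symmetric] using pos by simp
        finally show ?thesis .
      qed
      finally have "h n \<le> crit (x (r n))"
        unfolding h_def crit_def
        by (rule powr_mono2[rotated 2]) (use Pe Be pos Bp in \<open>auto simp: \<phi>_def\<close>)
      then have "h n \<le> t (r n)" using elim(2) by (simp add: Q_def)
      \<comment> \<open>The energy of a degenerate point does not increase along its ray, so the
        unknown \<open>t (r n)\<close> may be replaced by the smaller, explicit
        \<open>h n\<close>.\<close>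
      then have "?F (t (r n)) \<le> ?F (h n)"
      proof (rule DERIV_nonpos_imp_nonincreasing)
        fix y assume y: "h n \<le> y" "y \<le> t (r n)"
        then have yp: "y > 0" using elim(4) by simp
        then have "fib a lam 1 y u / y \<le> 0"
          using degenerate_fib_nonpos[OF u dg eq] by (simp add: divide_nonpos_pos)
        then show "\<exists>d. (?F has_real_derivative d) (at y) \<and> d \<le> 0" using energy_deriv[OF yp] by blast
      qed
      then show ?case using e(2)[of "r n"] by simp
    qed
    then show ?thesis using fl(2) by blast
  qed
  then obtain \<eta> where \<eta>: "\<eta> \<longlonglongrightarrow> 0" "\<forall>\<^sub>F n in sequentially. ?F (t (r n)) \<le> ?F 1 + \<eta> n * e (r n)" by blast
  have "\<forall>\<^sub>F n in sequentially. fib (a / k) (lam / q) (1 / g) (t (r n)) (x (r n)) - ?F (t (r n)) \<ge> - \<eta> n * e (r n)"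
    using mini \<eta>(2) by eventually_elim linarith
  then show "\<exists>r t \<eta>. strict_mono r \<and> t \<longlonglongrightarrow> 1 \<and> \<eta> \<longlonglongrightarrow> 0 \<and>
       (\<forall>\<^sub>F n in sequentially. fib (a / k) (lam / q) (1 / g) (t n) (x (r n)) - ?F (t n) \<ge> - \<eta> n * e (r n))"
    using r tl l1 \<eta>(1) by (intro exI[of _ r] exI[of _ "\<lambda>n. t (r n)"] exI[of _ \<eta>]) auto
qed

text \<open>Take \<open>t n = crit (x n)\<close>: there the fibre derivative of \<open>x n\<close>
  is nonnegative, since \<open>lam_star\<close> is an infimum, and that of \<open>u\<close> is
  nonpositive. This is the first order condition for \<open>u\<close> as a minimiser of
  \<open>ray\<close>, free of derivatives of \<open>A\<close>.\<close>

lemma stationary_degenerate: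
  assumes u: "u \<in> K" and dg: "(k - q) * a * P u = (g - q) * B u" and eq: "a * P u = lam_star * A u + B u"
  shows "stationary a lam_star 1 u"
  unfolding stationary_def
proof (intro allI impI)
  fix x e assume adm: "admissible u x e"
  note lim = admissible_tendsto[OF adm]
  have xK: "\<And>n. x n \<in> K" using adm by (auto simp: admissible_def)
  note pos = P_pos[OF u] a_pos q_less k_less q_less_g
  have "0 < (g - q) * B u" using pos unfolding dg[symmetric] by simp
  then have Bp: "B u > 0" using pos by (simp add: zero_less_mult_iff)
  have Bx: "\<forall>\<^sub>F n in sequentially. B (x n) > 0" using order_tendstoD(1)[OF lim(2) Bp] .
  have c1: "crit u = 1" using dg pos Bp by (simp add: crit_def)
  have cl: "(\<lambda>n. crit (x n)) \<longlonglongrightarrow> 1" using crit_tendsto[OF lim(1,2) u Bp] by (simp add: c1)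
  have "\<forall>\<^sub>F n in sequentially. fib a lam_star 1 (crit (x n)) (x n) - fib a lam_star 1 (crit (x n)) u \<ge> - 0 * e n"
    using Bx
  proof eventually_elim
    case (elim n)
    show ?case using fib_crit_nonneg[OF xK elim order_refl] degenerate_fib_nonpos[OF u dg eq crit_pos[OF xK elim]]
      by simp
  qed
  then show "\<exists>r t \<eta>. strict_mono r \<and> t \<longlonglongrightarrow> 1 \<and> \<eta> \<longlonglongrightarrow> 0 \<and>
       (\<forall>\<^sub>F n in sequentially. fib a lam_star 1 (t n) (x (r n)) - fib a lam_star 1 (t n) u \<ge> - \<eta> n * e (r n))"
    using cl by (intro exI[of _ id] exI[of _ "\<lambda>n. crit (x n)"] exI[of _ "\<lambda>_. 0"]) (auto simp: strict_mono_id)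
qed

section \<open>Existence of minimisers over \<open>N\<close>\<close>

lemma N_bounded:
  assumes "L > 0" "d \<ge> 0"
  shows "\<exists>M>0. \<forall>lam u. 0 < lam \<and> lam \<le> L \<and> u \<in> N lam \<and> reduced lam u \<le> d \<longrightarrow> P u \<le> M"
proof -
  define c1 where "c1 = a * (1 / k - 1 / g)"
  define c2 where "c2 = L * (1 / q - 1 / g) * C"
  have c: "c1 > 0" "c2 > 0" using assms a_pos exponents C_pos by (simp_all add: c1_def c2_def del: diff_gt_0_iff_gt)
  have "P u \<le> max 1 (((d + c2) / c1) powr (1 / (1 - q / k)))"
    if "0 < lam" "lam \<le> L" "u \<in> N lam" "reduced lam u \<le> d" for lam u
  proof (rule powr_sublinear_bound)
    have u: "u \<in> K" using that N_K by blast
    have "lam * (1 / q - 1 / g) * A u \<le> L * (1 / q - 1 / g) * (C * P u powr (q / k))"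
      using that A_le[OF u] A_pos[OF u] exponents(5) by (intro mult_mono) auto
    then show "c1 * P u \<le> d + c2 * P u powr (q / k)"
      using that(4) by (simp add: reduced_def c1_def c2_def mult_ac)
    show "P u > 0" using P_pos[OF u] .
  qed (use c exponents assms in auto)
  then show ?thesis
    by (intro exI[of _ "max 1 (((d + c2) / c1) powr (1 / (1 - q / k)))"]) auto
qed

text \<open>On \<open>N\<close> the value of \<open>P\<close> is at most a multiple of
  \<open>B\<close>, and \<open>B\<close> is at most a multiple of \<open>P^(g/k)\<close> with
  \<open>g > k\<close>; hence \<open>B\<close> cannot be small.\<close>

lemma N_B_bounded_below:
  "\<exists>b>0. \<forall>lam u. u \<in> N lam \<longrightarrow> b \<le> B u powr (g / k - 1)"
proof -
  define c where "c = (g - q) / ((k - q) * a)"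
  have c: "c > 0" using q_less_g q_less a_pos by (simp add: c_def)
  have "1 / (C * c powr (g / k)) \<le> B u powr (g / k - 1)" if "u \<in> N lam" for lam u
  proof -
    have u: "u \<in> K" and Bp: "B u > 0" using that N_K N_B_pos by blast+
    have "P u \<le> c * B u" using that q_less a_pos by (simp add: N_def c_def field_simps)
    then have "P u powr (g / k) \<le> (c * B u) powr (g / k)"
      using P_pos[OF u] exponents by (intro powr_mono2) auto
    also have "\<dots> = c powr (g / k) * B u powr (g / k)" using c Bp by (simp add: powr_mult)
    finally have "C * P u powr (g / k) \<le> C * (c powr (g / k) * B u powr (g / k))"
      using C_pos by (intro mult_left_mono) auto
    then have "B u \<le> (C * c powr (g / k)) * B u powr (g / k)" using B_le[OF u] by (simp add: mult_ac)
    also have "B u powr (g / k) = B u powr (g / k - 1) * B u" using Bp by (simp add: powr_diff)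
    finally have "1 * B u \<le> (C * c powr (g / k) * B u powr (g / k - 1)) * B u" by (simp add: mult_ac)
    then have "1 \<le> C * c powr (g / k) * B u powr (g / k - 1)" using Bp by (subst (asm) mult_le_cancel_right) auto
    then show ?thesis using C_pos c by (simp add: divide_simps mult_ac)
  qed
  then show ?thesis using C_pos c by (intro exI[of _ "1 / (C * c powr (g / k))"]) auto
qed

text \<open>The counterpart of \<open>U_limit\<close>, with vanishing excluded by the lower bound on
  \<open>B\<close> instead of the sign of the level.\<close>

lemma N_limit:
  assumes l: "l \<longlonglongrightarrow> lam" "lam > 0" "\<And>n. 0 < l n" and x: "\<And>n. x n \<in> N (l n)"
    and y: "\<And>n. reduced (l n) (x n) \<le> y n" "y \<longlonglongrightarrow> Y"
  shows "\<exists>r u pl. strict_mono r \<and> u \<in> N lam \<and> P u \<le> pl \<and> (\<lambda>n. P (x (r n))) \<longlonglongrightarrow> pl \<and>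
     (\<lambda>n. A (x (r n))) \<longlonglongrightarrow> A u \<and> (\<lambda>n. B (x (r n))) \<longlonglongrightarrow> B u \<and>
     a * (1 / k - 1 / g) * pl - lam * (1 / q - 1 / g) * A u \<le> Y"
proof -
  have "Bseq l" by (rule convergent_imp_Bseq[OF convergentI[OF l(1)]])
  then obtain L where L: "0 < L" and L0: "\<forall>n. norm (l n) \<le> L" by (rule BseqE)
  have "Bseq y" by (rule convergent_imp_Bseq[OF convergentI[OF y(2)]])
  then obtain d where d: "0 < d" and d0: "\<forall>n. norm (y n) \<le> d" by (rule BseqE)
  obtain M where M0: "\<forall>lam u. 0 < lam \<and> lam \<le> L \<and> u \<in> N lam \<and> reduced lam u \<le> d \<longrightarrow> P u \<le> M"
    using N_bounded[OF L, of d] d by auto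
  have M: "P (x n) \<le> M" for n
  proof -
    have "l n \<le> L" "y n \<le> d" using L0 d0 by (auto simp: abs_le_iff)
    then show ?thesis using M0[rule_format, of "l n" "x n"] l(3)[of n] x[of n] y(1)[of n] by auto
  qed
  have xK: "x n \<in> K" for n using x N_K by blast
  obtain r where r: "strict_mono r" and alt: "(\<lambda>n. A (x (r n))) \<longlonglongrightarrow> 0 \<and> (\<lambda>n. B (x (r n))) \<longlonglongrightarrow> 0 \<or>
         (\<exists>u\<in>K. \<exists>pl. P u \<le> pl \<and> (\<lambda>n. P (x (r n))) \<longlonglongrightarrow> pl \<and>
            (\<lambda>n. A (x (r n))) \<longlonglongrightarrow> A u \<and> (\<lambda>n. B (x (r n))) \<longlonglongrightarrow> B u)"
    using compactness[of x M] xK M by blast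
  have lr: "(\<lambda>n. l (r n)) \<longlonglongrightarrow> lam" and yr: "(\<lambda>n. y (r n)) \<longlonglongrightarrow> Y"
    using LIMSEQ_subseq_LIMSEQ[OF l(1) r] LIMSEQ_subseq_LIMSEQ[OF y(2) r] by (simp_all add: o_def)
  show ?thesis
  proof (cases "(\<lambda>n. A (x (r n))) \<longlonglongrightarrow> 0 \<and> (\<lambda>n. B (x (r n))) \<longlonglongrightarrow> 0")
    case True
    obtain b where b: "b > 0" "\<forall>lam u. u \<in> N lam \<longrightarrow> b \<le> B u powr (g / k - 1)"
      using N_B_bounded_below by blast
    have Bp: "B (x n) > 0" for n using x N_B_pos by blast
    have "(\<lambda>n. B (x (r n)) powr (g / k - 1)) \<longlonglongrightarrow> 0"
      by (rule tendsto_zero_powrI[of _ _ "\<lambda>_. g / k - 1" "g / k - 1"])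
        (use True exponents Bp in \<open>auto intro!: always_eventually less_imp_le\<close>)
    then have "b \<le> 0" by (rule LIMSEQ_le_const) (use b x in auto)
    then show ?thesis using b by simp
  next
    case False
    then obtain u pl where u: "u \<in> K" "P u \<le> pl" "(\<lambda>n. P (x (r n))) \<longlonglongrightarrow> pl"
      "(\<lambda>n. A (x (r n))) \<longlonglongrightarrow> A u" "(\<lambda>n. B (x (r n))) \<longlonglongrightarrow> B u" using alt by blast
    have "(\<lambda>n. a * (1 / k - 1 / g) * P (x (r n)) - l (r n) * (1 / q - 1 / g) * A (x (r n)))
        \<longlonglongrightarrow> a * (1 / k - 1 / g) * pl - lam * (1 / q - 1 / g) * A u"
      using u lr by (intro tendsto_intros) auto
    then have 1: "a * (1 / k - 1 / g) * pl - lam * (1 / q - 1 / g) * A u \<le> Y"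
      by (rule LIMSEQ_le[OF _ yr]) (use y(1) in \<open>auto simp: reduced_def\<close>)
    have "(\<lambda>n. a * P (x (r n))) \<longlonglongrightarrow> a * pl" "(\<lambda>n. l (r n) * A (x (r n)) + B (x (r n))) \<longlonglongrightarrow> lam * A u + B u"
      using u lr by (intro tendsto_intros; simp)+
    then have 2: "a * pl \<le> lam * A u + B u"
      by (rule LIMSEQ_le) (use x in \<open>auto simp: N_def\<close>)
    have "(\<lambda>n. (k - q) * a * P (x (r n))) \<longlonglongrightarrow> (k - q) * a * pl"
      "(\<lambda>n. (g - q) * B (x (r n))) \<longlonglongrightarrow> (g - q) * B u"
      using u by (intro tendsto_intros; simp)+
    then have 3: "(k - q) * a * pl \<le> (g - q) * B u"
      by (rule LIMSEQ_le) (use x in \<open>auto simp: N_def\<close>)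
    have "a * P u \<le> a * pl" "(k - q) * a * P u \<le> (k - q) * a * pl"
      using u(2) a_pos q_less by auto
    with 2 3 have "u \<in> N lam" using u by (simp add: N_def)
    then show ?thesis using u r 1 by blast
  qed
qed

lemma N_nonempty: assumes "lam > 0" shows "\<exists>u. u \<in> N lam"
proof -
  obtain v where v: "v \<in> K" "B v > 0" using B_positive_ex by blast
  note pos = P_pos[OF v(1)] A_pos[OF v(1)] q_pos q_less k_less q_less_g
  \<comment> \<open>The larger of the two thresholds for \<open>t powr (g - k)\<close>; in the first
    constraint the positive term with \<open>lam\<close> is dropped.\<close>
  define X where "X = max (a * P v / B v) ((k - q) * a * P v / ((g - q) * B v))"
  define t where "t = X powr (1 / (g - k))"
  have X: "X > 0" using pos a_pos v by (auto simp: X_def less_max_iff_disj)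
  then have t: "t > 0" by (simp add: t_def)
  have tX: "t powr (g - k) = X" using X pos by (simp add: t_def powr_powr)
  have "a * P v / B v \<le> X" "(k - q) * a * P v / ((g - q) * B v) \<le> X" by (auto simp: X_def)
  then have 1: "a * P v \<le> X * B v" "(k - q) * a * P v \<le> X * ((g - q) * B v)"
    using v pos by (simp_all add: divide_le_eq)
  have tg: "t powr g = t powr k * X" unfolding tX[symmetric] by (simp flip: powr_add)
  have "t powr k * (a * P v) \<le> t powr k * (X * B v)" "t powr k * ((k - q) * a * P v) \<le> t powr k * (X * ((g - q) * B v))"
    using 1 by (intro mult_left_mono; simp)+
  moreover have "lam * (t powr q * A v) \<ge> 0" using assms pos by simp
  ultimately have "a * (t powr k * P v) \<le> lam * (t powr q * A v) + t powr g * B v"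
    "(k - q) * a * (t powr k * P v) \<le> (g - q) * (t powr g * B v)"
    unfolding tg by (simp_all add: mult_ac)
  then have "sc t v \<in> N lam" using v t by (simp add: N_def sc_K P_sc A_sc B_sc)
  then show ?thesis by blast
qed

lemma min_N_ex:
  assumes lam: "lam > 0"
  shows "\<exists>u. min_N lam u"
proof -
  obtain M where M: "M > 0" "\<forall>mu u. 0 < mu \<and> mu \<le> lam \<and> u \<in> N mu \<and> reduced mu u \<le> 0 \<longrightarrow> P u \<le> M"
    using N_bounded[OF lam order_refl] by auto
  define b where "b = - (lam * (1 / q - 1 / g) * (C * M powr (q / k)))"
  have b: "b \<le> reduced lam u" if "u \<in> N lam" for u
  \<comment> \<open>The bound on \<open>P\<close> is at hand only where \<open>reduced\<close> is
    nonpositive; elsewhere \<open>b \<le> 0\<close> suffices.\<close>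
  proof (cases "reduced lam u \<le> 0")
    case True
    have u: "u \<in> K" using that N_K by blast
    have "P u \<le> M" using M(2) True that lam by auto
    then have "P u powr (q / k) \<le> M powr (q / k)"
      using P_pos[OF u] exponents by (intro powr_mono2) auto
    then have "A u \<le> C * M powr (q / k)"
      using A_le[OF u] C_pos by (meson mult_le_cancel_left_pos order_trans)
    then have "lam * (1 / q - 1 / g) * A u \<le> lam * (1 / q - 1 / g) * (C * M powr (q / k))"
      using lam exponents(5) by (intro mult_left_mono) auto
    moreover have "a * (1 / k - 1 / g) * P u \<ge> 0" using P_pos[OF u] a_pos exponents(4) by simp
    ultimately show ?thesis by (simp add: b_def reduced_def)
  next
    case False
    have "b \<le> 0" using lam exponents(5) C_pos by (simp add: b_def)
    then show ?thesis using False by simp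
  qed
  define Y where "Y = (INF u\<in>N lam. reduced lam u)"
  have ne: "N lam \<noteq> {}" using N_nonempty[OF lam] by blast
  have bdd: "bdd_below (reduced lam ` N lam)" by (rule bdd_belowI2[OF b])
  have Yle: "Y \<le> reduced lam u" if "u \<in> N lam" for u
    unfolding Y_def by (rule cINF_lower[OF bdd that])
  have "\<exists>u\<in>N lam. reduced lam u < Y + 1 / real (Suc n)" for n
    using cINF_less_iff[OF ne bdd, of "Y + 1 / real (Suc n)"] by (simp add: Y_def)
  then obtain x where x: "\<And>n. x n \<in> N lam" "\<And>n. reduced lam (x n) < Y + 1 / real (Suc n)" by metis
  have "(\<lambda>n. Y + 1 / real (Suc n)) \<longlonglongrightarrow> Y + 0"
    by (intro tendsto_intros LIMSEQ_Suc[OF lim_1_over_n])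
  then have yl: "(\<lambda>n. Y + 1 / real (Suc n)) \<longlonglongrightarrow> Y" by simp
  obtain r u pl where u: "u \<in> N lam" "P u \<le> pl" "a * (1 / k - 1 / g) * pl - lam * (1 / q - 1 / g) * A u \<le> Y"
    using N_limit[OF tendsto_const lam lam x(1) less_imp_le[OF x(2)] yl]
    by (elim exE conjE) (rule that)
  have "a * (1 / k - 1 / g) * P u \<le> a * (1 / k - 1 / g) * pl"
    using u a_pos exponents(4) by (intro mult_left_mono) auto
  then have "reduced lam u \<le> Y" using u by (simp add: reduced_def)
  then show "\<exists>u. min_N lam u" using u Yle unfolding min_N_def by (meson order_trans)
qed

text \<open>Hypothesis 2 says that \<open>reduced\<close> has positive derivative along the ray at
  1, so shrinking lowers it. If the equation failed, both constraints would be strict and the shrunk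
  point would stay in \<open>N\<close>.\<close>

lemma min_N_interior:
  assumes m: "min_N lam u" and lam: "lam > 0"
    and 1: "(k - q) * a * P u < (g - q) * B u" and 2: "lam * (g - q) * A u < (g - k) * a * P u"
  shows "a * P u = lam * A u + B u"
proof (rule ccontr)
  assume neq: "\<not> ?thesis"
  have uN: "u \<in> N lam" and u: "u \<in> K" using m N_K by (auto simp: min_N_def)
  have 3: "a * P u < lam * A u + B u" using neq uN by (simp add: N_def)
  let ?f = "\<lambda>t. fib (a * (1 / k - 1 / g)) (lam * (1 / q - 1 / g)) 0 t u"
  have red: "reduced lam (sc t u) = ?f t" if "t > 0" for t
    using that u by (simp add: reduced_def fib_def P_sc A_sc)
  have "g * (fib (a * (1 / k - 1 / g) * k) (lam * (1 / q - 1 / g) * q) (0 * g) 1 u)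
      = (g - k) * a * P u - lam * (g - q) * A u"
    using k_pos q_pos g_pos by (simp add: fib_def field_simps)
  then have "fib (a * (1 / k - 1 / g) * k) (lam * (1 / q - 1 / g) * q) (0 * g) 1 u / 1 > 0"
    using 2 zero_less_mult_pos[OF _ g_pos, of "fib (a * (1 / k - 1 / g) * k) (lam * (1 / q - 1 / g) * q) (0 * g) 1 u"]
    by simp
  from eventually_less_at_left_of_deriv_pos[OF fib_deriv this]
  have "\<forall>\<^sub>F t in at_left 1. ?f t < ?f 1" by simp
  moreover have "((\<lambda>t. lam * (t powr q * A u) + t powr g * B u - a * (t powr k * P u)) \<longlongrightarrow>
     lam * (1 powr q * A u) + 1 powr g * B u - a * (1 powr k * P u)) (at_left 1)"
    by (intro tendsto_intros) auto
  then have "\<forall>\<^sub>F t in at_left 1. lam * (t powr q * A u) + t powr g * B u - a * (t powr k * P u) > 0"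
    by (rule order_tendstoD) (use 3 in auto)
  moreover have "((\<lambda>t. (g - q) * (t powr g * B u) - (k - q) * a * (t powr k * P u)) \<longlongrightarrow>
     (g - q) * (1 powr g * B u) - (k - q) * a * (1 powr k * P u)) (at_left 1)"
    by (intro tendsto_intros) auto
  then have "\<forall>\<^sub>F t in at_left 1. (g - q) * (t powr g * B u) - (k - q) * a * (t powr k * P u) > 0"
    by (rule order_tendstoD) (use 1 in auto)
  moreover have "\<forall>\<^sub>F t in at_left (1::real). t > 0"
    by (auto simp: eventually_at_left_field intro!: exI[of _ 0])
  ultimately have "\<forall>\<^sub>F t in at_left 1. ?f t < ?f 1 \<and> lam * (t powr q * A u) + t powr g * B u - a * (t powr k * P u) > 0
     \<and> (g - q) * (t powr g * B u) - (k - q) * a * (t powr k * P u) > 0 \<and> t > 0"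
    by eventually_elim auto
  then obtain t where t: "?f t < ?f 1" "lam * (t powr q * A u) + t powr g * B u - a * (t powr k * P u) > 0"
     "(g - q) * (t powr g * B u) - (k - q) * a * (t powr k * P u) > 0" "t > 0"
    by (auto dest: eventually_happens)
  have "sc t u \<in> N lam" using t u by (simp add: N_def sc_K P_sc A_sc B_sc)
  then have "reduced lam u \<le> reduced lam (sc t u)" using m by (auto simp: min_N_def)
  moreover have "reduced lam u = ?f 1" by (simp add: reduced_def fib_def)
  ultimately show False using t(1) red[OF t(4)] by simp
qed

section \<open>Interior minimisers up to and slightly beyond the extremal parameter\<close>

lemma min_U_good:
  assumes nd: "\<And>u. u \<in> K \<Longrightarrow> (k - q) * a * P u = (g - q) * B u \<Longrightarrow> a * P u = lam_star * A u + B u \<Longrightarrow>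
      stationary (a / k) (lam_star / q) (1 / g) u \<Longrightarrow> stationary a lam_star 1 u \<Longrightarrow> False"
  shows "\<exists>\<epsilon>>0. \<forall>lam u. 0 < lam \<and> lam < lam_star + \<epsilon> \<and> min_U lam u \<longrightarrow> (g - k) * a * P u < (g - q) * lam * A u"
proof -
  have base: "(g - k) * a * P u < (g - q) * lam * A u" if lam: "0 < lam" "lam \<le> lam_star" and m: "min_U lam u" for lam u
  proof (rule ccontr)
    assume nlt: "\<not> ?thesis"
    have u: "u \<in> K" and "u \<in> U lam" using m U_K by (auto simp: min_U_def)
    then have e: "(g - k) * a * P u = (g - q) * lam * A u" using nlt by (simp add: U_def)
    \<comment> \<open>The active constraint together with \<open>min_U_fib_le\<close> gives the
      complementary inequality that \<open>degenerate_of_le_lam_star\<close> asks for.\<close>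
    have "(g - q) * (a * P u) \<le> (g - q) * (lam * A u + B u)"
      using min_U_fib_le[OF m lam(1)] q_less_g by (intro mult_left_mono) auto
    with e have 1: "(k - q) * a * P u \<le> (g - q) * B u" by (simp add: algebra_simps)
    note d = degenerate_of_le_lam_star[OF u lam 1 eq_refl[OF e]]
    have "stationary (a / k) (lam / q) (1 / g) u" by (rule stationary_U[OF m lam(1) d(3)])
    moreover have "stationary a lam_star 1 u" by (rule stationary_degenerate[OF u d(2)]) (use d in simp)
    ultimately show False using nd[OF u d(2)] d by simp
  qed
  show ?thesis
  proof (rule ccontr)
    assume neg: "\<not> ?thesis"
    have "\<exists>lam u. 0 < lam \<and> lam < lam_star + 1 / real (Suc n) \<and> min_U lam u \<and> \<not> (g - k) * a * P u < (g - q) * lam * A u" for n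
      using neg by (metis of_nat_0_less_iff zero_less_Suc zero_less_divide_1_iff)
    then obtain l x where lx: "\<And>n. 0 < l n" "\<And>n. l n < lam_star + 1 / real (Suc n)" "\<And>n. min_U (l n) (x n)"
      "\<And>n. \<not> (g - k) * a * P (x n) < (g - q) * l n * A (x n)" by metis
    have lge: "l n > lam_star" for n using base[OF lx(1) _ lx(3)] lx(4) by (meson not_le)
    have "(\<lambda>n. lam_star + 1 / real (Suc n)) \<longlonglongrightarrow> lam_star + 0"
      by (intro tendsto_intros LIMSEQ_Suc[OF lim_1_over_n])
    then have ll: "l \<longlonglongrightarrow> lam_star"
      by (intro tendsto_sandwich[of "\<lambda>_. lam_star" l sequentially "\<lambda>n. lam_star + 1 / real (Suc n)"])
        (auto intro!: always_eventually less_imp_le lge lx(2) simp del: of_nat_Suc)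
    obtain v where v: "min_U lam_star v" using min_U_ex(1)[OF lam_star_pos] by blast
    have vneg: "energy lam_star v < 0" by (rule min_U_ex(2)[OF lam_star_pos v])
    have vU: "v \<in> U lam_star" and vK: "v \<in> K" using v U_K by (auto simp: min_U_def)
    \<comment> \<open>\<open>U\<close> grows and the energy falls with the parameter, so the
      minimiser \<open>v\<close> at \<open>lam_star\<close> is a competitor for every
      \<open>l n\<close>.\<close>
    have le: "energy (l n) (x n) \<le> energy lam_star v" for n
    proof -
      have "(g - q) * lam_star * A v \<le> (g - q) * l n * A v"
        using lge[of n] A_pos[OF vK] q_less_g by (intro mult_right_mono mult_left_mono) auto
      then have "v \<in> U (l n)" using vU by (simp add: U_def)
      then have "energy (l n) (x n) \<le> energy (l n) v" using lx(3) by (auto simp: min_U_def)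
      also have "\<dots> \<le> energy lam_star v"
        using lge[of n] A_pos[OF vK] q_pos by (auto simp: energy_def intro!: mult_right_mono divide_right_mono)
      finally show ?thesis .
    qed
    have xU: "x n \<in> U (l n)" for n using lx(3) by (simp add: min_U_def)
    obtain r u pl where u: "strict_mono r" "u \<in> U lam_star" "P u \<le> pl" "(\<lambda>n. P (x (r n))) \<longlonglongrightarrow> pl"
       "(\<lambda>n. A (x (r n))) \<longlonglongrightarrow> A u" "a / k * pl - lam_star / q * A u - 1 / g * B u \<le> energy lam_star v"
      using U_limit[OF ll lam_star_pos lx(1) xU le tendsto_const vneg] by (elim exE conjE) (rule that)
    have ev: "energy lam_star v \<le> energy lam_star u" using v u(2) by (auto simp: min_U_def)
    \<comment> \<open>The limit \<open>u\<close> cannot have less energy than the minimum, so no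
      part of \<open>P\<close> is lost and inequalities containing \<open>P\<close> survive the
      limit from both sides.\<close>
    then have "a / k * pl \<le> a / k * P u" using u(6) by (simp add: energy_def)
    then have "pl \<le> P u" using a_pos k_pos by (subst (asm) mult_le_cancel_left_pos) auto
    then have pl: "pl = P u" using u(3) by simp
    have "min_U lam_star u" using u(2,6) v pl by (auto simp: min_U_def energy_def intro: order_trans)
    from base[OF lam_star_pos order_refl this]
    have "(g - k) * a * P u < (g - q) * lam_star * A u" .
    moreover have "(g - q) * lam_star * A u \<le> (g - k) * a * P u"
    proof (rule LIMSEQ_le)
      show "(\<lambda>n. (g - k) * a * P (x (r n))) \<longlonglongrightarrow> (g - k) * a * P u"
        using u(4) pl by (intro tendsto_intros) auto
      show "(\<lambda>n. (g - q) * l (r n) * A (x (r n))) \<longlonglongrightarrow> (g - q) * lam_star * A u"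
        using u(5) LIMSEQ_subseq_LIMSEQ[OF ll u(1)] by (intro tendsto_intros) (auto simp: o_def)
    qed (use lx(4) in \<open>auto simp: not_less\<close>)
    ultimately show False by simp
  qed
qed

lemma min_N_good:
  assumes nd: "\<And>u. u \<in> K \<Longrightarrow> (k - q) * a * P u = (g - q) * B u \<Longrightarrow> a * P u = lam_star * A u + B u \<Longrightarrow>
      stationary (a / k) (lam_star / q) (1 / g) u \<Longrightarrow> stationary a lam_star 1 u \<Longrightarrow> False"
  shows "\<exists>\<epsilon>>0. \<forall>lam u. 0 < lam \<and> lam < lam_star + \<epsilon> \<and> min_N lam u \<longrightarrow>
     max ((k - q) * a * P u - (g - q) * B u) (lam * (g - q) * A u - (g - k) * a * P u) < 0"
proof -
  \<comment> \<open>Negativity is the conjunction of the two strict hypotheses of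
    \<open>min_N_interior\<close>. The maximum is continuous in \<open>P\<close>, \<open>A\<close>,
    \<open>B\<close> and \<open>lam\<close>, so one limit treats both.\<close>
  define bad where "bad = (\<lambda>lam u. max ((k - q) * a * P u - (g - q) * B u) (lam * (g - q) * A u - (g - k) * a * P u))"
  have base: "bad lam u < 0" if lam: "0 < lam" "lam \<le> lam_star" and m: "min_N lam u" for lam u
  proof (rule ccontr)
    assume nlt: "\<not> ?thesis"
    have u: "u \<in> K" and uN: "u \<in> N lam" using m N_K by (auto simp: min_N_def)
    have 1: "(k - q) * a * P u \<le> (g - q) * B u" using uN by (simp add: N_def)
    have 2: "(g - k) * a * P u \<le> (g - q) * lam * A u"
    \<comment> \<open>If the second constraint is active, the first one supplies the claim;
      otherwise \<open>bad\<close> is nonnegative through its second entry.\<close>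
    proof (cases "(k - q) * a * P u = (g - q) * B u")
      case True
      have "(g - q) * (a * P u) \<le> (g - q) * (lam * A u + B u)"
        using uN q_less_g by (intro mult_left_mono) (auto simp: N_def)
      with True show ?thesis by (simp add: algebra_simps)
    next
      case False
      then show ?thesis using nlt 1 by (simp add: bad_def max_def mult_ac split: if_splits)
    qed
    note d = degenerate_of_le_lam_star[OF u lam 1 2]
    have "stationary (a / k) (lam / q) (1 / g) u" by (rule stationary_N[OF m lam(1) d(3)]) (use d in simp)
    moreover have "stationary a lam_star 1 u" by (rule stationary_degenerate[OF u d(2)]) (use d in simp)
    ultimately show False using nd[OF u d(2)] d by simp
  qed
  have "\<exists>\<epsilon>>0. \<forall>lam u. 0 < lam \<and> lam < lam_star + \<epsilon> \<and> min_N lam u \<longrightarrow> bad lam u < 0"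
  proof (rule ccontr)
    assume neg: "\<not> ?thesis"
    have "\<exists>lam u. 0 < lam \<and> lam < lam_star + 1 / real (Suc n) \<and> min_N lam u \<and> \<not> bad lam u < 0" for n
      using neg by (metis of_nat_0_less_iff zero_less_Suc zero_less_divide_1_iff)
    then obtain l x where lx: "\<And>n. 0 < l n" "\<And>n. l n < lam_star + 1 / real (Suc n)" "\<And>n. min_N (l n) (x n)"
      "\<And>n. \<not> bad (l n) (x n) < 0" by metis
    have lge: "l n > lam_star" for n using base[OF lx(1) _ lx(3)] lx(4) by (meson not_le)
    have "(\<lambda>n. lam_star + 1 / real (Suc n)) \<longlonglongrightarrow> lam_star + 0"
      by (intro tendsto_intros LIMSEQ_Suc[OF lim_1_over_n])
    then have ll: "l \<longlonglongrightarrow> lam_star"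
      by (intro tendsto_sandwich[of "\<lambda>_. lam_star" l sequentially "\<lambda>n. lam_star + 1 / real (Suc n)"])
        (auto intro!: always_eventually less_imp_le lge lx(2) simp del: of_nat_Suc)
    obtain v where v: "min_N lam_star v" using min_N_ex[OF lam_star_pos] by blast
    have vN: "v \<in> N lam_star" and vK: "v \<in> K" using v N_K by (auto simp: min_N_def)
    have le: "reduced (l n) (x n) \<le> reduced lam_star v" for n
    proof -
      have lA: "lam_star * A v \<le> l n * A v" using lge[of n] A_pos[OF vK] by (intro mult_right_mono) auto
      then have "v \<in> N (l n)" using vN by (simp add: N_def)
      then have "reduced (l n) (x n) \<le> reduced (l n) v" using lx(3) by (auto simp: min_N_def)
      also have "\<dots> \<le> reduced lam_star v"
        using lge[of n] A_pos[OF vK] exponents(5) unfolding reduced_def by (intro diff_left_mono mult_right_mono) auto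
      finally show ?thesis .
    qed
    have xN: "x n \<in> N (l n)" for n using lx(3) by (simp add: min_N_def)
    obtain r u pl where u: "strict_mono r" "u \<in> N lam_star" "P u \<le> pl" "(\<lambda>n. P (x (r n))) \<longlonglongrightarrow> pl"
       "(\<lambda>n. A (x (r n))) \<longlonglongrightarrow> A u" "(\<lambda>n. B (x (r n))) \<longlonglongrightarrow> B u"
       "a * (1 / k - 1 / g) * pl - lam_star * (1 / q - 1 / g) * A u \<le> reduced lam_star v"
      using N_limit[OF ll lam_star_pos lx(1) xN le tendsto_const] by (elim exE conjE) (rule that)
    have ev: "reduced lam_star v \<le> reduced lam_star u" using v u(2) by (auto simp: min_N_def)
    then have "(a * (1 / k - 1 / g)) * pl \<le> (a * (1 / k - 1 / g)) * P u" using u(7) by (simp add: reduced_def)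
    then have "pl \<le> P u" using a_pos exponents(4) by (subst (asm) mult_le_cancel_left_pos) auto
    then have pl: "pl = P u" using u(3) by simp
    have "min_N lam_star u" using u(2,7) v pl by (auto simp: min_N_def reduced_def intro: order_trans)
    from base[OF lam_star_pos order_refl this]
    have "bad lam_star u < 0" .
    moreover have "0 \<le> bad lam_star u"
    proof (rule LIMSEQ_le)
      show "(\<lambda>n. bad (l (r n)) (x (r n))) \<longlonglongrightarrow> bad lam_star u"
        unfolding bad_def using u(4-6) LIMSEQ_subseq_LIMSEQ[OF ll u(1)] pl
        by (intro tendsto_intros) (auto simp: o_def)
    qed (use lx(4) in \<open>auto simp: not_less\<close>)
    ultimately show False by simp
  qed
  then show ?thesis by (simp add: bad_def)
qed

theorem two_stationary_points:
  assumes nd: "\<And>u. u \<in> K \<Longrightarrow> (k - q) * a * P u = (g - q) * B u \<Longrightarrow> a * P u = lam_star * A u + B u \<Longrightarrow>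
      stationary (a / k) (lam_star / q) (1 / g) u \<Longrightarrow> stationary a lam_star 1 u \<Longrightarrow> False"
  shows "\<exists>\<epsilon>>0. \<forall>lam. 0 < lam \<and> lam < lam_star + \<epsilon> \<longrightarrow>
     (\<exists>u\<in>K. a * P u = lam * A u + B u \<and> (g - q) * B u < (k - q) * a * P u \<and> stationary (a / k) (lam / q) (1 / g) u) \<and>
     (\<exists>w\<in>K. a * P w = lam * A w + B w \<and> (k - q) * a * P w < (g - q) * B w \<and> stationary (a / k) (lam / q) (1 / g) w)"
proof -
  obtain e1 where e1: "e1 > 0" "\<forall>lam u. 0 < lam \<and> lam < lam_star + e1 \<and> min_U lam u \<longrightarrow> (g - k) * a * P u < (g - q) * lam * A u"
  proof -
    have "\<exists>\<epsilon>>0. \<forall>lam u. 0 < lam \<and> lam < lam_star + \<epsilon> \<and> min_U lam u \<longrightarrow> (g - k) * a * P u < (g - q) * lam * A u"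
      by (rule min_U_good) (fact nd)
    then show ?thesis using that by blast
  qed
  obtain e2 where e2: "e2 > 0" "\<forall>lam u. 0 < lam \<and> lam < lam_star + e2 \<and> min_N lam u \<longrightarrow>
     max ((k - q) * a * P u - (g - q) * B u) (lam * (g - q) * A u - (g - k) * a * P u) < 0"
  proof -
    have "\<exists>\<epsilon>>0. \<forall>lam u. 0 < lam \<and> lam < lam_star + \<epsilon> \<and> min_N lam u \<longrightarrow>
     max ((k - q) * a * P u - (g - q) * B u) (lam * (g - q) * A u - (g - k) * a * P u) < 0"
      by (rule min_N_good) (fact nd)
    then show ?thesis using that by blast
  qed
  show ?thesis
  proof (intro exI[of _ "min e1 e2"] conjI allI impI)
    show "min e1 e2 > 0" using e1 e2 by simp
  next
    fix lam assume l: "0 < lam \<and> lam < lam_star + min e1 e2"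
    then have lam: "lam > 0" by simp
    obtain u where m: "min_U lam u" using min_U_ex(1)[OF lam] by blast
    then have s: "(g - k) * a * P u < (g - q) * lam * A u" using e1 l by auto
    note eq = min_U_interior[OF m lam s]
    have "(g - k) * (a * P u) < (g - q) * (lam * A u)" using s by (simp add: mult_ac)
    also have "lam * A u = a * P u - B u" using eq by simp
    finally have "(g - q) * B u < (k - q) * a * P u" by (simp add: algebra_simps)
    then show "\<exists>u\<in>K. a * P u = lam * A u + B u \<and> (g - q) * B u < (k - q) * a * P u \<and> stationary (a / k) (lam / q) (1 / g) u"
      using eq stationary_U[OF m lam eq] m U_K by (auto simp: min_U_def)
  next
    fix lam assume l: "0 < lam \<and> lam < lam_star + min e1 e2"
    then have lam: "lam > 0" by simp
    obtain u where m: "min_N lam u" using min_N_ex[OF lam] by blast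
    then have s: "(k - q) * a * P u < (g - q) * B u" "lam * (g - q) * A u < (g - k) * a * P u"
      using e2(2)[rule_format, of lam u] l m by auto
    note eq = min_N_interior[OF m lam s]
    show "\<exists>w\<in>K. a * P w = lam * A w + B w \<and> (k - q) * a * P w < (g - q) * B w \<and> stationary (a / k) (lam / q) (1 / g) w"
      using eq stationary_N[OF m lam eq] s m N_K by (auto simp: min_N_def)
  qed
qed

end

section \<open>The fractional Sobolev embedding below the critical exponent\<close>

lemma powr_add_le:
  fixes x y p :: real
  assumes "x \<ge> 0" "y \<ge> 0" "p \<ge> 0"
  shows "(x + y) powr p \<le> 2 powr p * (x powr p + y powr p)"
proof -
  have "(x + y) powr p \<le> (2 * max x y) powr p" using assms by (intro powr_mono2) auto
  also have "\<dots> = 2 powr p * max x y powr p" using assms by (simp add: powr_mult)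
  also have "max x y powr p \<le> x powr p + y powr p" by (simp add: max_def)
  finally show ?thesis by simp
qed

lemma abs_add_powr_le:
  fixes x y p :: real
  assumes "p \<ge> 0"
  shows "\<bar>x + y\<bar> powr p \<le> 2 powr p * (\<bar>x\<bar> powr p + \<bar>y\<bar> powr p)"
proof -
  have "\<bar>x + y\<bar> powr p \<le> (\<bar>x\<bar> + \<bar>y\<bar>) powr p" using assms by (intro powr_mono2) auto
  also have "\<dots> \<le> 2 powr p * (\<bar>x\<bar> powr p + \<bar>y\<bar> powr p)" using assms by (intro powr_add_le) auto
  finally show ?thesis .
qed

text \<open>Below the level \<open>L\<close> the first term dominates, above it the second. The
  level is a free parameter to be tuned.\<close>

lemma powr_le_interpolate:
  fixes t L p q :: real
  assumes "t \<ge> 0" "L > 0" "0 < p" "p \<le> q"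
  shows "t powr p \<le> L powr p + L powr (p - q) * t powr q"
proof (cases "t \<le> L")
  case True
  then have "t powr p \<le> L powr p" using assms by (intro powr_mono2) auto
  then show ?thesis by (simp add: add_increasing2)
next
  case False
  then have tL: "t > L" by simp
  have "L powr (q - p) \<le> t powr (q - p)" using tL assms by (intro powr_mono2) auto
  then have "t powr p * 1 \<le> t powr p * (L powr (p - q) * t powr (q - p))"
    using assms tL by (intro mult_left_mono) (auto simp: powr_diff field_simps)
  also have "\<dots> = L powr (p - q) * t powr q" using assms tL by (simp add: powr_diff)
  finally show ?thesis by (simp add: add_increasing)
qed

text \<open>The cell containing \<open>x\<close> of the cubic grid with side \<open>r\<close>.
  Naming it by a point instead of an index makes cell averages functions on the space and membership
  an equivalence relation.\<close>

definition grid_cell :: "real \<Rightarrow> 'a::euclidean_space \<Rightarrow> 'a set" where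
  "grid_cell r x = {y. \<forall>b\<in>Basis. \<lfloor>y \<bullet> b / r\<rfloor> = \<lfloor>x \<bullet> b / r\<rfloor>}"

lemma grid_cell_self [simp]: "x \<in> grid_cell r x"
  by (simp add: grid_cell_def)

lemma grid_cell_sym: "y \<in> grid_cell r x \<longleftrightarrow> x \<in> grid_cell r y"
  by (auto simp: grid_cell_def)

lemma grid_cell_eq: "y \<in> grid_cell r x \<Longrightarrow> grid_cell r y = grid_cell r x"
  by (auto simp: grid_cell_def)

lemma pred_grid_cell [measurable]:
  "Measurable.pred (borel \<Otimes>\<^sub>M borel) (\<lambda>z::'a::euclidean_space \<times> 'a. snd z \<in> grid_cell r (fst z))"
  unfolding grid_cell_def mem_Collect_eq by measurable

lemma sets_grid_cell [measurable]: "grid_cell r (x::'a::euclidean_space) \<in> sets borel"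
proof -
  have "Measurable.pred borel (\<lambda>y. y \<in> grid_cell r x)"
    unfolding grid_cell_def mem_Collect_eq by measurable
  then show ?thesis by (simp add: pred_def)
qed

text \<open>The half-open cell lies between an open and a closed cube of equal volume, which yields
  its measure; the open cube also catches points of a dense set.\<close>

lemma grid_cell_bounds:
  assumes r: "r > 0"
  defines "l \<equiv> (\<lambda>x::'a::euclidean_space. \<Sum>b\<in>Basis. (r * of_int \<lfloor>x \<bullet> b / r\<rfloor>) *\<^sub>R b)"
  shows "box (l x) (l x + r *\<^sub>R One) \<subseteq> grid_cell r x" "grid_cell r x \<subseteq> cbox (l x) (l x + r *\<^sub>R One)"
proof -
  have lb: "l x \<bullet> b = r * of_int \<lfloor>x \<bullet> b / r\<rfloor>" if "b \<in> Basis" for b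
    using that by (simp add: l_def inner_sum_left inner_Basis if_distrib cong: if_cong)
  show "box (l x) (l x + r *\<^sub>R One) \<subseteq> grid_cell r x"
  proof
    fix y assume y: "y \<in> box (l x) (l x + r *\<^sub>R One)"
    have "\<lfloor>y \<bullet> b / r\<rfloor> = \<lfloor>x \<bullet> b / r\<rfloor>" if b: "b \<in> Basis" for b
    proof (rule floor_unique)
      have "r * of_int \<lfloor>x \<bullet> b / r\<rfloor> < y \<bullet> b" "y \<bullet> b < r * of_int \<lfloor>x \<bullet> b / r\<rfloor> + r"
        using y b lb by (auto simp: mem_box inner_add_left)
      then show "of_int \<lfloor>x \<bullet> b / r\<rfloor> \<le> y \<bullet> b / r" "y \<bullet> b / r < of_int \<lfloor>x \<bullet> b / r\<rfloor> + 1"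
        using r by (auto simp: field_simps)
    qed
    then show "y \<in> grid_cell r x" by (simp add: grid_cell_def)
  qed
  show "grid_cell r x \<subseteq> cbox (l x) (l x + r *\<^sub>R One)"
  proof
    fix y assume y: "y \<in> grid_cell r x"
    have "r * of_int \<lfloor>x \<bullet> b / r\<rfloor> \<le> y \<bullet> b \<and> y \<bullet> b \<le> r * of_int \<lfloor>x \<bullet> b / r\<rfloor> + r" if b: "b \<in> Basis" for b
    proof -
      have "\<lfloor>y \<bullet> b / r\<rfloor> = \<lfloor>x \<bullet> b / r\<rfloor>" using y b by (simp add: grid_cell_def)
      then have "of_int \<lfloor>x \<bullet> b / r\<rfloor> \<le> y \<bullet> b / r" "y \<bullet> b / r \<le> of_int \<lfloor>x \<bullet> b / r\<rfloor> + 1" by linarith+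
      then show ?thesis using r by (auto simp: field_simps)
    qed
    then show "y \<in> cbox (l x) (l x + r *\<^sub>R One)" by (auto simp: mem_box lb inner_add_left)
  qed
qed

lemma emeasure_grid_cell:
  assumes r: "r > 0"
  shows "emeasure lborel (grid_cell r (x::'a::euclidean_space)) = ennreal (r ^ DIM('a))"
proof -
  define l where "l = (\<Sum>b\<in>Basis. (r * of_int \<lfloor>x \<bullet> b / r\<rfloor>) *\<^sub>R b)"
  have P: "(\<Prod>b\<in>(Basis::'a set). (l + r *\<^sub>R One - l) \<bullet> b) = r ^ DIM('a)"
    by (simp add: inner_add_left)
  have e: "emeasure lborel (box l (l + r *\<^sub>R One)) = ennreal (r ^ DIM('a))"
    "emeasure lborel (cbox l (l + r *\<^sub>R One)) = ennreal (r ^ DIM('a))"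
    using r P by (auto simp: inner_add_left emeasure_lborel_box_eq emeasure_lborel_cbox_eq)
  show ?thesis
    using emeasure_mono[OF grid_cell_bounds(1)[OF r, of x], of lborel]
      emeasure_mono[OF grid_cell_bounds(2)[OF r, of x], of lborel] e
    by (auto simp flip: l_def intro: antisym)
qed

lemma grid_cell_norm:
  assumes r: "r > 0" and y: "y \<in> grid_cell r (x::'a::euclidean_space)"
  shows "norm (x - y) \<le> real DIM('a) * r"
proof -
  have "\<bar>(x - y) \<bullet> b\<bar> \<le> r" if b: "b \<in> Basis" for b
  proof -
    have "\<lfloor>y \<bullet> b / r\<rfloor> = \<lfloor>x \<bullet> b / r\<rfloor>" using y b by (simp add: grid_cell_def)
    then have "\<bar>x \<bullet> b / r - y \<bullet> b / r\<bar> \<le> 1" by linarith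
    then show ?thesis using r by (simp add: inner_diff_left abs_le_iff field_simps)
  qed
  then have "(\<Sum>b\<in>Basis. \<bar>(x - y) \<bullet> b\<bar>) \<le> real DIM('a) * r"
    by (intro order_trans[OF sum_bounded_above[of _ _ r]]) auto
  then show ?thesis using norm_le_l1[of "x - y"] by linarith
qed

text \<open>Anything constant on cells is therefore determined by its values on a countable dense
  set, as the diagonal extraction below requires.\<close>

lemma grid_cell_dense_point:
  assumes r: "r > 0" and D: "\<And>S. open S \<Longrightarrow> S \<noteq> {} \<Longrightarrow> \<exists>d\<in>D. d \<in> (S::'a::euclidean_space set)"
  shows "\<exists>d\<in>D. d \<in> grid_cell r (x::'a)"
proof -
  define l where "l = (\<Sum>b\<in>Basis. (r * of_int \<lfloor>x \<bullet> b / r\<rfloor>) *\<^sub>R b)"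
  have "box l (l + r *\<^sub>R One) \<noteq> {}" using r by (simp add: box_ne_empty inner_add_left)
  then obtain d where "d \<in> D" "d \<in> box l (l + r *\<^sub>R One)" using D[of "box l (l + r *\<^sub>R One)"] open_box by blast
  then show ?thesis using grid_cell_bounds(1)[OF r, of x] by (auto simp: l_def)
qed

section \<open>Gagliardo energy, and iteration towards the critical exponent\<close>

locale fractional_exponents =
  fixes s p expo :: real and dimension :: "'a::euclidean_space itself"
  assumes expo_eq: "expo = real DIM('a) + s * p" and s_pos: "0 < s" and p_gt_1: "1 < p" and sp_less: "s * p < real DIM('a)"
begin

text \<open>The inner integral of the Gagliardo double integral, kept as a function of
  \<open>x\<close> so that estimates can be made pointwise and integrated afterwards.\<close>

definition slice :: "('a \<Rightarrow> real) \<Rightarrow> 'a \<Rightarrow> ennreal" where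
  "slice u x = (\<integral>\<^sup>+ y. ennreal (\<bar>u x - u y\<bar> powr p / norm (x - y) powr expo) \<partial>lborel)"

definition gagliardo :: "('a \<Rightarrow> real) \<Rightarrow> ennreal" where
  "gagliardo u = (\<integral>\<^sup>+ x. slice u x \<partial>lborel)"

definition mass :: "real \<Rightarrow> ('a \<Rightarrow> real) \<Rightarrow> ennreal" where
  "mass q u = (\<integral>\<^sup>+ x. ennreal (\<bar>u x\<bar> powr q) \<partial>lborel)"

lemma p_pos: "0 < p" and expo_pos: "0 < expo" and sp_pos: "0 < s * p"
  using p_gt_1 s_pos by (auto simp: add_pos_pos expo_eq)

lemma measurable_slice [measurable]:
  assumes [measurable]: "u \<in> borel_measurable borel"
  shows "slice u \<in> borel_measurable borel"
proof -
  have "(\<lambda>x. \<integral>\<^sup>+ y. ennreal (\<bar>u x - u y\<bar> powr p / norm (x - y) powr expo) \<partial>lborel) \<in> borel_measurable lborel"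
    by (rule lborel.borel_measurable_nn_integral) measurable
  then show ?thesis by (simp add: slice_def[abs_def])
qed

lemma gagliardo_eq:
  assumes [measurable]: "u \<in> borel_measurable borel"
  shows "(\<integral>\<^sup>+ (x, y). ennreal (\<bar>u x - u y\<bar> powr p / norm (x - y) powr expo) \<partial>lborel) = gagliardo u"
proof -
  have "(\<integral>\<^sup>+ z. (case z of (x, y) \<Rightarrow> ennreal (\<bar>u x - u y\<bar> powr p / norm (x - y) powr expo)) \<partial>(lborel \<Otimes>\<^sub>M lborel))
     = (\<integral>\<^sup>+ x. \<integral>\<^sup>+ y. ennreal (\<bar>u x - u y\<bar> powr p / norm (x - y) powr expo) \<partial>lborel \<partial>lborel)"
    by (subst lborel.nn_integral_fst[symmetric]) (auto simp: split_beta)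
  then show ?thesis by (simp add: gagliardo_def slice_def lborel_prod)
qed

text \<open>On a cell the distance is at most the dimension times \<open>r\<close>, so the kernel is
  bounded below there.\<close>

lemma cell_oscillation:
  assumes [measurable]: "u \<in> borel_measurable borel" and r: "r > 0"
  shows "(\<integral>\<^sup>+ y. ennreal (\<bar>u x - u y\<bar> powr p) * indicator (grid_cell r x) y \<partial>lborel)
    \<le> ennreal ((real DIM('a) * r) powr expo) * slice u x"
proof -
  have "(\<integral>\<^sup>+ y. ennreal (\<bar>u x - u y\<bar> powr p) * indicator (grid_cell r x) y \<partial>lborel)
    \<le> (\<integral>\<^sup>+ y. ennreal ((real DIM('a) * r) powr expo) * ennreal (\<bar>u x - u y\<bar> powr p / norm (x - y) powr expo) \<partial>lborel)"
  proof (rule nn_integral_mono)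
    fix y
    show "ennreal (\<bar>u x - u y\<bar> powr p) * indicator (grid_cell r x) y
       \<le> ennreal ((real DIM('a) * r) powr expo) * ennreal (\<bar>u x - u y\<bar> powr p / norm (x - y) powr expo)"
    proof (cases "y \<in> grid_cell r x \<and> x \<noteq> y")
      case True
      then have n: "norm (x - y) > 0" "norm (x - y) \<le> real DIM('a) * r" using grid_cell_norm[OF r] by auto
      have "norm (x - y) powr expo \<le> (real DIM('a) * r) powr expo"
        using n expo_pos by (intro powr_mono2) auto
      then have "\<bar>u x - u y\<bar> powr p * norm (x - y) powr expo \<le> \<bar>u x - u y\<bar> powr p * (real DIM('a) * r) powr expo"
        by (intro mult_left_mono) auto
      then have "\<bar>u x - u y\<bar> powr p \<le> (real DIM('a) * r) powr expo * (\<bar>u x - u y\<bar> powr p / norm (x - y) powr expo)"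
        using n by (simp add: field_simps)
      then show ?thesis using True by (simp add: ennreal_mult[symmetric] ennreal_leI)
    qed auto
  qed
  also have "\<dots> = ennreal ((real DIM('a) * r) powr expo) * slice u x"
    unfolding slice_def by (rule nn_integral_cmult) measurable
  finally show ?thesis .
qed

text \<open>Compare \<open>u x\<close> with \<open>u y\<close> and integrate over all
  \<open>y\<close> in the cell of \<open>x\<close>.\<close>

lemma cell_split:
  assumes [measurable]: "u \<in> borel_measurable borel" and r: "r > 0"
  shows "ennreal (\<bar>u x\<bar> powr p * r ^ DIM('a)) \<le> ennreal (2 powr p) *
     ((\<integral>\<^sup>+ y. ennreal (\<bar>u y\<bar> powr p) * indicator (grid_cell r x) y \<partial>lborel)
       + ennreal ((real DIM('a) * r) powr expo) * slice u x)"
proof -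
  have "ennreal (\<bar>u x\<bar> powr p * r ^ DIM('a)) = (\<integral>\<^sup>+ y. ennreal (\<bar>u x\<bar> powr p) * indicator (grid_cell r x) y \<partial>lborel)"
    using r by (subst nn_integral_cmult_indicator) (auto simp: emeasure_grid_cell ennreal_mult)
  also have "\<dots> \<le> (\<integral>\<^sup>+ y. ennreal (2 powr p) * (ennreal (\<bar>u y\<bar> powr p) * indicator (grid_cell r x) y
       + ennreal (\<bar>u x - u y\<bar> powr p) * indicator (grid_cell r x) y) \<partial>lborel)"
  proof (rule nn_integral_mono)
    fix y
    have "\<bar>u x\<bar> powr p \<le> 2 powr p * (\<bar>u y\<bar> powr p + \<bar>u x - u y\<bar> powr p)"
      using abs_add_powr_le[of p "u y" "u x - u y"] p_pos by simp
    then have "ennreal (\<bar>u x\<bar> powr p) \<le> ennreal (2 powr p) * (ennreal (\<bar>u y\<bar> powr p) + ennreal (\<bar>u x - u y\<bar> powr p))"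
      by (simp add: ennreal_mult[symmetric] ennreal_plus[symmetric] del: ennreal_plus)
    then show "ennreal (\<bar>u x\<bar> powr p) * indicator (grid_cell r x) y \<le> ennreal (2 powr p) * (ennreal (\<bar>u y\<bar> powr p) * indicator (grid_cell r x) y
       + ennreal (\<bar>u x - u y\<bar> powr p) * indicator (grid_cell r x) y)"
      by (auto simp: indicator_def)
  qed
  also have "\<dots> = ennreal (2 powr p) * ((\<integral>\<^sup>+ y. ennreal (\<bar>u y\<bar> powr p) * indicator (grid_cell r x) y \<partial>lborel)
       + (\<integral>\<^sup>+ y. ennreal (\<bar>u x - u y\<bar> powr p) * indicator (grid_cell r x) y \<partial>lborel))"
    by (subst nn_integral_cmult, measurable, subst nn_integral_add) (auto)
  also have "\<dots> \<le> ennreal (2 powr p) *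
     ((\<integral>\<^sup>+ y. ennreal (\<bar>u y\<bar> powr p) * indicator (grid_cell r x) y \<partial>lborel)
       + ennreal ((real DIM('a) * r) powr expo) * slice u x)"
    by (intro mult_left_mono add_left_mono cell_oscillation[OF assms]) auto
  finally show ?thesis .
qed

text \<open>On the cell around \<open>x\<close> whose volume is a suitable multiple of \<open>|u x|^(-q)\<close>, bounded mass makes the mean of
  \<open>|u|^p\<close> small compared with \<open>|u x|^p\<close>, so the oscillation on the cell is comparable to \<open>|u x|^p\<close>.\<close>

lemma sobolev_pointwise:
  assumes q: "p \<le> q" and K: "K > 0"
  shows "\<exists>c>0. \<forall>u x. u \<in> borel_measurable borel \<longrightarrow> mass q u \<le> ennreal K \<longrightarrow>
     ennreal (\<bar>u x\<bar> powr (p + s * p * q / real DIM('a))) \<le> ennreal c * slice u x"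
proof -
  let ?n = "real DIM('a)"
  \<comment> \<open>The factor 4 makes each of the two terms in the bound for the mean absorb a
    quarter of the left-hand side.\<close>
  define \<kappa> where "\<kappa> = 4 * 2 powr p"
  define R where "R = K * \<kappa> powr (q / p)"
  define c where "c = 2 powr (p + 1) * ?n powr expo * R powr (s * p / ?n)"
  have \<kappa>: "\<kappa> > 0" by (simp add: \<kappa>_def)
  have R: "R > 0" using K \<kappa> by (simp add: R_def)
  have c: "c > 0" using R by (simp add: c_def)
  have "ennreal (\<bar>u x\<bar> powr (p + s * p * q / ?n)) \<le> ennreal c * slice u x"
    if [measurable]: "u \<in> borel_measurable borel" and mass: "mass q u \<le> ennreal K" for u x
  proof (cases "u x = 0 \<or> slice u x = \<infinity>")
    case True
    then show ?thesis using c by (auto simp: ennreal_mult_eq_top_iff)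
  next
    case False
    define t where "t = \<bar>u x\<bar>"
    have t: "t > 0" using False by (simp add: t_def)
    from False obtain G where G: "slice u x = ennreal G" "G \<ge> 0" by (cases "slice u x") auto
    \<comment> \<open>The level for \<open>powr_le_interpolate\<close>. It satisfies
      \<open>L powr p = t powr p / \<kappa>\<close>, and \<open>R\<close> is tuned so that the term
      containing \<open>K\<close> has the same size as the one containing the cell volume.\<close>
    define L where "L = t / \<kappa> powr (1 / p)"
    define r where "r = (R * t powr (-q)) powr (1 / ?n)"
    have L: "L > 0" using t \<kappa> by (simp add: L_def)
    have r: "r > 0" using R t by (simp add: r_def)
    have rn: "r ^ DIM('a) = R * t powr (-q)"
      using r R t by (simp add: r_def powr_realpow[symmetric] powr_powr)
    have Lp: "L powr p = t powr p / \<kappa>"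
      using t \<kappa> p_pos by (simp add: L_def powr_divide powr_powr)
    have Lpq: "\<kappa> * (L powr (p - q) * K) = t powr p * r ^ DIM('a)"
    proof -
      have "L powr (p - q) = t powr (p - q) / \<kappa> powr ((p - q) / p)"
        using t \<kappa> p_pos by (simp add: L_def powr_divide powr_powr)
      also have "\<dots> = t powr (p - q) * \<kappa> powr (q / p) / \<kappa>"
        using p_pos \<kappa> by (simp add: diff_divide_distrib powr_diff)
      finally have "\<kappa> * L powr (p - q) = t powr (p - q) * \<kappa> powr (q / p)" using \<kappa> by simp
      moreover have "t powr (p - q) = t powr p * t powr (- q)" by (simp flip: powr_add)
      ultimately show ?thesis unfolding rn R_def by (simp add: mult.assoc[symmetric])
    qed
    have mean: "(\<integral>\<^sup>+ y. ennreal (\<bar>u y\<bar> powr p) * indicator (grid_cell r x) y \<partial>lborel)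
        \<le> ennreal (L powr p * r ^ DIM('a) + L powr (p - q) * K)"
    proof -
      have "(\<integral>\<^sup>+ y. ennreal (\<bar>u y\<bar> powr p) * indicator (grid_cell r x) y \<partial>lborel)
         \<le> (\<integral>\<^sup>+ y. ennreal (L powr p) * indicator (grid_cell r x) y + ennreal (L powr (p - q)) * ennreal (\<bar>u y\<bar> powr q) \<partial>lborel)"
      proof (rule nn_integral_mono)
        fix y
        have "ennreal (\<bar>u y\<bar> powr p) \<le> ennreal (L powr p) + ennreal (L powr (p - q)) * ennreal (\<bar>u y\<bar> powr q)"
          using powr_le_interpolate[of "\<bar>u y\<bar>" L p q] L p_pos q
          by (simp add: ennreal_mult[symmetric] ennreal_plus[symmetric] del: ennreal_plus)
        then show "ennreal (\<bar>u y\<bar> powr p) * indicator (grid_cell r x) y \<le>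
           ennreal (L powr p) * indicator (grid_cell r x) y + ennreal (L powr (p - q)) * ennreal (\<bar>u y\<bar> powr q)"
          by (auto simp: indicator_def)
      qed
      also have "\<dots> = ennreal (L powr p) * ennreal (r ^ DIM('a)) + ennreal (L powr (p - q)) * mass q u"
        using r by (subst nn_integral_add)
          (auto simp: nn_integral_cmult_indicator emeasure_grid_cell nn_integral_cmult mass_def)
      also have "\<dots> \<le> ennreal (L powr p) * ennreal (r ^ DIM('a)) + ennreal (L powr (p - q)) * ennreal K"
        by (intro add_left_mono mult_left_mono mass) auto
      finally show ?thesis using K r by (simp add: ennreal_mult ennreal_plus)
    qed
    have "ennreal (t powr p * r ^ DIM('a)) \<le> ennreal (2 powr p) *
       (ennreal (L powr p * r ^ DIM('a) + L powr (p - q) * K) + ennreal ((?n * r) powr expo) * ennreal G)"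
      using order_trans[OF cell_split[OF that(1) r, of x] mult_left_mono[OF add_right_mono[OF mean]]]
      by (simp add: t_def G)
    also have "\<dots> = ennreal (2 powr p * (L powr p * r ^ DIM('a) + L powr (p - q) * K + (?n * r) powr expo * G))"
      using G K r by (simp add: ennreal_mult ennreal_plus)
    finally have "t powr p * r ^ DIM('a) \<le> 2 powr p * (L powr p * r ^ DIM('a) + L powr (p - q) * K + (?n * r) powr expo * G)"
      using G K r by (subst (asm) ennreal_le_iff) auto
    moreover have "2 powr p * (L powr p * r ^ DIM('a)) = t powr p * r ^ DIM('a) / 4"
      unfolding Lp \<kappa>_def by simp
    moreover have "2 powr p * (L powr (p - q) * K) = t powr p * r ^ DIM('a) / 4"
      using Lpq unfolding \<kappa>_def by simp
    ultimately have "t powr p * r ^ DIM('a) \<le> 2 * 2 powr p * ((?n * r) powr expo * G)"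
      by (simp add: distrib_left)
    also have "\<dots> = (2 powr (p + 1) * ?n powr expo * r powr (s * p) * G) * r ^ DIM('a)"
      using r by (simp add: powr_mult powr_add powr_realpow expo_eq)
    finally have "t powr p \<le> 2 powr (p + 1) * ?n powr expo * r powr (s * p) * G"
      using r by (subst (asm) mult_le_cancel_right) auto
    also have "r powr (s * p) = R powr (s * p / ?n) * t powr (- (s * p * q / ?n))"
      using R t by (simp add: r_def powr_powr powr_mult mult_ac)
    finally have "t powr p \<le> c * G * t powr (- (s * p * q / ?n))" by (simp add: c_def mult_ac)
    then have "t powr p * t powr (s * p * q / ?n) \<le> c * G * t powr (- (s * p * q / ?n)) * t powr (s * p * q / ?n)"
      by (intro mult_right_mono) auto
    also have "\<dots> = c * G" using t by (simp add: mult.assoc flip: powr_add)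
    finally have "t powr (p + s * p * q / ?n) \<le> c * G" by (simp add: powr_add)
    then show ?thesis using c G by (simp add: t_def ennreal_mult[symmetric] ennreal_leI)
  qed
  then show ?thesis using c by blast
qed

text \<open>The embedding for normalised functions; homogeneity is restored by scaling in
  \<open>sobolev_embedding\<close>.\<close>

definition bounded_mass :: "real \<Rightarrow> bool" where
  "bounded_mass q \<longleftrightarrow> (\<exists>C>0. \<forall>u\<in>borel_measurable borel. mass p u \<le> 1 \<longrightarrow> gagliardo u \<le> 1 \<longrightarrow> mass q u \<le> ennreal C)"

text \<open>Integrating the pointwise bound turns \<open>slice\<close> into the Gagliardo energy.
  The new exponent is an affine contraction of the old one, with the critical exponent as its fixed
  point.\<close>

lemma bounded_mass_step:
  assumes q: "p \<le> q" and b: "bounded_mass q"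
  shows "bounded_mass (p + s * p * q / real DIM('a))"
proof -
  obtain K where K: "K > 0" "\<And>u. u \<in> borel_measurable borel \<Longrightarrow> mass p u \<le> 1 \<Longrightarrow> gagliardo u \<le> 1 \<Longrightarrow> mass q u \<le> ennreal K"
    using b by (auto simp: bounded_mass_def)
  obtain c where c: "c > 0" "\<And>u x. u \<in> borel_measurable borel \<Longrightarrow> mass q u \<le> ennreal K \<Longrightarrow>
     ennreal (\<bar>u x\<bar> powr (p + s * p * q / real DIM('a))) \<le> ennreal c * slice u x"
    using sobolev_pointwise[OF q K(1)] by blast
  have "mass (p + s * p * q / real DIM('a)) u \<le> ennreal c"
    if u [measurable]: "u \<in> borel_measurable borel" and "mass p u \<le> 1" "gagliardo u \<le> 1" for u
  proof -
    have "mass (p + s * p * q / real DIM('a)) u \<le> (\<integral>\<^sup>+ x. ennreal c * slice u x \<partial>lborel)"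
      unfolding mass_def by (intro nn_integral_mono c(2) K(2) that)
    also have "\<dots> = ennreal c * gagliardo u" unfolding gagliardo_def by (rule nn_integral_cmult) measurable
    also have "\<dots> \<le> ennreal c * 1" using that by (intro mult_left_mono) auto
    finally show ?thesis by simp
  qed
  then show ?thesis unfolding bounded_mass_def using c(1) by blast
qed

lemma bounded_mass_between:
  assumes "bounded_mass q1" "bounded_mass q2" "q1 \<le> q" "q \<le> q2"
  shows "bounded_mass q"
proof -
  obtain C1 C2 where C: "C1 > 0" "C2 > 0"
    "\<And>u. u \<in> borel_measurable borel \<Longrightarrow> mass p u \<le> 1 \<Longrightarrow> gagliardo u \<le> 1 \<Longrightarrow> mass q1 u \<le> ennreal C1"
    "\<And>u. u \<in> borel_measurable borel \<Longrightarrow> mass p u \<le> 1 \<Longrightarrow> gagliardo u \<le> 1 \<Longrightarrow> mass q2 u \<le> ennreal C2"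
    using assms(1,2) by (auto simp: bounded_mass_def)
  have pw: "t powr q \<le> t powr q1 + t powr q2" if "t \<ge> 0" for t :: real
  proof (cases "t \<le> 1")
    case True
    then have "t powr q \<le> t powr q1" using assms that powr_mono'[of q1 q t] by (cases "t = 0") auto
    then show ?thesis by (simp add: add_increasing2)
  next
    case False
    then have "t powr q \<le> t powr q2" using assms by (intro powr_mono) auto
    then show ?thesis by (simp add: add_increasing)
  qed
  have "mass q u \<le> ennreal (C1 + C2)"
    if u [measurable]: "u \<in> borel_measurable borel" and "mass p u \<le> 1" "gagliardo u \<le> 1" for u
  proof -
    have "mass q u \<le> (\<integral>\<^sup>+ x. ennreal (\<bar>u x\<bar> powr q1) + ennreal (\<bar>u x\<bar> powr q2) \<partial>lborel)"
      unfolding mass_def by (intro nn_integral_mono) (use pw in \<open>auto simp: ennreal_plus[symmetric] simp del: ennreal_plus intro!: ennreal_leI\<close>)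
    also have "\<dots> = mass q1 u + mass q2 u" unfolding mass_def by (rule nn_integral_add) measurable
    also have "\<dots> \<le> ennreal C1 + ennreal C2" by (intro add_mono C that)
    finally show ?thesis using C by (simp add: ennreal_plus)
  qed
  then show ?thesis unfolding bounded_mass_def using C by (intro exI[of _ "C1 + C2"]) auto
qed

text \<open>The iterates started at \<open>p\<close> converge to the critical exponent, so some
  iterate exceeds \<open>q\<close>; interpolation with \<open>p\<close> covers the exponents in
  between.\<close>

lemma subcritical_bounded_mass:
  assumes "p \<le> q" "q < real DIM('a) * p / (real DIM('a) - s * p)"
  shows "bounded_mass q"
proof -
  define \<sigma> where "\<sigma> = s * p / real DIM('a)"
  have \<sigma>: "0 < \<sigma>" "\<sigma> < 1" using sp_pos sp_less by (auto simp: \<sigma>_def)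
  \<comment> \<open>The iterates in closed form, with contraction ratio \<sigma> and limit
    \<open>p / (1 - \<sigma>)\<close>.\<close>
  define e where "e = (\<lambda>j. p / (1 - \<sigma>) - (p / (1 - \<sigma>) - p) * \<sigma> ^ j)"
  have pp: "p \<le> p / (1 - \<sigma>)" using \<sigma> p_pos by (simp add: field_simps)
  have eS: "e (Suc j) = p + s * p * e j / real DIM('a)" for j
  proof -
    have "p + s * p * e j / real DIM('a) = p + \<sigma> * e j" by (simp add: \<sigma>_def)
    also have "\<dots> = e (Suc j)"
    proof -
      define Q where "Q = p / (1 - \<sigma>)"
      define D where "D = Q - p"
      have "Q = p + \<sigma> * Q" using \<sigma> by (simp add: Q_def field_simps)
      then have "p + \<sigma> * (Q - D * \<sigma> ^ j) = Q - D * \<sigma> ^ Suc j" by (simp add: algebra_simps)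
      then show ?thesis by (simp add: e_def D_def Q_def)
    qed
    finally show ?thesis by simp
  qed
  have ep: "p \<le> e j" for j
  proof -
    have "\<sigma> ^ j \<le> 1" using \<sigma> by (simp add: power_le_one)
    then have "(p / (1 - \<sigma>) - p) * \<sigma> ^ j \<le> p / (1 - \<sigma>) - p" using pp by (intro mult_left_le) auto
    then show ?thesis by (simp add: e_def)
  qed
  have b: "bounded_mass (e j)" for j
  proof (induction j)
    case 0
    have "bounded_mass p" unfolding bounded_mass_def by (intro exI[of _ 1]) auto
    then show ?case by (simp add: e_def)
  next
    case (Suc j)
    then show ?case unfolding eS by (intro bounded_mass_step ep)
  qed
  have "(\<lambda>j. \<sigma> ^ j) \<longlonglongrightarrow> 0" using \<sigma> by (intro LIMSEQ_realpow_zero) auto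
  then have "e \<longlonglongrightarrow> p / (1 - \<sigma>) - (p / (1 - \<sigma>) - p) * 0" unfolding e_def by (intro tendsto_intros) (use \<sigma> in auto)
  moreover have "p / (1 - \<sigma>) = real DIM('a) * p / (real DIM('a) - s * p)"
    using sp_less by (simp add: \<sigma>_def field_simps)
  ultimately have "e \<longlonglongrightarrow> real DIM('a) * p / (real DIM('a) - s * p)" by simp
  then have "\<forall>\<^sub>F j in sequentially. q < e j" using assms(2) by (rule order_tendstoD)
  then obtain j where "q < e j" by (auto dest: eventually_happens)
  moreover have "bounded_mass p" using b[of 0] by (simp add: e_def)
  ultimately show ?thesis using bounded_mass_between[OF _ b[of j]] assms by (meson less_imp_le)
qed

end

section \<open>Averaging over grid cells\<close>

lemma nn_integral_le_of_AE_tendsto: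
  fixes f :: "nat \<Rightarrow> 'b \<Rightarrow> ennreal"
  assumes [measurable]: "\<And>n. f n \<in> borel_measurable M"
    and lim: "AE x in M. (\<lambda>n. f n x) \<longlonglongrightarrow> g x"
    and le: "\<forall>\<^sub>F n in sequentially. (\<integral>\<^sup>+ x. f n x \<partial>M) \<le> C"
  shows "(\<integral>\<^sup>+ x. g x \<partial>M) \<le> C"
proof -
  have "(\<integral>\<^sup>+ x. g x \<partial>M) = (\<integral>\<^sup>+ x. liminf (\<lambda>n. f n x) \<partial>M)"
    using lim by (intro nn_integral_cong_AE) (auto dest!: lim_imp_Liminf[rotated])
  also have "\<dots> \<le> liminf (\<lambda>n. \<integral>\<^sup>+ x. f n x \<partial>M)" by (rule nn_integral_liminf) measurable
  also have "\<dots> \<le> limsup (\<lambda>n. \<integral>\<^sup>+ x. f n x \<partial>M)" by (rule Liminf_le_Limsup) simp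
  also have "\<dots> \<le> C" using le by (rule Limsup_bounded)
  finally show ?thesis .
qed

lemma tendsto_0_if_le:
  fixes f :: "'b \<Rightarrow> ennreal"
  assumes "\<And>\<eta>. \<eta> > 0 \<Longrightarrow> \<forall>\<^sub>F n in F. f n \<le> ennreal \<eta>"
  shows "(f \<longlongrightarrow> 0) F"
proof (rule order_tendstoI)
  fix a :: ennreal assume "0 < a"
  then obtain \<eta> where \<eta>: "0 < ennreal \<eta>" "ennreal \<eta> < a"
    by (metis dense ennreal_cases less_top_ennreal order_less_le_trans top_greatest)
  then have "\<eta> > 0" by simp
  from assms[OF this] show "\<forall>\<^sub>F n in F. f n < a" by eventually_elim (use \<eta> in auto)
qed simp

text \<open>Jensen's inequality for a mean, obtained from Young's: pairing \<open>f\<close> with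
  \<open>c'\<close> produces a term in \<open>\<bar>c\<bar> powr p\<close> with factor
  \<open>(p - 1) / p\<close>, which the left-hand side absorbs.\<close>

lemma Jensen_powr:
  fixes f :: "'b \<Rightarrow> real"
  assumes p: "p > 1" and f [measurable]: "f \<in> borel_measurable M" and S [measurable]: "S \<in> sets M"
    and m: "emeasure M S = ennreal m" "m > 0"
  shows "ennreal (\<bar>(LINT x|M. indicator S x * f x) / m\<bar> powr p)
     \<le> ennreal (1 / m) * (\<integral>\<^sup>+ x. ennreal (\<bar>f x\<bar> powr p) * indicator S x \<partial>M)"
proof (cases "(\<integral>\<^sup>+ x. ennreal (\<bar>f x\<bar> powr p) * indicator S x \<partial>M) = \<infinity>")
  case True
  then show ?thesis using m by (simp add: ennreal_mult_eq_top_iff)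
next
  case False
  define c where "c = (LINT x|M. indicator S x * f x) / m"
  define c' where "c' = \<bar>c\<bar> powr (p - 1)"
  have eq: "(\<integral>\<^sup>+ x. ennreal (\<bar>f x\<bar> powr p) * indicator S x \<partial>M) = (\<integral>\<^sup>+ x. ennreal (indicator S x * \<bar>f x\<bar> powr p) \<partial>M)"
    by (intro nn_integral_cong) (auto simp: indicator_def)
  have i1: "integrable M (\<lambda>x. indicator S x * \<bar>f x\<bar> powr p)"
    by (rule integrableI_nonneg) (use False eq in \<open>auto simp: less_top\<close>)
  have i2: "integrable M (\<lambda>x. indicator S x :: real)"
    using m by (intro integrable_real_indicator) auto
  have i3: "integrable M (\<lambda>x. indicator S x * f x)"
  proof (rule Bochner_Integration.integrable_bound[OF Bochner_Integration.integrable_add[OF i2 i1]])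
    show "AE x in M. norm (indicator S x * f x) \<le> norm (indicator S x + indicator S x * \<bar>f x\<bar> powr p)"
    proof (rule AE_I2)
      fix x
      have "\<bar>f x\<bar> \<le> 1 + \<bar>f x\<bar> powr p"
      proof (cases "\<bar>f x\<bar> \<le> 1")
        case False
        then have "\<bar>f x\<bar> powr 1 \<le> \<bar>f x\<bar> powr p" using p by (intro powr_mono) auto
        then show ?thesis using False by simp
      qed (simp add: add_increasing2)
      then show "norm (indicator S x * f x) \<le> norm (indicator S x + indicator S x * \<bar>f x\<bar> powr p)"
        by (auto simp: indicator_def)
    qed
  qed simp
  have mS: "Sigma_Algebra.measure M S = m" using m by (simp add: measure_def)
  have "m * \<bar>c\<bar> powr p = c' * \<bar>LINT x|M. indicator S x * f x\<bar>"
  proof -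
    have "\<bar>c\<bar> powr p = c' * \<bar>c\<bar>" using p by (cases "c = 0") (auto simp: c'_def powr_diff)
    then show ?thesis using m by (simp add: c_def)
  qed
  also have "\<dots> \<le> c' * (LINT x|M. norm (indicator S x * f x))"
    by (intro mult_left_mono) (use integral_norm_bound[of M "\<lambda>x. indicator S x * f x"] in \<open>auto simp: c'_def\<close>)
  also have "\<dots> = (LINT x|M. c' * norm (indicator S x * f x))" by simp
  also have "\<dots> \<le> (LINT x|M. 1 / p * (indicator S x * \<bar>f x\<bar> powr p) + ((p - 1) / p * \<bar>c\<bar> powr p) * indicator S x)"
  proof (rule integral_mono)
    fix x
    have "\<bar>f x\<bar> * c' \<le> \<bar>f x\<bar> powr p / p + c' powr (p / (p - 1)) / (p / (p - 1))"
      by (rule Youngs_inequality) (use p in \<open>auto simp: c'_def field_simps\<close>)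
    also have "c' powr (p / (p - 1)) = \<bar>c\<bar> powr p" using p by (simp add: c'_def powr_powr)
    finally show "c' * norm (indicator S x * f x) \<le> 1 / p * (indicator S x * \<bar>f x\<bar> powr p) + ((p - 1) / p * \<bar>c\<bar> powr p) * indicator S x"
      by (auto simp: indicator_def mult_ac)
  qed (use i1 i2 i3 in auto)
  also have "\<dots> = 1 / p * (LINT x|M. indicator S x * \<bar>f x\<bar> powr p) + (p - 1) / p * \<bar>c\<bar> powr p * m"
    using i1 i2 by (simp add: mS)
  finally have "m * \<bar>c\<bar> powr p \<le> 1 / p * (LINT x|M. indicator S x * \<bar>f x\<bar> powr p) + (p - 1) / p * \<bar>c\<bar> powr p * m" .
  then have "\<bar>c\<bar> powr p \<le> 1 / m * (LINT x|M. indicator S x * \<bar>f x\<bar> powr p)"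
    using p m by (simp add: field_simps)
  then have "ennreal (\<bar>c\<bar> powr p) \<le> ennreal (1 / m * (LINT x|M. indicator S x * \<bar>f x\<bar> powr p))" by (rule ennreal_leI)
  also have "\<dots> = ennreal (1 / m) * (\<integral>\<^sup>+ x. ennreal (indicator S x * \<bar>f x\<bar> powr p) \<partial>M)"
  proof -
    have "(LINT x|M. indicator S x * \<bar>f x\<bar> powr p) \<ge> 0" by (rule integral_nonneg_AE) simp
    then show ?thesis using m nn_integral_eq_integral[OF i1] by (simp add: ennreal_mult[symmetric])
  qed
  finally show ?thesis by (simp add: c_def eq)
qed

context fractional_exponents
begin

lemma mass_add_le:
  assumes [measurable]: "u \<in> borel_measurable borel" "v \<in> borel_measurable borel" and q: "q \<ge> 0"
  shows "mass q (\<lambda>x. u x + v x) \<le> ennreal (2 powr q) * (mass q u + mass q v)"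
proof -
  have "mass q (\<lambda>x. u x + v x) \<le> (\<integral>\<^sup>+ x. ennreal (2 powr q) * (ennreal (\<bar>u x\<bar> powr q) + ennreal (\<bar>v x\<bar> powr q)) \<partial>lborel)"
    unfolding mass_def
    by (intro nn_integral_mono)
      (use abs_add_powr_le[OF q] in \<open>auto simp: ennreal_mult[symmetric] ennreal_plus[symmetric] simp del: ennreal_plus\<close>)
  also have "\<dots> = ennreal (2 powr q) * (mass q u + mass q v)"
    unfolding mass_def by (subst nn_integral_cmult, measurable, subst nn_integral_add) auto
  finally show ?thesis .
qed

lemma mass_minus: "mass q (\<lambda>x. - u x) = mass q u"
  by (simp add: mass_def)

lemma mass_diff_le:
  assumes [measurable]: "u \<in> borel_measurable borel" "v \<in> borel_measurable borel" and q: "q \<ge> 0"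
  shows "mass q (\<lambda>x. u x - v x) \<le> ennreal (2 powr q) * (mass q u + mass q v)"
  using mass_add_le[of u "\<lambda>x. - v x" q] assms by (simp add: mass_minus)

lemma gagliardo_add_le:
  assumes [measurable]: "u \<in> borel_measurable borel" "v \<in> borel_measurable borel"
  shows "gagliardo (\<lambda>x. u x + v x) \<le> ennreal (2 powr p) * (gagliardo u + gagliardo v)"
proof -
  have "slice (\<lambda>x. u x + v x) x \<le> ennreal (2 powr p) * (slice u x + slice v x)" for x
  proof -
    have "slice (\<lambda>x. u x + v x) x \<le> (\<integral>\<^sup>+ y. ennreal (2 powr p) *
       (ennreal (\<bar>u x - u y\<bar> powr p / norm (x - y) powr expo) + ennreal (\<bar>v x - v y\<bar> powr p / norm (x - y) powr expo)) \<partial>lborel)"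
      unfolding slice_def
    proof (rule nn_integral_mono)
      fix y
      have "\<bar>(u x - u y) + (v x - v y)\<bar> powr p \<le> 2 powr p * (\<bar>u x - u y\<bar> powr p + \<bar>v x - v y\<bar> powr p)"
        using p_pos by (intro abs_add_powr_le) auto
      then have "\<bar>(u x + v x) - (u y + v y)\<bar> powr p / norm (x - y) powr expo
          \<le> 2 powr p * (\<bar>u x - u y\<bar> powr p + \<bar>v x - v y\<bar> powr p) / norm (x - y) powr expo"
        by (intro divide_right_mono) (auto simp: algebra_simps)
      then show "ennreal (\<bar>(u x + v x) - (u y + v y)\<bar> powr p / norm (x - y) powr expo) \<le> ennreal (2 powr p) *
         (ennreal (\<bar>u x - u y\<bar> powr p / norm (x - y) powr expo) + ennreal (\<bar>v x - v y\<bar> powr p / norm (x - y) powr expo))"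
        by (simp add: ennreal_mult[symmetric] ennreal_plus[symmetric] add_divide_distrib[symmetric] ennreal_leI del: ennreal_plus)
    qed
    also have "\<dots> = ennreal (2 powr p) * (slice u x + slice v x)"
      unfolding slice_def by (subst nn_integral_cmult, measurable, subst nn_integral_add) auto
    finally show ?thesis .
  qed
  then have "gagliardo (\<lambda>x. u x + v x) \<le> (\<integral>\<^sup>+ x. ennreal (2 powr p) * (slice u x + slice v x) \<partial>lborel)"
    unfolding gagliardo_def by (intro nn_integral_mono)
  also have "\<dots> = ennreal (2 powr p) * (gagliardo u + gagliardo v)"
    unfolding gagliardo_def by (subst nn_integral_cmult, measurable, subst nn_integral_add) auto
  finally show ?thesis .
qed

lemma gagliardo_minus: "gagliardo (\<lambda>x. - u x) = gagliardo u"
proof -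
  have "\<bar>u y - u x\<bar> = \<bar>u x - u y\<bar>" for x y by (rule abs_minus_commute)
  then show ?thesis by (simp add: gagliardo_def slice_def)
qed

lemma gagliardo_diff_le:
  assumes "u \<in> borel_measurable borel" "v \<in> borel_measurable borel"
  shows "gagliardo (\<lambda>x. u x - v x) \<le> ennreal (2 powr p) * (gagliardo u + gagliardo v)"
  using gagliardo_add_le[of u "\<lambda>x. - v x"] assms by (simp add: gagliardo_minus)

lemma cell_split':
  assumes [measurable]: "u \<in> borel_measurable borel" and r: "r > 0"
  shows "ennreal (\<bar>u x\<bar> powr p) \<le>
     ennreal (2 powr p / r ^ DIM('a)) * (\<integral>\<^sup>+ y. ennreal (\<bar>u y\<bar> powr p) * indicator (grid_cell r x) y \<partial>lborel)
       + ennreal (2 powr p * real DIM('a) powr expo * r powr (s * p)) * slice u x"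
proof -
  have e: "(real DIM('a) * r) powr expo = real DIM('a) powr expo * r powr (s * p) * r ^ DIM('a)"
    using r by (simp add: powr_mult expo_eq powr_add powr_realpow)
  have "ennreal (\<bar>u x\<bar> powr p) = ennreal (1 / r ^ DIM('a)) * ennreal (\<bar>u x\<bar> powr p * r ^ DIM('a))"
    using r by (simp add: ennreal_mult[symmetric])
  also have "\<dots> \<le> ennreal (1 / r ^ DIM('a)) * (ennreal (2 powr p) *
     ((\<integral>\<^sup>+ y. ennreal (\<bar>u y\<bar> powr p) * indicator (grid_cell r x) y \<partial>lborel)
       + ennreal ((real DIM('a) * r) powr expo) * slice u x))"
    by (intro mult_left_mono cell_split[OF assms]) auto
  also have "\<dots> = (ennreal (1 / r ^ DIM('a)) * ennreal (2 powr p)) * (\<integral>\<^sup>+ y. ennreal (\<bar>u y\<bar> powr p) * indicator (grid_cell r x) y \<partial>lborel)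
       + (ennreal (1 / r ^ DIM('a)) * ennreal (2 powr p) * ennreal ((real DIM('a) * r) powr expo)) * slice u x"
    by (simp add: distrib_left mult.assoc)
  also have "ennreal (1 / r ^ DIM('a)) * ennreal (2 powr p) = ennreal (2 powr p / r ^ DIM('a))"
    using r by (simp add: ennreal_mult[symmetric])
  also have "ennreal (2 powr p / r ^ DIM('a)) * ennreal ((real DIM('a) * r) powr expo)
      = ennreal (2 powr p * real DIM('a) powr expo * r powr (s * p))"
    unfolding e using r by (simp add: ennreal_mult[symmetric] mult_ac)
  finally show ?thesis .
qed

definition cell_mean :: "real \<Rightarrow> ('a \<Rightarrow> real) \<Rightarrow> 'a \<Rightarrow> real" where
  "cell_mean r u x = (LINT y|lborel. indicator (grid_cell r x) y * u y) / r ^ DIM('a)"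

lemma measurable_cell_mean [measurable]:
  assumes [measurable]: "u \<in> borel_measurable borel"
  shows "cell_mean r u \<in> borel_measurable borel"
proof -
  have [measurable]: "(\<lambda>z. indicator (grid_cell r (fst z)) (snd z) :: real) \<in> borel_measurable (borel \<Otimes>\<^sub>M borel)"
  proof -
    have "(\<lambda>z::'a \<times> 'a. indicator (grid_cell r (fst z)) (snd z) :: real) = (\<lambda>z. if snd z \<in> grid_cell r (fst z) then 1 else 0)"
      by (auto simp: indicator_def)
    then show ?thesis by simp
  qed
  have "(\<lambda>x. LINT y|lborel. indicator (grid_cell r x) y * u y) \<in> borel_measurable lborel"
    by (rule lborel.borel_measurable_lebesgue_integral) (simp add: split_beta)
  then show ?thesis unfolding cell_mean_def[abs_def] by simp
qed

lemma cell_integrable: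
  assumes [measurable]: "u \<in> borel_measurable borel" and m: "mass p u < \<infinity>" and r: "r > 0"
  shows "integrable lborel (\<lambda>y. indicator (grid_cell r x) y * u y)"
proof (rule Bochner_Integration.integrable_bound)
  have 1: "integrable lborel (\<lambda>y. \<bar>u y\<bar> powr p)"
    by (rule integrableI_nonneg) (use m in \<open>auto simp: mass_def\<close>)
  have 2: "integrable lborel (\<lambda>y. indicator (grid_cell r x) y :: real)"
    using r by (intro integrable_real_indicator) (auto simp: emeasure_grid_cell)
  show "integrable lborel (\<lambda>y. indicator (grid_cell r x) y + \<bar>u y\<bar> powr p)"
    using 1 2 by (rule Bochner_Integration.integrable_add[rotated])
  show "AE y in lborel. norm (indicator (grid_cell r x) y * u y) \<le> norm (indicator (grid_cell r x) y + \<bar>u y\<bar> powr p)"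
  proof (rule AE_I2)
    fix y
    have "\<bar>u y\<bar> \<le> 1 + \<bar>u y\<bar> powr p"
      using powr_le_interpolate[of "\<bar>u y\<bar>" 1 1 p] p_gt_1 by simp
    then show "norm (indicator (grid_cell r x) y * u y) \<le> norm (indicator (grid_cell r x) y + \<bar>u y\<bar> powr p)"
      by (auto simp: indicator_def)
  qed
qed simp

lemma cell_mean_diff:
  assumes "u \<in> borel_measurable borel" "v \<in> borel_measurable borel" "mass p u < \<infinity>" "mass p v < \<infinity>" "r > 0"
  shows "cell_mean r (\<lambda>x. u x - v x) x = cell_mean r u x - cell_mean r v x"
  using cell_integrable[OF assms(1,3,5), of x] cell_integrable[OF assms(2,4,5), of x]
  by (simp add: cell_mean_def right_diff_distrib diff_divide_distrib)

lemma cell_mean_powr_le: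
  assumes [measurable]: "u \<in> borel_measurable borel" and r: "r > 0"
  shows "ennreal (\<bar>cell_mean r u x\<bar> powr p) \<le> ennreal (1 / r ^ DIM('a)) * mass p u"
proof -
  have "ennreal (\<bar>cell_mean r u x\<bar> powr p) \<le> ennreal (1 / r ^ DIM('a)) * (\<integral>\<^sup>+ y. ennreal (\<bar>u y\<bar> powr p) * indicator (grid_cell r x) y \<partial>lborel)"
    unfolding cell_mean_def by (rule Jensen_powr[OF p_gt_1]) (use r in \<open>auto simp: emeasure_grid_cell\<close>)
  also have "\<dots> \<le> ennreal (1 / r ^ DIM('a)) * mass p u"
    unfolding mass_def by (intro mult_left_mono nn_integral_mono) (auto simp: indicator_def)
  finally show ?thesis .
qed

text \<open>The error at \<open>x\<close> is the mean of \<open>u x - u y\<close> over the cell.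
  Jensen and \<open>cell_oscillation\<close> leave the power \<open>s p\<close> of \<open>r\<close>,
  the excess of \<open>expo\<close> over the dimension.\<close>

lemma cell_mean_error:
  assumes [measurable]: "u \<in> borel_measurable borel" and m: "mass p u < \<infinity>" and r: "r > 0"
  shows "mass p (\<lambda>x. u x - cell_mean r u x) \<le> ennreal (real DIM('a) powr expo * r powr (s * p)) * gagliardo u"
proof -
  have pw: "ennreal (\<bar>u x - cell_mean r u x\<bar> powr p) \<le> ennreal (real DIM('a) powr expo * r powr (s * p)) * slice u x" for x
  proof -
    have e: "(real DIM('a) * r) powr expo = real DIM('a) powr expo * r powr (s * p) * r ^ DIM('a)"
      using r by (simp add: powr_mult expo_eq powr_add powr_realpow)
    have i: "integrable lborel (\<lambda>y. indicator (grid_cell r x) y * u x)"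
      using r by (intro integrable_mult_left integrable_real_indicator) (auto simp: emeasure_grid_cell)
    have "(LINT y|lborel. indicator (grid_cell r x) y * u x) = r ^ DIM('a) * u x"
      using r by (simp add: measure_def emeasure_grid_cell)
    then have "(LINT y|lborel. indicator (grid_cell r x) y * (u x - u y))
        = r ^ DIM('a) * u x - (LINT y|lborel. indicator (grid_cell r x) y * u y)"
      using Bochner_Integration.integral_diff[OF i cell_integrable[OF assms(1) m r, of x]]
      by (simp only: right_diff_distrib)
    then have "u x - cell_mean r u x = (LINT y|lborel. indicator (grid_cell r x) y * (u x - u y)) / r ^ DIM('a)"
      using r by (simp add: cell_mean_def diff_divide_distrib)
    then have eq: "u x - cell_mean r u x = (LINT y|lborel. indicator (grid_cell r x) y * (u x - u y)) / r ^ DIM('a)" .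
    have "ennreal (\<bar>u x - cell_mean r u x\<bar> powr p) \<le>
       ennreal (1 / r ^ DIM('a)) * (\<integral>\<^sup>+ y. ennreal (\<bar>u x - u y\<bar> powr p) * indicator (grid_cell r x) y \<partial>lborel)"
      unfolding eq by (rule Jensen_powr[OF p_gt_1]) (use r in \<open>auto simp: emeasure_grid_cell\<close>)
    also have "\<dots> \<le> ennreal (1 / r ^ DIM('a)) * (ennreal ((real DIM('a) * r) powr expo) * slice u x)"
      by (intro mult_left_mono cell_oscillation r) auto
    also have "\<dots> = ennreal (real DIM('a) powr expo * r powr (s * p)) * slice u x"
      unfolding e using r by (simp add: ennreal_mult[symmetric] mult.assoc[symmetric])
    finally show ?thesis .
  qed
  have "mass p (\<lambda>x. u x - cell_mean r u x) \<le> (\<integral>\<^sup>+ x. ennreal (real DIM('a) powr expo * r powr (s * p)) * slice u x \<partial>lborel)"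
    unfolding mass_def by (intro nn_integral_mono pw)
  also have "\<dots> = ennreal (real DIM('a) powr expo * r powr (s * p)) * gagliardo u"
    unfolding gagliardo_def by (rule nn_integral_cmult) measurable
  finally show ?thesis .
qed

text \<open>Multiplied by a positive integrable \<open>h\<close>, a sequence that is Cauchy in the
  p-th mean becomes Cauchy in \<open>L^1\<close>, where an almost everywhere convergent subsequence
  is available. Fatou's lemma then recovers convergence in the p-th mean.\<close>

lemma Lp_Cauchy_limit:
  fixes w :: "nat \<Rightarrow> 'a \<Rightarrow> real"
  assumes [measurable]: "\<And>n. w n \<in> borel_measurable borel" and fin: "\<And>n. mass p (w n) < \<infinity>"
    and Cauchy: "\<And>\<eta>. \<eta> > 0 \<Longrightarrow> \<exists>n0. \<forall>m\<ge>n0. \<forall>n\<ge>n0. mass p (\<lambda>x. w m x - w n x) \<le> ennreal \<eta>"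
  shows "\<exists>r u. strict_mono r \<and> u \<in> borel_measurable borel \<and> (AE x in lborel. (\<lambda>n. w (r n) x) \<longlonglongrightarrow> u x) \<and>
     (\<lambda>n. mass p (\<lambda>x. w (r n) x - u x)) \<longlonglongrightarrow> 0"
proof -
  obtain h :: "'a \<Rightarrow> real" where h [measurable]: "h \<in> borel_measurable lborel" and h0: "\<And>x. h x > 0" and h1: "\<And>x. h x \<le> 1"
    and hi: "integrable lborel h"
    using sigma_finite_measure.obtain_positive_integrable_function[OF sigma_finite_lborel] by blast
  have ip: "integrable lborel (\<lambda>x. \<bar>v x\<bar> powr p)" if "v \<in> borel_measurable borel" "mass p v < \<infinity>" for v
    by (rule integrableI_nonneg) (use that in \<open>auto simp: mass_def\<close>)
  have bound: "h x * \<bar>t\<bar> \<le> \<theta> * h x + \<theta> powr (1 - p) * \<bar>t\<bar> powr p" if "\<theta> > 0" for \<theta> x t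
  proof -
    have "h x * \<bar>t\<bar> \<le> h x * (\<theta> + \<theta> powr (1 - p) * \<bar>t\<bar> powr p)"
      using powr_le_interpolate[of "\<bar>t\<bar>" \<theta> 1 p] p_gt_1 that h0[of x] by (intro mult_left_mono) auto
    moreover have "h x * (\<theta> powr (1 - p) * \<bar>t\<bar> powr p) \<le> 1 * (\<theta> powr (1 - p) * \<bar>t\<bar> powr p)"
      using h1 by (intro mult_right_mono) auto
    ultimately show ?thesis by (simp add: algebra_simps)
  qed
  have hw: "integrable lborel (\<lambda>x. h x * v x)" if v [measurable]: "v \<in> borel_measurable borel" and "mass p v < \<infinity>" for v
  proof (rule Bochner_Integration.integrable_bound)
    show "integrable lborel (\<lambda>x. 1 * h x + 1 powr (1 - p) * \<bar>v x\<bar> powr p)"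
      using hi ip[OF that] by (intro Bochner_Integration.integrable_add integrable_mult_right)
    show "AE x in lborel. norm (h x * v x) \<le> norm (1 * h x + 1 powr (1 - p) * \<bar>v x\<bar> powr p)"
      using bound[of 1] h0 by (auto simp: abs_mult less_imp_le intro!: AE_I2)
  qed measurable
  define H where "H = (LINT x|lborel. h x)"
  have H: "H \<ge> 0" unfolding H_def by (rule integral_nonneg_AE) (simp add: h0 less_imp_le)
  have L1: "\<exists>n0. \<forall>i\<ge>n0. \<forall>j\<ge>n0. (LINT x|lborel. norm (h x * w i x - h x * w j x)) < e" if e: "e > 0" for e
  proof -
    \<comment> \<open>The choices of \<theta> and \<eta> split \<open>e\<close> into
      \<open>e / 2\<close> for the part below the level and \<open>e / 4\<close> for the part above
      it.\<close>
    define \<theta> where "\<theta> = e / (2 * (H + 1))"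
    have \<theta>: "\<theta> > 0" using e H by (simp add: \<theta>_def)
    define \<eta> where "\<eta> = e / (4 * \<theta> powr (1 - p))"
    have \<eta>: "\<eta> > 0" using e \<theta> by (simp add: \<eta>_def)
    obtain n0 where n0: "\<And>m n. m \<ge> n0 \<Longrightarrow> n \<ge> n0 \<Longrightarrow> mass p (\<lambda>x. w m x - w n x) \<le> ennreal \<eta>"
      using Cauchy[OF \<eta>] by blast
    have "(LINT x|lborel. norm (h x * w i x - h x * w j x)) < e" if "i \<ge> n0" "j \<ge> n0" for i j
    proof -
      let ?v = "\<lambda>x. w i x - w j x"
      have m: "mass p ?v \<le> ennreal \<eta>" using n0 that by blast
      then have mf: "mass p ?v < \<infinity>" using ennreal_less_top le_less_trans by (simp add: le_less_trans)
      have iv: "integrable lborel (\<lambda>x. \<bar>?v x\<bar> powr p)" by (rule ip[OF _ mf]) measurable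
      have "ennreal (LINT x|lborel. \<bar>?v x\<bar> powr p) \<le> ennreal \<eta>"
        using m nn_integral_eq_integral[OF iv] by (simp add: mass_def)
      then have le: "(LINT x|lborel. \<bar>?v x\<bar> powr p) \<le> \<eta>" using \<eta> by simp
      have "(LINT x|lborel. norm (h x * w i x - h x * w j x)) = (LINT x|lborel. norm (h x * ?v x))"
        by (simp add: right_diff_distrib)
      also have "\<dots> \<le> (LINT x|lborel. \<theta> * h x + \<theta> powr (1 - p) * \<bar>?v x\<bar> powr p)"
      proof (rule integral_mono)
        show "integrable lborel (\<lambda>x. norm (h x * ?v x))"
          by (rule integrable_norm, rule hw[OF _ mf]) measurable
        show "integrable lborel (\<lambda>x. \<theta> * h x + \<theta> powr (1 - p) * \<bar>?v x\<bar> powr p)"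
          using hi iv by (intro Bochner_Integration.integrable_add integrable_mult_right)
      qed (use bound[OF \<theta>] h0 in \<open>auto simp: abs_mult less_imp_le\<close>)
      also have "\<dots> = \<theta> * H + \<theta> powr (1 - p) * (LINT x|lborel. \<bar>?v x\<bar> powr p)"
        using hi iv by (simp add: H_def)
      also have "\<dots> \<le> \<theta> * (H + 1) + \<theta> powr (1 - p) * \<eta>"
        using le \<theta> by (intro add_mono mult_left_mono) auto
      also have "\<theta> * (H + 1) = e / 2" using H by (simp add: \<theta>_def divide_simps)
      also have "\<theta> powr (1 - p) * \<eta> = e / 4" using \<theta> by (simp add: \<eta>_def)
      also have "e / 2 + e / 4 < e" using e by simp
      finally show ?thesis .
    qed
    then show ?thesis by blast
  qed
  have hwn: "integrable lborel (\<lambda>x. h x * w n x)" for n by (rule hw[OF _ fin]) measurable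
  obtain r where r: "strict_mono r" and c: "AE x in lborel. Cauchy (\<lambda>i. h x * w (r i) x)"
    using cauchy_L1_AE_cauchy_subseq[of lborel "\<lambda>n x. h x * w n x", OF hwn L1] by blast
  define u where "u = (\<lambda>x. lim (\<lambda>i. w (r i) x))"
  have u [measurable]: "u \<in> borel_measurable borel"
    unfolding u_def by (rule borel_measurable_lim_metric) measurable
  have ae: "AE x in lborel. (\<lambda>n. w (r n) x) \<longlonglongrightarrow> u x"
    using c
  proof eventually_elim
    case (elim x)
    then obtain l where "(\<lambda>i. h x * w (r i) x) \<longlonglongrightarrow> l" using Cauchy_convergent_iff convergent_def by blast
    from tendsto_mult_left[OF this, of "1 / h x"] have "(\<lambda>i. w (r i) x) \<longlonglongrightarrow> l / h x" using h0[of x] by simp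
    then show ?case unfolding u_def by (simp add: limI)
  qed
  have "(\<lambda>n. mass p (\<lambda>x. w (r n) x - u x)) \<longlonglongrightarrow> 0"
  proof (rule tendsto_0_if_le)
    fix \<eta> :: real assume "\<eta> > 0"
    from Cauchy[OF this] obtain n0 where n0: "\<And>m n. m \<ge> n0 \<Longrightarrow> n \<ge> n0 \<Longrightarrow> mass p (\<lambda>x. w m x - w n x) \<le> ennreal \<eta>" by blast
    have "mass p (\<lambda>x. w (r n) x - u x) \<le> ennreal \<eta>" if "n \<ge> n0" for n
      unfolding mass_def
    proof (rule nn_integral_le_of_AE_tendsto)
      show "AE x in lborel. (\<lambda>i. ennreal (\<bar>w (r n) x - w (r i) x\<bar> powr p)) \<longlonglongrightarrow> ennreal (\<bar>w (r n) x - u x\<bar> powr p)"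
        using ae
      proof eventually_elim
        case (elim x)
        show ?case
          by (intro tendsto_ennrealI tendsto_powr' tendsto_intros elim) (use p_pos in auto)
      qed
      have "n0 \<le> r i" if "n0 \<le> i" for i using that seq_suble[OF r, of i] by simp
      then show "\<forall>\<^sub>F i in sequentially. (\<integral>\<^sup>+ x. ennreal (\<bar>w (r n) x - w (r i) x\<bar> powr p) \<partial>lborel) \<le> ennreal \<eta>"
        using n0 that unfolding mass_def by (auto simp: eventually_sequentially intro!: exI[of _ n0])
    qed measurable
    then show "\<forall>\<^sub>F n in sequentially. mass p (\<lambda>x. w (r n) x - u x) \<le> ennreal \<eta>"
      by (auto simp: eventually_sequentially)
  qed
  then show ?thesis using r u ae by blast
qed

end

section \<open>Compact embedding of the weighted space\<close>

lemma nn_integral_add_cmult_add: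
  fixes f g k :: "'b \<Rightarrow> ennreal"
  assumes [measurable]: "f \<in> borel_measurable M" "g \<in> borel_measurable M" "k \<in> borel_measurable M"
  shows "(\<integral>\<^sup>+ x. f x + c * (g x + k x) \<partial>M) = (\<integral>\<^sup>+ x. f x \<partial>M) + c * ((\<integral>\<^sup>+ x. g x \<partial>M) + (\<integral>\<^sup>+ x. k x \<partial>M))"
  by (simp add: nn_integral_add nn_integral_cmult)

locale weighted_fractional = fractional_exponents s p expo dimension
  for s p expo :: real and dimension :: "'a::euclidean_space itself" +
  fixes V :: "'a \<Rightarrow> real" and V0 h :: real
  assumes V_measurable [measurable]: "V \<in> borel_measurable borel"
    and V0_pos: "0 < V0" and V_ge: "\<And>x. V0 \<le> V x" and h_pos: "0 < h"
    and V_thin: "\<And>c. c > 0 \<Longrightarrow> ((\<lambda>y. measure lborel {x \<in> ball y h. V x \<le> c}) \<longlongrightarrow> 0) at_infinity"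
begin

definition potential :: "('a \<Rightarrow> real) \<Rightarrow> ennreal" where
  "potential u = (\<integral>\<^sup>+ x. ennreal (V x * \<bar>u x\<bar> powr p) \<partial>lborel)"

lemma V_pos: "V x > 0"
  using V0_pos V_ge[of x] by linarith

lemma mass_le_potential:
  assumes [measurable]: "u \<in> borel_measurable borel"
  shows "mass p u \<le> ennreal (1 / V0) * potential u"
proof -
  have "mass p u \<le> (\<integral>\<^sup>+ x. ennreal (1 / V0) * ennreal (V x * \<bar>u x\<bar> powr p) \<partial>lborel)"
    unfolding mass_def
  proof (rule nn_integral_mono)
    fix x
    have "V0 * \<bar>u x\<bar> powr p \<le> V x * \<bar>u x\<bar> powr p" using V_ge by (intro mult_right_mono) auto
    then have "\<bar>u x\<bar> powr p \<le> 1 / V0 * (V x * \<bar>u x\<bar> powr p)" using V0_pos by (simp add: field_simps)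
    then show "ennreal (\<bar>u x\<bar> powr p) \<le> ennreal (1 / V0) * ennreal (V x * \<bar>u x\<bar> powr p)"
      using V0_pos V_pos[of x] by (simp add: ennreal_mult[symmetric] ennreal_leI)
  qed
  also have "\<dots> = ennreal (1 / V0) * potential u"
    unfolding potential_def by (rule nn_integral_cmult) measurable
  finally show ?thesis .
qed

lemma potential_add_le:
  assumes [measurable]: "u \<in> borel_measurable borel" "v \<in> borel_measurable borel"
  shows "potential (\<lambda>x. u x + v x) \<le> ennreal (2 powr p) * (potential u + potential v)"
proof -
  have "potential (\<lambda>x. u x + v x) \<le> (\<integral>\<^sup>+ x. ennreal (2 powr p) * (ennreal (V x * \<bar>u x\<bar> powr p) + ennreal (V x * \<bar>v x\<bar> powr p)) \<partial>lborel)"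
    unfolding potential_def
  proof (rule nn_integral_mono)
    fix x
    have "V x * \<bar>u x + v x\<bar> powr p \<le> V x * (2 powr p * (\<bar>u x\<bar> powr p + \<bar>v x\<bar> powr p))"
      using V_pos[of x] p_pos by (intro mult_left_mono abs_add_powr_le) auto
    also have "\<dots> = 2 powr p * (V x * \<bar>u x\<bar> powr p + V x * \<bar>v x\<bar> powr p)" by (simp add: algebra_simps)
    finally show "ennreal (V x * \<bar>u x + v x\<bar> powr p) \<le> ennreal (2 powr p) * (ennreal (V x * \<bar>u x\<bar> powr p) + ennreal (V x * \<bar>v x\<bar> powr p))"
      using V_pos[of x] by (simp add: ennreal_mult[symmetric] ennreal_plus[symmetric] ennreal_leI del: ennreal_plus)
  qed
  also have "\<dots> = ennreal (2 powr p) * (potential u + potential v)"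
    unfolding potential_def by (subst nn_integral_cmult, measurable, subst nn_integral_add) auto
  finally show ?thesis .
qed

text \<open>Bound \<open>u\<close> on \<open>S\<close> by its cell averages plus the oscillation.
  After exchanging integrals, each point \<open>y\<close> is counted according to the share that
  \<open>S\<close> has in its cell, which is at most \<epsilon>.\<close>

lemma tail_cells:
  assumes [measurable]: "u \<in> borel_measurable borel" "S \<in> sets borel" and r: "r > 0"
    and small: "\<And>y. emeasure lborel (S \<inter> grid_cell r y) \<le> ennreal (\<epsilon> * r ^ DIM('a))" and \<epsilon>: "\<epsilon> \<ge> 0"
  shows "(\<integral>\<^sup>+ x. ennreal (\<bar>u x\<bar> powr p) * indicator S x \<partial>lborel)
    \<le> ennreal (2 powr p * \<epsilon>) * mass p u + ennreal (2 powr p * real DIM('a) powr expo * r powr (s * p)) * gagliardo u"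
proof -
  let ?c = "2 powr p * real DIM('a) powr expo * r powr (s * p)"
  let ?M = "\<lambda>x. \<integral>\<^sup>+ y. ennreal (\<bar>u y\<bar> powr p) * indicator (grid_cell r x) y \<partial>lborel"
  have mi [measurable]: "(\<lambda>z::'a \<times> 'a. indicator (grid_cell r (fst z)) (snd z) :: ennreal) \<in> borel_measurable (borel \<Otimes>\<^sub>M borel)"
  proof -
    have "(\<lambda>z::'a \<times> 'a. indicator (grid_cell r (fst z)) (snd z) :: ennreal) = (\<lambda>z. if snd z \<in> grid_cell r (fst z) then 1 else 0)"
      by (auto simp: indicator_def)
    then show ?thesis by simp
  qed
  have mi2 [measurable]: "(\<lambda>z::'a \<times> 'a. indicator (grid_cell r (snd z)) (fst z) :: ennreal) \<in> borel_measurable (borel \<Otimes>\<^sub>M borel)"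
  proof -
    have "(\<lambda>z::'a \<times> 'a. indicator (grid_cell r (snd z)) (fst z) :: ennreal) = (\<lambda>z. if snd z \<in> grid_cell r (fst z) then 1 else 0)"
      by (auto simp: indicator_def grid_cell_sym)
    then show ?thesis by simp
  qed
  have M [measurable]: "?M \<in> borel_measurable borel"
  proof -
    have "?M \<in> borel_measurable lborel"
      by (rule lborel.borel_measurable_nn_integral) (simp add: split_beta)
    then show ?thesis by simp
  qed
  have X: "(\<integral>\<^sup>+ x. ?M x * indicator S x \<partial>lborel) \<le> mass p u * ennreal (\<epsilon> * r ^ DIM('a))"
  proof -
    have "(\<integral>\<^sup>+ x. ?M x * indicator S x \<partial>lborel)
       = (\<integral>\<^sup>+ x. \<integral>\<^sup>+ y. ennreal (\<bar>u y\<bar> powr p) * indicator (grid_cell r x) y * indicator S x \<partial>lborel \<partial>lborel)"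
      by (intro nn_integral_cong nn_integral_multc[symmetric]) measurable
    also have "\<dots> = (\<integral>\<^sup>+ y. \<integral>\<^sup>+ x. ennreal (\<bar>u y\<bar> powr p) * indicator (grid_cell r x) y * indicator S x \<partial>lborel \<partial>lborel)"
      by (rule lborel_pair.Fubini') (simp add: split_beta)
    also have "\<dots> = (\<integral>\<^sup>+ y. ennreal (\<bar>u y\<bar> powr p) * emeasure lborel (S \<inter> grid_cell r y) \<partial>lborel)"
    proof (rule nn_integral_cong)
      fix y
      have "(\<integral>\<^sup>+ x. ennreal (\<bar>u y\<bar> powr p) * indicator (grid_cell r x) y * indicator S x \<partial>lborel)
         = (\<integral>\<^sup>+ x. ennreal (\<bar>u y\<bar> powr p) * indicator (S \<inter> grid_cell r y) x \<partial>lborel)"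
        by (intro nn_integral_cong) (auto simp: indicator_def grid_cell_sym)
      also have "\<dots> = ennreal (\<bar>u y\<bar> powr p) * emeasure lborel (S \<inter> grid_cell r y)"
        by (rule nn_integral_cmult_indicator) measurable
      finally show "(\<integral>\<^sup>+ x. ennreal (\<bar>u y\<bar> powr p) * indicator (grid_cell r x) y * indicator S x \<partial>lborel)
         = ennreal (\<bar>u y\<bar> powr p) * emeasure lborel (S \<inter> grid_cell r y)" .
    qed
    also have "\<dots> \<le> (\<integral>\<^sup>+ y. ennreal (\<bar>u y\<bar> powr p) * ennreal (\<epsilon> * r ^ DIM('a)) \<partial>lborel)"
      by (intro nn_integral_mono mult_left_mono small) auto
    also have "\<dots> = mass p u * ennreal (\<epsilon> * r ^ DIM('a))"
      unfolding mass_def by (rule nn_integral_multc) measurable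
    finally show ?thesis .
  qed
  have "(\<integral>\<^sup>+ x. ennreal (\<bar>u x\<bar> powr p) * indicator S x \<partial>lborel)
    \<le> (\<integral>\<^sup>+ x. ennreal (2 powr p / r ^ DIM('a)) * (?M x * indicator S x) + ennreal ?c * slice u x \<partial>lborel)"
  proof (rule nn_integral_mono)
    fix x
    show "ennreal (\<bar>u x\<bar> powr p) * indicator S x \<le> ennreal (2 powr p / r ^ DIM('a)) * (?M x * indicator S x) + ennreal ?c * slice u x"
      using cell_split'[OF assms(1) r, of x] by (auto simp: indicator_def)
  qed
  also have "\<dots> = ennreal (2 powr p / r ^ DIM('a)) * (\<integral>\<^sup>+ x. ?M x * indicator S x \<partial>lborel) + ennreal ?c * gagliardo u"
    unfolding gagliardo_def by (subst nn_integral_add) (auto simp: nn_integral_cmult)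
  also have "\<dots> \<le> ennreal (2 powr p / r ^ DIM('a)) * (mass p u * ennreal (\<epsilon> * r ^ DIM('a))) + ennreal ?c * gagliardo u"
    by (intro add_right_mono mult_left_mono X) simp
  also have "ennreal (2 powr p / r ^ DIM('a)) * (mass p u * ennreal (\<epsilon> * r ^ DIM('a)))
      = (ennreal (2 powr p / r ^ DIM('a)) * ennreal (\<epsilon> * r ^ DIM('a))) * mass p u"
    by (simp add: mult_ac)
  also have "ennreal (2 powr p / r ^ DIM('a)) * ennreal (\<epsilon> * r ^ DIM('a)) = ennreal (2 powr p * \<epsilon>)"
    using r \<epsilon> by (simp add: ennreal_mult[symmetric])
  finally show ?thesis .
qed

text \<open>Where \<open>V\<close> is large the potential energy controls the mass. Far away, the
  set where \<open>V\<close> is not large fills only a small share of each cell, because the cells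
  fit into balls of radius \<open>h\<close>.\<close>

lemma tail_small:
  assumes c: "c \<ge> 0" and \<eta>: "\<eta> > 0"
  shows "\<exists>R. \<forall>u\<in>borel_measurable borel. gagliardo u \<le> ennreal c \<longrightarrow> potential u \<le> ennreal c \<longrightarrow>
     (\<integral>\<^sup>+ x. ennreal (\<bar>u x\<bar> powr p) * indicator (- ball 0 R) x \<partial>lborel) \<le> ennreal \<eta>"
proof -
  let ?n = "real DIM('a)"
  \<comment> \<open>The budget: \<open>ct\<close> leaves \<eta>/2 for the region of large potential,
    while \<epsilon> and \<open>k\<close> leave \<eta>/4 for each term of \<open>tail_cells\<close>.
    The added ones in \<open>ct\<close>, \<open>D\<close> and \<open>c'\<close> keep these constants
    positive when \<open>c = 0\<close>.\<close>
  define ct where "ct = 2 * c / \<eta> + 1"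
  have ct: "ct > 0" using c \<eta> by (simp add: ct_def add_nonneg_pos)
  define D where "D = c / V0 + 1"
  define \<epsilon> where "\<epsilon> = \<eta> / (4 * 2 powr p * D)"
  have cV: "D > 0" using c V0_pos by (simp add: D_def add_nonneg_pos)
  have \<epsilon>: "\<epsilon> > 0" using \<eta> cV by (simp add: \<epsilon>_def)
  define c' where "c' = c + 1"
  have c': "c' > 0" using c by (simp add: c'_def)
  define k where "k = \<eta> / (4 * 2 powr p * ?n powr expo * c')"
  have k: "k > 0" using \<eta> c' by (simp add: k_def)
  \<comment> \<open>The first entry keeps cells inside balls of radius \<open>h\<close>, the second
    makes \<open>r powr (s * p)\<close> at most \<open>k\<close>.\<close>
  define r where "r = min (h / (2 * ?n)) (k powr (1 / (s * p)))"
  have n: "?n \<ge> 1" using DIM_positive[where 'a='a] by linarith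
  have r: "r > 0" using h_pos k n by (auto simp: r_def)
  have rh: "?n * r < h"
  proof -
    have "?n * r \<le> ?n * (h / (2 * ?n))" by (intro mult_left_mono) (auto simp: r_def)
    also have "\<dots> < h" using n h_pos by simp
    finally show ?thesis .
  qed
  have rk: "r powr (s * p) \<le> k"
  proof -
    have "r powr (s * p) \<le> (k powr (1 / (s * p))) powr (s * p)"
      using r sp_pos by (intro powr_mono2) (auto simp: r_def)
    also have "\<dots> = k" using k s_pos p_pos by (simp add: powr_powr)
    finally show ?thesis .
  qed
  have "\<forall>\<^sub>F y in at_infinity. measure lborel {x \<in> ball y h. V x \<le> ct} < \<epsilon> * r ^ DIM('a)"
    by (rule order_tendstoD(2)[OF V_thin[OF ct]]) (use \<epsilon> r in simp)
  then obtain R0 where R0: "\<And>y. R0 \<le> norm y \<Longrightarrow> measure lborel {x \<in> ball y h. V x \<le> ct} < \<epsilon> * r ^ DIM('a)"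
    by (auto simp: eventually_at_infinity)
  \<comment> \<open>With this radius, a cell that meets the complement of \<open>ball 0 R\<close>
    has all its points at norm at least \<open>R0\<close>.\<close>
  define R where "R = R0 + ?n * r"
  define S where "S = {x. V x \<le> ct} - ball 0 R"
  have S [measurable]: "S \<in> sets borel" unfolding S_def by measurable
  have small: "emeasure lborel (S \<inter> grid_cell r y) \<le> ennreal (\<epsilon> * r ^ DIM('a))" for y
  proof (cases "R0 \<le> norm y")
    case True
    have mb [measurable]: "{x \<in> ball y h. V x \<le> ct} \<in> sets borel"
    proof -
      have "{x \<in> ball y h. V x \<le> ct} = ball y h \<inter> {x. V x \<le> ct}" by auto
      then show ?thesis by simp
    qed
    have "grid_cell r y \<subseteq> ball y h" using grid_cell_norm[OF r, of _ y] rh by (force simp: dist_norm)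
    then have "emeasure lborel (S \<inter> grid_cell r y) \<le> emeasure lborel {x \<in> ball y h. V x \<le> ct}"
      by (intro emeasure_mono) (auto simp: S_def)
    also have "\<dots> = ennreal (measure lborel {x \<in> ball y h. V x \<le> ct})"
    proof (rule emeasure_eq_ennreal_measure)
      have "emeasure lborel {x \<in> ball y h. V x \<le> ct} \<le> emeasure lborel (ball y h)" by (intro emeasure_mono) auto
      also have "\<dots> < \<infinity>" using emeasure_bounded_finite[OF bounded_ball] by simp
      finally show "emeasure lborel {x \<in> ball y h. V x \<le> ct} \<noteq> top" by simp
    qed
    finally show ?thesis using R0[OF True] by (meson ennreal_leI less_imp_le order_trans)
  next
    case False
    have "S \<inter> grid_cell r y = {}"
    proof (rule ccontr)
      assume "S \<inter> grid_cell r y \<noteq> {}"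
      then obtain x where x: "x \<in> S" "x \<in> grid_cell r y" by blast
      have "norm x \<le> norm y + norm (y - x)" using norm_triangle_ineq4[of y "y - x"] by simp
      then have "norm x < R" using grid_cell_norm[OF r x(2)] False by (simp add: R_def)
      then show False using x by (simp add: S_def)
    qed
    then show ?thesis by simp
  qed
  show ?thesis
  proof (intro exI[of _ R] ballI impI)
    fix u :: "'a \<Rightarrow> real" assume u [measurable]: "u \<in> borel_measurable borel"
      and g: "gagliardo u \<le> ennreal c" and po: "potential u \<le> ennreal c"
    have "(\<integral>\<^sup>+ x. ennreal (\<bar>u x\<bar> powr p) * indicator (- ball 0 R) x \<partial>lborel)
       \<le> (\<integral>\<^sup>+ x. ennreal (1 / ct) * ennreal (V x * \<bar>u x\<bar> powr p) + ennreal (\<bar>u x\<bar> powr p) * indicator S x \<partial>lborel)"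
    proof (rule nn_integral_mono)
      fix x
      show "ennreal (\<bar>u x\<bar> powr p) * indicator (- ball 0 R) x
        \<le> ennreal (1 / ct) * ennreal (V x * \<bar>u x\<bar> powr p) + ennreal (\<bar>u x\<bar> powr p) * indicator S x"
      proof (cases "V x \<le> ct")
        case True
        then have "indicator (- ball 0 R) x = (indicator S x :: ennreal)" by (auto simp: S_def indicator_def)
        then show ?thesis by simp
      next
        case False
        then have "ct * \<bar>u x\<bar> powr p \<le> V x * \<bar>u x\<bar> powr p" by (intro mult_right_mono) auto
        then have "\<bar>u x\<bar> powr p \<le> 1 / ct * (V x * \<bar>u x\<bar> powr p)" using ct by (simp add: field_simps)
        then have "ennreal (\<bar>u x\<bar> powr p) \<le> ennreal (1 / ct) * ennreal (V x * \<bar>u x\<bar> powr p)"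
          using ct V_pos[of x] by (simp add: ennreal_mult[symmetric] ennreal_leI)
        then show ?thesis by (auto simp: indicator_def intro: add_increasing2)
      qed
    qed
    also have "\<dots> = ennreal (1 / ct) * potential u + (\<integral>\<^sup>+ x. ennreal (\<bar>u x\<bar> powr p) * indicator S x \<partial>lborel)"
      unfolding potential_def by (subst nn_integral_add) (auto simp: nn_integral_cmult)
    also have "\<dots> \<le> ennreal (1 / ct) * ennreal c +
       (ennreal (2 powr p * \<epsilon>) * (ennreal (1 / V0) * ennreal c) + ennreal (2 powr p * ?n powr expo * r powr (s * p)) * ennreal c)"
    proof (intro add_mono mult_left_mono po)
      have "mass p u \<le> ennreal (1 / V0) * ennreal c"
        by (rule order_trans[OF mass_le_potential[OF u] mult_left_mono[OF po]]) simp
      then show "(\<integral>\<^sup>+ x. ennreal (\<bar>u x\<bar> powr p) * indicator S x \<partial>lborel) \<le>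
        ennreal (2 powr p * \<epsilon>) * (ennreal (1 / V0) * ennreal c) + ennreal (2 powr p * ?n powr expo * r powr (s * p)) * ennreal c"
        using \<epsilon> by (intro order_trans[OF tail_cells[OF u S r small]] add_mono mult_left_mono g) auto
    qed auto
    also have "\<dots> = ennreal (1 / ct * c + (2 powr p * \<epsilon> * (1 / V0 * c) + 2 powr p * ?n powr expo * r powr (s * p) * c))"
      using ct c \<epsilon> V0_pos by (simp add: ennreal_mult[symmetric] ennreal_plus[symmetric] del: ennreal_plus)
    also have "\<dots> \<le> ennreal \<eta>"
    proof (rule ennreal_leI)
      have "1 / ct * c \<le> \<eta> / 2" using c \<eta> ct by (simp add: ct_def field_simps)
      moreover have "2 powr p * \<epsilon> * (1 / V0 * c) \<le> \<eta> / 4"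
      proof -
        have "2 powr p * \<epsilon> * (1 / V0 * c) \<le> 2 powr p * \<epsilon> * D" using \<epsilon> by (intro mult_left_mono) (auto simp: D_def)
        also have "\<dots> = \<eta> / 4" using cV by (simp add: \<epsilon>_def)
        finally show ?thesis .
      qed
      moreover have "2 powr p * ?n powr expo * r powr (s * p) * c \<le> \<eta> / 4"
      proof -
        have "2 powr p * ?n powr expo * r powr (s * p) * c \<le> 2 powr p * ?n powr expo * k * c'"
          using c k rk by (intro mult_mono mult_left_mono) (auto simp: c'_def)
        also have "\<dots> = \<eta> / 4" using c' n by (simp add: k_def)
        finally show ?thesis .
      qed
      ultimately show "1 / ct * c + (2 powr p * \<epsilon> * (1 / V0 * c) + 2 powr p * ?n powr expo * r powr (s * p) * c) \<le> \<eta>" by linarith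
    qed
    finally show "(\<integral>\<^sup>+ x. ennreal (\<bar>u x\<bar> powr p) * indicator (- ball 0 R) x \<partial>lborel) \<le> ennreal \<eta>" .
  qed
qed

lemma bounded_masses:
  fixes w :: "nat \<Rightarrow> 'a \<Rightarrow> real"
  assumes [measurable]: "\<And>n. w n \<in> borel_measurable borel" and c: "c \<ge> 0"
    and g: "\<And>n. gagliardo (w n) \<le> ennreal c" and po: "\<And>n. potential (w n) \<le> ennreal c"
  shows "mass p (w n) \<le> ennreal (c / V0)"
proof -
  have "mass p (w n) \<le> ennreal (1 / V0) * ennreal c"
    by (rule order_trans[OF mass_le_potential mult_left_mono[OF po]]) auto
  also have "\<dots> = ennreal (c / V0)" using c V0_pos by (simp add: ennreal_mult[symmetric])
  finally show ?thesis .
qed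

text \<open>Means are constant on cells, so one diagonal sequence over all sides
  \<open>1 / (j + 1)\<close> and a countable dense set of points gives convergence at every
  point.\<close>

lemma cell_means_convergent_subseq:
  fixes w :: "nat \<Rightarrow> 'a \<Rightarrow> real"
  assumes [measurable]: "\<And>n. w n \<in> borel_measurable borel" and c: "c \<ge> 0"
    and m: "\<And>n. mass p (w n) \<le> ennreal c"
  shows "\<exists>r. strict_mono (r :: nat \<Rightarrow> nat) \<and>
    (\<forall>j x. convergent (\<lambda>n. cell_mean (1 / real (Suc j)) (w (r n)) x))"
proof -
  obtain D :: "'a set" where D: "countable D" "\<And>S. open S \<Longrightarrow> S \<noteq> {} \<Longrightarrow> \<exists>d\<in>D. d \<in> S"
    using countable_dense_setE by blast
  let ?r = "\<lambda>j. 1 / real (Suc j)"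
  \<comment> \<open>The bound on the means deteriorates as cells shrink; this weight makes it the
    same for all \<open>j\<close>, since the extraction takes a single constant.\<close>
  let ?s = "\<lambda>j. (?r j ^ DIM('a)) powr (1 / p)"
  define f where "f = (\<lambda>n (j, x). ?s j * cell_mean (?r j) (w n) x)"
  have b: "norm (f n z) \<le> c powr (1 / p)" for n z
  proof -
    obtain j x where z: "z = (j, x)" by (cases z)
    have rp: "?r j ^ DIM('a) > 0" by simp
    have "ennreal (\<bar>cell_mean (?r j) (w n) x\<bar> powr p) \<le> ennreal (1 / ?r j ^ DIM('a)) * ennreal c"
      by (rule order_trans[OF cell_mean_powr_le mult_left_mono[OF m]]) auto
    also have "\<dots> = ennreal (c / ?r j ^ DIM('a))" using c rp by (simp add: ennreal_mult[symmetric])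
    finally have "\<bar>cell_mean (?r j) (w n) x\<bar> powr p \<le> c / ?r j ^ DIM('a)"
      using c rp by (simp add: ennreal_le_iff)
    then have "?r j ^ DIM('a) * \<bar>cell_mean (?r j) (w n) x\<bar> powr p \<le> c" using rp by (simp add: field_simps)
    moreover have "(?s j * \<bar>cell_mean (?r j) (w n) x\<bar>) powr p = ?r j ^ DIM('a) * \<bar>cell_mean (?r j) (w n) x\<bar> powr p"
      using rp p_pos by (simp add: powr_mult powr_powr)
    ultimately have "((?s j * \<bar>cell_mean (?r j) (w n) x\<bar>) powr p) powr (1 / p) \<le> c powr (1 / p)"
      using p_pos rp by (intro powr_mono2) auto
    then show ?thesis using p_pos by (simp add: f_def z abs_mult powr_powr)
  qed
  obtain r :: "nat \<Rightarrow> nat" where r: "strict_mono r" and cv: "\<And>z. z \<in> UNIV \<times> D \<Longrightarrow> \<exists>l. (\<lambda>n. f (r n) z) \<longlonglongrightarrow> l"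
    using function_convergent_subsequence[of "UNIV \<times> D" f "c powr (1 / p)"] D(1) b by (metis countable_SIGMA countableI_type)
  have "convergent (\<lambda>n. cell_mean (?r j) (w (r n)) x)" for j x
  proof -
    obtain d where d: "d \<in> D" "d \<in> grid_cell (?r j) x" using grid_cell_dense_point[OF _ D(2), of "?r j" x] by auto
    obtain l where "(\<lambda>n. f (r n) (j, d)) \<longlonglongrightarrow> l" using cv[of "(j, d)"] d by auto
    from tendsto_mult_left[OF this, of "1 / ?s j"] have "(\<lambda>n. cell_mean (?r j) (w (r n)) d) \<longlonglongrightarrow> l / ?s j"
      by (simp add: f_def)
    moreover have "cell_mean (?r j) u d = cell_mean (?r j) u x" for u
      using grid_cell_eq[OF d(2)] by (simp add: cell_mean_def)
    ultimately show ?thesis by (auto simp: convergent_def)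
  qed
  then show ?thesis using r by blast
qed

text \<open>For fixed \<open>r\<close> the means are uniformly bounded and converge everywhere, so
  dominated convergence applies on a ball.\<close>

lemma cell_means_Cauchy:
  fixes w :: "nat \<Rightarrow> 'a \<Rightarrow> real"
  assumes [measurable]: "\<And>n. w n \<in> borel_measurable borel" and c: "c \<ge> 0"
    and m: "\<And>n. mass p (w n) \<le> ennreal c" and r: "r > 0"
    and cv: "\<And>x. convergent (\<lambda>n. cell_mean r (w n) x)" and \<eta>: "\<eta> > 0"
  shows "\<exists>n0. \<forall>i\<ge>n0. \<forall>j\<ge>n0. (\<integral>\<^sup>+ x. ennreal (\<bar>cell_mean r (w i) x - cell_mean r (w j) x\<bar> powr p) * indicator (ball 0 R) x \<partial>lborel) \<le> ennreal \<eta>"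
proof -
  define L where "L = (\<lambda>x. lim (\<lambda>n. cell_mean r (w n) x))"
  have [measurable]: "L \<in> borel_measurable borel"
    unfolding L_def by (rule borel_measurable_lim_metric) measurable
  have lim: "(\<lambda>n. cell_mean r (w n) x) \<longlonglongrightarrow> L x" for x
    using cv[of x] unfolding L_def by (simp add: convergent_LIMSEQ_iff)
  define b where "b = (c / r ^ DIM('a)) powr (1 / p)"
  have b: "\<bar>cell_mean r (w n) x\<bar> \<le> b" for n x
  proof -
    have "ennreal (\<bar>cell_mean r (w n) x\<bar> powr p) \<le> ennreal (1 / r ^ DIM('a)) * ennreal c"
      by (rule order_trans[OF cell_mean_powr_le[OF _ r] mult_left_mono[OF m]]) auto
    also have "\<dots> = ennreal (c / r ^ DIM('a))" using c r by (simp add: ennreal_mult[symmetric])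
    finally have "\<bar>cell_mean r (w n) x\<bar> powr p \<le> c / r ^ DIM('a)"
      using c r by (simp add: ennreal_le_iff)
    then have "(\<bar>cell_mean r (w n) x\<bar> powr p) powr (1 / p) \<le> b"
      unfolding b_def using p_pos by (intro powr_mono2) auto
    then show ?thesis using p_pos by (simp add: powr_powr)
  qed
  have bL: "\<bar>L x\<bar> \<le> b" for x
    by (rule LIMSEQ_le_const2[OF tendsto_rabs[OF lim]]) (use b in auto)
  have ball [measurable]: "ball (0::'a) R \<in> sets borel" by simp
  let ?d = "\<lambda>n. \<integral>\<^sup>+ x. ennreal (\<bar>cell_mean r (w n) x - L x\<bar> powr p) * indicator (ball 0 R) x \<partial>lborel"
  have "?d \<longlonglongrightarrow> (\<integral>\<^sup>+ x. 0 \<partial>(lborel :: 'a measure))"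
  proof (rule nn_integral_dominated_convergence[where w = "\<lambda>x. ennreal ((2 * b) powr p) * indicator (ball 0 R) x"])
    show "(\<integral>\<^sup>+ x. ennreal ((2 * b) powr p) * indicator (ball 0 R) x \<partial>(lborel :: 'a measure)) < \<infinity>"
      using emeasure_bounded_finite[OF bounded_ball, of "0::'a" R]
      by (subst nn_integral_cmult_indicator) (auto simp: ennreal_mult_less_top)
    show "AE x in lborel. ennreal (\<bar>cell_mean r (w n) x - L x\<bar> powr p) * indicator (ball 0 R) x
        \<le> ennreal ((2 * b) powr p) * indicator (ball 0 R) x" for n
    proof (rule AE_I2)
      fix x
      have "\<bar>cell_mean r (w n) x - L x\<bar> \<le> 2 * b" using b[of n x] bL[of x] by linarith
      then show "ennreal (\<bar>cell_mean r (w n) x - L x\<bar> powr p) * indicator (ball 0 R) x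
        \<le> ennreal ((2 * b) powr p) * indicator (ball 0 R) x"
        using p_pos by (intro mult_right_mono ennreal_leI powr_mono2) auto
    qed
    show "AE x in lborel. (\<lambda>n. ennreal (\<bar>cell_mean r (w n) x - L x\<bar> powr p) * indicator (ball 0 R) x) \<longlonglongrightarrow> 0"
    proof (rule AE_I2)
      fix x
      have "(\<lambda>n. \<bar>cell_mean r (w n) x - L x\<bar> powr p) \<longlonglongrightarrow> \<bar>L x - L x\<bar> powr p"
        by (intro tendsto_powr' tendsto_intros lim) (use p_pos in auto)
      then have "(\<lambda>n. ennreal (\<bar>cell_mean r (w n) x - L x\<bar> powr p)) \<longlonglongrightarrow> ennreal 0"
        by (intro tendsto_ennrealI) simp
      then show "(\<lambda>n. ennreal (\<bar>cell_mean r (w n) x - L x\<bar> powr p) * indicator (ball 0 R) x) \<longlonglongrightarrow> 0"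
        by (cases "x \<in> ball 0 R") (auto simp: indicator_def)
    qed
    show "(\<lambda>x. ennreal (\<bar>cell_mean r (w n) x - L x\<bar> powr p) * indicator (ball 0 R) x) \<in> borel_measurable lborel" for n
      by measurable
    show "(\<lambda>x. ennreal ((2 * b) powr p) * indicator (ball 0 R) x) \<in> borel_measurable (lborel :: 'a measure)"
      by measurable
    show "(\<lambda>x. 0) \<in> borel_measurable (lborel :: 'a measure)"
      by (rule borel_measurable_const)
  qed
  then have "?d \<longlonglongrightarrow> 0" by simp
  then have "\<forall>\<^sub>F n in sequentially. ?d n < ennreal (\<eta> / (2 * 2 powr p))"
    by (rule order_tendstoD) (use \<eta> in simp)
  then obtain n0 where n0: "\<And>n. n \<ge> n0 \<Longrightarrow> ?d n < ennreal (\<eta> / (2 * 2 powr p))" by (auto simp: eventually_sequentially)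
  have "(\<integral>\<^sup>+ x. ennreal (\<bar>cell_mean r (w i) x - cell_mean r (w j) x\<bar> powr p) * indicator (ball 0 R) x \<partial>lborel) \<le> ennreal \<eta>"
    if "i \<ge> n0" "j \<ge> n0" for i j
  proof -
    have "(\<integral>\<^sup>+ x. ennreal (\<bar>cell_mean r (w i) x - cell_mean r (w j) x\<bar> powr p) * indicator (ball 0 R) x \<partial>lborel)
      \<le> (\<integral>\<^sup>+ x. ennreal (2 powr p) * (ennreal (\<bar>cell_mean r (w i) x - L x\<bar> powr p) * indicator (ball 0 R) x
         + ennreal (\<bar>cell_mean r (w j) x - L x\<bar> powr p) * indicator (ball 0 R) x) \<partial>lborel)"
    proof (rule nn_integral_mono)
      fix x
      have "\<bar>cell_mean r (w i) x - cell_mean r (w j) x\<bar> powr p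
         \<le> 2 powr p * (\<bar>cell_mean r (w i) x - L x\<bar> powr p + \<bar>cell_mean r (w j) x - L x\<bar> powr p)"
        using abs_add_powr_le[of p "cell_mean r (w i) x - L x" "L x - cell_mean r (w j) x"] p_pos
        by (simp add: abs_minus_commute)
      then have "ennreal (\<bar>cell_mean r (w i) x - cell_mean r (w j) x\<bar> powr p)
         \<le> ennreal (2 powr p) * (ennreal (\<bar>cell_mean r (w i) x - L x\<bar> powr p) + ennreal (\<bar>cell_mean r (w j) x - L x\<bar> powr p))"
        by (simp add: ennreal_mult[symmetric] ennreal_plus[symmetric] ennreal_leI del: ennreal_plus)
      then show "ennreal (\<bar>cell_mean r (w i) x - cell_mean r (w j) x\<bar> powr p) * indicator (ball 0 R) x
        \<le> ennreal (2 powr p) * (ennreal (\<bar>cell_mean r (w i) x - L x\<bar> powr p) * indicator (ball 0 R) x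
         + ennreal (\<bar>cell_mean r (w j) x - L x\<bar> powr p) * indicator (ball 0 R) x)"
        by (auto simp: indicator_def)
    qed
    also have "\<dots> = ennreal (2 powr p) * (?d i + ?d j)"
      by (subst nn_integral_cmult, measurable, subst nn_integral_add) auto
    also have "\<dots> \<le> ennreal (2 powr p) * (ennreal (\<eta> / (2 * 2 powr p)) + ennreal (\<eta> / (2 * 2 powr p)))"
      using n0[OF that(1)] n0[OF that(2)] by (intro mult_left_mono add_mono) auto
    also have "\<dots> = ennreal \<eta>" using \<eta> by (simp add: ennreal_mult[symmetric] ennreal_plus[symmetric] del: ennreal_plus)
    finally show ?thesis .
  qed
  then show ?thesis by blast
qed

text \<open>A difference of two members splits into its tail outside a ball, its deviation from cell
  means, and a difference of cell means on the ball. The first two are small uniformly once the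
  radius \<open>R\<close> and then the side \<rho> are fixed; only then is \<open>n0\<close> chosen
  for the third.\<close>

theorem compact_embedding:
  fixes w :: "nat \<Rightarrow> 'a \<Rightarrow> real"
  assumes [measurable]: "\<And>n. w n \<in> borel_measurable borel" and c: "c \<ge> 0"
    and g: "\<And>n. gagliardo (w n) \<le> ennreal c" and po: "\<And>n. potential (w n) \<le> ennreal c"
  shows "\<exists>r u. strict_mono r \<and> u \<in> borel_measurable borel \<and> (AE x in lborel. (\<lambda>n. w (r n) x) \<longlonglongrightarrow> u x) \<and>
     (\<lambda>n. mass p (\<lambda>x. w (r n) x - u x)) \<longlonglongrightarrow> 0"
proof -
  define c1 where "c1 = c / V0"
  have c1: "c1 \<ge> 0" using c V0_pos by (simp add: c1_def)
  have m: "mass p (w n) \<le> ennreal c1" for n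
    unfolding c1_def by (rule bounded_masses[OF assms])
  have mf: "mass p (w n) < \<infinity>" for n using m[of n] by (simp add: le_less_trans)
  obtain r where r: "strict_mono (r :: nat \<Rightarrow> nat)"
    and cv: "\<And>j x. convergent (\<lambda>n. cell_mean (1 / real (Suc j)) (w (r n)) x)"
    using cell_means_convergent_subseq[of w c1] assms(1) c1 m by blast
  define c2 where "c2 = 2 powr p * (2 * c)"
  have c2: "c2 \<ge> 0" using c by (simp add: c2_def)
  have twice: "ennreal (2 powr p) * (ennreal c + ennreal c) = ennreal c2"
    using c by (simp add: c2_def ennreal_mult[symmetric] ennreal_plus[symmetric] del: ennreal_plus)
  have Cauchy: "\<exists>n0. \<forall>i\<ge>n0. \<forall>k\<ge>n0. mass p (\<lambda>x. w (r i) x - w (r k) x) \<le> ennreal \<eta>" if \<eta>: "\<eta> > 0" for \<eta>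
  proof -
    obtain R where R: "\<And>u. u \<in> borel_measurable borel \<Longrightarrow> gagliardo u \<le> ennreal c2 \<Longrightarrow> potential u \<le> ennreal c2 \<Longrightarrow>
       (\<integral>\<^sup>+ x. ennreal (\<bar>u x\<bar> powr p) * indicator (- ball 0 R) x \<partial>lborel) \<le> ennreal (\<eta> / 2)"
      using tail_small[OF c2, of "\<eta> / 2"] \<eta> by auto
    define C where "C = real DIM('a) powr expo"
    define \<theta> where "\<theta> = \<eta> / (4 * 2 powr p)"
    have \<theta>: "\<theta> > 0" using \<eta> by (simp add: \<theta>_def)
    have "(\<lambda>j. (1 / real (Suc j)) powr (s * p)) \<longlonglongrightarrow> 0"
      by (rule tendsto_zero_powrI[of _ _ "\<lambda>_. s * p" "s * p"])
        (use sp_pos LIMSEQ_Suc[OF lim_1_over_n] in auto)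
    from tendsto_mult_left[OF this, of "C * c2"] have "(\<lambda>j. C * c2 * (1 / real (Suc j)) powr (s * p)) \<longlonglongrightarrow> 0" by simp
    then have "\<forall>\<^sub>F j in sequentially. C * c2 * (1 / real (Suc j)) powr (s * p) < \<theta>" using \<theta> by (rule order_tendstoD)
    then obtain j where j: "C * c2 * (1 / real (Suc j)) powr (s * p) < \<theta>" by (auto dest: eventually_happens)
    define \<rho> where "\<rho> = 1 / real (Suc j)"
    have \<rho>: "\<rho> > 0" by (simp add: \<rho>_def)
    obtain n0 where n0: "\<And>i k. i \<ge> n0 \<Longrightarrow> k \<ge> n0 \<Longrightarrow>
       (\<integral>\<^sup>+ x. ennreal (\<bar>cell_mean \<rho> (w (r i)) x - cell_mean \<rho> (w (r k)) x\<bar> powr p) * indicator (ball 0 R) x \<partial>lborel) \<le> ennreal \<theta>"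
    proof -
      have cv\<rho>: "convergent (\<lambda>n. cell_mean \<rho> (w (r n)) x)" for x unfolding \<rho>_def by (rule cv)
      show ?thesis using cell_means_Cauchy[of "\<lambda>n. w (r n)", OF _ c1 m \<rho> cv\<rho> \<theta>, of R] that by auto
    qed
    have "mass p (\<lambda>x. w (r i) x - w (r k) x) \<le> ennreal \<eta>" if "i \<ge> n0" "k \<ge> n0" for i k
    proof -
      let ?v = "\<lambda>x. w (r i) x - w (r k) x"
      have [measurable]: "ball (0::'a) R \<in> sets borel" by simp
      have gv: "gagliardo ?v \<le> ennreal c2"
        unfolding twice[symmetric] by (rule order_trans[OF gagliardo_diff_le]) (auto intro!: mult_left_mono add_mono g)
      have pv: "potential ?v \<le> ennreal c2"
      proof -
        have "potential (\<lambda>x. - w (r k) x) = potential (w (r k))" by (simp add: potential_def)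
        then show ?thesis
          using potential_add_le[of "w (r i)" "\<lambda>x. - w (r k) x"] order_trans[OF _ mult_left_mono[OF add_mono[OF po po]]]
          unfolding twice[symmetric] by simp
      qed
      have mv: "mass p ?v < \<infinity>"
      proof -
        have "mass p ?v \<le> ennreal (2 powr p) * (mass p (w (r i)) + mass p (w (r k)))"
          by (rule mass_diff_le) (use p_pos in auto)
        also have "\<dots> < \<infinity>" using mf by (simp add: ennreal_mult_less_top)
        finally show ?thesis .
      qed
      have e: "mass p (\<lambda>x. ?v x - cell_mean \<rho> ?v x) \<le> ennreal \<theta>"
      proof -
        have "mass p (\<lambda>x. ?v x - cell_mean \<rho> ?v x) \<le> ennreal (C * \<rho> powr (s * p)) * ennreal c2"
          unfolding C_def by (rule order_trans[OF cell_mean_error[OF _ mv \<rho>] mult_left_mono[OF gv]]) auto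
        also have "\<dots> \<le> ennreal \<theta>"
          using j c2 by (simp add: ennreal_mult[symmetric] C_def \<rho>_def mult_ac ennreal_leI)
        finally show ?thesis .
      qed
      have "mass p ?v \<le> (\<integral>\<^sup>+ x. ennreal (\<bar>?v x\<bar> powr p) * indicator (- ball 0 R) x + ennreal (2 powr p) *
         (ennreal (\<bar>?v x - cell_mean \<rho> ?v x\<bar> powr p) +
          ennreal (\<bar>cell_mean \<rho> (w (r i)) x - cell_mean \<rho> (w (r k)) x\<bar> powr p) * indicator (ball 0 R) x) \<partial>lborel)"
        unfolding mass_def
      proof (rule nn_integral_mono)
        fix x
        have cm: "cell_mean \<rho> (w (r i)) x - cell_mean \<rho> (w (r k)) x = cell_mean \<rho> ?v x"
          by (rule cell_mean_diff[symmetric]) (use mf \<rho> in auto)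
        show "ennreal (\<bar>?v x\<bar> powr p) \<le> ennreal (\<bar>?v x\<bar> powr p) * indicator (- ball 0 R) x + ennreal (2 powr p) *
         (ennreal (\<bar>?v x - cell_mean \<rho> ?v x\<bar> powr p) +
          ennreal (\<bar>cell_mean \<rho> (w (r i)) x - cell_mean \<rho> (w (r k)) x\<bar> powr p) * indicator (ball 0 R) x)"
        proof (cases "x \<in> ball 0 R")
          case True
          have "\<bar>?v x\<bar> powr p \<le> 2 powr p * (\<bar>?v x - cell_mean \<rho> ?v x\<bar> powr p + \<bar>cell_mean \<rho> ?v x\<bar> powr p)"
            using abs_add_powr_le[of p "?v x - cell_mean \<rho> ?v x" "cell_mean \<rho> ?v x"] p_pos by simp
          then have "ennreal (\<bar>?v x\<bar> powr p) \<le> ennreal (2 powr p) *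
             (ennreal (\<bar>?v x - cell_mean \<rho> ?v x\<bar> powr p) + ennreal (\<bar>cell_mean \<rho> ?v x\<bar> powr p))"
            by (simp add: ennreal_mult[symmetric] ennreal_plus[symmetric] ennreal_leI del: ennreal_plus)
          then show ?thesis using True unfolding cm by simp
        next
          case False
          then show ?thesis by simp
        qed
      qed
      also have "\<dots> = (\<integral>\<^sup>+ x. ennreal (\<bar>?v x\<bar> powr p) * indicator (- ball 0 R) x \<partial>lborel) + ennreal (2 powr p) *
         (mass p (\<lambda>x. ?v x - cell_mean \<rho> ?v x) +
          (\<integral>\<^sup>+ x. ennreal (\<bar>cell_mean \<rho> (w (r i)) x - cell_mean \<rho> (w (r k)) x\<bar> powr p) * indicator (ball 0 R) x \<partial>lborel))"
        unfolding mass_def by (rule nn_integral_add_cmult_add) measurable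
      also have "\<dots> \<le> ennreal (\<eta> / 2) + ennreal (2 powr p) * (ennreal \<theta> + ennreal \<theta>)"
        by (intro add_mono mult_left_mono R gv pv e n0 that) auto
      also have "\<dots> = ennreal \<eta>"
        using \<theta> \<eta> by (simp add: ennreal_mult[symmetric] ennreal_plus[symmetric] \<theta>_def del: ennreal_plus)
      finally show ?thesis .
    qed
    then show ?thesis by blast
  qed
  obtain r2 u where r2: "strict_mono r2" "u \<in> borel_measurable borel"
    "AE x in lborel. (\<lambda>n. w (r (r2 n)) x) \<longlonglongrightarrow> u x" "(\<lambda>n. mass p (\<lambda>x. w (r (r2 n)) x - u x)) \<longlonglongrightarrow> 0"
    using Lp_Cauchy_limit[of "\<lambda>n. w (r n)", OF assms(1) mf Cauchy, simplified] by (elim exE conjE) (rule that)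
  then show ?thesis using strict_mono_o[OF r r2(1)]
    by (intro exI[of _ "r \<circ> r2"] exI[of _ u]) (auto simp: o_def)
qed

end

section \<open>Null sets in products and the choice of fast subsequences\<close>

lemma fst_borel [measurable]: "(fst :: 'b::second_countable_topology \<times> 'c::second_countable_topology \<Rightarrow> 'b) \<in> borel \<rightarrow>\<^sub>M borel"
  by (intro borel_measurable_continuous_onI continuous_intros)

lemma snd_borel [measurable]: "(snd :: 'b::second_countable_topology \<times> 'c::second_countable_topology \<Rightarrow> 'c) \<in> borel \<rightarrow>\<^sub>M borel"
  by (intro borel_measurable_continuous_onI continuous_intros)

lemma AE_lborel_fst:
  assumes "AE x in (lborel :: 'b::euclidean_space measure). Q x"
  shows "AE z in (lborel :: ('b \<times> 'c::euclidean_space) measure). Q (fst z)"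
proof -
  obtain N where N: "{x \<in> space lborel. \<not> Q x} \<subseteq> N" "emeasure lborel N = 0" "N \<in> sets (lborel :: 'b measure)"
    using assms by (rule AE_E)
  have "N \<times> UNIV \<in> null_sets (lborel \<Otimes>\<^sub>M (lborel :: 'c measure))"
  proof (rule null_setsI)
    show "emeasure (lborel \<Otimes>\<^sub>M (lborel :: 'c measure)) (N \<times> UNIV) = 0"
      using N by (subst lborel.emeasure_pair_measure_Times) auto
    show "N \<times> UNIV \<in> sets (lborel \<Otimes>\<^sub>M (lborel :: 'c measure))" using N by auto
  qed
  then have "N \<times> UNIV \<in> null_sets (lborel :: ('b \<times> 'c) measure)" by (simp add: lborel_prod)
  then show ?thesis by (rule AE_I') (use N in auto)
qed

lemma AE_lborel_snd:
  assumes "AE x in (lborel :: 'c::euclidean_space measure). Q x"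
  shows "AE z in (lborel :: ('b::euclidean_space \<times> 'c) measure). Q (snd z)"
proof -
  obtain N where N: "{x \<in> space lborel. \<not> Q x} \<subseteq> N" "emeasure lborel N = 0" "N \<in> sets (lborel :: 'c measure)"
    using assms by (rule AE_E)
  have "UNIV \<times> N \<in> null_sets ((lborel :: 'b measure) \<Otimes>\<^sub>M lborel)"
  proof (rule null_setsI)
    show "emeasure ((lborel :: 'b measure) \<Otimes>\<^sub>M lborel) (UNIV \<times> N) = 0"
      using N by (subst lborel.emeasure_pair_measure_Times) auto
    show "UNIV \<times> N \<in> sets ((lborel :: 'b measure) \<Otimes>\<^sub>M lborel)" using N by auto
  qed
  then have "UNIV \<times> N \<in> null_sets (lborel :: ('b \<times> 'c) measure)" by (simp add: lborel_prod)
  then show ?thesis by (rule AE_I') (use N in auto)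
qed

lemma ennreal_term_le_suminf:
  fixes f :: "nat \<Rightarrow> ennreal"
  shows "f k \<le> (\<Sum>n. f n)"
proof -
  have "sum f {k} \<le> (\<Sum>n. f n)" by (rule sum_le_suminf) auto
  then show ?thesis by simp
qed

text \<open>Geometric decay of both error sequences at once makes their sums finite, which later
  produces integrable majorants for two exponents along the same subsequence.\<close>

lemma rapid_subsequence:
  fixes f g :: "nat \<Rightarrow> ennreal"
  assumes "f \<longlonglongrightarrow> 0" "g \<longlonglongrightarrow> 0"
  shows "\<exists>r::nat \<Rightarrow> nat. strict_mono r \<and> (\<forall>n. f (r n) \<le> ennreal ((1/2) ^ n) \<and> g (r n) \<le> ennreal ((1/2) ^ n))"
proof -
  have "\<exists>N. \<forall>m\<ge>N. f m \<le> ennreal ((1/2) ^ n) \<and> g m \<le> ennreal ((1/2) ^ n)" for n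
  proof -
    have p: "0 < ennreal ((1/2) ^ n)" by simp
    have "\<forall>\<^sub>F m in sequentially. f m < ennreal ((1/2) ^ n) \<and> g m < ennreal ((1/2) ^ n)"
      using order_tendstoD(2)[OF assms(1) p] order_tendstoD(2)[OF assms(2) p] by (rule eventually_conj)
    then show ?thesis by (auto simp: eventually_sequentially dest: less_imp_le)
  qed
  then obtain N where N: "\<And>n m. m \<ge> N n \<Longrightarrow> f m \<le> ennreal ((1/2) ^ n) \<and> g m \<le> ennreal ((1/2) ^ n)" by metis
  define r where "r = (\<lambda>n. n + (\<Sum>i\<le>n. N i))"
  have "strict_mono r" by (rule strict_mono_Suc_iff[THEN iffD2]) (simp add: r_def)
  moreover have "N n \<le> r n" for n
    unfolding r_def using member_le_sum[of n "{..n}" N] by (simp add: trans_le_add2)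
  ultimately show ?thesis using N by blast
qed

section \<open>The weighted space, its embedding and its compactness\<close>

context weighted_fractional
begin

definition kernel :: "'a \<times> 'a \<Rightarrow> real" where
  "kernel z = 1 / norm (fst z - snd z) powr expo"

text \<open>Borel functions only. Membership in \<open>L^p\<close> follows from finite
  \<open>potential\<close>, because \<open>V0 \<le> V x\<close> with \<open>V0 > 0\<close>.\<close>

definition wspace :: "('a \<Rightarrow> real) set" where
  "wspace = {u \<in> borel_measurable borel. gagliardo u < \<infinity> \<and> potential u < \<infinity>}"

definition wenergy :: "('a \<Rightarrow> real) \<Rightarrow> real" where
  "wenergy u = enn2real (gagliardo u + potential u)"

lemma kernel_nonneg: "kernel z \<ge> 0"
  by (simp add: kernel_def)

lemma kernel_measurable [measurable]: "kernel \<in> borel_measurable borel"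
  unfolding kernel_def[abs_def] by measurable

lemma wspace_measurable [measurable_dest]: "u \<in> wspace \<Longrightarrow> u \<in> borel_measurable borel"
  by (simp add: wspace_def)

lemma wspaceI: "u \<in> borel_measurable borel \<Longrightarrow> gagliardo u < \<infinity> \<Longrightarrow> potential u < \<infinity> \<Longrightarrow> u \<in> wspace"
  by (simp add: wspace_def)

lemma wenergy_nonneg: "wenergy u \<ge> 0"
  by (simp add: wenergy_def)

lemma wenergy_ennreal: "u \<in> wspace \<Longrightarrow> gagliardo u + potential u = ennreal (wenergy u)"
  unfolding wenergy_def by (rule ennreal_enn2real[symmetric]) (simp add: wspace_def)

lemma gagliardo_le_wenergy: "u \<in> wspace \<Longrightarrow> gagliardo u \<le> ennreal (wenergy u)"
  by (simp flip: wenergy_ennreal)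

lemma potential_le_wenergy: "u \<in> wspace \<Longrightarrow> potential u \<le> ennreal (wenergy u)"
  by (simp flip: wenergy_ennreal)

lemma gagliardo_kernel:
  assumes [measurable]: "u \<in> borel_measurable borel"
  shows "gagliardo u = (\<integral>\<^sup>+ z. ennreal (kernel z * \<bar>u (fst z) - u (snd z)\<bar> powr p) \<partial>lborel)"
  unfolding gagliardo_eq[OF assms, symmetric] by (simp add: kernel_def case_prod_beta')

lemma gagliardo_integrable:
  assumes "u \<in> wspace"
  shows "integrable lborel (\<lambda>z. kernel z * \<bar>u (fst z) - u (snd z)\<bar> powr p)"
proof -
  have [measurable]: "u \<in> borel_measurable borel" using assms by measurable
  show ?thesis
    by (rule integrableI_nonneg) (use assms gagliardo_kernel[of u] kernel_nonneg in \<open>auto simp: wspace_def\<close>)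
qed

lemma potential_integrable:
  assumes "u \<in> wspace"
  shows "integrable lborel (\<lambda>x. V x * \<bar>u x\<bar> powr p)"
proof -
  have [measurable]: "u \<in> borel_measurable borel" using assms by measurable
  show ?thesis
    by (rule integrableI_nonneg) (use assms V_pos in \<open>auto simp: wspace_def potential_def less_imp_le\<close>)
qed

lemma wenergy_integral:
  assumes "u \<in> wspace"
  shows "wenergy u = (LINT z|lborel. kernel z * \<bar>u (fst z) - u (snd z)\<bar> powr p) + (LINT x|lborel. V x * \<bar>u x\<bar> powr p)"
proof -
  have u: "u \<in> borel_measurable borel" using assms by measurable
  have "gagliardo u = ennreal (LINT z|lborel. kernel z * \<bar>u (fst z) - u (snd z)\<bar> powr p)"
    unfolding gagliardo_kernel[OF u] by (rule nn_integral_eq_integral[OF gagliardo_integrable[OF assms]]) (simp add: kernel_nonneg)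
  moreover have "potential u = ennreal (LINT x|lborel. V x * \<bar>u x\<bar> powr p)"
    unfolding potential_def by (rule nn_integral_eq_integral[OF potential_integrable[OF assms]]) (simp add: V_pos less_imp_le)
  moreover have "(LINT z|lborel. kernel z * \<bar>u (fst z) - u (snd z)\<bar> powr p) \<ge> 0"
    by (rule integral_nonneg_AE) (simp add: kernel_nonneg)
  moreover have "(LINT x|lborel. V x * \<bar>u x\<bar> powr p) \<ge> 0"
    by (rule integral_nonneg_AE) (simp add: V_pos less_imp_le)
  ultimately show ?thesis by (simp add: wenergy_def ennreal_plus[symmetric] del: ennreal_plus)
qed

lemma gagliardo_scale:
  assumes [measurable]: "u \<in> borel_measurable borel"
  shows "gagliardo (\<lambda>x. t * u x) = ennreal (\<bar>t\<bar> powr p) * gagliardo u"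
proof -
  have "gagliardo (\<lambda>x. t * u x) = (\<integral>\<^sup>+ z. ennreal (\<bar>t\<bar> powr p) * ennreal (kernel z * \<bar>u (fst z) - u (snd z)\<bar> powr p) \<partial>lborel)"
    by (subst gagliardo_kernel, measurable)
      (auto intro!: nn_integral_cong simp: ennreal_mult[symmetric] kernel_nonneg right_diff_distrib[symmetric] abs_mult powr_mult mult_ac)
  also have "\<dots> = ennreal (\<bar>t\<bar> powr p) * gagliardo u"
    unfolding gagliardo_kernel[OF assms] by (rule nn_integral_cmult) measurable
  finally show ?thesis .
qed

lemma potential_scale:
  assumes [measurable]: "u \<in> borel_measurable borel"
  shows "potential (\<lambda>x. t * u x) = ennreal (\<bar>t\<bar> powr p) * potential u"
proof -
  have "potential (\<lambda>x. t * u x) = (\<integral>\<^sup>+ x. ennreal (\<bar>t\<bar> powr p) * ennreal (V x * \<bar>u x\<bar> powr p) \<partial>lborel)"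
    unfolding potential_def
    by (auto intro!: nn_integral_cong simp: ennreal_mult[symmetric] V_pos less_imp_le abs_mult powr_mult mult_ac)
  also have "\<dots> = ennreal (\<bar>t\<bar> powr p) * potential u"
    unfolding potential_def by (rule nn_integral_cmult) measurable
  finally show ?thesis .
qed

lemma mass_scale:
  assumes [measurable]: "u \<in> borel_measurable borel"
  shows "mass q (\<lambda>x. t * u x) = ennreal (\<bar>t\<bar> powr q) * mass q u"
proof -
  have "mass q (\<lambda>x. t * u x) = (\<integral>\<^sup>+ x. ennreal (\<bar>t\<bar> powr q) * ennreal (\<bar>u x\<bar> powr q) \<partial>lborel)"
    unfolding mass_def by (auto intro!: nn_integral_cong simp: ennreal_mult[symmetric] abs_mult powr_mult)
  also have "\<dots> = ennreal (\<bar>t\<bar> powr q) * mass q u"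
    unfolding mass_def by (rule nn_integral_cmult) measurable
  finally show ?thesis .
qed

lemma wspace_scale: "u \<in> wspace \<Longrightarrow> (\<lambda>x. t * u x) \<in> wspace"
  by (rule wspaceI) (auto simp: gagliardo_scale potential_scale wspace_def ennreal_mult_less_top)

lemma wenergy_scale: "u \<in> wspace \<Longrightarrow> wenergy (\<lambda>x. t * u x) = \<bar>t\<bar> powr p * wenergy u"
proof -
  assume u: "u \<in> wspace"
  then have m: "u \<in> borel_measurable borel" by measurable
  show ?thesis
    unfolding wenergy_def gagliardo_scale[OF m] potential_scale[OF m]
    by (simp add: distrib_left[symmetric] enn2real_mult)
qed

lemma wspace_add: "u \<in> wspace \<Longrightarrow> v \<in> wspace \<Longrightarrow> (\<lambda>x. u x + v x) \<in> wspace"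
proof (rule wspaceI)
  assume uv: "u \<in> wspace" "v \<in> wspace"
  then have [measurable]: "u \<in> borel_measurable borel" "v \<in> borel_measurable borel" by measurable
  show "(\<lambda>x. u x + v x) \<in> borel_measurable borel" by measurable
  have "ennreal (2 powr p) * (gagliardo u + gagliardo v) < \<infinity>" "ennreal (2 powr p) * (potential u + potential v) < \<infinity>"
    using uv by (auto simp: wspace_def ennreal_mult_less_top)
  then show "gagliardo (\<lambda>x. u x + v x) < \<infinity>" "potential (\<lambda>x. u x + v x) < \<infinity>"
    using gagliardo_add_le[of u v] potential_add_le[of u v] by (auto intro: le_less_trans)
qed

text \<open>Both parts of the energy are monotone under contractions. This is what keeps positive
  parts in the space.\<close>

lemma wspace_contraction:
  assumes u: "u \<in> wspace" and [measurable]: "v \<in> borel_measurable borel"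
    and 1: "\<And>x y. \<bar>v x - v y\<bar> \<le> \<bar>u x - u y\<bar>" and 2: "\<And>x. \<bar>v x\<bar> \<le> \<bar>u x\<bar>"
  shows "v \<in> wspace"
proof (rule wspaceI)
  have [measurable]: "u \<in> borel_measurable borel" using u by measurable
  have "gagliardo v \<le> gagliardo u"
    unfolding gagliardo_kernel[OF \<open>u \<in> borel_measurable borel\<close>] gagliardo_kernel[OF assms(2)]
    using p_pos by (intro nn_integral_mono ennreal_leI mult_left_mono powr_mono2) (auto simp: kernel_nonneg 1)
  then show "gagliardo v < \<infinity>" using u by (auto simp: wspace_def)
  have "potential v \<le> potential u"
    unfolding potential_def
    using p_pos by (intro nn_integral_mono ennreal_leI mult_left_mono powr_mono2) (auto simp: 2 V_pos less_imp_le)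
  then show "potential v < \<infinity>" using u by (auto simp: wspace_def)
qed measurable

lemma wspace_pos_part: "u \<in> wspace \<Longrightarrow> (\<lambda>x. max (u x) 0) \<in> wspace"
  by (rule wspace_contraction[of u]) auto

lemma wspace_mass_p: "u \<in> wspace \<Longrightarrow> mass p u \<le> ennreal (wenergy u / V0)"
proof -
  assume u: "u \<in> wspace"
  then have "u \<in> borel_measurable borel" by measurable
  from mass_le_potential[OF this] have "mass p u \<le> ennreal (1 / V0) * ennreal (wenergy u)"
    by (rule order_trans) (intro mult_left_mono potential_le_wenergy u; simp)
  then show ?thesis using V0_pos by (simp add: ennreal_mult[symmetric] wenergy_nonneg)
qed

lemma AE_zero_of_mass:
  assumes [measurable]: "u \<in> borel_measurable borel" and "mass q u = 0"
  shows "AE x in lborel. u x = 0"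
proof -
  have "AE x in lborel. ennreal (\<bar>u x\<bar> powr q) = 0"
    using assms(2) unfolding mass_def by (subst (asm) nn_integral_0_iff_AE) auto
  then show ?thesis by eventually_elim (auto split: if_splits)
qed

lemma mass_AE_zero: "AE x in lborel. u x = 0 \<Longrightarrow> mass q u = 0"
  unfolding mass_def by (subst nn_integral_cong_AE[of _ "\<lambda>_. 0"]) auto

definition crit_power :: real where
  "crit_power = real DIM('a) * p / (real DIM('a) - s * p)"

text \<open>Scale to bring mass and Gagliardo energy below 1, apply \<open>bounded_mass\<close>, and
  scale back. Zero energy is treated apart because the scaling divides by it.\<close>

lemma sobolev_embedding:
  assumes q: "p \<le> q" "q < crit_power"
  shows "\<exists>C>0. \<forall>u\<in>wspace. mass q u \<le> ennreal (C * wenergy u powr (q / p))"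
proof -
  obtain C where C: "C > 0" "\<And>u. u \<in> borel_measurable borel \<Longrightarrow> mass p u \<le> 1 \<Longrightarrow> gagliardo u \<le> 1 \<Longrightarrow> mass q u \<le> ennreal C"
  proof -
    have "bounded_mass q" using subcritical_bounded_mass[OF q(1)] q(2) by (simp add: crit_power_def)
    then show ?thesis unfolding bounded_mass_def using that by auto
  qed
  \<comment> \<open>Dominates both 1 and \<open>1 / V0\<close>, the constants relating the Gagliardo
    energy and the mass to \<open>wenergy\<close>.\<close>
  define b where "b = max 1 (1 / V0)"
  have b: "b > 0" "1 / V0 \<le> b" "1 \<le> b" by (auto simp: b_def)
  have "mass q u \<le> ennreal (C * b powr (q / p) * wenergy u powr (q / p))" if u: "u \<in> wspace" for u
  proof (cases "wenergy u = 0")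
    case True
    have [measurable]: "u \<in> borel_measurable borel" using u by measurable
    have "mass p u = 0" using wspace_mass_p[OF u] True by simp
    then have "AE x in lborel. u x = 0" by (intro AE_zero_of_mass) auto
    then have "mass q u = 0" by (rule mass_AE_zero)
    then show ?thesis by simp
  next
    case False
    have m [measurable]: "u \<in> borel_measurable borel" using u by measurable
    define E where "E = wenergy u"
    have E: "E > 0" using False wenergy_nonneg[of u] by (simp add: E_def)
    define t where "t = (b * E) powr (- (1 / p))"
    have t: "t > 0" using b E by (simp add: t_def)
    have "t powr p = (b * E) powr (- 1)" unfolding t_def powr_powr using p_pos by simp
    then have tp: "t powr p = 1 / (b * E)" using b E by (simp add: powr_minus_divide)
    have mb: "mass p (\<lambda>x. t * u x) \<le> 1"
    proof -
      have "mass p (\<lambda>x. t * u x) \<le> ennreal (1 / (b * E)) * ennreal (E / V0)"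
        using wspace_mass_p[OF u] t unfolding mass_scale[OF m] by (simp add: tp E_def mult_left_mono)
      also have "\<dots> = ennreal (1 / V0 / b)" using b E V0_pos by (simp add: ennreal_mult[symmetric] field_simps)
      also have "\<dots> \<le> ennreal 1"
      proof (rule ennreal_leI)
        have "1 \<le> V0 * b" using b(2) V0_pos by (simp add: field_simps)
        then show "1 / V0 / b \<le> 1" using V0_pos b(1) by simp
      qed
      finally show ?thesis by simp
    qed
    have gb: "gagliardo (\<lambda>x. t * u x) \<le> 1"
    proof -
      have "gagliardo (\<lambda>x. t * u x) \<le> ennreal (1 / (b * E)) * ennreal E"
        using gagliardo_le_wenergy[OF u] t unfolding gagliardo_scale[OF m] by (simp add: tp E_def mult_left_mono)
      also have "\<dots> = ennreal (1 / b)" using b E by (simp add: ennreal_mult[symmetric])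
      also have "\<dots> \<le> ennreal 1" using b by (intro ennreal_leI) simp
      finally show ?thesis by simp
    qed
    have "ennreal (t powr q) * mass q u \<le> ennreal C"
      using C(2)[OF _ mb gb] t unfolding mass_scale[OF m] by simp
    then have "ennreal (t powr - q) * (ennreal (t powr q) * mass q u) \<le> ennreal (t powr - q) * ennreal C"
      by (intro mult_left_mono) auto
    moreover have "ennreal (t powr - q) * (ennreal (t powr q) * mass q u) = mass q u"
      using t by (simp add: mult.assoc[symmetric] ennreal_mult[symmetric] flip: powr_add)
    ultimately have "mass q u \<le> ennreal (t powr - q * C)" using C(1) by (simp add: ennreal_mult)
    also have "t powr - q = b powr (q / p) * E powr (q / p)"
      using b E by (simp add: t_def powr_powr powr_mult)
    finally show ?thesis by (simp add: E_def mult_ac)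
  qed
  then show ?thesis using C(1) b by (intro exI[of _ "C * b powr (q / p)"]) auto
qed

text \<open>Above a height \<open>T\<close> the bounded \<open>q2\<close> mass enters with a small
  factor; below \<open>T\<close> the vanishing \<open>p\<close> mass takes over. \<open>T\<close> is
  chosen so that the first contribution is \<eta>/2.\<close>

lemma mass_tendsto_interpolate:
  assumes w: "\<And>n. w n \<in> borel_measurable borel" and 0: "(\<lambda>n. mass p (w n)) \<longlonglongrightarrow> 0"
    and C: "\<And>n. mass q2 (w n) \<le> ennreal C" and q: "p \<le> q" "q < q2"
  shows "(\<lambda>n. mass q (w n)) \<longlonglongrightarrow> 0"
proof (rule tendsto_0_if_le)
  fix \<eta> :: real assume \<eta>: "\<eta> > 0"
  note [measurable] = w
  define D where "D = \<bar>C\<bar> + 1"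
  have D: "D > 0" "C \<le> D" by (auto simp: D_def)
  define T where "T = (\<eta> / (2 * D)) powr (1 / (q - q2))"
  have T: "T > 0" using \<eta> D by (simp add: T_def)
  have Tq: "T powr (q - q2) = \<eta> / (2 * D)" using \<eta> D q by (simp add: T_def powr_powr)
  have pw: "t powr q \<le> T powr (q - q2) * t powr q2 + T powr (q - p) * t powr p" if "t \<ge> 0" for t :: real
  proof (cases "t \<ge> T")
    case True
    then have tp: "t > 0" using T by simp
    have "t powr q = t powr (q - q2) * t powr q2" by (simp flip: powr_add)
    also have "\<dots> \<le> T powr (q - q2) * t powr q2"
      using True T q by (intro mult_right_mono powr_mono2') auto
    finally show ?thesis by (simp add: add_increasing2)
  next
    case False
    have "t powr q = t powr (q - p) * t powr p" by (simp flip: powr_add)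
    also have "\<dots> \<le> T powr (q - p) * t powr p"
      using False that q by (intro mult_right_mono powr_mono2) auto
    finally show ?thesis by (simp add: add_increasing)
  qed
  have le: "mass q (w n) \<le> ennreal (T powr (q - q2)) * mass q2 (w n) + ennreal (T powr (q - p)) * mass p (w n)" for n
  proof -
    have "mass q (w n) \<le> (\<integral>\<^sup>+ x. ennreal (T powr (q - q2)) * ennreal (\<bar>w n x\<bar> powr q2) + ennreal (T powr (q - p)) * ennreal (\<bar>w n x\<bar> powr p) \<partial>lborel)"
      unfolding mass_def
      by (intro nn_integral_mono) (use pw in \<open>auto simp: ennreal_mult[symmetric] ennreal_plus[symmetric] simp del: ennreal_plus intro!: ennreal_leI\<close>)
    also have "\<dots> = ennreal (T powr (q - q2)) * mass q2 (w n) + ennreal (T powr (q - p)) * mass p (w n)"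
      unfolding mass_def by (subst nn_integral_add) (auto simp: nn_integral_cmult)
    finally show ?thesis .
  qed
  define \<theta> where "\<theta> = \<eta> / (2 * T powr (q - p))"
  have \<theta>: "\<theta> > 0" using \<eta> T by (simp add: \<theta>_def)
  have "\<forall>\<^sub>F n in sequentially. mass p (w n) < ennreal \<theta>"
    by (rule order_tendstoD(2)[OF 0]) (simp add: \<theta>)
  then show "\<forall>\<^sub>F n in sequentially. mass q (w n) \<le> ennreal \<eta>"
  proof eventually_elim
    case (elim n)
    have "mass q2 (w n) \<le> ennreal D" using C[of n] D(2) by (meson ennreal_leI order_trans)
    then have "mass q (w n) \<le> ennreal (T powr (q - q2)) * ennreal D + ennreal (T powr (q - p)) * ennreal \<theta>"
      using elim by (intro order_trans[OF le] add_mono mult_left_mono) auto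
    also have "\<dots> = ennreal \<eta>"
      using D T \<eta> \<theta> unfolding Tq by (simp add: ennreal_mult[symmetric] ennreal_plus[symmetric] \<theta>_def del: ennreal_plus)
    finally show ?case .
  qed
qed

lemma gagliardo_Fatou:
  assumes w: "\<And>n. w n \<in> borel_measurable borel" and u: "u \<in> borel_measurable borel"
    and lim: "AE x in lborel. (\<lambda>n. w n x) \<longlonglongrightarrow> u x"
    and C: "\<forall>\<^sub>F n in sequentially. gagliardo (w n) \<le> C"
  shows "gagliardo u \<le> C"
  unfolding gagliardo_kernel[OF u]
proof (rule nn_integral_le_of_AE_tendsto)
  note [measurable] = w u
  show "(\<lambda>z. ennreal (kernel z * \<bar>w n (fst z) - w n (snd z)\<bar> powr p)) \<in> borel_measurable lborel" for n by measurable
  show "AE z in lborel. (\<lambda>n. ennreal (kernel z * \<bar>w n (fst z) - w n (snd z)\<bar> powr p)) \<longlonglongrightarrow>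
     ennreal (kernel z * \<bar>u (fst z) - u (snd z)\<bar> powr p)"
    using AE_lborel_fst[OF lim] AE_lborel_snd[OF lim]
  proof eventually_elim
    case (elim z)
    then show ?case by (intro tendsto_ennrealI tendsto_mult tendsto_powr' tendsto_intros) (use p_pos in auto)
  qed
  show "\<forall>\<^sub>F n in sequentially. (\<integral>\<^sup>+ z. ennreal (kernel z * \<bar>w n (fst z) - w n (snd z)\<bar> powr p) \<partial>lborel) \<le> C"
    using C by (simp add: gagliardo_kernel[OF w])
qed

lemma potential_Fatou:
  assumes w: "\<And>n. w n \<in> borel_measurable borel" and u: "u \<in> borel_measurable borel"
    and lim: "AE x in lborel. (\<lambda>n. w n x) \<longlonglongrightarrow> u x"
    and C: "\<forall>\<^sub>F n in sequentially. potential (w n) \<le> C"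
  shows "potential u \<le> C"
  unfolding potential_def
proof (rule nn_integral_le_of_AE_tendsto)
  note [measurable] = w u
  show "(\<lambda>x. ennreal (V x * \<bar>w n x\<bar> powr p)) \<in> borel_measurable lborel" for n by measurable
  show "AE x in lborel. (\<lambda>n. ennreal (V x * \<bar>w n x\<bar> powr p)) \<longlonglongrightarrow> ennreal (V x * \<bar>u x\<bar> powr p)"
    using lim
  proof eventually_elim
    case (elim x)
    then show ?case by (intro tendsto_ennrealI tendsto_mult tendsto_powr' tendsto_intros) (use p_pos in auto)
  qed
  show "\<forall>\<^sub>F n in sequentially. (\<integral>\<^sup>+ x. ennreal (V x * \<bar>w n x\<bar> powr p) \<partial>lborel) \<le> C"
    using C by (simp add: potential_def)
qed

text \<open>Passing to a rapidly converging subsequence provides an integrable majorant, so that the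
  ordinary dominated convergence theorem applies to the lower order terms.\<close>

theorem wspace_compactness:
  fixes w :: "nat \<Rightarrow> 'a \<Rightarrow> real"
  assumes w: "\<And>n. w n \<in> wspace" and c: "\<And>n. wenergy (w n) \<le> c"
    and q: "p \<le> q1" "q1 < crit_power" "p \<le> q2" "q2 < crit_power"
  shows "\<exists>r u D1 D2 L. strict_mono r \<and> u \<in> wspace \<and> (AE x in lborel. (\<lambda>n. w (r n) x) \<longlonglongrightarrow> u x) \<and>
     (\<lambda>n. wenergy (w (r n))) \<longlonglongrightarrow> L \<and> wenergy u \<le> L \<and>
     integrable lborel D1 \<and> integrable lborel D2 \<and>
     (AE x in lborel. \<forall>n. \<bar>w (r n) x\<bar> powr q1 \<le> D1 x) \<and> (AE x in lborel. \<forall>n. \<bar>w (r n) x\<bar> powr q2 \<le> D2 x)"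
proof -
  have wm [measurable]: "w n \<in> borel_measurable borel" for n using w by measurable
  have c0: "c \<ge> 0" using c[of 0] wenergy_nonneg[of "w 0"] by linarith
  have gc: "gagliardo (w n) \<le> ennreal c" "potential (w n) \<le> ennreal c" for n
    using gagliardo_le_wenergy[OF w, of n] potential_le_wenergy[OF w, of n] c[of n] by (meson ennreal_leI order_trans)+
  obtain r1 u where r1: "strict_mono (r1 :: nat \<Rightarrow> nat)" and um [measurable]: "u \<in> borel_measurable borel"
    and lim1: "AE x in lborel. (\<lambda>n. w (r1 n) x) \<longlonglongrightarrow> u x" and m1: "(\<lambda>n. mass p (\<lambda>x. w (r1 n) x - u x)) \<longlonglongrightarrow> 0"
    using compact_embedding[of w c, OF wm c0 gc] by (elim exE conjE) (rule that)
  have uw: "u \<in> wspace"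
  proof (rule wspaceI[OF um])
    have "gagliardo u \<le> ennreal c" by (rule gagliardo_Fatou[OF _ um lim1]) (use gc in auto)
    then show "gagliardo u < \<infinity>" by (simp add: le_less_trans)
    have "potential u \<le> ennreal c" by (rule potential_Fatou[OF _ um lim1]) (use gc in auto)
    then show "potential u < \<infinity>" by (simp add: le_less_trans)
  qed
  have dw: "(\<lambda>x. w n x - u x) \<in> wspace" for n
    using wspace_add[OF w[of n] wspace_scale[OF uw, of "-1"]] by simp
  define c' where "c' = 2 powr p * (2 * (c + wenergy u))"
  have dE: "wenergy (\<lambda>x. w n x - u x) \<le> c'" for n
  proof -
    have "gagliardo (\<lambda>x. w n x - u x) \<le> ennreal (2 powr p) * (ennreal c + ennreal (wenergy u))"
      by (rule order_trans[OF gagliardo_diff_le]) (auto intro!: mult_left_mono add_mono gc gagliardo_le_wenergy uw)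
    moreover have "potential (\<lambda>x. w n x - u x) \<le> ennreal (2 powr p) * (ennreal c + ennreal (wenergy u))"
    proof -
      have "potential (\<lambda>x. w n x + - u x) \<le> ennreal (2 powr p) * (potential (w n) + potential (\<lambda>x. - u x))"
        by (rule potential_add_le) auto
      also have "potential (\<lambda>x. - u x) = potential u" by (simp add: potential_def)
      also have "ennreal (2 powr p) * (potential (w n) + potential u) \<le> ennreal (2 powr p) * (ennreal c + ennreal (wenergy u))"
        by (intro mult_left_mono add_mono gc(2) potential_le_wenergy[OF uw]) simp
      finally show ?thesis by simp
    qed
    ultimately have "ennreal (wenergy (\<lambda>x. w n x - u x)) \<le> ennreal (2 powr p) * (ennreal c + ennreal (wenergy u)) + ennreal (2 powr p) * (ennreal c + ennreal (wenergy u))"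
      unfolding wenergy_ennreal[OF dw, symmetric] by (rule add_mono)
    also have "\<dots> = ennreal c'"
      using c0 wenergy_nonneg[of u] by (simp add: c'_def ennreal_mult[symmetric] ennreal_plus[symmetric] algebra_simps del: ennreal_plus)
    finally show ?thesis
      using c0 wenergy_nonneg[of u] by (simp add: c'_def ennreal_le_iff)
  qed
  have mq: "(\<lambda>n. mass q (\<lambda>x. w (r1 n) x - u x)) \<longlonglongrightarrow> 0" if "p \<le> q" "q < crit_power" for q
  proof -
    \<comment> \<open>Room between \<open>q\<close> and the critical exponent provides the bounded
      higher mass for the interpolation.\<close>
    obtain q' where q': "q < q'" "q' < crit_power" using dense[OF \<open>q < crit_power\<close>] by blast
    have "p \<le> q'" using that q' by simp
    then obtain C where C: "C > 0" "\<And>u. u \<in> wspace \<Longrightarrow> mass q' u \<le> ennreal (C * wenergy u powr (q' / p))"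
      using sobolev_embedding[OF _ q'(2)] by blast
    have "mass q' (\<lambda>x. w (r1 n) x - u x) \<le> ennreal (C * c' powr (q' / p))" for n
    proof -
      have "C * wenergy (\<lambda>x. w (r1 n) x - u x) powr (q' / p) \<le> C * c' powr (q' / p)"
        using C dE[of "r1 n"] wenergy_nonneg \<open>p \<le> q'\<close> p_pos by (intro mult_left_mono powr_mono2) auto
      then show ?thesis using C(2)[OF dw, of "r1 n"] by (meson ennreal_leI order_trans)
    qed
    then show ?thesis by (intro mass_tendsto_interpolate[OF _ m1 _ that(1) q'(1)]) auto
  qed
  obtain r2 where r2: "strict_mono (r2 :: nat \<Rightarrow> nat)"
    and s1: "\<And>n. mass q1 (\<lambda>x. w (r1 (r2 n)) x - u x) \<le> ennreal ((1/2) ^ n)"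
    and s2: "\<And>n. mass q2 (\<lambda>x. w (r1 (r2 n)) x - u x) \<le> ennreal ((1/2) ^ n)"
    using rapid_subsequence[OF mq[OF q(1,2)] mq[OF q(3,4)]] by blast
  \<comment> \<open>The two parts of the energy are given limits of their own, because lower
    semicontinuity is known for each of them separately.\<close>
  have bG: "bounded (range (\<lambda>n. (enn2real (gagliardo (w (r1 (r2 n)))), enn2real (potential (w (r1 (r2 n)))))))"
  proof (rule bounded_subset[OF bounded_Times[OF bounded_closed_interval[of 0 c] bounded_closed_interval[of 0 c]]])
    have "enn2real x \<le> c" if "x \<le> ennreal c" for x
      using enn2real_mono[OF that] c0 by simp
    then show "range (\<lambda>n. (enn2real (gagliardo (w (r1 (r2 n)))), enn2real (potential (w (r1 (r2 n)))))) \<subseteq> {0..c} \<times> {0..c}"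
      using gc by auto
  qed
  obtain l :: "real \<times> real" and r3 where r3: "strict_mono (r3 :: nat \<Rightarrow> nat)"
    and l: "((\<lambda>n. (enn2real (gagliardo (w (r1 (r2 n)))), enn2real (potential (w (r1 (r2 n)))))) \<circ> r3) \<longlonglongrightarrow> l"
    using bounded_imp_convergent_subsequence[OF bG] by blast
  define r where "r = (\<lambda>n. r1 (r2 (r3 n)))"
  have rm: "strict_mono r" unfolding r_def using strict_mono_o[OF r1 strict_mono_o[OF r2 r3]] by (simp add: o_def)
  have gl: "(\<lambda>n. enn2real (gagliardo (w (r n)))) \<longlonglongrightarrow> fst l" and pl: "(\<lambda>n. enn2real (potential (w (r n)))) \<longlonglongrightarrow> snd l"
    using tendsto_fst[OF l] tendsto_snd[OF l] by (simp_all add: o_def r_def)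
  have er: "gagliardo (w n) = ennreal (enn2real (gagliardo (w n)))" "potential (w n) = ennreal (enn2real (potential (w n)))" for n
    using w[of n] by (simp_all add: wspace_def)
  have r12: "strict_mono (\<lambda>n. r2 (r3 n))" using strict_mono_o[OF r2 r3] by (simp add: o_def)
  have lim: "AE x in lborel. (\<lambda>n. w (r n) x) \<longlonglongrightarrow> u x"
    using lim1 by eventually_elim (use LIMSEQ_subseq_LIMSEQ[OF _ r12] in \<open>auto simp: o_def r_def\<close>)
  have E: "(\<lambda>n. wenergy (w (r n))) \<longlonglongrightarrow> fst l + snd l"
  proof -
    have "wenergy (w n) = enn2real (gagliardo (w n)) + enn2real (potential (w n))" for n
      unfolding wenergy_def using w[of n] by (intro enn2real_plus) (auto simp: wspace_def)
    then show ?thesis using tendsto_add[OF gl pl] by simp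
  qed
  have le: "wenergy u \<le> fst l + snd l"
  proof (rule field_le_epsilon)
    fix \<epsilon> :: real assume \<epsilon>: "\<epsilon> > 0"
    have l0: "fst l \<ge> 0" "snd l \<ge> 0" by (rule LIMSEQ_le_const[OF gl], simp, rule LIMSEQ_le_const[OF pl], simp)
    have "\<forall>\<^sub>F n in sequentially. enn2real (gagliardo (w (r n))) < fst l + \<epsilon> / 2"
      by (rule order_tendstoD[OF gl]) (use \<epsilon> in simp)
    then have "\<forall>\<^sub>F n in sequentially. gagliardo (w (r n)) \<le> ennreal (fst l + \<epsilon> / 2)"
      by eventually_elim (subst er, rule ennreal_leI, simp)
    then have 1: "gagliardo u \<le> ennreal (fst l + \<epsilon> / 2)" by (intro gagliardo_Fatou[OF _ um lim]) auto
    have "\<forall>\<^sub>F n in sequentially. enn2real (potential (w (r n))) < snd l + \<epsilon> / 2"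
      by (rule order_tendstoD[OF pl]) (use \<epsilon> in simp)
    then have "\<forall>\<^sub>F n in sequentially. potential (w (r n)) \<le> ennreal (snd l + \<epsilon> / 2)"
      by eventually_elim (subst er, rule ennreal_leI, simp)
    then have 2: "potential u \<le> ennreal (snd l + \<epsilon> / 2)" by (intro potential_Fatou[OF _ um lim]) auto
    have "ennreal (wenergy u) \<le> ennreal (fst l + \<epsilon> / 2) + ennreal (snd l + \<epsilon> / 2)"
      unfolding wenergy_ennreal[OF uw, symmetric] using 1 2 by (rule add_mono)
    also have "\<dots> = ennreal (fst l + snd l + \<epsilon>)"
      using \<epsilon> l0 by (simp add: ennreal_plus[symmetric] algebra_simps del: ennreal_plus)
    finally show "wenergy u \<le> fst l + snd l + \<epsilon>" using \<epsilon> l0 by (subst (asm) ennreal_le_iff) auto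
  qed
  have maj: "\<exists>D. integrable lborel D \<and> (AE x in lborel. \<forall>n. \<bar>w (r n) x\<bar> powr q \<le> D x)"
    if q: "p \<le> q" "q < crit_power" and sq: "\<And>n. mass q (\<lambda>x. w (r1 (r2 n)) x - u x) \<le> ennreal ((1/2) ^ n)" for q
  proof -
    have q0: "q \<ge> 0" using q p_pos by linarith
    \<comment> \<open>Along the fast subsequence this dominates
      \<open>\<bar>u x\<bar> powr q\<close> plus each single error term, and the geometric bounds
      make its integral finite.\<close>
    define S where "S = (\<lambda>x. ennreal (\<bar>u x\<bar> powr q) + (\<Sum>n. ennreal (\<bar>w (r1 (r2 n)) x - u x\<bar> powr q)))"
    have [measurable]: "S \<in> borel_measurable borel" unfolding S_def by measurable
    obtain C where C: "C > 0" "\<And>u. u \<in> wspace \<Longrightarrow> mass q u \<le> ennreal (C * wenergy u powr (q / p))"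
      using sobolev_embedding[OF q] by blast
    have "(\<integral>\<^sup>+ x. S x \<partial>lborel) = mass q u + (\<Sum>n. mass q (\<lambda>x. w (r1 (r2 n)) x - u x))"
      unfolding S_def mass_def by (subst nn_integral_add) (auto simp: nn_integral_suminf)
    also have "\<dots> \<le> ennreal (C * wenergy u powr (q / p)) + (\<Sum>n. ennreal ((1/2) ^ n))"
      by (intro add_mono C uw suminf_le sq) auto
    also have "(\<Sum>n. ennreal ((1/2) ^ n)) = ennreal (\<Sum>n. (1/2) ^ n)"
      by (rule suminf_ennreal2) (auto intro: summable_geometric)
    finally have Sfin: "(\<integral>\<^sup>+ x. S x \<partial>lborel) < \<infinity>" by (auto simp: le_less_trans)
    have AEf: "AE x in lborel. S x < \<infinity>"
      using nn_integral_noteq_infinite[of S lborel] Sfin by (auto simp: less_top)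
    have int: "integrable lborel (\<lambda>x. 2 powr q * enn2real (S x))"
    proof (rule integrable_mult_right, rule integrableI_nonneg)
      have "(\<integral>\<^sup>+ x. ennreal (enn2real (S x)) \<partial>lborel) = (\<integral>\<^sup>+ x. S x \<partial>lborel)"
        by (rule nn_integral_cong_AE) (use AEf in \<open>auto elim: eventually_mono\<close>)
      then show "(\<integral>\<^sup>+ x. ennreal (enn2real (S x)) \<partial>lborel) < \<infinity>" using Sfin by simp
    qed auto
    have "AE x in lborel. \<forall>n. \<bar>w (r n) x\<bar> powr q \<le> 2 powr q * enn2real (S x)"
      using AEf
    proof eventually_elim
      case (elim x)
      show ?case
      proof
        fix n
        have "\<bar>w (r n) x\<bar> powr q \<le> 2 powr q * (\<bar>u x\<bar> powr q + \<bar>w (r n) x - u x\<bar> powr q)"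
          using abs_add_powr_le[OF q0, of "u x" "w (r n) x - u x"] by simp
        also have "\<bar>u x\<bar> powr q + \<bar>w (r n) x - u x\<bar> powr q \<le> enn2real (S x)"
        proof -
          have "ennreal (\<bar>w (r1 (r2 (r3 n))) x - u x\<bar> powr q) \<le> (\<Sum>n. ennreal (\<bar>w (r1 (r2 n)) x - u x\<bar> powr q))"
            by (rule ennreal_term_le_suminf)
          from add_left_mono[OF this, of "ennreal (\<bar>u x\<bar> powr q)"]
          have "ennreal (\<bar>u x\<bar> powr q) + ennreal (\<bar>w (r n) x - u x\<bar> powr q) \<le> S x"
            by (simp only: S_def r_def)
          then have "ennreal (\<bar>u x\<bar> powr q + \<bar>w (r n) x - u x\<bar> powr q) \<le> S x"
            by (subst ennreal_plus) simp_all
          then have "enn2real (ennreal (\<bar>u x\<bar> powr q + \<bar>w (r n) x - u x\<bar> powr q)) \<le> enn2real (S x)"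
            using elim by (intro enn2real_mono) auto
          then show ?thesis by (subst (asm) enn2real_ennreal) simp_all
        qed
        finally show "\<bar>w (r n) x\<bar> powr q \<le> 2 powr q * enn2real (S x)" by simp
      qed
    qed
    then show ?thesis using int by blast
  qed
  obtain D1 where D1: "integrable lborel D1" "AE x in lborel. \<forall>n. \<bar>w (r n) x\<bar> powr q1 \<le> D1 x"
    using maj[OF q(1,2) s1] by (elim exE conjE) (rule that)
  obtain D2 where D2: "integrable lborel D2" "AE x in lborel. \<forall>n. \<bar>w (r n) x\<bar> powr q2 \<le> D2 x"
    using maj[OF q(3,4) s2] by (elim exE conjE) (rule that)
  show ?thesis
    using rm uw lim E le D1 D2
    by (intro exI[of _ r] exI[of _ u] exI[of _ D1] exI[of _ D2] exI[of _ "fst l + snd l"] conjI)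
qed

end

section \<open>Directional derivatives and bump functions\<close>

lemma abs_powr_has_derivative:
  fixes x r :: real
  assumes r: "r > 1"
  shows "((\<lambda>x. \<bar>x\<bar> powr r) has_real_derivative r * (\<bar>x\<bar> powr (r - 2) * x)) (at x)"
proof (cases "x = 0")
  case True
  have "((\<lambda>h::real. \<bar>h\<bar> powr (r - 1)) \<longlongrightarrow> 0) (at 0)"
    by (rule tendsto_zero_powrI[of _ _ "\<lambda>_. r - 1" "r - 1"]) (use r in \<open>auto intro!: tendsto_eq_intros\<close>)
  then have "((\<lambda>h::real. \<bar>h\<bar> powr r / h) \<longlongrightarrow> 0) (at 0)"
  proof (rule Lim_null_comparison[rotated])
    have "norm (\<bar>h\<bar> powr r / h) \<le> \<bar>h\<bar> powr (r - 1)" for h :: real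
      by (cases "h = 0") (auto simp: abs_mult powr_diff)
    then show "\<forall>\<^sub>F h in at (0::real). norm (\<bar>h\<bar> powr r / h) \<le> \<bar>h\<bar> powr (r - 1)" by auto
  qed
  then show ?thesis using True by (simp add: has_field_derivative_iff)
next
  case False
  then consider "x > 0" | "x < 0" by linarith
  then show ?thesis
  proof cases
    case 1
    have "((\<lambda>x. x powr r) has_real_derivative r * x powr (r - 1)) (at x)"
      by (rule has_real_derivative_powr[OF 1])
    moreover have "x powr (r - 1) = \<bar>x\<bar> powr (r - 2) * x"
      using 1 by (simp add: powr_diff power2_eq_square powr_numeral)
    ultimately have "((\<lambda>x. x powr r) has_real_derivative r * (\<bar>x\<bar> powr (r - 2) * x)) (at x)" by simp
    then show ?thesis
      by (rule DERIV_cong_ev[THEN iffD1, rotated -1, OF _ refl _ refl])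
        (use eventually_nhds_in_open[of "{0<..}" x] 1 in \<open>auto elim!: eventually_mono\<close>)
  next
    case 2
    have "((\<lambda>x. (- x) powr r) has_real_derivative (r * (- x) powr (r - 1)) * (-1)) (at x)"
      by (rule DERIV_chain2[OF has_real_derivative_powr]) (use 2 in \<open>auto intro!: derivative_eq_intros\<close>)
    moreover have "(- x) powr (r - 1) * (-1) = \<bar>x\<bar> powr (r - 2) * x"
      using 2 by (simp add: powr_diff power2_eq_square powr_numeral)
    ultimately have "((\<lambda>x. (- x) powr r) has_real_derivative r * (\<bar>x\<bar> powr (r - 2) * x)) (at x)"
      by (simp only: mult.assoc)
    then show ?thesis
      by (rule DERIV_cong_ev[THEN iffD1, rotated -1, OF _ refl _ refl])
        (use eventually_nhds_in_open[of "{..<0}" x] 2 in \<open>auto elim!: eventually_mono\<close>)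
  qed
qed

lemma abs_powr_mult_self: "\<bar>x\<bar> powr (r - 2) * x * x = \<bar>x :: real\<bar> powr r"
proof -
  have "\<bar>x\<bar> powr (r - 2) * (x * x) = \<bar>x\<bar> powr (r - 2) * (\<bar>x\<bar> powr 2)"
    by (simp add: powr_numeral power2_eq_square)
  also have "\<bar>x\<bar> powr (r - 2) * \<bar>x\<bar> powr 2 = \<bar>x\<bar> powr (r - 2 + 2)" by (rule powr_add[symmetric])
  also have "\<dots> = \<bar>x\<bar> powr r" by simp
  finally show ?thesis by (simp add: mult.assoc)
qed

lemma abs_powr_mult_abs: "\<bar>x\<bar> powr (r - 2) * \<bar>x\<bar> = \<bar>x :: real\<bar> powr (r - 1)"
proof -
  have "\<bar>x\<bar> powr (r - 2) * \<bar>x\<bar> powr 1 = \<bar>x\<bar> powr (r - 2 + 1)" by (rule powr_add[symmetric])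
  then show ?thesis by simp
qed

text \<open>The mean value theorem bounds the difference quotients independently of
  \<open>e\<close>, as dominated convergence requires.\<close>

lemma abs_powr_quotient_bound:
  fixes a b e r :: real
  assumes r: "r > 1" and e: "0 < e" "e \<le> 1"
  shows "\<bar>(\<bar>a + e * b\<bar> powr r - \<bar>a\<bar> powr r) / e\<bar> \<le> r * 2 powr r * (\<bar>a\<bar> powr r + \<bar>b\<bar> powr r)"
proof -
  let ?D = "\<lambda>t. r * (\<bar>a + t * b\<bar> powr (r - 2) * (a + t * b)) * b"
  have "((\<lambda>t. \<bar>a + t * b\<bar> powr r) has_real_derivative ?D t) (at t)" for t
    by (rule DERIV_chain2[OF abs_powr_has_derivative[OF r]]) (auto intro!: derivative_eq_intros)
  then obtain z where z: "0 < z" "z < e" "\<bar>a + e * b\<bar> powr r - \<bar>a + 0 * b\<bar> powr r = (e - 0) * ?D z"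
    using MVT2[of 0 e "\<lambda>t. \<bar>a + t * b\<bar> powr r" ?D] e by auto
  have q: "(\<bar>a + e * b\<bar> powr r - \<bar>a\<bar> powr r) / e = ?D z" using z(3) e by (simp add: field_simps)
  have le: "\<bar>a + z * b\<bar> \<le> \<bar>a\<bar> + \<bar>b\<bar>"
  proof -
    have "\<bar>z * b\<bar> \<le> 1 * \<bar>b\<bar>" unfolding abs_mult using z e by (intro mult_right_mono) auto
    then show ?thesis by linarith
  qed
  have "\<bar>?D z\<bar> = r * (\<bar>a + z * b\<bar> powr (r - 2) * \<bar>a + z * b\<bar>) * \<bar>b\<bar>"
    using r by (simp add: abs_mult)
  also have "\<dots> = r * (\<bar>a + z * b\<bar> powr (r - 1) * \<bar>b\<bar>)" by (simp add: abs_powr_mult_abs)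
  also have "\<dots> \<le> r * ((\<bar>a\<bar> + \<bar>b\<bar>) powr (r - 1) * (\<bar>a\<bar> + \<bar>b\<bar>))"
    using r le by (intro mult_left_mono mult_mono powr_mono2) auto
  also have "(\<bar>a\<bar> + \<bar>b\<bar>) powr (r - 1) * (\<bar>a\<bar> + \<bar>b\<bar>) = (\<bar>a\<bar> + \<bar>b\<bar>) powr r"
    by (cases "\<bar>a\<bar> + \<bar>b\<bar> = 0") (auto simp: powr_diff)
  also have "r * (\<bar>a\<bar> + \<bar>b\<bar>) powr r \<le> r * (2 powr r * (\<bar>a\<bar> powr r + \<bar>b\<bar> powr r))"
    using r by (intro mult_left_mono powr_add_le) auto
  finally show ?thesis unfolding q by (simp add: mult_ac)
qed

text \<open>Applied to the kernel on pairs of points, to \<open>V\<close> and to \<beta>; because of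
  the last one the weight may change sign.\<close>

lemma powr_integral_direction:
  fixes w f g :: "'b \<Rightarrow> real"
  assumes r: "r > 1" and [measurable]: "w \<in> borel_measurable M" "f \<in> borel_measurable M" "g \<in> borel_measurable M"
    and f: "integrable M (\<lambda>x. w x * \<bar>f x\<bar> powr r)" and g: "integrable M (\<lambda>x. w x * \<bar>g x\<bar> powr r)"
    and e: "e \<longlonglongrightarrow> 0" "\<And>n. 0 < e n" "\<And>n. e n \<le> 1"
  shows "integrable M (\<lambda>x. w x * (\<bar>f x\<bar> powr (r - 2) * f x * g x))"
    and "integrable M (\<lambda>x. w x * \<bar>f x + e n * g x\<bar> powr r)"
    and "(\<lambda>n. ((LINT x|M. w x * \<bar>f x + e n * g x\<bar> powr r) - (LINT x|M. w x * \<bar>f x\<bar> powr r)) / e n)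
       \<longlonglongrightarrow> r * (LINT x|M. w x * (\<bar>f x\<bar> powr (r - 2) * f x * g x))"
proof -
  define s where "s = (\<lambda>n x. w x * ((\<bar>f x + e n * g x\<bar> powr r - \<bar>f x\<bar> powr r) / e n))"
  define D where "D = (\<lambda>x. r * 2 powr r * (\<bar>w x * \<bar>f x\<bar> powr r\<bar> + \<bar>w x * \<bar>g x\<bar> powr r\<bar>))"
  have D: "integrable M D" unfolding D_def using f g by (intro integrable_mult_right Bochner_Integration.integrable_add integrable_abs)
  have e0: "filterlim e (at 0) sequentially"
    by (rule filterlim_atI[OF e(1)]) (simp add: e(2) less_imp_neq[symmetric])
  have lim: "(\<lambda>n. s n x) \<longlonglongrightarrow> w x * (r * (\<bar>f x\<bar> powr (r - 2) * f x) * g x)" for x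
  proof -
    have "((\<lambda>t. \<bar>f x + t * g x\<bar> powr r) has_real_derivative r * (\<bar>f x + 0 * g x\<bar> powr (r - 2) * (f x + 0 * g x)) * g x) (at 0)"
      by (rule DERIV_chain2[OF abs_powr_has_derivative[OF r]]) (auto intro!: derivative_eq_intros)
    then have "((\<lambda>t. (\<bar>f x + t * g x\<bar> powr r - \<bar>f x\<bar> powr r) / t) \<longlongrightarrow> r * (\<bar>f x\<bar> powr (r - 2) * f x) * g x) (at 0)"
      by (simp add: has_field_derivative_iff)
    from filterlim_compose[OF this e0] show ?thesis unfolding s_def by (intro tendsto_mult tendsto_const)
  qed
  have sD: "norm (s n x) \<le> D x" for n x
  proof -
    have "norm (s n x) = \<bar>w x\<bar> * \<bar>(\<bar>f x + e n * g x\<bar> powr r - \<bar>f x\<bar> powr r) / e n\<bar>"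
      unfolding s_def by (simp only: real_norm_def abs_mult)
    also have "\<dots> \<le> \<bar>w x\<bar> * (r * 2 powr r * (\<bar>f x\<bar> powr r + \<bar>g x\<bar> powr r))"
      by (intro mult_left_mono abs_powr_quotient_bound r e) auto
    finally show ?thesis by (simp add: D_def abs_mult algebra_simps)
  qed
  have [measurable]: "s n \<in> borel_measurable M" for n unfolding s_def by measurable
  have Dm [measurable]: "D \<in> borel_measurable M" unfolding D_def by measurable
  have si: "integrable M (s n)" for n
  proof (rule Bochner_Integration.integrable_bound[OF D])
    show "AE x in M. norm (s n x) \<le> norm (D x)"
    proof (rule AE_I2)
      fix x
      show "norm (s n x) \<le> norm (D x)" using sD[of n x] by simp
    qed
  qed measurable
  have L: "integrable M (\<lambda>x. w x * (r * (\<bar>f x\<bar> powr (r - 2) * f x) * g x))"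
    by (rule integrable_dominated_convergence[where s = s, OF _ _ D]) (use lim sD in auto)
  have "(\<lambda>x. w x * (\<bar>f x\<bar> powr (r - 2) * f x * g x)) = (\<lambda>x. (1 / r) * (w x * (r * (\<bar>f x\<bar> powr (r - 2) * f x) * g x)))"
    using r by (auto simp: field_simps)
  then show "integrable M (\<lambda>x. w x * (\<bar>f x\<bar> powr (r - 2) * f x * g x))"
    using integrable_mult_right[OF L, of "1 / r"] by simp
  have eq: "w x * \<bar>f x + e n * g x\<bar> powr r = e n * s n x + w x * \<bar>f x\<bar> powr r" for n x
    using e(2)[of n] by (simp add: s_def field_simps)
  show i: "integrable M (\<lambda>x. w x * \<bar>f x + e n * g x\<bar> powr r)" for n
    unfolding eq using si f by (intro Bochner_Integration.integrable_add integrable_mult_right)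
  have "(\<lambda>n. LINT x|M. s n x) \<longlonglongrightarrow> (LINT x|M. w x * (r * (\<bar>f x\<bar> powr (r - 2) * f x) * g x))"
    by (rule integral_dominated_convergence[OF _ _ D]) (use lim sD in auto)
  also have "(LINT x|M. w x * (r * (\<bar>f x\<bar> powr (r - 2) * f x) * g x)) = r * (LINT x|M. w x * (\<bar>f x\<bar> powr (r - 2) * f x * g x))"
    by (subst integral_mult_right_zero[symmetric]) (simp add: mult_ac)
  also have "(\<lambda>n. LINT x|M. s n x) = (\<lambda>n. ((LINT x|M. w x * \<bar>f x + e n * g x\<bar> powr r) - (LINT x|M. w x * \<bar>f x\<bar> powr r)) / e n)"
  proof
    fix n
    show "(LINT x|M. s n x) = ((LINT x|M. w x * \<bar>f x + e n * g x\<bar> powr r) - (LINT x|M. w x * \<bar>f x\<bar> powr r)) / e n"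
      unfolding eq using si f e(2)[of n] by simp
  qed
  finally show "(\<lambda>n. ((LINT x|M. w x * \<bar>f x + e n * g x\<bar> powr r) - (LINT x|M. w x * \<bar>f x\<bar> powr r)) / e n)
       \<longlonglongrightarrow> r * (LINT x|M. w x * (\<bar>f x\<bar> powr (r - 2) * f x * g x))" .
qed

lemma dyadic_shell_inside:
  fixes t :: real
  assumes "0 < t" "t < 1"
  shows "\<exists>j. (1/2) ^ Suc j \<le> t \<and> t < (1/2) ^ j"
proof -
  have "\<exists>n. (1/2::real) ^ n < t" by (rule real_arch_pow_inv) (use assms in auto)
  then have ex: "\<exists>n. (1/2::real) ^ n \<le> t" by (auto intro: less_imp_le)
  define n where "n = (LEAST n. (1/2::real) ^ n \<le> t)"
  have n: "(1/2::real) ^ n \<le> t" unfolding n_def using ex by (rule LeastI_ex)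
  then have "n \<noteq> 0" using assms by (intro notI) simp
  then obtain j where j: "n = Suc j" using not0_implies_Suc by blast
  have "\<not> (1/2::real) ^ j \<le> t" using not_less_Least[of j "\<lambda>n. (1/2::real) ^ n \<le> t"] j by (simp add: n_def)
  then show ?thesis using n j by auto
qed

lemma dyadic_shell_outside:
  fixes t :: real
  assumes "1 \<le> t"
  shows "\<exists>j. 2 ^ j \<le> t \<and> t < 2 ^ Suc j"
proof -
  have ex: "\<exists>n. t < (2::real) ^ n" by (rule real_arch_pow) simp
  define n where "n = (LEAST n. t < (2::real) ^ n)"
  have n: "t < (2::real) ^ n" unfolding n_def using ex by (rule LeastI_ex)
  then have "n \<noteq> 0" using assms by (intro notI) simp
  then obtain j where j: "n = Suc j" using not0_implies_Suc by blast
  have "\<not> t < (2::real) ^ j" using not_less_Least[of j "\<lambda>n. t < (2::real) ^ n"] j by (simp add: n_def)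
  then show ?thesis using n j by (intro exI[of _ j]) (simp add: not_less)
qed

section \<open>Integrability of the truncated kernel and Lipschitz bumps\<close>

context weighted_fractional
begin

text \<open>Dyadic shells around \<open>x\<close>: those inside the unit ball contribute a geometric
  series of ratio \<open>2 powr (- (p * (1 - s)))\<close>, convergent since \<open>s < 1\<close>;
  those outside contribute one of ratio \<open>2 powr (- (s * p))\<close>.\<close>

lemma singular_kernel_integral:
  assumes s1: "s < 1" and L: "L > 0"
  shows "\<exists>C. \<forall>x::'a. (\<integral>\<^sup>+ y. ennreal (min (L * norm (x - y) powr p) 1 / norm (x - y) powr expo) \<partial>lborel) \<le> ennreal C"
proof -
  let ?\<omega> = "unit_ball_vol (real DIM('a))"
  define \<rho> where "\<rho> = 2 powr (- (p * (1 - s)))"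
  define \<sigma> where "\<sigma> = 2 powr (- (s * p))"
  have \<rho>: "0 \<le> \<rho>" "\<rho> < 1" using p_pos s1 powr_less_mono[of "- (p * (1 - s))" 0 2] by (auto simp: \<rho>_def)
  have \<sigma>: "0 \<le> \<sigma>" "\<sigma> < 1" using sp_pos powr_less_mono[of "- (s * p)" 0 2] by (auto simp: \<sigma>_def)
  \<comment> \<open>\<open>a j\<close> and \<open>b j\<close> bound the integrand on the inner and
    outer shells. The shells are then enlarged to balls, whose volumes are explicit.\<close>
  define a where "a = (\<lambda>j::nat. L * ((1/2) ^ j) powr p / ((1/2) ^ Suc j) powr expo)"
  define b where "b = (\<lambda>j::nat. 1 / (2 ^ j) powr expo)"
  have ab: "a j \<ge> 0" "b j \<ge> 0" for j using L by (auto simp: a_def b_def)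
  define ca where "ca = L * 2 powr expo * ?\<omega>"
  define cb where "cb = 2 ^ DIM('a) * ?\<omega>"
  have w: "?\<omega> \<ge> 0" by simp
  have half: "(1/2::real) ^ j = 2 powr (- real j)" for j
    by (simp add: powr_minus powr_realpow power_one_over inverse_eq_divide)
  have two: "(2::real) ^ j = 2 powr real j" for j
    by (simp add: powr_realpow)
  have pw: "(2 powr x :: real) ^ n = 2 powr (x * real n)" for x n
    by (simp add: powr_power mult.commute)
  have aj: "a j * (?\<omega> * ((1/2) ^ j) ^ DIM('a)) = ca * \<rho> ^ j" for j
  proof -
    have "a j * (?\<omega> * ((1/2) ^ j) ^ DIM('a))
       = L * ?\<omega> * (2 powr (- real j * p) / 2 powr (- real (Suc j) * expo) * 2 powr (- real j * real DIM('a)))"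
      unfolding a_def half pw powr_powr by simp
    also have "2 powr (- real j * p) / 2 powr (- real (Suc j) * expo) * 2 powr (- real j * real DIM('a))
       = (2::real) powr (expo + (- (p * (1 - s)) * real j))"
      unfolding powr_diff[symmetric] powr_add[symmetric]
      by (rule arg_cong[of _ _ "\<lambda>x. 2 powr x"]) (simp add: expo_eq algebra_simps)
    also have "\<dots> = 2 powr expo * \<rho> ^ j" unfolding \<rho>_def pw by (rule powr_add)
    finally show ?thesis by (simp add: ca_def)
  qed
  have bj: "b j * (?\<omega> * (2 ^ Suc j) ^ DIM('a)) = cb * \<sigma> ^ j" for j
  proof -
    have "b j * (?\<omega> * (2 ^ Suc j) ^ DIM('a))
        = ?\<omega> * (2 powr (real (Suc j) * real DIM('a)) / 2 powr (real j * expo))"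
      unfolding b_def two pw powr_powr by (simp del: of_nat_Suc)
    also have "2 powr (real (Suc j) * real DIM('a)) / 2 powr (real j * expo) = (2::real) powr (real DIM('a) + - (s * p) * real j)"
      unfolding powr_diff[symmetric]
      by (rule arg_cong[of _ _ "\<lambda>x. 2 powr x"]) (simp add: expo_eq algebra_simps)
    also have "\<dots> = 2 ^ DIM('a) * \<sigma> ^ j" unfolding \<sigma>_def pw two by (rule powr_add)
    finally show ?thesis by (simp add: cb_def)
  qed
  have "(\<integral>\<^sup>+ y. ennreal (min (L * norm (x - y) powr p) 1 / norm (x - y) powr expo) \<partial>lborel) \<le> ennreal (ca * (1 / (1 - \<rho>)) + cb * (1 / (1 - \<sigma>)))" for x :: 'a
  proof -
    have [measurable]: "ball x t \<in> sets borel" for t by simp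
    have "(\<integral>\<^sup>+ y. ennreal (min (L * norm (x - y) powr p) 1 / norm (x - y) powr expo) \<partial>lborel)
      \<le> (\<integral>\<^sup>+ y. (\<Sum>j. ennreal (a j) * indicator (ball x ((1/2) ^ j)) y) + (\<Sum>j. ennreal (b j) * indicator (ball x (2 ^ Suc j)) y) \<partial>lborel)"
    proof (rule nn_integral_mono)
      fix y
      define t where "t = norm (x - y)"
      consider "t = 0" | "0 < t" "t < 1" | "1 \<le> t" unfolding t_def by (metis norm_ge_zero not_le less_eq_real_def)
      then show "ennreal (min (L * norm (x - y) powr p) 1 / norm (x - y) powr expo)
         \<le> (\<Sum>j. ennreal (a j) * indicator (ball x ((1/2) ^ j)) y) + (\<Sum>j. ennreal (b j) * indicator (ball x (2 ^ Suc j)) y)"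
      proof cases
        case 1
        then show ?thesis by (simp add: t_def)
      next
        case 2
        obtain j where j: "(1/2) ^ Suc j \<le> t" "t < (1/2) ^ j" using dyadic_shell_inside[OF 2] by blast
        have "min (L * t powr p) 1 / t powr expo \<le> L * t powr p / t powr expo" by (intro divide_right_mono) auto
        also have "\<dots> \<le> a j"
          unfolding a_def using j 2 L p_pos expo_pos
          by (intro frac_le mult_left_mono powr_mono2 mult_nonneg_nonneg) auto
        finally have "ennreal (min (L * t powr p) 1 / t powr expo) \<le> ennreal (a j) * indicator (ball x ((1/2) ^ j)) y"
          using j by (auto simp: t_def dist_norm intro: ennreal_leI)
        also have "\<dots> \<le> (\<Sum>j. ennreal (a j) * indicator (ball x ((1/2) ^ j)) y)" by (rule ennreal_term_le_suminf)
        finally show ?thesis unfolding t_def by (rule order_trans) (simp add: add_increasing2)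
      next
        case 3
        obtain j where j: "2 ^ j \<le> t" "t < 2 ^ Suc j" using dyadic_shell_outside[OF 3] by blast
        have "min (L * t powr p) 1 / t powr expo \<le> b j"
          unfolding b_def using j 3 expo_pos by (intro frac_le powr_mono2) auto
        then have "ennreal (min (L * t powr p) 1 / t powr expo) \<le> ennreal (b j) * indicator (ball x (2 ^ Suc j)) y"
          using j by (auto simp: t_def dist_norm intro: ennreal_leI)
        also have "\<dots> \<le> (\<Sum>j. ennreal (b j) * indicator (ball x (2 ^ Suc j)) y)" by (rule ennreal_term_le_suminf)
        finally show ?thesis unfolding t_def by (rule order_trans) (simp add: add_increasing)
      qed
    qed
    also have "\<dots> = (\<Sum>j. ennreal (a j) * emeasure lborel (ball x ((1/2) ^ j))) + (\<Sum>j. ennreal (b j) * emeasure lborel (ball x (2 ^ Suc j)))"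
      by (subst nn_integral_add) (auto simp: nn_integral_suminf nn_integral_cmult_indicator)
    also have "(\<Sum>j. ennreal (a j) * emeasure lborel (ball x ((1/2) ^ j))) = (\<Sum>j. ennreal (ca * \<rho> ^ j))"
      by (intro suminf_cong) (simp add: emeasure_ball ennreal_mult[symmetric] ab w aj del: power_Suc)
    also have "\<dots> = ennreal (\<Sum>j. ca * \<rho> ^ j)"
      by (rule suminf_ennreal2) (use \<rho> L w in \<open>auto simp: ca_def intro!: summable_mult summable_geometric\<close>)
    also have "(\<Sum>j. ca * \<rho> ^ j) = ca * (1 / (1 - \<rho>))"
      using \<rho> by (subst suminf_mult) (auto simp: suminf_geometric intro!: summable_geometric)
    also have "(\<Sum>j. ennreal (b j) * emeasure lborel (ball x (2 ^ Suc j))) = (\<Sum>j. ennreal (cb * \<sigma> ^ j))"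
      by (intro suminf_cong) (simp add: emeasure_ball ennreal_mult[symmetric] ab w bj del: power_Suc)
    also have "\<dots> = ennreal (\<Sum>j. cb * \<sigma> ^ j)"
      by (rule suminf_ennreal2) (use \<sigma> w in \<open>auto simp: cb_def intro!: summable_mult summable_geometric\<close>)
    also have "(\<Sum>j. cb * \<sigma> ^ j) = cb * (1 / (1 - \<sigma>))"
      using \<sigma> by (subst suminf_mult) (auto simp: suminf_geometric intro!: summable_geometric)
    also have "ennreal (ca * (1 / (1 - \<rho>))) + ennreal (cb * (1 / (1 - \<sigma>))) = ennreal (ca * (1 / (1 - \<rho>)) + cb * (1 / (1 - \<sigma>)))"
      using \<rho> \<sigma> L w by (intro ennreal_plus[symmetric]) (auto simp: ca_def cb_def intro!: mult_nonneg_nonneg)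
    finally show ?thesis .
  qed
  then show ?thesis by blast
qed

text \<open>The integrand is at most the truncated kernel and vanishes unless one of the two points
  lies in the ball. By symmetry the double integral is at most twice the kernel bound times the
  volume of the ball.\<close>

lemma lipschitz_bump_wspace:
  assumes s1: "s < 1" and VR: "\<And>x. norm x \<le> R \<Longrightarrow> V x \<le> CV"
    and [measurable]: "\<phi> \<in> borel_measurable borel"
    and \<phi>: "\<And>x. 0 \<le> \<phi> x" "\<And>x. \<phi> x \<le> 1" and L: "L > 0" "\<And>x y. \<bar>\<phi> x - \<phi> y\<bar> \<le> L * norm (x - y)"
    and supp: "\<And>x. R < norm x \<Longrightarrow> \<phi> x = 0"
  shows "\<phi> \<in> wspace"
proof (rule wspaceI)
  let ?k = "\<lambda>(x::'a) y. min (L powr p * norm (x - y) powr p) 1 / norm (x - y) powr expo"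
  obtain C where C: "\<And>x::'a. (\<integral>\<^sup>+ y. ennreal (?k x y) \<partial>lborel) \<le> ennreal C"
    using singular_kernel_integral[OF s1, of "L powr p"] L by auto
  have cb [measurable]: "cball (0::'a) R \<in> sets borel" by simp
  have fin: "emeasure lborel (cball (0::'a) R) < \<infinity>"
    using emeasure_bounded_finite[OF bounded_cball] by blast
  have one: "(\<integral>\<^sup>+ x. \<integral>\<^sup>+ y. indicator (cball 0 R) x * ennreal (?k x y) \<partial>lborel \<partial>lborel) \<le> ennreal C * emeasure lborel (cball (0::'a) R)"
  proof -
    have "(\<integral>\<^sup>+ x. \<integral>\<^sup>+ y. indicator (cball 0 R) x * ennreal (?k x y) \<partial>lborel \<partial>lborel)
       = (\<integral>\<^sup>+ x. indicator (cball 0 R) x * (\<integral>\<^sup>+ y. ennreal (?k x y) \<partial>lborel) \<partial>lborel)"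
      by (rule nn_integral_cong) (rule nn_integral_cmult, measurable)
    also have "\<dots> \<le> (\<integral>\<^sup>+ x. ennreal C * indicator (cball 0 R) x \<partial>(lborel :: 'a measure))"
      using C by (intro nn_integral_mono) (auto simp: indicator_def)
    also have "\<dots> = ennreal C * emeasure lborel (cball (0::'a) R)" by (rule nn_integral_cmult_indicator) measurable
    finally show ?thesis .
  qed
  have "gagliardo \<phi> \<le> (\<integral>\<^sup>+ x. \<integral>\<^sup>+ y. indicator (cball 0 R) x * ennreal (?k x y) + indicator (cball 0 R) y * ennreal (?k x y) \<partial>lborel \<partial>lborel)"
    unfolding gagliardo_def slice_def
  proof (intro nn_integral_mono)
    fix x y
    show "ennreal (\<bar>\<phi> x - \<phi> y\<bar> powr p / norm (x - y) powr expo)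
      \<le> indicator (cball 0 R) x * ennreal (?k x y) + indicator (cball 0 R) y * ennreal (?k x y)"
    proof (cases "x \<in> cball 0 R \<or> y \<in> cball 0 R")
      case True
      have "\<bar>\<phi> x - \<phi> y\<bar> \<le> 1" using \<phi>[of x] \<phi>[of y] by linarith
      then have "\<bar>\<phi> x - \<phi> y\<bar> powr p \<le> 1 powr p" using p_pos by (intro powr_mono2) auto
      moreover have "\<bar>\<phi> x - \<phi> y\<bar> powr p \<le> (L * norm (x - y)) powr p" using L p_pos by (intro powr_mono2) auto
      ultimately have "\<bar>\<phi> x - \<phi> y\<bar> powr p / norm (x - y) powr expo \<le> ?k x y"
        using L by (intro divide_right_mono) (auto simp: powr_mult)
      then have "ennreal (\<bar>\<phi> x - \<phi> y\<bar> powr p / norm (x - y) powr expo) \<le> ennreal (?k x y)" by (rule ennreal_leI)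
      then show ?thesis using True by (auto simp: indicator_def intro: add_increasing add_increasing2)
    next
      case False
      then have "\<phi> x = 0" "\<phi> y = 0" using supp by auto
      then show ?thesis by simp
    qed
  qed
  also have "\<dots> = (\<integral>\<^sup>+ x. \<integral>\<^sup>+ y. indicator (cball 0 R) x * ennreal (?k x y) \<partial>lborel \<partial>lborel)
     + (\<integral>\<^sup>+ x. \<integral>\<^sup>+ y. indicator (cball 0 R) y * ennreal (?k x y) \<partial>lborel \<partial>lborel)"
  proof -
    have [measurable]: "(\<lambda>x. \<integral>\<^sup>+ y. indicator (cball 0 R) x * ennreal (?k x y) \<partial>lborel) \<in> borel_measurable (lborel :: 'a measure)"
      by (rule lborel.borel_measurable_nn_integral) measurable
    have [measurable]: "(\<lambda>x. \<integral>\<^sup>+ y. indicator (cball 0 R) y * ennreal (?k x y) \<partial>lborel) \<in> borel_measurable (lborel :: 'a measure)"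
      by (rule lborel.borel_measurable_nn_integral) measurable
    show ?thesis
      by (subst nn_integral_add[symmetric], measurable, rule nn_integral_cong, rule nn_integral_add) measurable
  qed
  also have "(\<integral>\<^sup>+ x. \<integral>\<^sup>+ y. indicator (cball 0 R) y * ennreal (?k x y) \<partial>lborel \<partial>lborel)
     = (\<integral>\<^sup>+ y. \<integral>\<^sup>+ x. indicator (cball 0 R) y * ennreal (?k x y) \<partial>lborel \<partial>lborel)"
    by (rule lborel_pair.Fubini') measurable
  also have "\<dots> = (\<integral>\<^sup>+ x. \<integral>\<^sup>+ y. indicator (cball 0 R) x * ennreal (?k x y) \<partial>lborel \<partial>lborel)"
    by (simp add: norm_minus_commute)
  finally have "gagliardo \<phi> \<le> ennreal C * emeasure lborel (cball (0::'a) R) + ennreal C * emeasure lborel (cball (0::'a) R)"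
    using add_mono[OF one one] by (rule order_trans)
  also have "\<dots> < \<infinity>" using fin by (simp add: ennreal_mult_less_top)
  finally show "gagliardo \<phi> < \<infinity>" .
  have "potential \<phi> \<le> (\<integral>\<^sup>+ x. ennreal CV * indicator (cball 0 R) x \<partial>(lborel :: 'a measure))"
    unfolding potential_def
  proof (rule nn_integral_mono)
    fix x
    show "ennreal (V x * \<bar>\<phi> x\<bar> powr p) \<le> ennreal CV * indicator (cball 0 R) x"
    proof (cases "norm x \<le> R")
      case True
      have "\<bar>\<phi> x\<bar> powr p \<le> 1 powr p" using \<phi>[of x] p_pos by (intro powr_mono2) auto
      then have "V x * \<bar>\<phi> x\<bar> powr p \<le> CV * 1" using VR[OF True] V_pos[of x] by (intro mult_mono) auto
      then show ?thesis using True by (simp add: ennreal_leI)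
    next
      case False
      then show ?thesis using supp[of x] by simp
    qed
  qed
  also have "\<dots> = ennreal CV * emeasure lborel (cball (0::'a) R)" by (rule nn_integral_cmult_indicator) measurable
  also have "\<dots> < \<infinity>" using fin by (simp add: ennreal_mult_less_top)
  finally show "potential \<phi> < \<infinity>" .
qed measurable

end

section \<open>The Kirchhoff functional on the cone of nonnegative functions\<close>

lemma ex_compact_positive_measure:
  fixes S :: "'b::euclidean_space set"
  assumes S: "S \<in> sets borel" and pos: "emeasure lborel S > 0"
  shows "\<exists>K. compact K \<and> K \<subseteq> S \<and> emeasure lborel K > 0"
proof -
  obtain e where e: "e > 0" "ennreal e < emeasure lborel S"
  proof -
    obtain d where d: "0 < d" "d < emeasure lborel S" using dense[OF pos] by blast
    then have "d < top" using top.not_eq_extremum by fastforce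
    then obtain e where "d = ennreal e" "e \<ge> 0" by (cases d) auto
    then show thesis using d by (intro that[of e]) (auto simp: less_le)
  qed
  have "S \<in> sets lebesgue" using S by simp
  then obtain T where T: "closed T" "T \<subseteq> S" "emeasure lebesgue (S - T) < ennreal e"
    by (rule sets_lebesgue_inner_closed[OF _ e(1)])
  have Tb [measurable]: "T \<in> sets borel" using T by (simp add: borel_closed)
  have "emeasure lborel S \<le> emeasure lborel T + emeasure lborel (S - T)"
    using S T Tb by (subst plus_emeasure) (auto intro!: emeasure_mono)
  moreover have "emeasure lborel (S - T) < ennreal e"
    using T S Tb by simp
  ultimately have Tpos: "emeasure lborel T \<noteq> 0" using e(2) by auto
  have "\<exists>n. emeasure lborel (T \<inter> cball 0 (real n)) > 0"
  proof (rule ccontr)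
    assume "\<not> ?thesis"
    then have "\<And>n. emeasure lborel (T \<inter> cball 0 (real n)) = 0" by (simp add: zero_less_iff_neq_zero)
    then have "emeasure lborel (\<Union>n. T \<inter> cball 0 (real n)) = 0"
      by (intro emeasure_UN_eq_0) auto
    moreover have "(\<Union>n. T \<inter> cball 0 (real n)) = T" by (auto simp: real_arch_simple)
    ultimately show False using Tpos by simp
  qed
  then obtain n where "emeasure lborel (T \<inter> cball 0 (real n)) > 0" by blast
  moreover have "compact (T \<inter> cball 0 (real n))" using T by (intro closed_Int_compact) auto
  ultimately show ?thesis using T by blast
qed

locale kirchhoff_problem = weighted_fractional s p expo dimension V V0 h
  for s p expo :: real and dimension :: "'a::euclidean_space itself" and V :: "'a \<Rightarrow> real" and V0 h :: real +
  fixes \<alpha> \<beta> :: "'a \<Rightarrow> real" and \<delta> \<gamma> \<xi> \<tau> a m c\<beta> :: real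
  assumes s_lt_1: "s < 1" and V_locally_bounded: "\<And>R. \<exists>C. \<forall>x. norm x \<le> R \<longrightarrow> V x \<le> C"
    and \<alpha>_measurable [measurable]: "\<alpha> \<in> borel_measurable borel"
    and \<beta>_measurable [measurable]: "\<beta> \<in> borel_measurable borel"
    and \<alpha>_pos: "AE x in lborel. \<alpha> x > 0" and \<xi>_gt_1: "\<xi> > 1"
    and \<alpha>_integrable: "integrable lborel (\<lambda>x. \<bar>\<alpha> x\<bar> powr \<xi>)"
    and \<beta>_bounded: "AE x in lborel. \<bar>\<beta> x\<bar> \<le> c\<beta>"
    and \<beta>_plus: "\<not> (AE x in lborel. max (\<beta> x) 0 = 0)"
    and \<delta>_pos: "0 < \<delta>" and \<delta>_lt_1: "\<delta> < 1" and \<gamma>_gt: "p < \<gamma>" and \<gamma>_lt: "\<gamma> < crit_power"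
    and \<tau>_gt: "p < \<tau>" and \<tau>_lt: "\<tau> < crit_power" and conj: "1 / \<xi> + (1 - \<delta>) / \<tau> = 1"
    and a_pos: "0 < a" and m_pos: "0 < m" and pm_less: "p * (m + 1) < \<gamma>"
begin

definition cone :: "('a \<Rightarrow> real) set" where
  "cone = {u \<in> wspace. (AE x in lborel. u x \<ge> 0) \<and> \<not> (AE x in lborel. u x = 0)}"

definition P_fun :: "('a \<Rightarrow> real) \<Rightarrow> real" where
  "P_fun u = wenergy u powr (m + 1)"

definition A_fun :: "('a \<Rightarrow> real) \<Rightarrow> real" where
  "A_fun u = (LINT x|lborel. \<alpha> x * \<bar>u x\<bar> powr (1 - \<delta>))"

definition B_fun :: "('a \<Rightarrow> real) \<Rightarrow> real" where
  "B_fun u = (LINT x|lborel. \<beta> x * \<bar>u x\<bar> powr \<gamma>)"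

lemma \<tau>_pos: "0 < \<tau>" and \<gamma>_gt_1: "1 < \<gamma>"
  using \<tau>_gt \<gamma>_gt p_gt_1 by auto

text \<open>A negative bound could hold almost everywhere only if every statement did, against
  \<open>\<beta>_plus\<close>.\<close>

lemma c\<beta>_nonneg: "c\<beta> \<ge> 0"
proof (rule ccontr)
  assume "\<not> ?thesis"
  then have "AE x in lborel. max (\<beta> x) 0 = 0" using \<beta>_bounded by (auto elim!: eventually_mono)
  then show False using \<beta>_plus by simp
qed

text \<open>Young's inequality with the exponents \<xi> and \<open>\<tau> / (1 - \<delta>)\<close>,
  which \<open>conj\<close> makes conjugate. The additive form directly yields integrable
  majorants.\<close>

lemma A_young: "\<bar>\<alpha> x * \<bar>t\<bar> powr (1 - \<delta>)\<bar> \<le> \<bar>\<alpha> x\<bar> powr \<xi> + \<bar>t\<bar> powr \<tau>"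
proof -
  define \<zeta> where "\<zeta> = \<tau> / (1 - \<delta>)"
  have \<zeta>: "1 / \<xi> + 1 / \<zeta> = 1" "\<zeta> > 1"
    using conj \<delta>_lt_1 \<delta>_pos \<tau>_gt p_gt_1 by (auto simp: \<zeta>_def field_simps)
  have "\<bar>\<alpha> x\<bar> * \<bar>t\<bar> powr (1 - \<delta>) \<le> \<bar>\<alpha> x\<bar> powr \<xi> / \<xi> + (\<bar>t\<bar> powr (1 - \<delta>)) powr \<zeta> / \<zeta>"
    by (rule Youngs_inequality) (use \<zeta> \<xi>_gt_1 in auto)
  also have "(\<bar>t\<bar> powr (1 - \<delta>)) powr \<zeta> = \<bar>t\<bar> powr \<tau>"
    using \<delta>_lt_1 by (simp add: powr_powr \<zeta>_def)
  also have "\<bar>\<alpha> x\<bar> powr \<xi> / \<xi> + \<bar>t\<bar> powr \<tau> / \<zeta> \<le> \<bar>\<alpha> x\<bar> powr \<xi> / 1 + \<bar>t\<bar> powr \<tau> / 1"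
    using \<zeta> \<xi>_gt_1 by (intro add_mono divide_left_mono) auto
  finally show ?thesis by (simp add: abs_mult)
qed

lemma wspace_powr_integrable:
  assumes u: "u \<in> wspace" and q: "p \<le> q" "q < crit_power"
  shows "integrable lborel (\<lambda>x. \<bar>u x\<bar> powr q)"
proof -
  have [measurable]: "u \<in> borel_measurable borel" using u by measurable
  obtain C where "mass q u \<le> ennreal (C * wenergy u powr (q / p))" using sobolev_embedding[OF q] u by blast
  then have "mass q u < \<infinity>" by (simp add: le_less_trans)
  then show ?thesis by (intro integrableI_nonneg) (auto simp: mass_def)
qed

lemma wspace_powr_integral_le:
  assumes q: "p \<le> q" "q < crit_power"
  shows "\<exists>C>0. \<forall>u\<in>wspace. (LINT x|lborel. \<bar>u x\<bar> powr q) \<le> C * wenergy u powr (q / p)"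
proof -
  obtain C where C: "C > 0" "\<And>u. u \<in> wspace \<Longrightarrow> mass q u \<le> ennreal (C * wenergy u powr (q / p))"
    using sobolev_embedding[OF q] by auto
  have "(LINT x|lborel. \<bar>u x\<bar> powr q) \<le> C * wenergy u powr (q / p)" if u: "u \<in> wspace" for u
  proof -
    have "mass q u = ennreal (LINT x|lborel. \<bar>u x\<bar> powr q)"
      unfolding mass_def by (rule nn_integral_eq_integral[OF wspace_powr_integrable[OF u q]]) simp
    then show ?thesis using C(2)[OF u] C(1) by simp
  qed
  then show ?thesis using C(1) by blast
qed

lemma A_integrable_of:
  assumes [measurable]: "u \<in> borel_measurable borel" and "integrable lborel (\<lambda>x. \<bar>u x\<bar> powr \<tau>)"
  shows "integrable lborel (\<lambda>x. \<alpha> x * \<bar>u x\<bar> powr (1 - \<delta>))"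
proof (rule Bochner_Integration.integrable_bound[OF Bochner_Integration.integrable_add[OF \<alpha>_integrable assms(2)]])
  show "AE x in lborel. norm (\<alpha> x * \<bar>u x\<bar> powr (1 - \<delta>)) \<le> norm (\<bar>\<alpha> x\<bar> powr \<xi> + \<bar>u x\<bar> powr \<tau>)"
    using A_young by (intro AE_I2) simp
qed measurable

lemma B_integrable_of:
  assumes [measurable]: "u \<in> borel_measurable borel" and "integrable lborel (\<lambda>x. \<bar>u x\<bar> powr \<gamma>)"
  shows "integrable lborel (\<lambda>x. \<beta> x * \<bar>u x\<bar> powr \<gamma>)"
proof (rule Bochner_Integration.integrable_bound[OF integrable_mult_right[OF assms(2), of c\<beta>]])
  show "AE x in lborel. norm (\<beta> x * \<bar>u x\<bar> powr \<gamma>) \<le> norm (c\<beta> * \<bar>u x\<bar> powr \<gamma>)"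
    using \<beta>_bounded by eventually_elim (simp add: abs_mult c\<beta>_nonneg mult_right_mono)
qed measurable

lemma A_integrable: "u \<in> wspace \<Longrightarrow> integrable lborel (\<lambda>x. \<alpha> x * \<bar>u x\<bar> powr (1 - \<delta>))"
  by (rule A_integrable_of[OF _ wspace_powr_integrable]) (use \<tau>_gt \<tau>_lt in auto)

lemma B_integrable: "u \<in> wspace \<Longrightarrow> integrable lborel (\<lambda>x. \<beta> x * \<bar>u x\<bar> powr \<gamma>)"
  by (rule B_integrable_of[OF _ wspace_powr_integrable]) (use \<gamma>_gt \<gamma>_lt in auto)

lemma cone_wspace: "u \<in> cone \<Longrightarrow> u \<in> wspace"
  by (simp add: cone_def)

lemma cone_energy_pos: "u \<in> cone \<Longrightarrow> wenergy u > 0"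
proof -
  assume u: "u \<in> cone"
  have [measurable]: "u \<in> borel_measurable borel" using cone_wspace[OF u] by measurable
  have "wenergy u \<noteq> 0"
  proof
    assume "wenergy u = 0"
    then have "mass p u = 0" using wspace_mass_p[OF cone_wspace[OF u]] by simp
    then have "AE x in lborel. u x = 0" by (intro AE_zero_of_mass) auto
    then show False using u by (simp add: cone_def)
  qed
  then show ?thesis using wenergy_nonneg[of u] by linarith
qed

lemma P_scale: "u \<in> wspace \<Longrightarrow> t > 0 \<Longrightarrow> P_fun (\<lambda>x. t * u x) = t powr (p * (m + 1)) * P_fun u"
  by (simp add: P_fun_def wenergy_scale powr_mult powr_powr wenergy_nonneg)

lemma A_scale: "t > 0 \<Longrightarrow> A_fun (\<lambda>x. t * u x) = t powr (1 - \<delta>) * A_fun u"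
proof -
  assume t: "t > 0"
  have "A_fun (\<lambda>x. t * u x) = (LINT x|lborel. t powr (1 - \<delta>) * (\<alpha> x * \<bar>u x\<bar> powr (1 - \<delta>)))"
    unfolding A_fun_def using t by (intro Bochner_Integration.integral_cong) (auto simp: abs_mult powr_mult)
  then show ?thesis by (simp add: A_fun_def)
qed

lemma B_scale: "t > 0 \<Longrightarrow> B_fun (\<lambda>x. t * u x) = t powr \<gamma> * B_fun u"
proof -
  assume t: "t > 0"
  have "B_fun (\<lambda>x. t * u x) = (LINT x|lborel. t powr \<gamma> * (\<beta> x * \<bar>u x\<bar> powr \<gamma>))"
    unfolding B_fun_def using t by (intro Bochner_Integration.integral_cong) (auto simp: abs_mult powr_mult)
  then show ?thesis by (simp add: B_fun_def)
qed

lemma cone_scale: "u \<in> cone \<Longrightarrow> t > 0 \<Longrightarrow> (\<lambda>x. t * u x) \<in> cone"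
  by (auto simp: cone_def wspace_scale)

lemma A_positive: "u \<in> cone \<Longrightarrow> A_fun u > 0"
proof -
  assume u: "u \<in> cone"
  have [measurable]: "u \<in> borel_measurable borel" using cone_wspace[OF u] by measurable
  have nn: "AE x in lborel. 0 \<le> \<alpha> x * \<bar>u x\<bar> powr (1 - \<delta>)" using \<alpha>_pos by eventually_elim simp
  have "A_fun u \<noteq> 0"
  proof
    assume "A_fun u = 0"
    then have "AE x in lborel. \<alpha> x * \<bar>u x\<bar> powr (1 - \<delta>) = 0"
      using integral_nonneg_eq_0_iff_AE[OF A_integrable[OF cone_wspace[OF u]] nn] by (simp add: A_fun_def)
    then have "AE x in lborel. u x = 0" using \<alpha>_pos by eventually_elim (auto split: if_splits)
    then show False using u by (simp add: cone_def)
  qed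
  moreover have "A_fun u \<ge> 0" unfolding A_fun_def using nn by (rule integral_nonneg_AE)
  ultimately show ?thesis by linarith
qed

text \<open>The additive bound of \<open>A_young\<close> becomes homogeneous when it is applied to
  \<open>u\<close> rescaled to energy 1.\<close>

lemma A_bound: "\<exists>C>0. \<forall>u\<in>cone. A_fun u \<le> C * P_fun u powr ((1 - \<delta>) / (p * (m + 1)))"
proof -
  obtain C where C: "C > 0" "\<And>u. u \<in> wspace \<Longrightarrow> (LINT x|lborel. \<bar>u x\<bar> powr \<tau>) \<le> C * wenergy u powr (\<tau> / p)"
    using wspace_powr_integral_le[of \<tau>] \<tau>_gt \<tau>_lt by auto
  define I where "I = (LINT x|lborel. \<bar>\<alpha> x\<bar> powr \<xi>)"
  have I: "I \<ge> 0" unfolding I_def by (rule integral_nonneg_AE) simp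
  have unit: "A_fun v \<le> I + C" if v: "v \<in> wspace" and E: "wenergy v = 1" for v
  proof -
    have i: "integrable lborel (\<lambda>x. \<bar>v x\<bar> powr \<tau>)" using wspace_powr_integrable[OF v, of \<tau>] \<tau>_gt \<tau>_lt by auto
    have "A_fun v \<le> (LINT x|lborel. \<bar>\<alpha> x\<bar> powr \<xi> + \<bar>v x\<bar> powr \<tau>)"
      unfolding A_fun_def
    proof (rule integral_mono[OF A_integrable[OF v] Bochner_Integration.integrable_add[OF \<alpha>_integrable i]])
      show "\<alpha> x * \<bar>v x\<bar> powr (1 - \<delta>) \<le> \<bar>\<alpha> x\<bar> powr \<xi> + \<bar>v x\<bar> powr \<tau>" for x
        using A_young[of x "v x"] by linarith
    qed
    also have "\<dots> = I + (LINT x|lborel. \<bar>v x\<bar> powr \<tau>)" using \<alpha>_integrable i by (simp add: I_def)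
    also have "\<dots> \<le> I + C" using C(2)[OF v] E by simp
    finally show ?thesis .
  qed
  have "A_fun u \<le> (I + C) * P_fun u powr ((1 - \<delta>) / (p * (m + 1)))" if u: "u \<in> cone" for u
  proof -
    define E where "E = wenergy u"
    have E: "E > 0" using cone_energy_pos[OF u] by (simp add: E_def)
    define t where "t = E powr (1 / p)"
    have t: "t > 0" using E by (simp add: t_def)
    define v where "v = (\<lambda>x. (1 / t) * u x)"
    have v: "v \<in> wspace" unfolding v_def by (rule wspace_scale[OF cone_wspace[OF u]])
    have "wenergy v = (1 / t) powr p * E"
      unfolding v_def using t by (subst wenergy_scale[OF cone_wspace[OF u]]) (simp add: E_def)
    also have "\<dots> = 1" using E p_pos by (simp add: t_def powr_divide powr_powr)
    finally have "A_fun v \<le> I + C" by (rule unit[OF v])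
    moreover have "A_fun v = (1 / t) powr (1 - \<delta>) * A_fun u" unfolding v_def using t by (intro A_scale) simp
    ultimately have "A_fun u \<le> (I + C) * t powr (1 - \<delta>)" using t by (simp add: powr_divide field_simps)
    also have "t powr (1 - \<delta>) = P_fun u powr ((1 - \<delta>) / (p * (m + 1)))"
      using E m_pos p_pos by (simp add: t_def P_fun_def E_def powr_powr)
    finally show ?thesis .
  qed
  then show ?thesis using I C(1) by (intro exI[of _ "I + C"]) auto
qed

lemma B_bound: "\<exists>C>0. \<forall>u\<in>cone. B_fun u \<le> C * P_fun u powr (\<gamma> / (p * (m + 1)))"
proof -
  obtain C where C: "C > 0" "\<And>u. u \<in> wspace \<Longrightarrow> (LINT x|lborel. \<bar>u x\<bar> powr \<gamma>) \<le> C * wenergy u powr (\<gamma> / p)"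
    using wspace_powr_integral_le[of \<gamma>] \<gamma>_gt \<gamma>_lt by auto
  \<comment> \<open>The added 1 keeps the constant positive when
    \<open>c\<beta> = 0\<close>.\<close>
  have "B_fun u \<le> ((c\<beta> + 1) * C) * P_fun u powr (\<gamma> / (p * (m + 1)))" if u: "u \<in> cone" for u
  proof -
    have i: "integrable lborel (\<lambda>x. \<bar>u x\<bar> powr \<gamma>)"
      using wspace_powr_integrable[OF cone_wspace[OF u], of \<gamma>] \<gamma>_gt \<gamma>_lt by auto
    have "B_fun u \<le> (LINT x|lborel. (c\<beta> + 1) * \<bar>u x\<bar> powr \<gamma>)"
      unfolding B_fun_def
    proof (rule integral_mono_AE[OF B_integrable[OF cone_wspace[OF u]] integrable_mult_right[OF i]])
      show "AE x in lborel. \<beta> x * \<bar>u x\<bar> powr \<gamma> \<le> (c\<beta> + 1) * \<bar>u x\<bar> powr \<gamma>"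
        using \<beta>_bounded by eventually_elim (intro mult_right_mono, auto)
    qed
    also have "\<dots> = (c\<beta> + 1) * (LINT x|lborel. \<bar>u x\<bar> powr \<gamma>)" by simp
    also have "\<dots> \<le> (c\<beta> + 1) * (C * wenergy u powr (\<gamma> / p))"
      using C(2)[OF cone_wspace[OF u]] c\<beta>_nonneg by (intro mult_left_mono) auto
    also have "wenergy u powr (\<gamma> / p) = P_fun u powr (\<gamma> / (p * (m + 1)))"
      using m_pos p_pos by (simp add: P_fun_def powr_powr)
    finally show ?thesis by (simp add: mult_ac)
  qed
  then show ?thesis using C(1) c\<beta>_nonneg by (intro exI[of _ "(c\<beta> + 1) * C"]) auto
qed

text \<open>The majorants of \<open>wspace_compactness\<close> give continuity of both lower order
  integrals. The two alternatives distinguish whether or not the limit vanishes almost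
  everywhere.\<close>

lemma cone_compactness:
  fixes x :: "nat \<Rightarrow> 'a \<Rightarrow> real"
  assumes x: "\<And>n. x n \<in> cone" and c: "\<And>n. P_fun (x n) \<le> c"
  shows "\<exists>r. strict_mono r \<and> ((\<lambda>n. A_fun (x (r n))) \<longlonglongrightarrow> 0 \<and> (\<lambda>n. B_fun (x (r n))) \<longlonglongrightarrow> 0 \<or>
         (\<exists>u\<in>cone. \<exists>pl. P_fun u \<le> pl \<and> (\<lambda>n. P_fun (x (r n))) \<longlonglongrightarrow> pl \<and>
            (\<lambda>n. A_fun (x (r n))) \<longlonglongrightarrow> A_fun u \<and> (\<lambda>n. B_fun (x (r n))) \<longlonglongrightarrow> B_fun u))"
proof -
  have xw: "x n \<in> wspace" for n using x cone_wspace by blast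
  have xm [measurable]: "x n \<in> borel_measurable borel" for n using xw by measurable
  have E: "wenergy (x n) \<le> c powr (1 / (m + 1))" for n
  proof -
    have "(wenergy (x n) powr (m + 1)) powr (1 / (m + 1)) \<le> c powr (1 / (m + 1))"
      using c[of n] m_pos by (intro powr_mono2) (auto simp: P_fun_def)
    then show ?thesis using m_pos by (simp add: powr_powr wenergy_nonneg)
  qed
  obtain r u D1 D2 L where r: "strict_mono (r :: nat \<Rightarrow> nat)" and u: "u \<in> wspace"
    and lim: "AE y in lborel. (\<lambda>n. x (r n) y) \<longlonglongrightarrow> u y"
    and EL: "(\<lambda>n. wenergy (x (r n))) \<longlonglongrightarrow> L" "wenergy u \<le> L"
    and D: "integrable lborel D1" "integrable lborel D2"
    and D1: "AE y in lborel. \<forall>n. \<bar>x (r n) y\<bar> powr \<tau> \<le> D1 y" and D2: "AE y in lborel. \<forall>n. \<bar>x (r n) y\<bar> powr \<gamma> \<le> D2 y"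
    using wspace_compactness[of x "c powr (1 / (m + 1))" \<tau> \<gamma>, OF xw E less_imp_le[OF \<tau>_gt] \<tau>_lt less_imp_le[OF \<gamma>_gt] \<gamma>_lt]
    by (elim exE conjE) (rule that)
  have um [measurable]: "u \<in> borel_measurable borel" using u by measurable
  have AA: "(\<lambda>n. A_fun (x (r n))) \<longlonglongrightarrow> A_fun u"
    unfolding A_fun_def
  proof (rule integral_dominated_convergence[OF _ _ Bochner_Integration.integrable_add[OF \<alpha>_integrable D(1)]])
    show "AE y in lborel. (\<lambda>n. \<alpha> y * \<bar>x (r n) y\<bar> powr (1 - \<delta>)) \<longlonglongrightarrow> \<alpha> y * \<bar>u y\<bar> powr (1 - \<delta>)"
      using lim
    proof eventually_elim
      case (elim y)
      then show ?case by (intro tendsto_mult tendsto_powr' tendsto_intros) (use \<delta>_lt_1 in auto)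
    qed
    show "AE y in lborel. norm (\<alpha> y * \<bar>x (r n) y\<bar> powr (1 - \<delta>)) \<le> \<bar>\<alpha> y\<bar> powr \<xi> + D1 y" for n
      using D1
    proof eventually_elim
      case (elim y)
      show ?case using A_young[of y "x (r n) y"] elim[rule_format, of n] by simp
    qed
  qed measurable
  have BB: "(\<lambda>n. B_fun (x (r n))) \<longlonglongrightarrow> B_fun u"
    unfolding B_fun_def
  proof (rule integral_dominated_convergence[OF _ _ integrable_mult_right[OF D(2), of c\<beta>]])
    show "AE y in lborel. (\<lambda>n. \<beta> y * \<bar>x (r n) y\<bar> powr \<gamma>) \<longlonglongrightarrow> \<beta> y * \<bar>u y\<bar> powr \<gamma>"
      using lim
    proof eventually_elim
      case (elim y)
      then show ?case by (intro tendsto_mult tendsto_powr' tendsto_intros) (use \<gamma>_gt_1 in auto)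
    qed
    show "AE y in lborel. norm (\<beta> y * \<bar>x (r n) y\<bar> powr \<gamma>) \<le> c\<beta> * D2 y" for n
      using D2 \<beta>_bounded
    proof eventually_elim
      case (elim y)
      then show ?case unfolding real_norm_def abs_mult by (intro mult_mono) (auto simp: c\<beta>_nonneg)
    qed
  qed measurable
  have nn: "AE y in lborel. u y \<ge> 0"
  proof -
    have "AE y in lborel. \<forall>n. x (r n) y \<ge> 0"
      unfolding AE_all_countable using x by (auto simp: cone_def)
    with lim show ?thesis
    proof eventually_elim
      case (elim y)
      show ?case by (rule LIMSEQ_le_const[OF elim(1)]) (use elim(2) in auto)
    qed
  qed
  show ?thesis
  proof (cases "AE y in lborel. u y = 0")
    case True
    have "A_fun u = 0" "B_fun u = 0"
      unfolding A_fun_def B_fun_def using True by (auto intro!: integral_eq_zero_AE elim!: eventually_mono)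
    then show ?thesis using r AA BB by auto
  next
    case False
    then have uc: "u \<in> cone" using u nn by (simp add: cone_def)
    have L0: "L \<ge> 0" using EL(2) wenergy_nonneg[of u] by linarith
    have "(\<lambda>n. P_fun (x (r n))) \<longlonglongrightarrow> L powr (m + 1)"
      unfolding P_fun_def by (intro tendsto_powr' EL tendsto_const) (use m_pos wenergy_nonneg in auto)
    moreover have "P_fun u \<le> L powr (m + 1)"
      unfolding P_fun_def using EL(2) m_pos wenergy_nonneg by (intro powr_mono2) auto
    ultimately show ?thesis using r AA BB uc by blast
  qed
qed

section \<open>Bumps around compact sets and the fundamental lemma for test functions\<close>

lemma bump_family:
  fixes K :: "'a set"
  assumes K: "compact K" "K \<noteq> {}"
  obtains \<phi> :: "nat \<Rightarrow> 'a \<Rightarrow> real" and R where "\<And>n. \<phi> n \<in> wspace" "\<And>n x. 0 \<le> \<phi> n x" "\<And>n x. \<phi> n x \<le> 1"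
    "\<And>n x. R < norm x \<Longrightarrow> \<phi> n x = 0" "\<And>n x. x \<in> K \<Longrightarrow> \<phi> n x = 1" "\<And>x. (\<lambda>n. \<phi> n x) \<longlonglongrightarrow> indicator K x"
proof -
  obtain R0 where R0: "\<And>x. x \<in> K \<Longrightarrow> norm x \<le> R0"
    using compact_imp_bounded[OF K(1)] unfolding bounded_iff by blast
  \<comment> \<open>Tents over \<open>K\<close> of slope \<open>n + 1\<close>; starting with slope 1
    keeps all supports within distance 1 of \<open>K\<close>.\<close>
  define \<phi> where "\<phi> = (\<lambda>(n::nat) x. max 0 (1 - real (Suc n) * infdist x K))"
  define R where "R = R0 + 1"
  have lip: "\<bar>infdist x K - infdist y K\<bar> \<le> norm (x - y)" for x y :: 'a
    using infdist_triangle[of x K y] infdist_triangle[of y K x] by (simp add: dist_norm norm_minus_commute)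
  have one: "\<phi> n x = 1" if "x \<in> K" for n x using that by (simp add: \<phi>_def infdist_zero)
  have b: "0 \<le> \<phi> n x" "\<phi> n x \<le> 1" for n x by (auto simp: \<phi>_def infdist_nonneg)
  have supp: "\<phi> n x = 0" if "R < norm x" for n x
  proof -
    have "1 \<le> infdist x K"
    proof (unfold infdist_notempty[OF K(2)], rule cINF_greatest[OF K(2)])
      fix y assume "y \<in> K"
      then show "1 \<le> dist x y" using R0[of y] that norm_triangle_ineq2[of x y] by (simp add: R_def dist_norm)
    qed
    then have "1 \<le> real (Suc n) * infdist x K" by (simp add: mult_ge1_I)
    then show ?thesis by (simp add: \<phi>_def)
  qed
  have w: "\<phi> n \<in> wspace" for n
  proof -
    obtain CV where CV: "\<And>x. norm x \<le> R \<Longrightarrow> V x \<le> CV" using V_locally_bounded[of R] by blast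
    have "continuous_on UNIV (\<phi> n)"
      unfolding \<phi>_def by (intro continuous_intros)
    then have [measurable]: "\<phi> n \<in> borel_measurable borel" by (rule borel_measurable_continuous_onI)
    show ?thesis
    proof (rule lipschitz_bump_wspace[OF s_lt_1 CV])
      show "\<bar>\<phi> n x - \<phi> n y\<bar> \<le> real (Suc n) * norm (x - y)" for x y
      proof -
        have "\<bar>\<phi> n x - \<phi> n y\<bar> \<le> \<bar>real (Suc n) * infdist x K - real (Suc n) * infdist y K\<bar>"
          unfolding \<phi>_def by linarith
        also have "\<dots> = real (Suc n) * \<bar>infdist x K - infdist y K\<bar>"
          by (simp only: right_diff_distrib[symmetric] abs_mult abs_of_nat)
        also have "\<dots> \<le> real (Suc n) * norm (x - y)" by (intro mult_left_mono lip) simp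
        finally show ?thesis .
      qed
    qed (use b supp in auto)
  qed
  have lim: "(\<lambda>n. \<phi> n x) \<longlonglongrightarrow> indicator K x" for x
  proof (cases "x \<in> K")
    case True
    then show ?thesis using one by simp
  next
    case False
    then have d: "infdist x K > 0"
      using in_closed_iff_infdist_zero[OF compact_imp_closed[OF K(1)] K(2), of x] infdist_nonneg[of x K] by linarith
    obtain N where N: "1 / infdist x K < real N" using reals_Archimedean2 by blast
    have "\<phi> n x = 0" if "n \<ge> N" for n
    proof -
      have "1 < real N * infdist x K" using N d by (simp add: field_simps)
      also have "\<dots> \<le> real (Suc n) * infdist x K" using that d by (intro mult_right_mono) auto
      finally show ?thesis by (simp add: \<phi>_def)
    qed
    then have "\<forall>\<^sub>F n in sequentially. \<phi> n x = 0" by (auto simp: eventually_sequentially)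
    then show ?thesis using False by (simp add: tendsto_eventually)
  qed
  show thesis using w b supp one lim by (rule that[of \<phi> R])
qed

text \<open>Bumps shrinking to the indicator of a compact part of \<open>{x. \<beta> x > 0}\<close>
  have \<open>B_fun\<close> converging to a positive integral of \<beta>.\<close>

lemma B_positive_exists: "\<exists>u\<in>cone. B_fun u > 0"
proof -
  define S where "S = {x. \<beta> x > 0}"
  have S [measurable]: "S \<in> sets borel" unfolding S_def by measurable
  have "emeasure lborel S \<noteq> 0"
  proof
    assume "emeasure lborel S = 0"
    then have "AE x in lborel. x \<notin> S" by (intro AE_not_in null_setsI) auto
    then have "AE x in lborel. max (\<beta> x) 0 = 0" by eventually_elim (simp add: S_def)
    then show False using \<beta>_plus by simp
  qed
  then obtain K where K: "compact K" "K \<subseteq> S" "emeasure lborel K > 0"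
    using ex_compact_positive_measure[OF S] by (auto simp: zero_less_iff_neq_zero)
  then have Kne: "K \<noteq> {}" by auto
  have Kb [measurable]: "K \<in> sets borel" using K by (simp add: borel_closed compact_imp_closed)
  obtain \<phi> R where \<phi>: "\<And>n. \<phi> n \<in> wspace" "\<And>n x. 0 \<le> \<phi> n x" "\<And>n x. \<phi> n x \<le> 1"
    "\<And>n x. R < norm x \<Longrightarrow> \<phi> n x = 0" "\<And>n x. x \<in> K \<Longrightarrow> \<phi> n x = 1" "\<And>x. (\<lambda>n. \<phi> n x) \<longlonglongrightarrow> indicator K x"
    by (rule bump_family[OF K(1) Kne]) (rule that)
  have [measurable]: "\<phi> n \<in> borel_measurable borel" for n using \<phi>(1) by measurable
  have cb [measurable]: "cball (0::'a) R \<in> sets borel" by simp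
  have ib: "integrable lborel (\<lambda>x. c\<beta> * indicator (cball (0::'a) R) x)"
    using emeasure_bounded_finite[OF bounded_cball, of "0::'a" R]
    by (intro integrable_mult_right integrable_real_indicator) auto
  have lim: "(\<lambda>n. B_fun (\<phi> n)) \<longlonglongrightarrow> (LINT x|lborel. \<beta> x * indicator K x)"
    unfolding B_fun_def
  proof (rule integral_dominated_convergence[OF _ _ ib])
    show "AE x in lborel. (\<lambda>n. \<beta> x * \<bar>\<phi> n x\<bar> powr \<gamma>) \<longlonglongrightarrow> \<beta> x * indicator K x"
    proof (rule AE_I2)
      fix x
      have "(\<lambda>n. \<bar>\<phi> n x\<bar> powr \<gamma>) \<longlonglongrightarrow> \<bar>indicator K x\<bar> powr \<gamma>"
        by (intro tendsto_powr' tendsto_intros \<phi>(6)) (use \<gamma>_gt_1 in auto)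
      then have "(\<lambda>n. \<bar>\<phi> n x\<bar> powr \<gamma>) \<longlonglongrightarrow> indicator K x" by (cases "x \<in> K") auto
      then show "(\<lambda>n. \<beta> x * \<bar>\<phi> n x\<bar> powr \<gamma>) \<longlonglongrightarrow> \<beta> x * indicator K x" by (rule tendsto_mult_left)
    qed
    show "AE x in lborel. norm (\<beta> x * \<bar>\<phi> n x\<bar> powr \<gamma>) \<le> c\<beta> * indicator (cball 0 R) x" for n
      using \<beta>_bounded
    proof eventually_elim
      case (elim x)
      show ?case
      proof (cases "norm x \<le> R")
        case True
        have "\<bar>\<phi> n x\<bar> powr \<gamma> \<le> 1 powr \<gamma>" using \<phi>(2,3)[of n x] \<gamma>_gt_1 by (intro powr_mono2) auto
        then have "\<bar>\<beta> x\<bar> * \<bar>\<phi> n x\<bar> powr \<gamma> \<le> c\<beta> * 1" using elim by (intro mult_mono) auto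
        then show ?thesis using True by (simp add: abs_mult)
      next
        case False
        then show ?thesis using \<phi>(4)[of x n] by simp
      qed
    qed
  qed measurable
  have iK: "integrable lborel (\<lambda>x. \<beta> x * indicator K x)"
  proof (rule Bochner_Integration.integrable_bound[OF ib])
    show "AE x in lborel. norm (\<beta> x * indicator K x) \<le> norm (c\<beta> * indicator (cball 0 R) x)"
      using \<beta>_bounded
    proof eventually_elim
      case (elim x)
      show ?case
      proof (cases "x \<in> K")
        case True
        then have "norm x \<le> R" using \<phi>(4)[of x 0] \<phi>(5)[of x 0] by fastforce
        then show ?thesis using True elim by (simp add: c\<beta>_nonneg)
      qed simp
    qed
  qed measurable
  have nn: "AE x in lborel. 0 \<le> \<beta> x * indicator K x" using K(2) by (intro AE_I2) (auto simp: S_def indicator_def)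
  have "(LINT x|lborel. \<beta> x * indicator K x) \<noteq> 0"
  proof
    assume "(LINT x|lborel. \<beta> x * indicator K x) = 0"
    then have "AE x in lborel. \<beta> x * indicator K x = 0" using integral_nonneg_eq_0_iff_AE[OF iK nn] by simp
    then have "AE x in lborel. x \<notin> K" by eventually_elim (use K(2) in \<open>auto simp: S_def indicator_def split: if_splits\<close>)
    then have "emeasure lborel K = 0" by (subst (asm) AE_iff_null) auto
    then show False using K(3) by simp
  qed
  moreover have "(LINT x|lborel. \<beta> x * indicator K x) \<ge> 0" using nn by (rule integral_nonneg_AE)
  ultimately have "\<forall>\<^sub>F n in sequentially. B_fun (\<phi> n) > 0" by (intro order_tendstoD(1)[OF lim]) linarith
  then obtain n where n: "B_fun (\<phi> n) > 0" by (auto dest: eventually_happens)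
  have "\<not> (AE x in lborel. \<phi> n x = 0)"
  proof
    assume "AE x in lborel. \<phi> n x = 0"
    then have "B_fun (\<phi> n) = 0" unfolding B_fun_def by (intro integral_eq_zero_AE) (auto elim!: eventually_mono)
    then show False using n by simp
  qed
  then have "\<phi> n \<in> cone" using \<phi>(1,2) by (simp add: cone_def)
  then show ?thesis using n by blast
qed

lemma AE_zero_of_test:
  assumes [measurable]: "f \<in> borel_measurable borel"
    and i: "\<And>v. v \<in> wspace \<Longrightarrow> integrable lborel (\<lambda>x. f x * v x)"
    and z: "\<And>v. v \<in> wspace \<Longrightarrow> (LINT x|lborel. f x * v x) = 0"
  shows "AE x in lborel. f x = 0"
proof -
  have compact0: "(LINT x|lborel. f x * indicator K x) = 0 \<and> integrable lborel (\<lambda>x. f x * indicator K x)" if K: "compact K" "K \<noteq> {}" for K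
  proof -
    have Kb [measurable]: "K \<in> sets borel" using K by (simp add: borel_closed compact_imp_closed)
    obtain \<phi> R where \<phi>: "\<And>n. \<phi> n \<in> wspace" "\<And>n x. 0 \<le> \<phi> n x" "\<And>n x. \<phi> n x \<le> 1"
      "\<And>n x. R < norm x \<Longrightarrow> \<phi> n x = 0" "\<And>n x. x \<in> K \<Longrightarrow> \<phi> n x = 1" "\<And>x. (\<lambda>n. \<phi> n x) \<longlonglongrightarrow> indicator K x"
      by (rule bump_family[OF K]) (rule that)
    have [measurable]: "\<phi> n \<in> borel_measurable borel" for n using \<phi>(1) by measurable
    have "K \<noteq> {}" by fact
    then have Rn: "R \<ge> 0" using \<phi>(4,5) by (metis ex_in_conv norm_ge_zero not_le order_trans zero_neq_one)
    then have ne: "cball (0::'a) R \<noteq> {}" by simp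
    obtain \<psi> R' where \<psi>: "\<And>n. \<psi> n \<in> wspace" "\<And>n x. 0 \<le> \<psi> n x" "\<And>n x. \<psi> n x \<le> 1"
      "\<And>n x. R' < norm x \<Longrightarrow> \<psi> n x = 0" "\<And>n x. x \<in> cball 0 R \<Longrightarrow> \<psi> n x = 1"
      "\<And>x. (\<lambda>n. \<psi> n x) \<longlonglongrightarrow> indicator (cball 0 R) x"
      by (rule bump_family[OF compact_cball ne]) (rule that)
    \<comment> \<open>\<open>\<psi> 0\<close> equals 1 on the ball carrying all
      \<open>\<phi> n\<close>, so testing with it yields an integrable majorant without prior local
      integrability of \<open>f\<close>.\<close>
    have ip: "integrable lborel (\<lambda>x. \<bar>f x * \<psi> 0 x\<bar>)" by (intro integrable_abs i \<psi>(1))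
    have b: "\<bar>f x * \<phi> n x\<bar> \<le> \<bar>f x * \<psi> 0 x\<bar>" for n x
    proof (cases "norm x \<le> R")
      case True
      then have "\<psi> 0 x = 1" using \<psi>(5)[of x 0] by simp
      moreover have "\<bar>f x\<bar> * \<bar>\<phi> n x\<bar> \<le> \<bar>f x\<bar> * 1" using \<phi>(2,3)[of n x] by (intro mult_left_mono) auto
      ultimately show ?thesis by (simp add: abs_mult)
    next
      case False
      then show ?thesis using \<phi>(4)[of x n] by simp
    qed
    have lim: "(\<lambda>n. f x * \<phi> n x) \<longlonglongrightarrow> f x * indicator K x" for x
      by (intro tendsto_mult_left \<phi>(6))
    have "(\<lambda>n. LINT x|lborel. f x * \<phi> n x) \<longlonglongrightarrow> (LINT x|lborel. f x * indicator K x)"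
      by (rule integral_dominated_convergence[OF _ _ ip]) (use lim b in auto)
    then have "(\<lambda>n. 0) \<longlonglongrightarrow> (LINT x|lborel. f x * indicator K x)" by (simp add: z[OF \<phi>(1)])
    then have "(LINT x|lborel. f x * indicator K x) = 0" using LIMSEQ_unique tendsto_const by metis
    moreover have "integrable lborel (\<lambda>x. f x * indicator K x)"
      by (rule integrable_dominated_convergence[where s = "\<lambda>n x. f x * \<phi> n x", OF _ _ ip]) (use lim b in auto)
    ultimately show ?thesis by blast
  qed
  have half: "emeasure lborel S = 0"
    if S [measurable]: "S \<in> sets borel" and sg: "(\<forall>x\<in>S. f x > 0) \<or> (\<forall>x\<in>S. f x < 0)" for S
  proof (rule ccontr)
    assume "emeasure lborel S \<noteq> 0"
    then obtain K where K: "compact K" "K \<subseteq> S" "emeasure lborel K > 0"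
      using ex_compact_positive_measure[OF S] by (auto simp: zero_less_iff_neq_zero)
    then have Kne: "K \<noteq> {}" by auto
    have Kb [measurable]: "K \<in> sets borel" using K by (simp add: borel_closed compact_imp_closed)
    note c = compact0[OF K(1) Kne]
    have "AE x in lborel. f x * indicator K x = 0"
      using sg
    proof
      assume "\<forall>x\<in>S. f x > 0"
      then have "AE x in lborel. 0 \<le> f x * indicator K x" using K(2) by (intro AE_I2) (auto simp: indicator_def less_imp_le)
      then show ?thesis using integral_nonneg_eq_0_iff_AE c by blast
    next
      assume "\<forall>x\<in>S. f x < 0"
      then have "AE x in lborel. 0 \<le> - (f x * indicator K x)" using K(2) by (intro AE_I2) (auto simp: indicator_def less_imp_le)
      moreover have "integrable lborel (\<lambda>x. - (f x * indicator K x))" using c by (intro integrable_minus) simp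
      moreover have "(LINT x|lborel. - (f x * indicator K x)) = 0" using c by simp
      ultimately have "AE x in lborel. - (f x * indicator K x) = 0" using integral_nonneg_eq_0_iff_AE by blast
      then show ?thesis by simp
    qed
    moreover have "f x \<noteq> 0" if "x \<in> K" for x using sg K(2) that by force
    ultimately have "AE x in lborel. x \<notin> K" by (auto elim!: eventually_mono simp: indicator_def split: if_splits)
    then have "emeasure lborel K = 0" by (subst (asm) AE_iff_null) auto
    then show False using K(3) by simp
  qed
  have 1: "{x. f x > 0} \<in> null_sets lborel" by (rule null_setsI[OF half]) auto
  have 2: "{x. f x < 0} \<in> null_sets lborel" by (rule null_setsI[OF half]) auto
  show ?thesis using AE_not_in[OF 1] AE_not_in[OF 2] by eventually_elim auto
qed

end

section \<open>From stationary points to weak solutions\<close>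

lemma ennreal_tendsto_top_of_at_top:
  fixes f :: "nat \<Rightarrow> real"
  assumes "filterlim f at_top sequentially"
  shows "(\<lambda>n. ennreal (f n)) \<longlonglongrightarrow> top"
  using assms by (simp add: ennreal_tendsto_top_eq_at_top)

text \<open>Caratheodory's form of the derivative avoids dividing by \<open>y n - x\<close>, which
  may vanish.\<close>

lemma deriv_sequence:
  fixes f :: "real \<Rightarrow> real"
  assumes f: "(f has_real_derivative D) (at x)" and y: "(\<lambda>n. (y n - x) / e n) \<longlonglongrightarrow> d"
    and e: "e \<longlonglongrightarrow> 0" "\<And>n. 0 < e n"
  shows "(\<lambda>n. (f (y n) - f x) / e n) \<longlonglongrightarrow> D * d"
proof -
  obtain g where g: "\<And>z. f z - f x = g z * (z - x)" "isCont g x" "g x = D"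
    using f by (auto simp: CARAT_DERIV)
  have "(\<lambda>n. (y n - x) / e n * e n) \<longlonglongrightarrow> d * 0" by (intro tendsto_mult y e)
  moreover have "(y n - x) / e n * e n = y n - x" for n using e(2)[of n] by simp
  ultimately have "(\<lambda>n. y n - x) \<longlonglongrightarrow> 0" by simp
  then have "y \<longlonglongrightarrow> x" by (simp add: LIM_zero_iff)
  then have "(\<lambda>n. g (y n)) \<longlonglongrightarrow> D" using isCont_tendsto_compose[OF g(2)] g(3) by fastforce
  then have "(\<lambda>n. g (y n) * ((y n - x) / e n)) \<longlonglongrightarrow> D * d" by (intro tendsto_mult y)
  then show ?thesis by (simp add: g(1))
qed

text \<open>The pairing of the nonlocal operator with the negative part of a perturbation is of
  higher order: only pairs of points where the perturbation changes sign contribute.\<close>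

lemma negative_part_pairing:
  fixes a b c d e r :: real
  assumes "e > 0"
  defines "N \<equiv> (\<lambda>x. max (- x) 0)"
  shows "\<bar>a - b\<bar> powr r * (a - b) * (N (a + e * c) - N (b + e * d))
     \<le> e * (\<bar>a - b\<bar> powr r * \<bar>a - b\<bar> * \<bar>c - d\<bar> * (if a + e * c < 0 \<or> b + e * d < 0 then 1 else 0))"
proof (cases "a + e * c < 0 \<or> b + e * d < 0")
  case False
  then show ?thesis by (simp add: N_def max_def)
next
  case True
  \<comment> \<open>The two points may be exchanged, so assume \<open>a \<ge> b\<close>; then the
    pairing can be positive only if the perturbation reverses the order of the two values.\<close>
  have key: "(a - b) * (N (a + e * c) - N (b + e * d)) \<le> e * (\<bar>a - b\<bar> * \<bar>c - d\<bar>)"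
    if "a \<ge> b" for a b c d :: real
  proof (cases "a + e * c \<ge> b + e * d")
    case True
    then have "N (a + e * c) - N (b + e * d) \<le> 0" by (simp add: N_def)
    then have "(a - b) * (N (a + e * c) - N (b + e * d)) \<le> 0" using that by (simp add: mult_nonneg_nonpos)
    also have "0 \<le> e * (\<bar>a - b\<bar> * \<bar>c - d\<bar>)" using assms by simp
    finally show ?thesis .
  next
    case False
    have "N (a + e * c) - N (b + e * d) \<le> (b + e * d) - (a + e * c)" using False by (auto simp: N_def)
    also have "\<dots> \<le> e * (d - c)" using that by (simp add: algebra_simps)
    also have "\<dots> \<le> e * \<bar>c - d\<bar>" using assms by (intro mult_left_mono) auto
    finally have "(a - b) * (N (a + e * c) - N (b + e * d)) \<le> (a - b) * (e * \<bar>c - d\<bar>)"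
      using that by (intro mult_left_mono) auto
    then show ?thesis using that by (simp add: mult_ac)
  qed
  have "(a - b) * (N (a + e * c) - N (b + e * d)) \<le> e * (\<bar>a - b\<bar> * \<bar>c - d\<bar>)"
  proof (cases "a \<ge> b")
    case False
    then have "(b - a) * (N (b + e * d) - N (a + e * c)) \<le> e * (\<bar>b - a\<bar> * \<bar>d - c\<bar>)" by (intro key) simp
    then show ?thesis by (simp add: algebra_simps abs_minus_commute)
  qed (rule key)
  then have "\<bar>a - b\<bar> powr r * ((a - b) * (N (a + e * c) - N (b + e * d))) \<le> \<bar>a - b\<bar> powr r * (e * (\<bar>a - b\<bar> * \<bar>c - d\<bar>))"
    by (intro mult_left_mono) auto
  then show ?thesis using True by (simp add: mult_ac)
qed

section \<open>Directional behaviour of the three integrals\<close>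

context kirchhoff_problem
begin

definition gform :: "('a \<Rightarrow> real) \<Rightarrow> ('a \<Rightarrow> real) \<Rightarrow> real" where
  "gform u v = (LINT z|lborel. kernel z * (\<bar>u (fst z) - u (snd z)\<bar> powr (p - 2) * (u (fst z) - u (snd z)) * (v (fst z) - v (snd z))))"

definition vform :: "('a \<Rightarrow> real) \<Rightarrow> ('a \<Rightarrow> real) \<Rightarrow> real" where
  "vform u v = (LINT x|lborel. V x * (\<bar>u x\<bar> powr (p - 2) * u x * v x))"

definition bform :: "('a \<Rightarrow> real) \<Rightarrow> ('a \<Rightarrow> real) \<Rightarrow> real" where
  "bform u v = (LINT x|lborel. \<beta> x * (\<bar>u x\<bar> powr (\<gamma> - 2) * u x * v x))"

definition aform :: "('a \<Rightarrow> real) \<Rightarrow> ('a \<Rightarrow> real) \<Rightarrow> real" where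
  "aform u v = (LINT x|lborel. \<alpha> x * u x powr (- \<delta>) * v x)"

definition fibre :: "real \<Rightarrow> real \<Rightarrow> real \<Rightarrow> real \<Rightarrow> ('a \<Rightarrow> real) \<Rightarrow> real" where
  "fibre c1 c2 c3 t u = c1 * t powr (p * (m + 1)) * P_fun u - c2 * t powr (1 - \<delta>) * A_fun u - c3 * t powr \<gamma> * B_fun u"

lemma harmonic_e: "(\<lambda>n. 1 / real (Suc n)) \<longlonglongrightarrow> 0" "0 < 1 / real (Suc n)" "1 / real (Suc n) \<le> 1"
  using LIMSEQ_Suc[OF lim_1_over_n] by (auto simp: divide_le_eq_1)

lemma form_directions:
  assumes u: "u \<in> wspace" and v: "v \<in> wspace" and e: "e \<longlonglongrightarrow> 0" "\<And>n. 0 < e n" "\<And>n. e n \<le> 1"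
  shows "integrable lborel (\<lambda>z. kernel z * (\<bar>u (fst z) - u (snd z)\<bar> powr (p - 2) * (u (fst z) - u (snd z)) * (v (fst z) - v (snd z))))"
    and "integrable lborel (\<lambda>x. V x * (\<bar>u x\<bar> powr (p - 2) * u x * v x))"
    and "integrable lborel (\<lambda>x. \<beta> x * (\<bar>u x\<bar> powr (\<gamma> - 2) * u x * v x))"
    and "(\<lambda>n. (wenergy (\<lambda>x. u x + e n * v x) - wenergy u) / e n) \<longlonglongrightarrow> p * (gform u v + vform u v)"
    and "(\<lambda>n. (B_fun (\<lambda>x. u x + e n * v x) - B_fun u) / e n) \<longlonglongrightarrow> \<gamma> * bform u v"
proof -
  have [measurable]: "u \<in> borel_measurable borel" "v \<in> borel_measurable borel" using u v by measurable
  have G: "integrable lborel (\<lambda>z. kernel z * \<bar>u (fst z) - u (snd z)\<bar> powr p)"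
    "integrable lborel (\<lambda>z. kernel z * \<bar>v (fst z) - v (snd z)\<bar> powr p)"
    using u v by (auto intro: gagliardo_integrable)
  note D1 = powr_integral_direction[OF p_gt_1 _ _ _ G e]
  note D2 = powr_integral_direction[OF p_gt_1 _ _ _ potential_integrable[OF u] potential_integrable[OF v] e]
  note D3 = powr_integral_direction[OF \<gamma>_gt_1 _ _ _ B_integrable[OF u] B_integrable[OF v] e]
  show "integrable lborel (\<lambda>z. kernel z * (\<bar>u (fst z) - u (snd z)\<bar> powr (p - 2) * (u (fst z) - u (snd z)) * (v (fst z) - v (snd z))))"
    by (rule D1(1)) measurable
  show "integrable lborel (\<lambda>x. V x * (\<bar>u x\<bar> powr (p - 2) * u x * v x))"
    by (rule D2(1)) measurable
  show "integrable lborel (\<lambda>x. \<beta> x * (\<bar>u x\<bar> powr (\<gamma> - 2) * u x * v x))"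
    by (rule D3(1)) measurable
  show "(\<lambda>n. (B_fun (\<lambda>x. u x + e n * v x) - B_fun u) / e n) \<longlonglongrightarrow> \<gamma> * bform u v"
    unfolding B_fun_def bform_def by (rule D3(3)) measurable
  have uv: "(\<lambda>x. u x + e n * v x) \<in> wspace" for n by (rule wspace_add[OF u wspace_scale[OF v]])
  let ?G = "\<lambda>n. LINT z|lborel. kernel z * \<bar>(u (fst z) - u (snd z)) + e n * (v (fst z) - v (snd z))\<bar> powr p"
  let ?V = "\<lambda>n. LINT x|lborel. V x * \<bar>u x + e n * v x\<bar> powr p"
  have E: "wenergy (\<lambda>x. u x + e n * v x) = ?G n + ?V n" for n
    unfolding wenergy_integral[OF uv] by (simp add: algebra_simps)
  have "(\<lambda>n. (?G n - (LINT z|lborel. kernel z * \<bar>u (fst z) - u (snd z)\<bar> powr p)) / e n) \<longlonglongrightarrow> p * gform u v"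
    unfolding gform_def by (rule D1(3)) measurable
  moreover have "(\<lambda>n. (?V n - (LINT x|lborel. V x * \<bar>u x\<bar> powr p)) / e n) \<longlonglongrightarrow> p * vform u v"
    unfolding vform_def by (rule D2(3)) measurable
  ultimately have "(\<lambda>n. (?G n - (LINT z|lborel. kernel z * \<bar>u (fst z) - u (snd z)\<bar> powr p)) / e n
      + (?V n - (LINT x|lborel. V x * \<bar>u x\<bar> powr p)) / e n) \<longlonglongrightarrow> p * gform u v + p * vform u v"
    by (rule tendsto_add)
  then show "(\<lambda>n. (wenergy (\<lambda>x. u x + e n * v x) - wenergy u) / e n) \<longlonglongrightarrow> p * (gform u v + vform u v)"
    unfolding E wenergy_integral[OF u] by (simp add: add_divide_distrib[symmetric] diff_divide_distrib distrib_left algebra_simps)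
qed

lemma P_direction:
  assumes u: "u \<in> cone" and v: "v \<in> wspace" and e: "e \<longlonglongrightarrow> 0" "\<And>n. 0 < e n" "\<And>n. e n \<le> 1"
  shows "(\<lambda>n. (P_fun (\<lambda>x. u x + e n * v x) - P_fun u) / e n)
     \<longlonglongrightarrow> p * (m + 1) * (wenergy u powr m * (gform u v + vform u v))"
proof -
  have "(\<lambda>n. (P_fun (\<lambda>x. u x + e n * v x) - P_fun u) / e n)
     \<longlonglongrightarrow> ((m + 1) * wenergy u powr (m + 1 - 1)) * (p * (gform u v + vform u v))"
    unfolding P_fun_def
    by (rule deriv_sequence[OF has_real_derivative_powr[OF cone_energy_pos[OF u]] form_directions(4)[OF cone_wspace[OF u] v e] e(1,2)])
  then show ?thesis by (simp add: mult_ac)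
qed

lemma cone_add:
  assumes u: "u \<in> cone" and v: "v \<in> wspace" and v0: "AE x in lborel. v x \<ge> 0" and e: "0 < e"
  shows "(\<lambda>x. u x + e * v x) \<in> cone"
proof -
  have w: "(\<lambda>x. u x + e * v x) \<in> wspace" by (rule wspace_add[OF cone_wspace[OF u] wspace_scale[OF v]])
  have u0: "AE x in lborel. u x \<ge> 0" using u by (simp add: cone_def)
  have "\<not> (AE x in lborel. u x + e * v x = 0)"
  proof
    assume "AE x in lborel. u x + e * v x = 0"
    then have "AE x in lborel. u x = 0"
      using u0 v0
    proof eventually_elim
      case (elim x)
      have "e * v x \<ge> 0" using e elim by simp
      then show ?case using elim by linarith
    qed
    then show False using u by (simp add: cone_def)
  qed
  moreover have "AE x in lborel. u x + e * v x \<ge> 0" using u0 v0 by eventually_elim (use e in simp)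
  ultimately show ?thesis using w by (simp add: cone_def)
qed

lemma A_mono_add:
  assumes u: "u \<in> cone" and v: "v \<in> wspace" and v0: "AE x in lborel. v x \<ge> 0" and e: "0 < e"
  shows "A_fun u \<le> A_fun (\<lambda>x. u x + e * v x)"
  unfolding A_fun_def
proof (rule integral_mono_AE)
  have u0: "AE x in lborel. u x \<ge> 0" using u by (simp add: cone_def)
  show "AE x in lborel. \<alpha> x * \<bar>u x\<bar> powr (1 - \<delta>) \<le> \<alpha> x * \<bar>u x + e * v x\<bar> powr (1 - \<delta>)"
    using u0 v0 \<alpha>_pos
    by eventually_elim (intro mult_left_mono powr_mono2, use e \<delta>_lt_1 in auto)
qed (auto intro!: A_integrable wspace_add wspace_scale v cone_wspace[OF u])

lemma A_tendsto_add:
  assumes u: "u \<in> wspace" and v: "v \<in> wspace" and e: "e \<longlonglongrightarrow> 0" "\<And>n. 0 < e n" "\<And>n. e n \<le> 1"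
  shows "(\<lambda>n. A_fun (\<lambda>x. u x + e n * v x)) \<longlonglongrightarrow> A_fun u"
  unfolding A_fun_def
proof (rule integral_dominated_convergence)
  have [measurable]: "u \<in> borel_measurable borel" "v \<in> borel_measurable borel" using u v by measurable
  show "integrable lborel (\<lambda>x. \<bar>\<alpha> x\<bar> powr \<xi> + 2 powr \<tau> * (\<bar>u x\<bar> powr \<tau> + \<bar>v x\<bar> powr \<tau>))"
    using \<tau>_gt \<tau>_lt by (intro Bochner_Integration.integrable_add integrable_mult_right \<alpha>_integrable wspace_powr_integrable u v) auto
  show "AE x in lborel. (\<lambda>n. \<alpha> x * \<bar>u x + e n * v x\<bar> powr (1 - \<delta>)) \<longlonglongrightarrow> \<alpha> x * \<bar>u x\<bar> powr (1 - \<delta>)"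
  proof (rule AE_I2)
    fix x
    have "(\<lambda>n. \<bar>u x + e n * v x\<bar>) \<longlonglongrightarrow> \<bar>u x + 0 * v x\<bar>" by (intro tendsto_intros e)
    then have "(\<lambda>n. \<bar>u x + e n * v x\<bar> powr (1 - \<delta>)) \<longlonglongrightarrow> \<bar>u x\<bar> powr (1 - \<delta>)"
      by (intro tendsto_powr') (use \<delta>_lt_1 in auto)
    then show "(\<lambda>n. \<alpha> x * \<bar>u x + e n * v x\<bar> powr (1 - \<delta>)) \<longlonglongrightarrow> \<alpha> x * \<bar>u x\<bar> powr (1 - \<delta>)" by (rule tendsto_mult_left)
  qed
  show "AE x in lborel. norm (\<alpha> x * \<bar>u x + e n * v x\<bar> powr (1 - \<delta>)) \<le> \<bar>\<alpha> x\<bar> powr \<xi> + 2 powr \<tau> * (\<bar>u x\<bar> powr \<tau> + \<bar>v x\<bar> powr \<tau>)" for n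
  proof (rule AE_I2)
    fix x
    have "\<bar>e n * v x\<bar> \<le> 1 * \<bar>v x\<bar>" unfolding abs_mult using e(2,3)[of n] by (intro mult_right_mono) auto
    then have "\<bar>e n * v x\<bar> powr \<tau> \<le> \<bar>v x\<bar> powr \<tau>" using \<tau>_pos by (intro powr_mono2) auto
    then have "2 powr \<tau> * (\<bar>u x\<bar> powr \<tau> + \<bar>e n * v x\<bar> powr \<tau>) \<le> 2 powr \<tau> * (\<bar>u x\<bar> powr \<tau> + \<bar>v x\<bar> powr \<tau>)"
      by (intro mult_left_mono) auto
    then show "norm (\<alpha> x * \<bar>u x + e n * v x\<bar> powr (1 - \<delta>)) \<le> \<bar>\<alpha> x\<bar> powr \<xi> + 2 powr \<tau> * (\<bar>u x\<bar> powr \<tau> + \<bar>v x\<bar> powr \<tau>)"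
      using A_young[of x "u x + e n * v x"] abs_add_powr_le[of \<tau> "u x" "e n * v x"] \<tau>_pos
      unfolding real_norm_def by linarith
  qed
qed (use u v in measurable)

text \<open>Fatou's lemma for the difference quotients of the singular term: they blow up where
  \<open>u\<close> vanishes, so a bound from the other terms forces \<open>u > 0\<close>.\<close>

lemma singular_Fatou:
  assumes u: "u \<in> cone" and v: "v \<in> wspace" and v0: "AE x in lborel. v x \<ge> 0"
    and e: "e \<longlonglongrightarrow> 0" "\<And>n. 0 < e n" "\<And>n. e n \<le> 1"
    and b: "\<forall>\<^sub>F n in sequentially. (A_fun (\<lambda>x. u x + e n * v x) - A_fun u) / e n \<le> R n" and R: "R \<longlonglongrightarrow> R0"
  shows "AE x in lborel. \<not> (u x = 0 \<and> v x > 0)"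
    and "(\<integral>\<^sup>+ x. ennreal ((1 - \<delta>) * (\<alpha> x * u x powr (- \<delta>) * v x)) \<partial>lborel) \<le> ennreal R0"
    and "R0 \<ge> 0"
proof -
  have [measurable]: "u \<in> borel_measurable borel" "v \<in> borel_measurable borel" using cone_wspace[OF u] v by measurable
  have u0: "AE x in lborel. u x \<ge> 0" using u by (simp add: cone_def)
  define f where "f = (\<lambda>n x. \<alpha> x * ((\<bar>u x + e n * v x\<bar> powr (1 - \<delta>) - \<bar>u x\<bar> powr (1 - \<delta>)) / e n))"
  \<comment> \<open>The pointwise limit of the quotients; the value \<open>top\<close> records their
    growth like \<open>e n powr (- \<delta>)\<close> at zeros of \<open>u\<close>.\<close>
  define g where "g = (\<lambda>x. if u x = 0 \<and> v x > 0 then top else ennreal ((1 - \<delta>) * (\<alpha> x * u x powr (- \<delta>) * v x)))"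
  have fi: "(\<integral>\<^sup>+ x. ennreal (f n x) \<partial>lborel) = ennreal ((A_fun (\<lambda>x. u x + e n * v x) - A_fun u) / e n)" for n
  proof -
    have i1: "integrable lborel (\<lambda>x. \<alpha> x * \<bar>u x + e n * v x\<bar> powr (1 - \<delta>))"
      by (intro A_integrable wspace_add wspace_scale v cone_wspace[OF u])
    note i2 = A_integrable[OF cone_wspace[OF u]]
    have eq: "f n x = (\<alpha> x * \<bar>u x + e n * v x\<bar> powr (1 - \<delta>) - \<alpha> x * \<bar>u x\<bar> powr (1 - \<delta>)) / e n" for x
      by (simp add: f_def right_diff_distrib)
    have i: "integrable lborel (f n)" unfolding eq using i1 i2 by (intro integrable_divide_zero Bochner_Integration.integrable_diff) auto
    have nn: "AE x in lborel. 0 \<le> f n x"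
      using u0 v0 \<alpha>_pos
    proof eventually_elim
      case (elim x)
      have "\<bar>u x\<bar> powr (1 - \<delta>) \<le> \<bar>u x + e n * v x\<bar> powr (1 - \<delta>)"
        using elim e(2)[of n] \<delta>_lt_1 by (intro powr_mono2) auto
      then show ?case unfolding f_def using elim e(2)[of n] by simp
    qed
    have "(LINT x|lborel. f n x) = (A_fun (\<lambda>x. u x + e n * v x) - A_fun u) / e n"
      unfolding eq A_fun_def using i1 i2 by simp
    then show ?thesis using nn_integral_eq_integral[OF i nn] by simp
  qed
  have lim: "AE x in lborel. (\<lambda>n. ennreal (f n x)) \<longlonglongrightarrow> g x"
    using u0 v0 \<alpha>_pos
  proof eventually_elim
    case (elim x)
    consider "v x = 0" | "u x = 0" "v x > 0" | "u x > 0" "v x > 0" using elim by linarith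
    then show ?case
    proof cases
      case 1
      then show ?thesis by (simp add: f_def g_def)
    next
      case 2
      have "filterlim (\<lambda>n. \<alpha> x * v x powr (1 - \<delta>) / e n powr \<delta>) at_top sequentially"
      proof (rule filterlim_at_top_mono[OF _ always_eventually])
        have "(\<lambda>n. e n powr \<delta>) \<longlonglongrightarrow> 0"
          by (rule tendsto_zero_powrI[OF e(1) tendsto_const _ \<delta>_pos]) (use e(2) in \<open>auto intro!: always_eventually less_imp_le\<close>)
        then have "filterlim (\<lambda>n. e n powr \<delta>) (at_right 0) sequentially"
          by (rule tendsto_imp_filterlim_at_right) (simp add: e(2) less_imp_neq[symmetric])
        then have "filterlim (\<lambda>n. inverse (e n powr \<delta>)) at_top sequentially" by (rule filterlim_compose[OF filterlim_inverse_at_top_right])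
        then show "filterlim (\<lambda>n. (\<alpha> x * v x powr (1 - \<delta>)) * inverse (e n powr \<delta>)) at_top sequentially"
          using 2 elim by (intro filterlim_tendsto_pos_mult_at_top[OF tendsto_const]) auto
      qed (auto simp: divide_inverse)
      moreover have "f n x = \<alpha> x * v x powr (1 - \<delta>) / e n powr \<delta>" for n
        using 2 e(2)[of n] by (simp add: f_def abs_mult powr_mult powr_diff)
      ultimately have "(\<lambda>n. ennreal (f n x)) \<longlonglongrightarrow> top" by (intro ennreal_tendsto_top_of_at_top) simp
      then show ?thesis using 2 by (simp add: g_def)
    next
      case 3
      have d: "((\<lambda>y. y powr (1 - \<delta>)) has_real_derivative (1 - \<delta>) * u x powr (1 - \<delta> - 1)) (at (u x))"
        by (rule has_real_derivative_powr) (rule 3)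
      have "(\<lambda>n. ((u x + e n * v x) - u x) / e n) \<longlonglongrightarrow> v x"
        using e(2) by (simp add: less_imp_neq[symmetric])
      from deriv_sequence[OF d this e(1,2)]
      have "(\<lambda>n. ((u x + e n * v x) powr (1 - \<delta>) - u x powr (1 - \<delta>)) / e n) \<longlonglongrightarrow> (1 - \<delta>) * u x powr (- \<delta>) * v x" by simp
      then have "(\<lambda>n. \<alpha> x * (((u x + e n * v x) powr (1 - \<delta>) - u x powr (1 - \<delta>)) / e n)) \<longlonglongrightarrow> \<alpha> x * ((1 - \<delta>) * u x powr (- \<delta>) * v x)"
        by (rule tendsto_mult_left)
      moreover have "f n x = \<alpha> x * (((u x + e n * v x) powr (1 - \<delta>) - u x powr (1 - \<delta>)) / e n)" for n
        using 3 e(2)[of n] by (simp add: f_def)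
      ultimately have "(\<lambda>n. f n x) \<longlonglongrightarrow> (1 - \<delta>) * (\<alpha> x * u x powr (- \<delta>) * v x)" by (simp add: mult_ac)
      then have "(\<lambda>n. ennreal (f n x)) \<longlonglongrightarrow> ennreal ((1 - \<delta>) * (\<alpha> x * u x powr (- \<delta>) * v x))" by (rule tendsto_ennrealI)
      then show ?thesis using 3 by (simp add: g_def)
    qed
  qed
  have nnA: "0 \<le> (A_fun (\<lambda>x. u x + e n * v x) - A_fun u) / e n" for n
    using A_mono_add[OF u v v0 e(2)] e(2)[of n] by simp
  show R0: "R0 \<ge> 0"
    by (rule tendsto_lowerbound[OF R]) (use b nnA in \<open>auto elim!: eventually_mono intro: order_trans\<close>)
  \<comment> \<open>The upper bounds \<open>R n\<close> only tend to \<open>R0\<close>, so a margin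
    \<epsilon> is carried along and removed at the end.\<close>
  have G: "(\<integral>\<^sup>+ x. g x \<partial>lborel) \<le> ennreal (R0 + \<epsilon>)" if "\<epsilon> > 0" for \<epsilon>
  proof (rule nn_integral_le_of_AE_tendsto[OF _ lim])
    show "(\<lambda>x. ennreal (f n x)) \<in> borel_measurable lborel" for n unfolding f_def by measurable
    have "\<forall>\<^sub>F n in sequentially. R n < R0 + \<epsilon>" by (rule order_tendstoD(2)[OF R]) (use that in simp)
    with b show "\<forall>\<^sub>F n in sequentially. (\<integral>\<^sup>+ x. ennreal (f n x) \<partial>lborel) \<le> ennreal (R0 + \<epsilon>)"
      by eventually_elim (auto simp: fi intro!: ennreal_leI)
  qed
  have gm [measurable]: "g \<in> borel_measurable lborel" unfolding g_def by measurable
  have "(\<integral>\<^sup>+ x. g x \<partial>lborel) \<noteq> \<infinity>" using G[of 1] by (auto simp: top_unique)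
  then have "AE x in lborel. g x \<noteq> \<infinity>" by (rule nn_integral_noteq_infinite[OF gm])
  then show ae: "AE x in lborel. \<not> (u x = 0 \<and> v x > 0)" by eventually_elim (auto simp: g_def)
  have "(\<integral>\<^sup>+ x. ennreal ((1 - \<delta>) * (\<alpha> x * u x powr (- \<delta>) * v x)) \<partial>lborel) = (\<integral>\<^sup>+ x. g x \<partial>lborel)"
    using ae by (intro nn_integral_cong_AE) (auto elim!: eventually_mono simp: g_def)
  also have "\<dots> \<le> ennreal R0"
  proof (rule ennreal_le_epsilon)
    fix \<epsilon> :: real assume "0 < \<epsilon>"
    then show "(\<integral>\<^sup>+ x. g x \<partial>lborel) \<le> ennreal R0 + ennreal \<epsilon>" using G[of \<epsilon>] R0 by (simp add: ennreal_plus)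
  qed
  finally show "(\<integral>\<^sup>+ x. ennreal ((1 - \<delta>) * (\<alpha> x * u x powr (- \<delta>) * v x)) \<partial>lborel) \<le> ennreal R0" .
qed

section \<open>From one-sided stationarity to the weak equation\<close>

lemma form_integrable:
  assumes u: "u \<in> wspace" and v: "v \<in> wspace"
  shows "integrable lborel (\<lambda>z. kernel z * (\<bar>u (fst z) - u (snd z)\<bar> powr (p - 2) * (u (fst z) - u (snd z)) * (v (fst z) - v (snd z))))"
    and "integrable lborel (\<lambda>x. V x * (\<bar>u x\<bar> powr (p - 2) * u x * v x))"
    and "integrable lborel (\<lambda>x. \<beta> x * (\<bar>u x\<bar> powr (\<gamma> - 2) * u x * v x))"
  by (rule form_directions(1-3)[OF u v harmonic_e])+

lemma form_linear:
  assumes u: "u \<in> wspace" and v: "v \<in> wspace" and w: "w \<in> wspace"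
  shows "gform u (\<lambda>x. v x + t * w x) = gform u v + t * gform u w"
    and "vform u (\<lambda>x. v x + t * w x) = vform u v + t * vform u w"
    and "bform u (\<lambda>x. v x + t * w x) = bform u v + t * bform u w"
proof -
  note i = form_integrable[OF u v] and j = form_integrable[OF u w]
  have "gform u (\<lambda>x. v x + t * w x) = (LINT z|lborel.
     kernel z * (\<bar>u (fst z) - u (snd z)\<bar> powr (p - 2) * (u (fst z) - u (snd z)) * (v (fst z) - v (snd z)))
     + t * (kernel z * (\<bar>u (fst z) - u (snd z)\<bar> powr (p - 2) * (u (fst z) - u (snd z)) * (w (fst z) - w (snd z)))))"
    unfolding gform_def by (intro Bochner_Integration.integral_cong) (auto simp: algebra_simps)
  also have "\<dots> = gform u v + t * gform u w"
    unfolding gform_def using i(1) j(1) by (subst Bochner_Integration.integral_add) auto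
  finally show "gform u (\<lambda>x. v x + t * w x) = gform u v + t * gform u w" .
  have "vform u (\<lambda>x. v x + t * w x) = (LINT x|lborel.
     V x * (\<bar>u x\<bar> powr (p - 2) * u x * v x) + t * (V x * (\<bar>u x\<bar> powr (p - 2) * u x * w x)))"
    unfolding vform_def by (intro Bochner_Integration.integral_cong) (auto simp: algebra_simps)
  also have "\<dots> = vform u v + t * vform u w"
    unfolding vform_def using i(2) j(2) by (subst Bochner_Integration.integral_add) auto
  finally show "vform u (\<lambda>x. v x + t * w x) = vform u v + t * vform u w" .
  have "bform u (\<lambda>x. v x + t * w x) = (LINT x|lborel.
     \<beta> x * (\<bar>u x\<bar> powr (\<gamma> - 2) * u x * v x) + t * (\<beta> x * (\<bar>u x\<bar> powr (\<gamma> - 2) * u x * w x)))"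
    unfolding bform_def by (intro Bochner_Integration.integral_cong) (auto simp: algebra_simps)
  also have "\<dots> = bform u v + t * bform u w"
    unfolding bform_def using i(3) j(3) by (subst Bochner_Integration.integral_add) auto
  finally show "bform u (\<lambda>x. v x + t * w x) = bform u v + t * bform u w" .
qed

lemma form_self:
  assumes u: "u \<in> cone"
  shows "gform u u + vform u u = wenergy u" "bform u u = B_fun u"
    "(AE x in lborel. u x > 0) \<Longrightarrow> aform u u = A_fun u"
proof -
  show "gform u u + vform u u = wenergy u"
    unfolding gform_def vform_def wenergy_integral[OF cone_wspace[OF u]] by (simp only: abs_powr_mult_self)
  show "bform u u = B_fun u"
    unfolding bform_def B_fun_def by (simp only: abs_powr_mult_self)
  assume pos: "AE x in lborel. u x > 0"
  have [measurable]: "u \<in> borel_measurable borel" using cone_wspace[OF u] by measurable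
  show "aform u u = A_fun u"
    unfolding aform_def A_fun_def
  proof (rule integral_cong_AE)
    show "AE x in lborel. \<alpha> x * u x powr - \<delta> * u x = \<alpha> x * \<bar>u x\<bar> powr (1 - \<delta>)"
      using pos
    proof eventually_elim
      case (elim x)
      have "u x powr (- \<delta>) * u x powr 1 = u x powr (- \<delta> + 1)" by (rule powr_add[symmetric])
      then show ?case using elim by (simp add: mult.assoc)
    qed
  qed measurable
qed

text \<open>The residual \<open>\<Lambda>\<close> is linear, vanishes at \<open>u\<close> and is
  nonnegative on nonnegative functions by Fatou. Testing with the positive part of
  \<open>u + e v\<close> extends the inequality to every \<open>v\<close>, and \<open>- v\<close>
  gives equality. The coefficients are left general so that the lemma serves both the problem and
  the quotient defining the extremal parameter.\<close>

lemma stationary_weak_form: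
  assumes u: "u \<in> cone" and c1: "c1 > 0" and c2: "c2 > 0"
    and st: "\<And>v. v \<in> wspace \<Longrightarrow> AE x in lborel. v x \<ge> 0 \<Longrightarrow> \<exists>\<rho> t \<eta>. strict_mono (\<rho> :: nat \<Rightarrow> nat) \<and> t \<longlonglongrightarrow> 1 \<and> \<eta> \<longlonglongrightarrow> 0 \<and>
       (\<forall>\<^sub>F n in sequentially. fibre c1 c2 c3 (t n) (\<lambda>x. u x + 1 / real (Suc (\<rho> n)) * v x) - fibre c1 c2 c3 (t n) u
          \<ge> - \<eta> n * (1 / real (Suc (\<rho> n))))"
    and zero: "c1 * (p * (m + 1)) * P_fun u - c2 * (1 - \<delta>) * A_fun u - c3 * \<gamma> * B_fun u = 0"
  shows "AE x in lborel. u x > 0"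
    and "v \<in> wspace \<Longrightarrow> integrable lborel (\<lambda>x. \<alpha> x * u x powr (- \<delta>) * v x)"
    and "v \<in> wspace \<Longrightarrow> c1 * (p * (m + 1)) * (wenergy u powr m * (gform u v + vform u v))
       - c2 * (1 - \<delta>) * aform u v - c3 * \<gamma> * bform u v = 0"
proof -
  note uw = cone_wspace[OF u]
  have um [measurable]: "u \<in> borel_measurable borel" using uw by measurable
  have u0: "AE x in lborel. u x \<ge> 0" using u by (simp add: cone_def)
  define kE where "kE = c1 * (p * (m + 1)) * wenergy u powr m"
  have kE: "kE > 0" unfolding kE_def using c1 p_pos m_pos cone_energy_pos[OF u] by simp
  define Lf where "Lf = (\<lambda>v. kE * (gform u v + vform u v) - c3 * \<gamma> * bform u v)"
  have Fatou: "(AE x in lborel. \<not> (u x = 0 \<and> v x > 0)) \<and>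
      (\<integral>\<^sup>+ x. ennreal ((1 - \<delta>) * (\<alpha> x * u x powr (- \<delta>) * v x)) \<partial>lborel) \<le> ennreal (Lf v / c2) \<and> Lf v / c2 \<ge> 0"
    if v: "v \<in> wspace" and v0: "AE x in lborel. v x \<ge> 0" for v
  proof -
    obtain \<rho> t \<eta> where \<rho>: "strict_mono (\<rho> :: nat \<Rightarrow> nat)" and t: "t \<longlonglongrightarrow> 1" and \<eta>: "\<eta> \<longlonglongrightarrow> 0" and
       ineq: "\<forall>\<^sub>F n in sequentially. fibre c1 c2 c3 (t n) (\<lambda>x. u x + 1 / real (Suc (\<rho> n)) * v x) - fibre c1 c2 c3 (t n) u
          \<ge> - \<eta> n * (1 / real (Suc (\<rho> n)))"
      using st[OF v v0] by (elim exE conjE) (rule that)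
    define e where "e = (\<lambda>n. 1 / real (Suc (\<rho> n)))"
    have e: "e \<longlonglongrightarrow> 0" "\<And>n. 0 < e n" "\<And>n. e n \<le> 1"
      using LIMSEQ_subseq_LIMSEQ[OF harmonic_e(1) \<rho>] by (auto simp: e_def o_def divide_le_eq_1)
    let ?x = "\<lambda>n x. u x + e n * v x"
    let ?dP = "\<lambda>n. (P_fun (?x n) - P_fun u) / e n"
    let ?dB = "\<lambda>n. (B_fun (?x n) - B_fun u) / e n"
    let ?dA = "\<lambda>n. (A_fun (?x n) - A_fun u) / e n"
    \<comment> \<open>The stationarity inequality solved for the difference quotient of
      \<open>A_fun\<close>; the powers of \<open>t n\<close> tend to 1 and leave no trace in the
      limit.\<close>
    define R where "R = (\<lambda>n. (c1 * t n powr (p * (m + 1)) * ?dP n - c3 * t n powr \<gamma> * ?dB n + \<eta> n) / (c2 * t n powr (1 - \<delta>)))"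
    have dP: "?dP \<longlonglongrightarrow> p * (m + 1) * (wenergy u powr m * (gform u v + vform u v))" by (rule P_direction[OF u v e])
    have dB: "?dB \<longlonglongrightarrow> \<gamma> * bform u v" by (rule form_directions(5)[OF uw v e])
    have tp: "(\<lambda>n. t n powr y) \<longlonglongrightarrow> 1" for y
      using tendsto_powr[OF t tendsto_const, of y] by simp
    have "R \<longlonglongrightarrow> (c1 * 1 * (p * (m + 1) * (wenergy u powr m * (gform u v + vform u v))) - c3 * 1 * (\<gamma> * bform u v) + 0) / (c2 * 1)"
      unfolding R_def using c2 by (intro tendsto_intros tp dP dB \<eta>) auto
    then have R: "R \<longlonglongrightarrow> Lf v / c2" by (simp add: Lf_def kE_def mult_ac)
    have "\<forall>\<^sub>F n in sequentially. t n > 0" using order_tendstoD(1)[OF t, of 0] by simp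
    with ineq have b: "\<forall>\<^sub>F n in sequentially. ?dA n \<le> R n"
    proof eventually_elim
      case (elim n)
      define D where "D = c2 * t n powr (1 - \<delta>)"
      have D: "D > 0" using c2 elim by (simp add: D_def)
      have "- \<eta> n * e n \<le> c1 * t n powr (p * (m + 1)) * (P_fun (?x n) - P_fun u)
          - D * (A_fun (?x n) - A_fun u) - c3 * t n powr \<gamma> * (B_fun (?x n) - B_fun u)"
        using elim(1) unfolding fibre_def e_def[symmetric] D_def by (simp add: e_def algebra_simps)
      then have "D * (A_fun (?x n) - A_fun u) \<le> c1 * t n powr (p * (m + 1)) * (P_fun (?x n) - P_fun u)
          - c3 * t n powr \<gamma> * (B_fun (?x n) - B_fun u) + \<eta> n * e n" by linarith
      then have "D * (A_fun (?x n) - A_fun u) / e n \<le> (c1 * t n powr (p * (m + 1)) * (P_fun (?x n) - P_fun u)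
          - c3 * t n powr \<gamma> * (B_fun (?x n) - B_fun u) + \<eta> n * e n) / e n"
        using e(2)[of n] by (intro divide_right_mono) auto
      then have "D * ?dA n \<le> c1 * t n powr (p * (m + 1)) * ?dP n - c3 * t n powr \<gamma> * ?dB n + \<eta> n"
      proof -
        have "(x * y1 - z * y2 + w * d) / d = x * (y1 / d) - z * (y2 / d) + w" if "d > 0" for x y1 z y2 w d :: real
          using that by (simp add: add_divide_distrib diff_divide_distrib)
        then show ?thesis using \<open>D * (A_fun (?x n) - A_fun u) / e n \<le> _\<close> e(2)[of n] by (simp only: times_divide_eq_right)
      qed
      then show ?case unfolding R_def D_def[symmetric] using D by (simp add: pos_le_divide_eq mult.commute)
    qed
    show ?thesis using singular_Fatou[OF u v v0 e b R] by blast
  qed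
  \<comment> \<open>A bump equal to 1 on a given ball excludes zeros of \<open>u\<close> there, up
    to a null set; countably many balls cover the space.\<close>
  have "AE x in lborel. \<forall>n::nat. norm x \<le> real n \<longrightarrow> u x \<noteq> 0"
    unfolding AE_all_countable
  proof
    fix n :: nat
    have ne: "cball (0::'a) (real n) \<noteq> {}" by simp
    obtain \<phi> R where \<phi>: "\<And>n. \<phi> n \<in> wspace" "\<And>n x. 0 \<le> \<phi> n x" "\<And>n x. \<phi> n x \<le> 1"
      "\<And>n x. R < norm x \<Longrightarrow> \<phi> n x = 0" "\<And>k x. x \<in> cball 0 (real n) \<Longrightarrow> \<phi> k x = 1"
      "\<And>x. (\<lambda>n. \<phi> n x) \<longlonglongrightarrow> indicator (cball 0 (real n)) x"
      by (rule bump_family[OF compact_cball ne]) (rule that)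
    have "AE x in lborel. \<not> (u x = 0 \<and> \<phi> 0 x > 0)" using Fatou[OF \<phi>(1)[of 0]] \<phi>(2) by auto
    then show "AE x in lborel. norm x \<le> real n \<longrightarrow> u x \<noteq> 0"
      by eventually_elim (use \<phi>(5)[of _ 0] in auto)
  qed
  with u0 show upos: "AE x in lborel. u x > 0"
  proof eventually_elim
    case (elim x)
    obtain n :: nat where "norm x \<le> real n" using real_arch_simple by blast
    then show ?case using elim by force
  qed
  have nonneg: "integrable lborel (\<lambda>x. \<alpha> x * u x powr (- \<delta>) * v x) \<and> c2 * (1 - \<delta>) * aform u v \<le> Lf v"
    if v: "v \<in> wspace" and v0: "AE x in lborel. v x \<ge> 0" for v
  proof -
    have [measurable]: "v \<in> borel_measurable borel" using v by measurable
    let ?f = "\<lambda>x. (1 - \<delta>) * (\<alpha> x * u x powr (- \<delta>) * v x)"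
    have nn: "AE x in lborel. 0 \<le> ?f x"
      using v0 \<alpha>_pos by eventually_elim (use \<delta>_lt_1 in simp)
    have le: "(\<integral>\<^sup>+ x. ennreal (?f x) \<partial>lborel) \<le> ennreal (Lf v / c2)" and L0: "Lf v / c2 \<ge> 0" using Fatou[OF v v0] by auto
    have i: "integrable lborel ?f"
    proof (rule integrableI_nonneg[OF _ nn])
      show "(\<integral>\<^sup>+ x. ennreal (?f x) \<partial>lborel) < \<infinity>" using le by (simp add: le_less_trans)
    qed measurable
    then have i': "integrable lborel (\<lambda>x. \<alpha> x * u x powr (- \<delta>) * v x)" using \<delta>_lt_1 by simp
    have "ennreal (LINT x|lborel. ?f x) \<le> ennreal (Lf v / c2)" using le nn_integral_eq_integral[OF i nn] by simp
    then have "(LINT x|lborel. ?f x) \<le> Lf v / c2" using L0 by simp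
    then have "(1 - \<delta>) * aform u v \<le> Lf v / c2" by (simp add: aform_def)
    then have "c2 * (1 - \<delta>) * aform u v \<le> Lf v" using c2 by (simp add: field_simps)
    then show ?thesis using i' by simp
  qed
  have int: "integrable lborel (\<lambda>x. \<alpha> x * u x powr (- \<delta>) * v x)" if v: "v \<in> wspace" for v
  proof -
    have 1: "(\<lambda>x. max (v x) 0) \<in> wspace" by (rule wspace_pos_part[OF v])
    have 2: "(\<lambda>x. max (- v x) 0) \<in> wspace" using wspace_pos_part[OF wspace_scale[OF v, of "-1"]] by simp
    have "integrable lborel (\<lambda>x. \<alpha> x * u x powr (- \<delta>) * max (v x) 0 - \<alpha> x * u x powr (- \<delta>) * max (- v x) 0)"
      using nonneg[OF 1] nonneg[OF 2] by (intro Bochner_Integration.integrable_diff) auto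
    moreover have "\<alpha> x * u x powr (- \<delta>) * max (v x) 0 - \<alpha> x * u x powr (- \<delta>) * max (- v x) 0 = \<alpha> x * u x powr (- \<delta>) * v x" for x
      by (simp add: max_def)
    ultimately show ?thesis by simp
  qed
  show "v \<in> wspace \<Longrightarrow> integrable lborel (\<lambda>x. \<alpha> x * u x powr (- \<delta>) * v x)" by (rule int)
  define \<Lambda> where "\<Lambda> = (\<lambda>v. Lf v - c2 * (1 - \<delta>) * aform u v)"
  have lin: "\<Lambda> (\<lambda>x. v x + t * w x) = \<Lambda> v + t * \<Lambda> w" if v: "v \<in> wspace" and w: "w \<in> wspace" for v w t
  proof -
    have "aform u (\<lambda>x. v x + t * w x) = (LINT x|lborel. \<alpha> x * u x powr (- \<delta>) * v x + t * (\<alpha> x * u x powr (- \<delta>) * w x))"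
      unfolding aform_def by (intro Bochner_Integration.integral_cong) (auto simp: algebra_simps)
    also have "\<dots> = aform u v + t * aform u w"
      unfolding aform_def using int[OF v] int[OF w] by (subst Bochner_Integration.integral_add) auto
    finally show ?thesis unfolding \<Lambda>_def Lf_def form_linear[OF uw v w] by (simp add: algebra_simps)
  qed
  have \<Lambda>u: "\<Lambda> u = 0"
  proof -
    have "wenergy u powr m * wenergy u = P_fun u"
      using cone_energy_pos[OF u] by (simp add: P_fun_def powr_add)
    then show ?thesis
      using zero form_self[OF u] upos by (simp add: \<Lambda>_def Lf_def kE_def mult.assoc)
  qed
  have ge: "\<Lambda> v \<ge> 0" if v: "v \<in> wspace" for v
  proof -
    have vm [measurable]: "v \<in> borel_measurable borel" using v by measurable
    define e where "e = (\<lambda>n. 1 / real (Suc n))"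
    have e: "e \<longlonglongrightarrow> 0" "\<And>n. 0 < e n" using harmonic_e by (auto simp: e_def)
    let ?X = "\<lambda>n x. u x + e n * v x"
    define I1 where "I1 = (\<lambda>z. kernel z * (\<bar>u (fst z) - u (snd z)\<bar> powr (p - 2) * \<bar>u (fst z) - u (snd z)\<bar> * \<bar>v (fst z) - v (snd z)\<bar>))"
    define I2 where "I2 = (\<lambda>x. V x * (\<bar>u x\<bar> powr (p - 2) * \<bar>u x\<bar> * \<bar>v x\<bar>))"
    define I3 where "I3 = (\<lambda>x. \<bar>\<beta> x\<bar> * (\<bar>u x\<bar> powr (\<gamma> - 2) * \<bar>u x\<bar> * \<bar>v x\<bar>))"
    \<comment> \<open>\<open>S1\<close> and \<open>S2\<close> mark where the perturbation has become
      negative. As \<open>u > 0\<close> almost everywhere they tend to 0 pointwise, so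
      \<open>T n\<close> tends to 0.\<close>
    define S1 where "S1 = (\<lambda>n z. if ?X n (fst z) < 0 \<or> ?X n (snd z) < 0 then 1 else 0 :: real)"
    define S2 where "S2 = (\<lambda>n x. if ?X n x < 0 then 1 else 0 :: real)"
    have [measurable]: "I1 \<in> borel_measurable borel" "I2 \<in> borel_measurable borel" "I3 \<in> borel_measurable borel"
      unfolding I1_def I2_def I3_def by measurable
    have [measurable]: "S1 n \<in> borel_measurable borel" "S2 n \<in> borel_measurable borel" for n
      unfolding S1_def S2_def by measurable
    have i1: "integrable lborel I1"
      using integrable_abs[OF form_integrable(1)[OF uw v]] unfolding I1_def by (simp add: abs_mult kernel_nonneg)
    have i2: "integrable lborel I2"
      using integrable_abs[OF form_integrable(2)[OF uw v]] V_pos unfolding I2_def by (simp add: abs_mult less_imp_le)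
    have i3: "integrable lborel I3"
      using integrable_abs[OF form_integrable(3)[OF uw v]] unfolding I3_def by (simp add: abs_mult)
    have ev: "\<forall>\<^sub>F n in sequentially. ?X n x > 0" if "u x > 0" for x
    proof (rule order_tendstoD(1))
      show "(\<lambda>n. ?X n x) \<longlonglongrightarrow> u x + 0 * v x" by (intro tendsto_intros e)
    qed (use that in simp)
    have S1b: "\<bar>S1 n z\<bar> \<le> 1" and S2b: "\<bar>S2 n x\<bar> \<le> 1" for n z x by (auto simp: S1_def S2_def)
    have j1: "integrable lborel (\<lambda>z. I1 z * S1 n z)" for n
      by (rule Bochner_Integration.integrable_bound[OF i1]) (use S1b in \<open>auto simp: abs_mult intro!: AE_I2 mult_left_le\<close>)
    have j2: "integrable lborel (\<lambda>x. I2 x * S2 n x)" for n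
      by (rule Bochner_Integration.integrable_bound[OF i2]) (use S2b in \<open>auto simp: abs_mult intro!: AE_I2 mult_left_le\<close>)
    have j3: "integrable lborel (\<lambda>x. I3 x * S2 n x)" for n
      by (rule Bochner_Integration.integrable_bound[OF i3]) (use S2b in \<open>auto simp: abs_mult intro!: AE_I2 mult_left_le\<close>)
    define T where "T = (\<lambda>n. kE * ((LINT z|lborel. I1 z * S1 n z) + (LINT x|lborel. I2 x * S2 n x)) + \<bar>c3\<bar> * \<gamma> * (LINT x|lborel. I3 x * S2 n x))"
    have lim2: "AE x in lborel. (\<lambda>n. I x * S2 n x) \<longlonglongrightarrow> 0" for I :: "'a \<Rightarrow> real"
      using upos
    proof eventually_elim
      case (elim x)
      have "\<forall>\<^sub>F n in sequentially. I x * S2 n x = 0" using ev[OF elim] by eventually_elim (simp add: S2_def)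
      then show ?case by (rule tendsto_eventually)
    qed
    have lim1: "AE z in lborel. (\<lambda>n. I1 z * S1 n z) \<longlonglongrightarrow> 0"
      using AE_lborel_fst[OF upos] AE_lborel_snd[OF upos]
    proof eventually_elim
      case (elim z)
      have "\<forall>\<^sub>F n in sequentially. I1 z * S1 n z = 0" using ev[OF elim(1)] ev[OF elim(2)] by eventually_elim (simp add: S1_def)
      then show ?case by (rule tendsto_eventually)
    qed
    have t1: "(\<lambda>n. LINT z|lborel. I1 z * S1 n z) \<longlonglongrightarrow> (LINT z|(lborel::('a \<times> 'a) measure). 0)"
      by (rule integral_dominated_convergence[OF _ _ integrable_abs[OF i1] lim1])
        (use S1b in \<open>auto simp: abs_mult intro!: AE_I2 mult_left_le\<close>)
    have t2: "(\<lambda>n. LINT x|lborel. I2 x * S2 n x) \<longlonglongrightarrow> (LINT x|(lborel::'a measure). 0)"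
      by (rule integral_dominated_convergence[OF _ _ integrable_abs[OF i2] lim2])
        (use S2b in \<open>auto simp: abs_mult intro!: AE_I2 mult_left_le\<close>)
    have t3: "(\<lambda>n. LINT x|lborel. I3 x * S2 n x) \<longlonglongrightarrow> (LINT x|(lborel::'a measure). 0)"
      by (rule integral_dominated_convergence[OF _ _ integrable_abs[OF i3] lim2])
        (use S2b in \<open>auto simp: abs_mult intro!: AE_I2 mult_left_le\<close>)
    have "T \<longlonglongrightarrow> kE * (0 + 0) + \<bar>c3\<bar> * \<gamma> * 0"
      unfolding T_def using t1 t2 t3 by (intro tendsto_intros) simp_all
    then have T0: "(\<lambda>n. - T n) \<longlonglongrightarrow> 0" using tendsto_minus[of T 0] by simp
    have "- T n \<le> \<Lambda> v" for n
    proof -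
      define X where "X = ?X n"
      have Xw: "X \<in> wspace" unfolding X_def by (rule wspace_add[OF uw wspace_scale[OF v]])
      define ng where "ng = (\<lambda>x. max (- X x) 0)"
      have ngw: "ng \<in> wspace" unfolding ng_def using wspace_pos_part[OF wspace_scale[OF Xw, of "-1"]] by simp
      have [measurable]: "ng \<in> borel_measurable borel" using ngw by measurable
      have ng0: "ng x \<ge> 0" for x by (simp add: ng_def)
      have pos: "(\<lambda>x. max (X x) 0) \<in> wspace" by (rule wspace_pos_part[OF Xw])
      \<comment> \<open>Nonnegativity at the positive part of \<open>u + e v\<close> reads
        \<open>0 \<le> e n * \<Lambda> v + \<Lambda> ng\<close>, so it remains to bound
        \<open>\<Lambda> ng\<close> by o(e).\<close>
      have "(\<lambda>x. max (X x) 0) = (\<lambda>x. X x + 1 * ng x)" by (auto simp: ng_def max_def)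
      then have "\<Lambda> (\<lambda>x. max (X x) 0) = \<Lambda> X + 1 * \<Lambda> ng" using lin[OF Xw ngw, of 1] by simp
      moreover have "\<Lambda> X = \<Lambda> u + e n * \<Lambda> v" unfolding X_def by (rule lin[OF uw v])
      moreover have "\<Lambda> (\<lambda>x. max (X x) 0) \<ge> 0" using nonneg[OF pos] by (simp add: \<Lambda>_def)
      ultimately have key: "0 \<le> e n * \<Lambda> v + \<Lambda> ng" using \<Lambda>u by simp
      have small: "AE x in lborel. ng x \<le> e n * (\<bar>v x\<bar> * S2 n x)"
        using u0
      proof eventually_elim
        case (elim x)
        have "- (e n * v x) \<le> e n * \<bar>v x\<bar>" using e(2)[of n] by (simp add: abs_mult[symmetric] abs_if)
        then show ?case using elim by (auto simp: ng_def X_def S2_def max_def)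
      qed
      have g: "gform u ng \<le> e n * (LINT z|lborel. I1 z * S1 n z)"
      proof -
        have "gform u ng \<le> (LINT z|lborel. e n * (I1 z * S1 n z))"
          unfolding gform_def
        proof (rule integral_mono[OF form_integrable(1)[OF uw ngw] integrable_mult_right[OF j1]])
          fix z
          have "\<bar>u (fst z) - u (snd z)\<bar> powr (p - 2) * (u (fst z) - u (snd z)) * (ng (fst z) - ng (snd z))
             \<le> e n * (\<bar>u (fst z) - u (snd z)\<bar> powr (p - 2) * \<bar>u (fst z) - u (snd z)\<bar> * \<bar>v (fst z) - v (snd z)\<bar> * S1 n z)"
            unfolding ng_def X_def S1_def by (rule negative_part_pairing[OF e(2)])
          then have "kernel z * (\<bar>u (fst z) - u (snd z)\<bar> powr (p - 2) * (u (fst z) - u (snd z)) * (ng (fst z) - ng (snd z)))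
             \<le> kernel z * (e n * (\<bar>u (fst z) - u (snd z)\<bar> powr (p - 2) * \<bar>u (fst z) - u (snd z)\<bar> * \<bar>v (fst z) - v (snd z)\<bar> * S1 n z))"
            by (rule mult_left_mono) (rule kernel_nonneg)
          then show "kernel z * (\<bar>u (fst z) - u (snd z)\<bar> powr (p - 2) * (u (fst z) - u (snd z)) * (ng (fst z) - ng (snd z))) \<le> e n * (I1 z * S1 n z)"
            by (simp add: I1_def mult_ac)
        qed
        then show ?thesis by simp
      qed
      have vf: "vform u ng \<le> e n * (LINT x|lborel. I2 x * S2 n x)"
      proof -
        have "vform u ng \<le> (LINT x|lborel. e n * (I2 x * S2 n x))"
          unfolding vform_def
        proof (rule integral_mono_AE[OF form_integrable(2)[OF uw ngw] integrable_mult_right[OF j2]])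
          show "AE x in lborel. V x * (\<bar>u x\<bar> powr (p - 2) * u x * ng x) \<le> e n * (I2 x * S2 n x)"
            using small u0
          proof eventually_elim
            case (elim x)
            have "V x * (\<bar>u x\<bar> powr (p - 2) * u x * ng x) \<le> V x * (\<bar>u x\<bar> powr (p - 2) * u x * (e n * (\<bar>v x\<bar> * S2 n x)))"
              using elim V_pos[of x] by (intro mult_left_mono) auto
            then show ?case using elim by (simp add: I2_def mult_ac)
          qed
        qed
        then show ?thesis by simp
      qed
      have bf: "\<bar>bform u ng\<bar> \<le> e n * (LINT x|lborel. I3 x * S2 n x)"
      proof -
        have "\<bar>bform u ng\<bar> \<le> (LINT x|lborel. \<bar>\<beta> x * (\<bar>u x\<bar> powr (\<gamma> - 2) * u x * ng x)\<bar>)"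
          unfolding bform_def by (rule integral_abs_bound)
        also have "\<dots> \<le> (LINT x|lborel. e n * (I3 x * S2 n x))"
        proof (rule integral_mono_AE[OF integrable_abs[OF form_integrable(3)[OF uw ngw]] integrable_mult_right[OF j3]])
          show "AE x in lborel. \<bar>\<beta> x * (\<bar>u x\<bar> powr (\<gamma> - 2) * u x * ng x)\<bar> \<le> e n * (I3 x * S2 n x)"
            using small u0
          proof eventually_elim
            case (elim x)
            have "\<bar>\<beta> x\<bar> * (\<bar>u x\<bar> powr (\<gamma> - 2) * \<bar>u x\<bar> * ng x) \<le> \<bar>\<beta> x\<bar> * (\<bar>u x\<bar> powr (\<gamma> - 2) * \<bar>u x\<bar> * (e n * (\<bar>v x\<bar> * S2 n x)))"
              using elim by (intro mult_left_mono) auto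
            then show ?case using ng0[of x] by (simp add: I3_def abs_mult mult_ac)
          qed
        qed
        finally show ?thesis by simp
      qed
      \<comment> \<open>The singular term enters \<open>\<Lambda>\<close> with a minus sign, so its
        sign on \<open>ng\<close> is enough.\<close>
      have af: "aform u ng \<ge> 0"
        unfolding aform_def
        by (rule integral_nonneg_AE) (use \<alpha>_pos ng0 in \<open>auto elim!: eventually_mono\<close>)
      have "- (c3 * \<gamma> * bform u ng) \<le> \<bar>c3\<bar> * \<gamma> * \<bar>bform u ng\<bar>"
        using \<gamma>_gt_1 abs_ge_minus_self[of "c3 * \<gamma> * bform u ng"] by (simp add: abs_mult)
      also have "\<dots> \<le> \<bar>c3\<bar> * \<gamma> * (e n * (LINT x|lborel. I3 x * S2 n x))"
        using bf \<gamma>_gt_1 by (intro mult_left_mono) auto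
      finally have b: "- (c3 * \<gamma> * bform u ng) \<le> \<bar>c3\<bar> * \<gamma> * (e n * (LINT x|lborel. I3 x * S2 n x))" .
      have "kE * (gform u ng + vform u ng) \<le> kE * (e n * (LINT z|lborel. I1 z * S1 n z) + e n * (LINT x|lborel. I2 x * S2 n x))"
        using g vf kE by (intro mult_left_mono add_mono) auto
      moreover have "c2 * (1 - \<delta>) * aform u ng \<ge> 0" using af c2 \<delta>_lt_1 by simp
      ultimately have "\<Lambda> ng \<le> kE * (e n * (LINT z|lborel. I1 z * S1 n z) + e n * (LINT x|lborel. I2 x * S2 n x))
          + \<bar>c3\<bar> * \<gamma> * (e n * (LINT x|lborel. I3 x * S2 n x))"
        using b unfolding \<Lambda>_def Lf_def by linarith
      also have "\<dots> = e n * T n" by (simp add: T_def algebra_simps)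
      finally have "0 \<le> e n * (\<Lambda> v + T n)" using key by (simp add: algebra_simps)
      then have "0 \<le> \<Lambda> v + T n" using e(2)[of n] by (simp add: zero_le_mult_iff)
      then show ?thesis by linarith
    qed
    then show ?thesis by (intro LIMSEQ_le_const2[OF T0]) auto
  qed
  assume v: "v \<in> wspace"
  have "\<Lambda> (\<lambda>x. 0 * v x + (-1) * v x) = \<Lambda> (\<lambda>x. 0 * v x) + (-1) * \<Lambda> v" by (rule lin[OF wspace_scale[OF v] v])
  moreover have "\<Lambda> (\<lambda>x. 0 * v x) = 0" by (simp add: \<Lambda>_def Lf_def gform_def vform_def bform_def aform_def)
  moreover have "\<Lambda> (\<lambda>x. 0 * v x + (-1) * v x) \<ge> 0" by (intro ge wspace_add wspace_scale v)
  ultimately have "\<Lambda> v = 0" using ge[OF v] by linarith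
  then show "c1 * (p * (m + 1)) * (wenergy u powr m * (gform u v + vform u v))
       - c2 * (1 - \<delta>) * aform u v - c3 * \<gamma> * bform u v = 0"
    by (simp add: \<Lambda>_def Lf_def kE_def algebra_simps)
qed

end

context weighted_fractional
begin

lemma gagliardo_cong_AE:
  assumes [measurable]: "u \<in> borel_measurable borel" "v \<in> borel_measurable borel"
    and ae: "AE x in lborel. u x = v x"
  shows "gagliardo u = gagliardo v"
  unfolding gagliardo_kernel[OF assms(1)] gagliardo_kernel[OF assms(2)]
proof (rule nn_integral_cong_AE)
  show "AE z in lborel. ennreal (kernel z * \<bar>u (fst z) - u (snd z)\<bar> powr p) = ennreal (kernel z * \<bar>v (fst z) - v (snd z)\<bar> powr p)"
    using AE_lborel_fst[OF ae] AE_lborel_snd[OF ae] by eventually_elim simp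
qed

lemma potential_cong_AE:
  assumes ae: "AE x in lborel. u x = v x"
  shows "potential u = potential v"
  unfolding potential_def using ae by (intro nn_integral_cong_AE) (auto elim!: eventually_mono)

lemma wspace_cong_AE:
  assumes "u \<in> wspace" "v \<in> borel_measurable borel" "AE x in lborel. u x = v x"
  shows "v \<in> wspace"
  using assms gagliardo_cong_AE[of u v] potential_cong_AE[of u v] by (auto simp: wspace_def)

end

section \<open>Two solutions at the level of Borel functions\<close>

context kirchhoff_problem
begin

lemma nehari_fibering_exists:
  "\<exists>C. nehari_fibering cone (\<lambda>t u x. t * u x) P_fun A_fun B_fun a (p * (m + 1)) (1 - \<delta>) \<gamma> C"
proof -
  obtain C1 where C1: "C1 > 0" "\<And>u. u \<in> cone \<Longrightarrow> A_fun u \<le> C1 * P_fun u powr ((1 - \<delta>) / (p * (m + 1)))"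
    using A_bound by auto
  obtain C2 where C2: "C2 > 0" "\<And>u. u \<in> cone \<Longrightarrow> B_fun u \<le> C2 * P_fun u powr (\<gamma> / (p * (m + 1)))"
    using B_bound by auto
  define C where "C = max C1 C2"
  have CC: "C1 \<le> C" "C2 \<le> C" "C > 0" using C1 C2 by (auto simp: C_def)
  have k: "1 < p * (m + 1)"
  proof -
    have "p * 1 < p * (m + 1)" using p_pos m_pos by (intro mult_strict_left_mono) auto
    then show ?thesis using p_gt_1 by linarith
  qed
  have "nehari_fibering cone (\<lambda>t u x. t * u x) P_fun A_fun B_fun a (p * (m + 1)) (1 - \<delta>) \<gamma> C"
  proof unfold_locales
    show "A_fun u \<le> C * P_fun u powr ((1 - \<delta>) / (p * (m + 1)))" if "u \<in> cone" for u
      by (rule order_trans[OF C1(2)[OF that] mult_right_mono[OF CC(1)]]) simp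
    show "B_fun u \<le> C * P_fun u powr (\<gamma> / (p * (m + 1)))" if "u \<in> cone" for u
      by (rule order_trans[OF C2(2)[OF that] mult_right_mono[OF CC(2)]]) simp
    show "\<exists>r. strict_mono r \<and> ((\<lambda>n. A_fun (x (r n))) \<longlonglongrightarrow> 0 \<and> (\<lambda>n. B_fun (x (r n))) \<longlonglongrightarrow> 0 \<or>
         (\<exists>u\<in>cone. \<exists>pl. P_fun u \<le> pl \<and> (\<lambda>n. P_fun (x (r n))) \<longlonglongrightarrow> pl \<and>
            (\<lambda>n. A_fun (x (r n))) \<longlonglongrightarrow> A_fun u \<and> (\<lambda>n. B_fun (x (r n))) \<longlonglongrightarrow> B_fun u))"
      if "\<And>n. x n \<in> cone" "\<And>n. P_fun (x n) \<le> c" for x :: "nat \<Rightarrow> 'a \<Rightarrow> real" and c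
      using that by (rule cone_compactness)
    show "P_fun u > 0" if "u \<in> cone" for u
      using cone_energy_pos[OF that] by (simp add: P_fun_def)
  qed (use a_pos \<delta>_lt_1 \<delta>_pos k pm_less CC cone_scale P_scale[OF cone_wspace] A_scale B_scale A_positive B_positive_exists in auto)
  then show ?thesis by blast
qed

lemma bounded_quotient:
  fixes f :: "nat \<Rightarrow> real"
  assumes "(\<lambda>n. (f n - c) / e n) \<longlonglongrightarrow> d" "\<And>n. 0 < e n"
  shows "\<exists>D. \<forall>n. \<bar>f n - c\<bar> \<le> D * e n"
proof -
  have "Bseq (\<lambda>n. (f n - c) / e n)" by (rule convergent_imp_Bseq[OF convergentI[OF assms(1)]])
  then obtain D where "0 < D" and D: "\<forall>n. norm ((f n - c) / e n) \<le> D" by (rule BseqE)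
  have "\<bar>f n - c\<bar> \<le> D * e n" for n
    using D[rule_format, of n] assms(2)[of n] by (simp add: abs_divide divide_le_eq)
  then show ?thesis by blast
qed

definition solves :: "real \<Rightarrow> ('a \<Rightarrow> real) \<Rightarrow> bool" where
  "solves lam u \<longleftrightarrow> u \<in> cone \<and> (AE x in lborel. u x > 0) \<and> a * P_fun u = lam * A_fun u + B_fun u \<and>
     (\<forall>v\<in>wspace. integrable lborel (\<lambda>x. \<alpha> x * u x powr (- \<delta>) * v x) \<and>
        a * (wenergy u powr m * (gform u v + vform u v)) - lam * aform u v - bform u v = 0)"

theorem two_solutions:
  assumes ndeg: "(AE x in lborel. \<beta> x > 0) \<Longrightarrow> (\<lambda>x. (\<alpha> x / \<beta> x) powr (1 / (\<gamma> + \<delta> - 1))) \<notin> wspace"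
  defines "ls \<equiv> (INF u\<in>{u \<in> cone. B_fun u > 0}. a * ((\<gamma> - p * (m + 1)) / (\<gamma> - (1 - \<delta>)))
      * (a * ((p * (m + 1) - (1 - \<delta>)) / (\<gamma> - (1 - \<delta>)))) powr ((p * (m + 1) - (1 - \<delta>)) / (\<gamma> - p * (m + 1)))
      * (P_fun u powr ((\<gamma> - (1 - \<delta>)) / (\<gamma> - p * (m + 1))) / (A_fun u * B_fun u powr ((p * (m + 1) - (1 - \<delta>)) / (\<gamma> - p * (m + 1))))))"
  shows "ls > 0" and "\<exists>\<epsilon>>0. \<forall>lam. 0 < lam \<and> lam < ls + \<epsilon> \<longrightarrow>
     (\<exists>u. solves lam u \<and> (\<gamma> - (1 - \<delta>)) * B_fun u < (p * (m + 1) - (1 - \<delta>)) * a * P_fun u) \<and>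
     (\<exists>w. solves lam w \<and> (p * (m + 1) - (1 - \<delta>)) * a * P_fun w < (\<gamma> - (1 - \<delta>)) * B_fun w)"
proof -
  define k where "k = p * (m + 1)"
  define q where "q = 1 - \<delta>"
  obtain C where "nehari_fibering cone (\<lambda>t u x. t * u x) P_fun A_fun B_fun a (p * (m + 1)) (1 - \<delta>) \<gamma> C"
    using nehari_fibering_exists by blast
  then interpret N: nehari_fibering cone "\<lambda>t u x. t * u x" P_fun A_fun B_fun a k q \<gamma> C
    by (simp add: k_def q_def)
  have ls: "ls = N.lam_star" unfolding ls_def k_def[symmetric] q_def[symmetric] N.lam_star_def N.ray_def ..
  show "ls > 0" unfolding ls by (rule N.lam_star_pos)
  let ?x = "\<lambda>u v n x. u x + 1 / real (Suc n) * v x"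
  have adm: "N.admissible u (?x u v) (\<lambda>n. 1 / real (Suc n))"
    if u: "u \<in> cone" and v: "v \<in> wspace" and v0: "AE x in lborel. v x \<ge> 0" for u v
  proof -
    obtain D1 where D1: "\<And>n. \<bar>P_fun (?x u v n) - P_fun u\<bar> \<le> D1 * (1 / real (Suc n))"
      using bounded_quotient[OF P_direction[OF u v harmonic_e] harmonic_e(2)] by blast
    obtain D2 where D2: "\<And>n. \<bar>B_fun (?x u v n) - B_fun u\<bar> \<le> D2 * (1 / real (Suc n))"
      using bounded_quotient[OF form_directions(5)[OF cone_wspace[OF u] v harmonic_e] harmonic_e(2)] by blast
    have "D1 * (1 / real (Suc n)) \<le> max D1 D2 * (1 / real (Suc n))" "D2 * (1 / real (Suc n)) \<le> max D1 D2 * (1 / real (Suc n))" for n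
      by (intro mult_right_mono; simp)+
    then have "\<bar>P_fun (?x u v n) - P_fun u\<bar> \<le> max D1 D2 * (1 / real (Suc n)) \<and> \<bar>B_fun (?x u v n) - B_fun u\<bar> \<le> max D1 D2 * (1 / real (Suc n))" for n
      using D1[of n] D2[of n] by (meson order_trans)
    then show ?thesis
      unfolding N.admissible_def
      using cone_add[OF u v v0 harmonic_e(2)] harmonic_e A_mono_add[OF u v v0 harmonic_e(2)]
        A_tendsto_add[OF cone_wspace[OF u] v harmonic_e] by blast
  qed
  have st: "\<exists>\<rho> t \<eta>. strict_mono (\<rho> :: nat \<Rightarrow> nat) \<and> t \<longlonglongrightarrow> 1 \<and> \<eta> \<longlonglongrightarrow> 0 \<and>
       (\<forall>\<^sub>F n in sequentially. fibre c1 c2 c3 (t n) (\<lambda>x. u x + 1 / real (Suc (\<rho> n)) * v x) - fibre c1 c2 c3 (t n) u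
          \<ge> - \<eta> n * (1 / real (Suc (\<rho> n))))"
    if "u \<in> cone" "N.stationary c1 c2 c3 u" "v \<in> wspace" "AE x in lborel. v x \<ge> 0" for c1 c2 c3 u v
  proof -
    have fib: "fibre c1 c2 c3 t y = N.fib c1 c2 c3 t y" for t y unfolding fibre_def k_def[symmetric] q_def[symmetric] N.fib_def ..
    show ?thesis
      unfolding fib by (rule that(2)[unfolded N.stationary_def, rule_format, OF adm[OF that(1,3,4)]])
  qed
  have kq: "k > 0" "q > 0" "\<gamma> > 0" using N.k_pos N.q_pos N.g_pos by auto
  have sol: "solves lam u" if u: "u \<in> cone" and lam: "lam > 0" and eq: "a * P_fun u = lam * A_fun u + B_fun u"
    and S: "N.stationary (a / k) (lam / q) (1 / \<gamma>) u" for lam u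
  proof -
    have c: "a / k > 0" "lam / q > 0" using a_pos lam kq by auto
    have z: "a / k * (p * (m + 1)) * P_fun u - lam / q * (1 - \<delta>) * A_fun u - 1 / \<gamma> * \<gamma> * B_fun u = 0"
      unfolding k_def[symmetric] q_def[symmetric] using kq eq by simp
    note W = stationary_weak_form[OF u c st[OF u S] z]
    have "a / k * (p * (m + 1)) = a" "lam / q * (1 - \<delta>) = lam" "1 / \<gamma> * \<gamma> = 1"
      unfolding k_def[symmetric] q_def[symmetric] using kq by auto
    then show ?thesis unfolding solves_def using u eq W by simp
  qed
  have nd: False if u: "u \<in> cone" and d: "(k - q) * a * P_fun u = (\<gamma> - q) * B_fun u"
    and eq: "a * P_fun u = N.lam_star * A_fun u + B_fun u"
    and S1: "N.stationary (a / k) (N.lam_star / q) (1 / \<gamma>) u" and S2: "N.stationary a N.lam_star 1 u" for u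
  proof -
    note ls0 = N.lam_star_pos
    have s1: "solves N.lam_star u" by (rule sol[OF u ls0 eq S1])
    then have upos: "AE x in lborel. u x > 0" by (simp add: solves_def)
    \<comment> \<open>Combined with the Nehari identity, degeneracy is the hypothesis
      \<open>zero\<close> of \<open>stationary_weak_form\<close> for the coefficients
      \<open>a\<close>, \<open>lam_star\<close>, \<open>1\<close>.\<close>
    have "k * (a * P_fun u) - q * (a * P_fun u - B_fun u) - \<gamma> * B_fun u = 0" using d by (simp add: algebra_simps)
    moreover have "N.lam_star * A_fun u = a * P_fun u - B_fun u" using eq by simp
    ultimately have "k * (a * P_fun u) - q * (N.lam_star * A_fun u) - \<gamma> * B_fun u = 0" by (simp only:)
    then have z: "a * (p * (m + 1)) * P_fun u - N.lam_star * (1 - \<delta>) * A_fun u - 1 * \<gamma> * B_fun u = 0"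
      unfolding k_def[symmetric] q_def[symmetric] by (simp add: mult_ac)
    have um [measurable]: "u \<in> borel_measurable borel" using cone_wspace[OF u] by measurable
    define c1 where "c1 = \<gamma> - k"
    define c2 where "c2 = (k - q) * N.lam_star"
    have c: "c1 > 0" "c2 > 0" using N.k_less N.q_less ls0 by (auto simp: c1_def c2_def)
    \<comment> \<open>What is left of the two equations after the operator has been eliminated;
      \<open>f\<close> annihilates every test function and hence vanishes almost everywhere.\<close>
    define f where "f = (\<lambda>x. c1 * (\<beta> x * (\<bar>u x\<bar> powr (\<gamma> - 2) * u x)) - c2 * (\<alpha> x * u x powr (- \<delta>)))"
    have fv: "f x * v x = c1 * (\<beta> x * (\<bar>u x\<bar> powr (\<gamma> - 2) * u x * v x)) - c2 * (\<alpha> x * u x powr (- \<delta>) * v x)" for v x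
      by (simp add: f_def algebra_simps)
    have "AE x in lborel. f x = 0"
    proof (rule AE_zero_of_test)
      show "f \<in> borel_measurable borel" unfolding f_def by measurable
      fix v assume v: "v \<in> wspace"
      have i1: "integrable lborel (\<lambda>x. \<beta> x * (\<bar>u x\<bar> powr (\<gamma> - 2) * u x * v x))" by (rule form_integrable(3)[OF cone_wspace[OF u] v])
      have i2: "integrable lborel (\<lambda>x. \<alpha> x * u x powr (- \<delta>) * v x)"
        by (rule stationary_weak_form(2)[OF u a_pos ls0 _ z v]) (rule st[OF u S2])
      show "integrable lborel (\<lambda>x. f x * v x)" unfolding fv using i1 i2 by (intro Bochner_Integration.integrable_diff integrable_mult_right)
      have e1: "a * (wenergy u powr m * (gform u v + vform u v)) = N.lam_star * aform u v + bform u v"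
        using s1 v by (auto simp: solves_def)
      define L where "L = a * (wenergy u powr m * (gform u v + vform u v))"
      have "k * L - N.lam_star * q * aform u v - \<gamma> * bform u v = 0"
      proof -
        have "a * (p * (m + 1)) * (wenergy u powr m * (gform u v + vform u v))
           - N.lam_star * (1 - \<delta>) * aform u v - 1 * \<gamma> * bform u v = 0"
          by (rule stationary_weak_form(3)[OF u a_pos ls0 _ z v]) (rule st[OF u S2])
        then show ?thesis unfolding k_def[symmetric] q_def[symmetric] L_def by (simp add: algebra_simps)
      qed
      then have "k * (N.lam_star * aform u v + bform u v) - N.lam_star * q * aform u v - \<gamma> * bform u v = 0"
        using e1 by (simp add: L_def)
      then have "c1 * bform u v - c2 * aform u v = 0" by (simp add: c1_def c2_def algebra_simps)
      then show "(LINT x|lborel. f x * v x) = 0" unfolding fv using i1 i2 by (simp add: bform_def aform_def)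
    qed
    then have eqx: "AE x in lborel. \<beta> x > 0 \<and> c2 / c1 > 0 \<and> (c1 / c2) powr (1 / (\<gamma> + \<delta> - 1)) * u x = (\<alpha> x / \<beta> x) powr (1 / (\<gamma> + \<delta> - 1))"
      using upos \<alpha>_pos
    proof eventually_elim
      case (elim x)
      have e: "\<gamma> + \<delta> - 1 > 0" using \<gamma>_gt_1 \<delta>_pos by simp
      have "u x powr (\<gamma> - 2) * u x = u x powr (\<gamma> - 1)" using elim by (simp add: powr_diff powr_numeral power2_eq_square)
      then have eq1: "c1 * (\<beta> x * u x powr (\<gamma> - 1)) = c2 * (\<alpha> x * u x powr (- \<delta>))" using elim by (simp add: f_def)
      moreover have "c2 * (\<alpha> x * u x powr (- \<delta>)) > 0" using c elim by simp
      ultimately have "c1 * (\<beta> x * u x powr (\<gamma> - 1)) > 0" by simp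
      then have b: "\<beta> x > 0" using c elim by (simp add: zero_less_mult_iff)
      have "c1 * \<beta> x * u x powr (\<gamma> - 1) * u x powr \<delta> = c2 * \<alpha> x * (u x powr (- \<delta>) * u x powr \<delta>)" using eq1 by simp
      also have "u x powr (- \<delta>) * u x powr \<delta> = 1" using elim by (simp flip: powr_add)
      finally have "c1 * \<beta> x * (u x powr (\<gamma> - 1) * u x powr \<delta>) = c2 * \<alpha> x" by simp
      also have "u x powr (\<gamma> - 1) * u x powr \<delta> = u x powr (\<gamma> + \<delta> - 1)" by (simp add: algebra_simps flip: powr_add)
      finally have "\<alpha> x / \<beta> x = (c1 / c2) * u x powr (\<gamma> + \<delta> - 1)" using b c by (simp add: field_simps)
      then have "(\<alpha> x / \<beta> x) powr (1 / (\<gamma> + \<delta> - 1)) = (c1 / c2) powr (1 / (\<gamma> + \<delta> - 1)) * (u x powr (\<gamma> + \<delta> - 1)) powr (1 / (\<gamma> + \<delta> - 1))"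
        by (simp only:) (subst powr_mult, use c in auto)
      also have "(u x powr (\<gamma> + \<delta> - 1)) powr (1 / (\<gamma> + \<delta> - 1)) = u x" using e elim by (simp add: powr_powr)
      finally show ?case using b c by simp
    qed
    have "(\<lambda>x. (c1 / c2) powr (1 / (\<gamma> + \<delta> - 1)) * u x) \<in> wspace" by (rule wspace_scale[OF cone_wspace[OF u]])
    then have "(\<lambda>x. (\<alpha> x / \<beta> x) powr (1 / (\<gamma> + \<delta> - 1))) \<in> wspace"
      by (rule wspace_cong_AE) (use eqx in \<open>auto elim: eventually_mono\<close>)
    moreover have "AE x in lborel. \<beta> x > 0" using eqx by (auto elim: eventually_mono)
    ultimately show False using ndeg by blast
  qed
  obtain \<epsilon> where \<epsilon>: "\<epsilon> > 0" and two: "\<forall>lam. 0 < lam \<and> lam < N.lam_star + \<epsilon> \<longrightarrow>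
     (\<exists>u\<in>cone. a * P_fun u = lam * A_fun u + B_fun u \<and> (\<gamma> - q) * B_fun u < (k - q) * a * P_fun u \<and> N.stationary (a / k) (lam / q) (1 / \<gamma>) u) \<and>
     (\<exists>w\<in>cone. a * P_fun w = lam * A_fun w + B_fun w \<and> (k - q) * a * P_fun w < (\<gamma> - q) * B_fun w \<and> N.stationary (a / k) (lam / q) (1 / \<gamma>) w)"
  proof -
    have "\<exists>\<epsilon>>0. \<forall>lam. 0 < lam \<and> lam < N.lam_star + \<epsilon> \<longrightarrow>
     (\<exists>u\<in>cone. a * P_fun u = lam * A_fun u + B_fun u \<and> (\<gamma> - q) * B_fun u < (k - q) * a * P_fun u \<and> N.stationary (a / k) (lam / q) (1 / \<gamma>) u) \<and>
     (\<exists>w\<in>cone. a * P_fun w = lam * A_fun w + B_fun w \<and> (k - q) * a * P_fun w < (\<gamma> - q) * B_fun w \<and> N.stationary (a / k) (lam / q) (1 / \<gamma>) w)"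
      by (rule N.two_stationary_points) (fact nd)
    then show thesis by (elim exE conjE) (rule that)
  qed
  show "\<exists>\<epsilon>>0. \<forall>lam. 0 < lam \<and> lam < ls + \<epsilon> \<longrightarrow>
     (\<exists>u. solves lam u \<and> (\<gamma> - (1 - \<delta>)) * B_fun u < (p * (m + 1) - (1 - \<delta>)) * a * P_fun u) \<and>
     (\<exists>w. solves lam w \<and> (p * (m + 1) - (1 - \<delta>)) * a * P_fun w < (\<gamma> - (1 - \<delta>)) * B_fun w)"
    unfolding k_def[symmetric] q_def[symmetric] ls
  proof (intro exI[of _ \<epsilon>] conjI allI impI)
    fix lam assume l: "0 < lam \<and> lam < N.lam_star + \<epsilon>"
    from two[rule_format, OF l]
    show "\<exists>u. solves lam u \<and> (\<gamma> - q) * B_fun u < (k - q) * a * P_fun u"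
      and "\<exists>w. solves lam w \<and> (k - q) * a * P_fun w < (\<gamma> - q) * B_fun w"
      using sol l by blast+
  qed (rule \<epsilon>)
qed

end

section \<open>Borel representatives of Lebesgue measurable functions\<close>

lemma AE_lebesgue_iff_lborel: "(AE x in lebesgue. Q x) \<longleftrightarrow> (AE x in lborel. Q x)"
  by (rule AE_completion_iff)

lemma lebesgue_borel_representative:
  fixes f :: "'b::euclidean_space \<Rightarrow> real"
  assumes "f \<in> borel_measurable lebesgue"
  shows "\<exists>g\<in>borel_measurable borel. AE x in lborel. f x = g x"
  using completion_ex_borel_measurable_real[OF assms] by simp

lemma lebesgue_measurable_cong_AE:
  fixes f g :: "'b::euclidean_space \<Rightarrow> real"
  assumes g: "g \<in> borel_measurable borel" and ae: "AE x in lborel. f x = g x"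
  shows "f \<in> borel_measurable lebesgue"
proof (rule measurableI)
  fix A :: "real set" assume A: "A \<in> sets borel"
  have "g -` A \<inter> space lborel \<in> sets lborel" using g A by (intro measurable_sets[of g lborel borel]) auto
  then have gA: "g -` A \<in> sets lebesgue" by simp
  have "f -` A \<in> sets lebesgue"
    by (rule completion.in_sets_AE[OF _ gA]) (use ae in \<open>auto simp: AE_lebesgue_iff_lborel elim: eventually_mono\<close>)
  then show "f -` A \<inter> space lebesgue \<in> sets lebesgue" by simp
qed simp

lemma nn_integral_lebesgue_cong_AE:
  assumes "AE x in lborel. f x = g x"
  shows "(\<integral>\<^sup>+ x. f x \<partial>lebesgue) = (\<integral>\<^sup>+ x. g x \<partial>lborel)"
  unfolding nn_integral_completion using assms by (rule nn_integral_cong_AE)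

lemma integral_lebesgue_cong_AE:
  fixes f g :: "'b::euclidean_space \<Rightarrow> real"
  assumes g: "g \<in> borel_measurable borel" and ae: "AE x in lborel. f x = g x"
  shows "(LINT x|lebesgue. f x) = (LINT x|lborel. g x)" "integrable lebesgue f \<longleftrightarrow> integrable lborel g"
proof -
  have f: "f \<in> borel_measurable lebesgue" by (rule lebesgue_measurable_cong_AE[OF assms])
  have g': "g \<in> borel_measurable lborel" using g by simp
  have gl: "g \<in> borel_measurable lebesgue" by (rule measurable_completion[OF g'])
  have ae': "AE x in lebesgue. f x = g x" using ae by (simp add: AE_lebesgue_iff_lborel)
  have "(LINT x|lebesgue. f x) = (LINT x|lebesgue. g x)" by (rule integral_cong_AE[OF f gl ae'])
  then show "(LINT x|lebesgue. f x) = (LINT x|lborel. g x)" using integral_completion[OF g'] by simp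
  have "integrable lebesgue f \<longleftrightarrow> integrable lebesgue g" by (rule integrable_cong_AE[OF f gl ae'])
  then show "integrable lebesgue f \<longleftrightarrow> integrable lborel g" using integrable_completion[OF g'] by simp
qed

lemma kirchhoff_prim_eq: "m > 0 \<Longrightarrow> t \<ge> 0 \<Longrightarrow> kirchhoff_prim a m t = a * t powr (m + 1) / (m + 1)"
proof -
  assume "m > 0" "t \<ge> 0"
  then have "((\<lambda>x. x powr m) has_integral (t powr (m + 1) / (m + 1))) {0..t}" by (intro has_integral_powr_from_0) auto
  then have "((\<lambda>x. a * x powr m) has_integral a * (t powr (m + 1) / (m + 1))) {0..t}" by (rule has_integral_mult_right)
  moreover have "kirchhoff a m = (\<lambda>x. a * x powr m)" by (auto simp: kirchhoff_def)
  ultimately show ?thesis unfolding kirchhoff_prim_def using integral_unique by (simp only: times_divide_eq_right)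
qed

text \<open>The primed coefficients are Borel representatives, on which the analysis runs; the
  unprimed ones are the data as given.\<close>

locale kirchhoff_data = kirchhoff_problem s p "real CARD('n) + s * p" "TYPE(real ^ 'n)" V V0 h \<alpha>' \<beta>' \<delta> \<gamma> \<xi> \<tau> a m c\<beta>
  for s p :: real and V :: "real ^ 'n \<Rightarrow> real" and V0 h :: real and \<alpha>' \<beta>' :: "real ^ 'n \<Rightarrow> real"
    and \<delta> \<gamma> \<xi> \<tau> a m c\<beta> :: real +
  fixes \<alpha> \<beta> :: "real ^ 'n \<Rightarrow> real"
  assumes \<alpha>_rep: "AE x in lborel. \<alpha> x = \<alpha>' x" and \<beta>_rep: "AE x in lborel. \<beta> x = \<beta>' x"
begin

lemma W_energy_rep:
  assumes g: "g \<in> borel_measurable borel" and ae: "AE x in lborel. u x = g x"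
  shows "W_energy s p V u = gagliardo g + potential g"
proof -
  have "(\<integral>\<^sup>+ (x, y). ennreal (\<bar>u x - u y\<bar> powr p / norm (x - y) powr (real CARD('n) + s * p)) \<partial>lebesgue)
    = (\<integral>\<^sup>+ (x, y). ennreal (\<bar>g x - g y\<bar> powr p / norm (x - y) powr (real CARD('n) + s * p)) \<partial>lborel)"
  proof (rule nn_integral_lebesgue_cong_AE)
    show "AE z in lborel. (case z of (x, y) \<Rightarrow> ennreal (\<bar>u x - u y\<bar> powr p / norm (x - y) powr (real CARD('n) + s * p)))
      = (case z of (x, y) \<Rightarrow> ennreal (\<bar>g x - g y\<bar> powr p / norm (x - y) powr (real CARD('n) + s * p)))"
      using AE_lborel_fst[OF ae] AE_lborel_snd[OF ae] by eventually_elim (simp add: split_beta)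
  qed
  moreover have "(\<integral>\<^sup>+ x. ennreal (V x * \<bar>u x\<bar> powr p) \<partial>lebesgue) = potential g"
    unfolding potential_def using ae by (intro nn_integral_lebesgue_cong_AE) (auto elim!: eventually_mono)
  ultimately show ?thesis unfolding W_energy_def by (simp add: gagliardo_eq[OF g])
qed

lemma p_less_crit: "p < crit_power"
  using \<gamma>_gt \<gamma>_lt by linarith

lemma W_space_iff:
  assumes g: "g \<in> borel_measurable borel" and ae: "AE x in lborel. u x = g x"
  shows "u \<in> W_space s p V \<longleftrightarrow> g \<in> wspace"
proof
  assume "u \<in> W_space s p V"
  then show "g \<in> wspace" using W_energy_rep[OF assms] g by (simp add: W_space_def wspace_def)
next
  assume gw: "g \<in> wspace"
  have "integrable lborel (\<lambda>x. \<bar>g x\<bar> powr p)" by (rule wspace_powr_integrable[OF gw order_refl p_less_crit])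
  moreover have "AE x in lborel. \<bar>u x\<bar> powr p = \<bar>g x\<bar> powr p" using ae by (auto elim!: eventually_mono)
  ultimately have "integrable lebesgue (\<lambda>x. \<bar>u x\<bar> powr p)"
    using integral_lebesgue_cong_AE(2)[of "\<lambda>x. \<bar>g x\<bar> powr p" "\<lambda>x. \<bar>u x\<bar> powr p"] g by simp
  moreover have "W_energy s p V u < \<infinity>" using gw W_energy_rep[OF assms] by (simp add: wspace_def)
  ultimately show "u \<in> W_space s p V"
    using lebesgue_measurable_cong_AE[OF assms] by (simp add: W_space_def Lspace_def)
qed

lemma W_space_measurable: "u \<in> W_space s p V \<Longrightarrow> u \<in> borel_measurable lebesgue"
  by (simp add: W_space_def Lspace_def)

lemma W_norm_powr:
  assumes g: "g \<in> borel_measurable borel" and ae: "AE x in lborel. u x = g x"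
  shows "W_norm s p V u powr p = wenergy g" "W_norm s p V u powr (p * (m + 1)) = P_fun g"
  using p_pos by (simp_all add: W_norm_def W_energy_rep[OF assms] wenergy_def P_fun_def powr_powr)

lemma A_rep:
  assumes g: "g \<in> borel_measurable borel" and ae: "AE x in lborel. u x = g x"
  shows "(LINT x|lebesgue. \<alpha> x * \<bar>u x\<bar> powr (1 - \<delta>)) = A_fun g"
proof -
  have "AE x in lborel. \<alpha> x * \<bar>u x\<bar> powr (1 - \<delta>) = \<alpha>' x * \<bar>g x\<bar> powr (1 - \<delta>)"
    using ae \<alpha>_rep by eventually_elim simp
  then show ?thesis unfolding A_fun_def using g by (intro integral_lebesgue_cong_AE) auto
qed

lemma B_rep:
  assumes g: "g \<in> borel_measurable borel" and ae: "AE x in lborel. u x = g x"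
  shows "(LINT x|lebesgue. \<beta> x * \<bar>u x\<bar> powr \<gamma>) = B_fun g"
proof -
  have "AE x in lborel. \<beta> x * \<bar>u x\<bar> powr \<gamma> = \<beta>' x * \<bar>g x\<bar> powr \<gamma>"
    using ae \<beta>_rep by eventually_elim simp
  then show ?thesis unfolding B_fun_def using g by (intro integral_lebesgue_cong_AE) auto
qed

lemma W_cone_iff:
  assumes g: "g \<in> borel_measurable borel" and ae: "AE x in lborel. u x = g x"
  shows "u \<in> W_cone s p V \<longleftrightarrow> g \<in> cone"
proof -
  have "(AE x in lborel. u x = 0) \<longleftrightarrow> (AE x in lborel. g x = 0)" "(AE x in lborel. u x \<ge> 0) \<longleftrightarrow> (AE x in lborel. g x \<ge> 0)"
    using ae by (auto intro!: eventually_subst elim!: eventually_mono)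
  then show ?thesis
    using W_space_iff[OF assms] by (auto simp: W_cone_def cone_def AE_lebesgue_iff_lborel)
qed

text \<open>The two infima run over the same set of values: each member of \<open>G_plus\<close> has
  a Borel representative with the same quotient, and Borel functions represent themselves.\<close>

lemma lambda_star_eq:
  "lambda_star s p \<delta> \<gamma> a m V \<alpha> \<beta> = (INF u\<in>{u \<in> cone. B_fun u > 0}. a * ((\<gamma> - p * (m + 1)) / (\<gamma> - (1 - \<delta>)))
      * (a * ((p * (m + 1) - (1 - \<delta>)) / (\<gamma> - (1 - \<delta>)))) powr ((p * (m + 1) - (1 - \<delta>)) / (\<gamma> - p * (m + 1)))
      * (P_fun u powr ((\<gamma> - (1 - \<delta>)) / (\<gamma> - p * (m + 1))) / (A_fun u * B_fun u powr ((p * (m + 1) - (1 - \<delta>)) / (\<gamma> - p * (m + 1))))))"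
  (is "_ = (INF u\<in>?G. ?ray u)")
proof -
  have lf: "lambda_fun s p \<delta> \<gamma> a m V \<alpha> \<beta> u = ?ray g"
    if g: "g \<in> borel_measurable borel" and ae: "AE x in lborel. u x = g x" for u g
  proof -
    have e: "\<gamma> + \<delta> - 1 = \<gamma> - (1 - \<delta>)" "p * (m + 1) + \<delta> - 1 = p * (m + 1) - (1 - \<delta>)" by simp_all
    show ?thesis unfolding lambda_fun_def A_rep[OF that] B_rep[OF that] W_norm_powr[OF that] e ..
  qed
  have "lambda_fun s p \<delta> \<gamma> a m V \<alpha> \<beta> ` G_plus s p \<gamma> V \<beta> = ?ray ` ?G"
  proof (intro set_eqI iffI)
    fix y assume "y \<in> lambda_fun s p \<delta> \<gamma> a m V \<alpha> \<beta> ` G_plus s p \<gamma> V \<beta>"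
    then obtain u where u: "u \<in> W_cone s p V" "(LINT x|lebesgue. \<beta> x * \<bar>u x\<bar> powr \<gamma>) > 0" "y = lambda_fun s p \<delta> \<gamma> a m V \<alpha> \<beta> u"
      by (auto simp: G_plus_def)
    have "u \<in> borel_measurable lebesgue" using u(1) by (intro W_space_measurable) (simp add: W_cone_def)
    then obtain g where g: "g \<in> borel_measurable borel" "AE x in lborel. u x = g x" using lebesgue_borel_representative by blast
    have gG: "g \<in> ?G" using u(1,2) unfolding W_cone_iff[OF g] B_rep[OF g] by blast
    show "y \<in> ?ray ` ?G" unfolding image_iff
      by (rule bexI[OF _ gG]) (simp only: u(3) lf[OF g])
  next
    fix y assume "y \<in> ?ray ` ?G"
    then obtain g where gG: "g \<in> ?G" and y: "y = ?ray g" by (rule imageE)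
    then have g: "g \<in> cone" "B_fun g > 0" by simp_all
    have gm: "g \<in> borel_measurable borel" using cone_wspace[OF g(1)] by measurable
    have ae: "AE x in lborel. g x = g x" by simp
    show "y \<in> lambda_fun s p \<delta> \<gamma> a m V \<alpha> \<beta> ` G_plus s p \<gamma> V \<beta>"
    proof (rule rev_image_eqI)
      show "g \<in> G_plus s p \<gamma> V \<beta>"
        using g unfolding G_plus_def W_cone_iff[OF gm ae, symmetric] B_rep[OF gm ae, symmetric] by blast
      show "y = lambda_fun s p \<delta> \<gamma> a m V \<alpha> \<beta> g" unfolding y by (rule lf[OF gm ae, symmetric])
    qed
  qed
  then show ?thesis by (simp add: lambda_star_def)
qed

lemma fibering_eq:
  assumes u: "u \<in> cone" and t: "t > 0"
  shows "fibering s p \<delta> \<gamma> a m V \<alpha> \<beta> lam u t = fibre (a / (p * (m + 1))) (lam / (1 - \<delta>)) (1 / \<gamma>) t u"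
proof -
  have uw: "u \<in> wspace" by (rule cone_wspace[OF u])
  have um: "u \<in> borel_measurable borel" using uw by measurable
  have g: "(\<lambda>x. t * u x) \<in> borel_measurable borel" using um by measurable
  have ae: "AE x in lborel. t * u x = t * u x" by simp
  have "kirchhoff_prim a m (W_norm s p V (\<lambda>x. t * u x) powr p) = a * P_fun (\<lambda>x. t * u x) / (m + 1)"
    unfolding W_norm_powr[OF g ae] P_fun_def by (rule kirchhoff_prim_eq[OF m_pos wenergy_nonneg])
  then show ?thesis
    unfolding fibering_def Psi_def A_rep[OF g ae] B_rep[OF g ae] P_scale[OF uw t] A_scale[OF t] B_scale[OF t] fibre_def
    using p_pos m_pos by simp
qed

text \<open>The second derivative is expressed through \<open>P_fun\<close> and \<open>B_fun\<close>
  by eliminating \<open>A_fun\<close> with the Nehari identity, matching the strict inequalities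
  obtained from the minimisation.\<close>

lemma fibering_derivs:
  assumes u: "u \<in> cone" and eq: "a * P_fun u = lam * A_fun u + B_fun u"
  shows "deriv (fibering s p \<delta> \<gamma> a m V \<alpha> \<beta> lam u) 1 = 0"
    and "deriv (deriv (fibering s p \<delta> \<gamma> a m V \<alpha> \<beta> lam u)) 1 = (p * (m + 1) - (1 - \<delta>)) * a * P_fun u - (\<gamma> - (1 - \<delta>)) * B_fun u"
proof -
  define k where "k = p * (m + 1)"
  define q where "q = 1 - \<delta>"
  have k: "k > 0" "q > 0" "\<gamma> > 0" using p_pos m_pos \<delta>_lt_1 \<gamma>_gt_1 by (auto simp: k_def q_def)
  let ?F = "fibering s p \<delta> \<gamma> a m V \<alpha> \<beta> lam u"
  let ?F1 = "\<lambda>t. a * t powr (k - 1) * P_fun u - lam * t powr (q - 1) * A_fun u - t powr (\<gamma> - 1) * B_fun u"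
  have d: "(?F has_real_derivative ?F1 t) (at t)" if t: "t > 0" for t
  proof -
    have "((\<lambda>t. a / k * t powr k * P_fun u - lam / q * t powr q * A_fun u - 1 / \<gamma> * t powr \<gamma> * B_fun u) has_real_derivative ?F1 t) (at t)"
      using t k by (auto intro!: derivative_eq_intros)
    then show ?thesis
    proof (rule has_field_derivative_transform_within_open[of _ _ _ "{0<..}"])
      fix y :: real assume "y \<in> {0<..}"
      then show "a / k * y powr k * P_fun u - lam / q * y powr q * A_fun u - 1 / \<gamma> * y powr \<gamma> * B_fun u = ?F y"
        by (simp add: fibering_eq[OF u] fibre_def k_def q_def)
    qed (use t in auto)
  qed
  have d1: "deriv ?F t = ?F1 t" if "t > 0" for t by (rule DERIV_imp_deriv[OF d[OF that]])
  show "deriv ?F 1 = 0" using d1[of 1] eq by simp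
  have "(?F1 has_real_derivative a * (k - 1) * P_fun u - lam * (q - 1) * A_fun u - (\<gamma> - 1) * B_fun u) (at 1)"
    by (auto intro!: derivative_eq_intros)
  then have "(deriv ?F has_real_derivative a * (k - 1) * P_fun u - lam * (q - 1) * A_fun u - (\<gamma> - 1) * B_fun u) (at 1)"
    by (rule has_field_derivative_transform_within_open[of _ _ _ "{0<..}"]) (use d1 in auto)
  then have "deriv (deriv ?F) 1 = a * (k - 1) * P_fun u - lam * (q - 1) * A_fun u - (\<gamma> - 1) * B_fun u" by (rule DERIV_imp_deriv)
  also have "\<dots> = (k - 1) * (a * P_fun u) - (q - 1) * (lam * A_fun u) - (\<gamma> - 1) * B_fun u" by simp
  also have "lam * A_fun u = a * P_fun u - B_fun u" using eq by simp
  also have "(k - 1) * (a * P_fun u) - (q - 1) * (a * P_fun u - B_fun u) - (\<gamma> - 1) * B_fun u = (k - q) * a * P_fun u - (\<gamma> - q) * B_fun u"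
    by (simp add: algebra_simps)
  finally show "deriv (deriv ?F) 1 = (p * (m + 1) - (1 - \<delta>)) * a * P_fun u - (\<gamma> - (1 - \<delta>)) * B_fun u"
    by (simp add: k_def q_def)
qed

lemma solves_weak_solution:
  assumes u: "solves lam u"
  shows "weak_solution s p \<delta> \<gamma> a m V \<alpha> \<beta> lam u"
proof -
  have uc: "u \<in> cone" and upos: "AE x in lborel. u x > 0" using u by (auto simp: solves_def)
  have um [measurable]: "u \<in> borel_measurable borel" using cone_wspace[OF uc] by measurable
  have aeu: "AE x in lborel. u x = u x" by simp
  have main: "integrable lebesgue (\<lambda>x. \<alpha> x * u x powr (- \<delta>) * v x) \<and>
        kirchhoff a m (W_norm s p V u powr p)
          * (gagliardo_form s p u v + (LINT x|lebesgue. V x * u x powr (p - 1) * v x))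
        - lam * (LINT x|lebesgue. \<alpha> x * u x powr (- \<delta>) * v x)
        - (LINT x|lebesgue. \<beta> x * u x powr (\<gamma> - 1) * v x) = 0" if v: "v \<in> W_space s p V" for v
  proof -
    obtain g where g [measurable]: "g \<in> borel_measurable borel" and ae: "AE x in lborel. v x = g x"
      using lebesgue_borel_representative[OF W_space_measurable[OF v]] by blast
    have gw: "g \<in> wspace" using v W_space_iff[OF g ae] by simp
    have aeA: "AE x in lborel. \<alpha> x * u x powr (- \<delta>) * v x = \<alpha>' x * u x powr (- \<delta>) * g x"
      using ae \<alpha>_rep by eventually_elim simp
    have mA: "(\<lambda>x. \<alpha>' x * u x powr (- \<delta>) * g x) \<in> borel_measurable borel" by measurable
    have i: "integrable lebesgue (\<lambda>x. \<alpha> x * u x powr (- \<delta>) * v x)"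
      using integral_lebesgue_cong_AE(2)[OF mA aeA] u gw by (simp add: solves_def)
    have A: "(LINT x|lebesgue. \<alpha> x * u x powr (- \<delta>) * v x) = aform u g"
      unfolding aform_def by (rule integral_lebesgue_cong_AE(1)[OF mA aeA])
    have pw: "\<bar>t\<bar> powr (r - 2) * t = t powr (r - 1)" if "t > 0" for t r :: real
      using that by (simp add: powr_diff powr_numeral power2_eq_square)
    have Vf: "(LINT x|lebesgue. V x * u x powr (p - 1) * v x) = vform u g"
      unfolding vform_def
    proof (rule integral_lebesgue_cong_AE(1))
      show "AE x in lborel. V x * u x powr (p - 1) * v x = V x * (\<bar>u x\<bar> powr (p - 2) * u x * g x)"
        using ae upos by eventually_elim (simp only: pw mult.assoc)
    qed measurable
    have Bf: "(LINT x|lebesgue. \<beta> x * u x powr (\<gamma> - 1) * v x) = bform u g"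
      unfolding bform_def
    proof (rule integral_lebesgue_cong_AE(1))
      show "AE x in lborel. \<beta> x * u x powr (\<gamma> - 1) * v x = \<beta>' x * (\<bar>u x\<bar> powr (\<gamma> - 2) * u x * g x)"
        using ae upos \<beta>_rep by eventually_elim (simp only: pw mult.assoc)
    qed measurable
    have G: "gagliardo_form s p u v = gform u g"
      unfolding gagliardo_form_def gform_def
    proof (rule integral_lebesgue_cong_AE(1))
      show "AE z in lborel. (case z of (x, y) \<Rightarrow> \<bar>u x - u y\<bar> powr (p - 2) * (u x - u y) * (v x - v y) / norm (x - y) powr (real CARD('n) + s * p))
         = kernel z * (\<bar>u (fst z) - u (snd z)\<bar> powr (p - 2) * (u (fst z) - u (snd z)) * (g (fst z) - g (snd z)))"
        using AE_lborel_fst[OF ae] AE_lborel_snd[OF ae] by eventually_elim (simp add: kernel_def split_beta)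
    qed measurable
    show ?thesis
      unfolding A Vf Bf G W_norm_powr(1)[OF um aeu] kirchhoff_def
      using i u gw by (simp add: solves_def mult.assoc)
  qed
  have "u \<in> W_space s p V" using W_space_iff[OF um aeu] cone_wspace[OF uc] by simp
  then show ?thesis
    unfolding weak_solution_def using upos main by (simp add: AE_lebesgue_iff_lborel)
qed

theorem two_weak_solutions:
  assumes ndeg: "(AE x in lebesgue. \<beta> x > 0) \<Longrightarrow> (\<lambda>x. (\<alpha> x / \<beta> x) powr (1 / (\<gamma> + \<delta> - 1))) \<notin> W_space s p V"
  shows "lambda_star s p \<delta> \<gamma> a m V \<alpha> \<beta> > 0 \<and>
    (\<exists>\<epsilon> > 0. \<forall>lam. 0 < lam \<and> lam < lambda_star s p \<delta> \<gamma> a m V \<alpha> \<beta> + \<epsilon> \<longrightarrow>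
       (\<exists>u w. weak_solution s p \<delta> \<gamma> a m V \<alpha> \<beta> lam u \<and> weak_solution s p \<delta> \<gamma> a m V \<alpha> \<beta> lam w \<and>
              u \<in> Nehari_plus s p \<delta> \<gamma> a m V \<alpha> \<beta> lam \<and> w \<in> Nehari_minus s p \<delta> \<gamma> a m V \<alpha> \<beta> lam \<and>
              \<not> (AE x in lebesgue. u x = w x)))"
proof -
  have nd: "(\<lambda>x. (\<alpha>' x / \<beta>' x) powr (1 / (\<gamma> + \<delta> - 1))) \<notin> wspace" if pos: "AE x in lborel. \<beta>' x > 0"
  proof -
    have "AE x in lborel. \<beta> x > 0" using pos \<beta>_rep by eventually_elim simp
    then have "(\<lambda>x. (\<alpha> x / \<beta> x) powr (1 / (\<gamma> + \<delta> - 1))) \<notin> W_space s p V"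
      by (intro ndeg) (simp add: AE_lebesgue_iff_lborel)
    moreover have "AE x in lborel. (\<alpha> x / \<beta> x) powr (1 / (\<gamma> + \<delta> - 1)) = (\<alpha>' x / \<beta>' x) powr (1 / (\<gamma> + \<delta> - 1))"
      using \<alpha>_rep \<beta>_rep by eventually_elim simp
    ultimately show ?thesis
      using W_space_iff[of "\<lambda>x. (\<alpha>' x / \<beta>' x) powr (1 / (\<gamma> + \<delta> - 1))" "\<lambda>x. (\<alpha> x / \<beta> x) powr (1 / (\<gamma> + \<delta> - 1))"] by simp
  qed
  let ?ls = "lambda_star s p \<delta> \<gamma> a m V \<alpha> \<beta>"
  have N: "u \<in> Nehari s p \<delta> \<gamma> a m V \<alpha> \<beta> lam" if "solves lam u" for lam u
  proof -
    have uc: "u \<in> cone" and eq: "a * P_fun u = lam * A_fun u + B_fun u" using that by (auto simp: solves_def)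
    have "u \<in> borel_measurable borel" using cone_wspace[OF uc] by measurable
    then have "u \<in> W_cone s p V" using W_cone_iff[of u u] uc by simp
    then show ?thesis using fibering_derivs(1)[OF uc eq] by (simp add: Nehari_def)
  qed
  have "\<exists>\<epsilon>>0. \<forall>lam. 0 < lam \<and> lam < ?ls + \<epsilon> \<longrightarrow>
     (\<exists>u. solves lam u \<and> (\<gamma> - (1 - \<delta>)) * B_fun u < (p * (m + 1) - (1 - \<delta>)) * a * P_fun u) \<and>
     (\<exists>w. solves lam w \<and> (p * (m + 1) - (1 - \<delta>)) * a * P_fun w < (\<gamma> - (1 - \<delta>)) * B_fun w)"
    unfolding lambda_star_eq by (rule two_solutions(2)) (rule nd)
  then obtain \<epsilon> where \<epsilon>: "\<epsilon> > 0" and two: "\<And>lam. 0 < lam \<Longrightarrow> lam < ?ls + \<epsilon> \<Longrightarrow>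
     (\<exists>u. solves lam u \<and> (\<gamma> - (1 - \<delta>)) * B_fun u < (p * (m + 1) - (1 - \<delta>)) * a * P_fun u) \<and>
     (\<exists>w. solves lam w \<and> (p * (m + 1) - (1 - \<delta>)) * a * P_fun w < (\<gamma> - (1 - \<delta>)) * B_fun w)" by blast
  have pos: "?ls > 0" unfolding lambda_star_eq by (rule two_solutions(1)) (rule nd)
  show ?thesis
  proof (intro conjI pos exI[of _ \<epsilon>] \<epsilon> allI impI)
    fix lam assume l: "0 < lam \<and> lam < ?ls + \<epsilon>"
    obtain u where u: "solves lam u" "(\<gamma> - (1 - \<delta>)) * B_fun u < (p * (m + 1) - (1 - \<delta>)) * a * P_fun u"
      using two l by blast
    obtain w where w: "solves lam w" "(p * (m + 1) - (1 - \<delta>)) * a * P_fun w < (\<gamma> - (1 - \<delta>)) * B_fun w"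
      using two l by blast
    have uc: "u \<in> cone" and equ: "a * P_fun u = lam * A_fun u + B_fun u" using u by (auto simp: solves_def)
    have wc: "w \<in> cone" and eqw: "a * P_fun w = lam * A_fun w + B_fun w" using w by (auto simp: solves_def)
    have "u \<in> Nehari_plus s p \<delta> \<gamma> a m V \<alpha> \<beta> lam"
      using N[OF u(1)] fibering_derivs(2)[OF uc equ] u(2) by (simp add: Nehari_plus_def)
    moreover have "w \<in> Nehari_minus s p \<delta> \<gamma> a m V \<alpha> \<beta> lam"
      using N[OF w(1)] fibering_derivs(2)[OF wc eqw] w(2) by (simp add: Nehari_minus_def)
    \<comment> \<open>Equal classes would share \<open>P_fun\<close> and \<open>B_fun\<close>,
      against the opposite strict inequalities.\<close>
    moreover have "\<not> (AE x in lebesgue. u x = w x)"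
    proof
      assume "AE x in lebesgue. u x = w x"
      then have ae: "AE x in lborel. u x = w x" by (simp add: AE_lebesgue_iff_lborel)
      have um: "u \<in> borel_measurable borel" "w \<in> borel_measurable borel"
        using cone_wspace[OF uc] cone_wspace[OF wc] by measurable
      have aew: "AE x in lborel. w x = w x" by simp
      have "P_fun u = P_fun w" "B_fun u = B_fun w"
        using W_norm_powr(2)[OF um(2) ae] W_norm_powr(2)[OF um(1), of u] B_rep[OF um(2) ae] B_rep[OF um(1), of u] by simp_all
      then show False using u(2) w(2) by simp
    qed
    ultimately show "\<exists>u w. weak_solution s p \<delta> \<gamma> a m V \<alpha> \<beta> lam u \<and> weak_solution s p \<delta> \<gamma> a m V \<alpha> \<beta> lam w \<and>
              u \<in> Nehari_plus s p \<delta> \<gamma> a m V \<alpha> \<beta> lam \<and> w \<in> Nehari_minus s p \<delta> \<gamma> a m V \<alpha> \<beta> lam \<and>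
              \<not> (AE x in lebesgue. u x = w x)"
      using solves_weak_solution[OF u(1)] solves_weak_solution[OF w(1)] by blast
  qed
qed

end

theorem theorem1p3:
  fixes s p \<delta> \<gamma> \<xi> \<tau> a m V0 h :: real
    and V \<alpha> \<beta> :: "real ^ 'n \<Rightarrow> real"
  assumes "CARD('n) \<ge> 2"
    and "0 < s" and "s < 1" and "1 < p" and "s * p < real CARD('n)"
    and "0 < \<delta>" and "\<delta> < 1" and "p < \<gamma>" and "\<gamma> < crit_exp CARD('n) s p - 1"
    and "AE x in lebesgue. \<alpha> x > 0"
    and "\<xi> > 1" and "\<alpha> \<in> Lspace \<xi>" and "\<alpha> \<in> Linfty"
    and "p < \<tau>" and "\<tau> < crit_exp CARD('n) s p" and "1 / \<xi> + (1 - \<delta>) / \<tau> = 1"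
    and "\<beta> \<in> Linfty" and "\<not> (AE x in lebesgue. max (\<beta> x) 0 = 0)"
    and "(AE x in lebesgue. \<beta> x > 0) \<Longrightarrow>
           (\<lambda>x. (\<alpha> x / \<beta> x) powr (1 / (\<gamma> + \<delta> - 1))) \<notin> W_space s p V"
    and "a > 0" and "m > 0" and "p * (m + 1) < \<gamma>"
    and "continuous_on UNIV V" and "\<And>x. V x > 0" and "V0 > 0" and "(INF x. V x) \<ge> V0"
    and "h > 0"
    and "\<And>c. c > 0 \<Longrightarrow> ((\<lambda>y. measure lebesgue {x \<in> ball y h. V x \<le> c}) \<longlongrightarrow> 0) at_infinity"
  shows "lambda_star s p \<delta> \<gamma> a m V \<alpha> \<beta> > 0 \<and>
    (\<exists>\<epsilon> > 0. \<forall>lam. 0 < lam \<and> lam < lambda_star s p \<delta> \<gamma> a m V \<alpha> \<beta> + \<epsilon> \<longrightarrow>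
       (\<exists>u w. weak_solution s p \<delta> \<gamma> a m V \<alpha> \<beta> lam u \<and> weak_solution s p \<delta> \<gamma> a m V \<alpha> \<beta> lam w \<and>
              u \<in> Nehari_plus s p \<delta> \<gamma> a m V \<alpha> \<beta> lam \<and> w \<in> Nehari_minus s p \<delta> \<gamma> a m V \<alpha> \<beta> lam \<and>
              \<not> (AE x in lebesgue. u x = w x)))"
proof -
  obtain \<alpha>' where \<alpha>' [measurable]: "\<alpha>' \<in> borel_measurable borel" and \<alpha>_rep: "AE x in lborel. \<alpha> x = \<alpha>' x"
    using lebesgue_borel_representative[of \<alpha>] assms(12) by (auto simp: Lspace_def)
  obtain \<beta>' where \<beta>' [measurable]: "\<beta>' \<in> borel_measurable borel" and \<beta>_rep: "AE x in lborel. \<beta> x = \<beta>' x"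
    using lebesgue_borel_representative[of \<beta>] assms(17) by (auto simp: Linfty_def)
  obtain c\<beta> where c\<beta>: "AE x in lborel. \<bar>\<beta> x\<bar> \<le> c\<beta>"
    using assms(17) by (auto simp: Linfty_def AE_lebesgue_iff_lborel)
  have Vm [measurable]: "V \<in> borel_measurable borel" using assms(23) by (rule borel_measurable_continuous_onI)
  have W: "weighted_fractional s p (real CARD('n) + s * p) V V0 h"
  proof unfold_locales
    \<comment> \<open>The real infimum bounds \<open>V\<close> from below only if the range is
      bounded below, which positivity of \<open>V\<close> supplies.\<close>
    have "bdd_below (range V)" using assms(24) by (intro bdd_belowI2[of _ 0]) (simp add: less_imp_le)
    then show "V0 \<le> V x" for x using assms(26) cINF_lower[of V UNIV x] by simp
    show "((\<lambda>y. measure lborel {x \<in> ball y h. V x \<le> c}) \<longlongrightarrow> 0) at_infinity" if "c > 0" for c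
    proof -
      have "{x \<in> ball y h. V x \<le> c} \<in> sets borel" for y
      proof -
        have "{x \<in> ball y h. V x \<le> c} = ball y h \<inter> {x. V x \<le> c}" by auto
        then show ?thesis by simp
      qed
      then have "measure lebesgue {x \<in> ball y h. V x \<le> c} = measure lborel {x \<in> ball y h. V x \<le> c}" for y
        by (intro measure_completion) simp
      then show ?thesis using assms(28)[OF that] by simp
    qed
  qed (use assms in auto)
  interpret W: weighted_fractional s p "real CARD('n) + s * p" "TYPE(real ^ 'n)" V V0 h by (rule W)
  have crit: "W.crit_power = crit_exp CARD('n) s p"
    by (simp add: W.crit_power_def crit_exp_def)
  interpret kirchhoff_data s p V V0 h \<alpha>' \<beta>' \<delta> \<gamma> \<xi> \<tau> a m c\<beta> \<alpha> \<beta>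
  proof unfold_locales
    show "\<exists>C. \<forall>x. norm x \<le> R \<longrightarrow> V x \<le> C" for R
    proof -
      have "compact (V ` cball 0 R)" using assms(23) by (intro compact_continuous_image) (auto intro: continuous_on_subset)
      then have "bdd_above (V ` cball 0 R)" by (intro bounded_imp_bdd_above compact_imp_bounded)
      then obtain C where "\<And>y. y \<in> V ` cball 0 R \<Longrightarrow> y \<le> C" unfolding bdd_above_def by blast
      then show ?thesis by (intro exI[of _ C]) auto
    qed
    have "AE x in lborel. \<alpha> x > 0" using assms(10) by (simp add: AE_lebesgue_iff_lborel)
    then show "AE x in lborel. \<alpha>' x > 0" using \<alpha>_rep by eventually_elim simp
    have "AE x in lborel. \<bar>\<alpha> x\<bar> powr \<xi> = \<bar>\<alpha>' x\<bar> powr \<xi>" using \<alpha>_rep by eventually_elim simp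
    then show "integrable lborel (\<lambda>x. \<bar>\<alpha>' x\<bar> powr \<xi>)"
      using assms(12) integral_lebesgue_cong_AE(2)[of "\<lambda>x. \<bar>\<alpha>' x\<bar> powr \<xi>" "\<lambda>x. \<bar>\<alpha> x\<bar> powr \<xi>"] by (simp add: Lspace_def)
    show "AE x in lborel. \<bar>\<beta>' x\<bar> \<le> c\<beta>" using c\<beta> \<beta>_rep by eventually_elim simp
    show "\<not> (AE x in lborel. max (\<beta>' x) 0 = 0)"
    proof
      assume "AE x in lborel. max (\<beta>' x) 0 = 0"
      then have "AE x in lborel. max (\<beta> x) 0 = 0" using \<beta>_rep by eventually_elim simp
      then show False using assms(18) by (simp add: AE_lebesgue_iff_lborel)
    qed
    show "\<gamma> < W.crit_power" "\<tau> < W.crit_power" using assms by (simp_all add: crit)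
  qed (use assms \<alpha>_rep \<beta>_rep \<alpha>' \<beta>' in auto)
  show ?thesis by (rule two_weak_solutions) (use assms(19) in blast)
qed

end
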